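(* Let $n\ge 1$ and $0<\delta<1$, let $\Psi$ satisfy conditions (i)–(iii) of the context, and consider $$(\mathrm E)\qquad v_t+\mathcal L^{n,\delta}[v]=0\ \text{ on } \mathcal D_\delta,\qquad v=\Psi\ \text{ on } \mathcal D^{*,c}_\delta .$$ Let $\overline u$ be a viscosity supersolution and $\underline u$ a viscosity subsolution of $(\mathrm E)$ on $\mathcal D_\delta$, both of class $(\Psi)$. Then $\underline u\le\overline u$ on $D_\delta$. Consequently, the functions $u^*$ and $u_*$ defined in the context coincide, and $u:=u^*=u_*$ is the unique continuous viscosity solution (i.e. both sub- and supersolution) of class $(\Psi)$ to $(\mathrm E)$.
   Context: **Data.** Fix $T>0$, positive constants $p,r,\mu,\sigma,c$ and $M\ge p$. $F$ is an absolutely continuous distribution function on $[0,\infty)$ with density $f$, $\bar F=1-F$, and intensity $\lambda(t)=f(t)/\bar F(t)>0$, $t\in[0,T]$. $G$ is a continuous distribution function on $[0,\infty)$ with density $g$. Whenever $\lambda(w)$ is used for $w\in[-1,T+1]$, $\lambda$ is understood as a bounded continuous function there. **Hamiltonians.** For $\theta=(s,x,w)$, $\xi=(\xi^1,\xi^2)\in\mathbb R^2$, $y,A,z\in\mathbb R$, $(\gamma,a)\in[0,1]\times[0,M]$, $$H(\theta,y,\xi,A,z,\gamma,a)=\tfrac{\sigma^2}{2}\gamma^2x^2A+[p+(r+(\mu-r)\gamma)x-a]\xi^1+\xi^2+\lambda(w)z+(a-cy).$$ Fix $\varepsilon_n>0$, $\varepsilon_n\downarrow0$, and set $H^n(\theta,y,\xi,A_1,A_2,z,\gamma,a)=H(\theta,y,\xi,A_1,z,\gamma,a)+\frac{\varepsilon_n}{2}A_1+\frac{\varepsilon_n}{2}A_2$.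 **Domains.** For $0<\delta\le 1$: $D_\delta=\{(s,x,w):0<s\le T+\delta,\ x\ge-\delta,\ -\delta\le w\le s+\delta\}$, $\mathcal D_\delta=\mathrm{int}\,D_\delta$. For $0<s<T+\delta$ let $\mathcal D_{\delta,s}=\{(x,w):x>-\delta,\ -\delta<w<s+\delta\}$, and $$\mathcal D^{*,c}_\delta=(\{T+\delta\}\times\mathbb R^2)\cup\bigcup_{0<s<T+\delta}\{s\}\times(\mathbb R^2\setminus\mathcal D_{\delta,s}).$$ **Operators.** With $\nabla\varphi=(\varphi_x,\varphi_w)$, $$I^\delta[\varphi](s,x,w)=\int_0^{x+\delta}\varphi(s,x-u,-\delta)\,dG(u)-\varphi(s,x,w),$$ $$\mathcal L^{n,\delta}[\varphi](\theta)=\sup_{\gamma\in[0,1],a\in[0,M]}H^n(\theta,\varphi,\nabla\varphi,\varphi_{xx},\varphi_{ww},I^\delta[\varphi],\gamma,a).$$ **Conditions on $\Psi\in C^{1,3,3}(\mathbb R^3)$.** (i) There is $K_1>0$ with $0\le\Psi\le K_1$ on $D_1$, and $\Psi=0$ on $D_1^c$. (ii) There is $0<K_2<M$ such that for all $\theta\in D_1$, $0<\delta<1$, $n\ge1$: $M-K_2\le\Psi_t+H^n(\theta,\Psi,\nabla\Psi,\Psi_{xx},\Psi_{ww},I^\delta[\Psi],0,M)$. (iii) $\Psi$ is strictly increasing in $x$ on the interior of $D_1$ and, for some $0<\delta_0<1$, $b:=\inf\{\Psi_x(s,x,w):s\in(0,T],x\in[-\delta_0,0],w\in[0,s]\}>1$.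 **Class $(\Psi)$.** A function $v$ is of class $(\Psi)$ if (1) $v=\Psi$ on $\mathcal D^{*,c}_\delta$; (2) $v$ is increasing in $x$ on $D_\delta$; (3) $v$ is bounded on $D_\delta$; (4) $v(s,x,w)-v(s,-\delta,w)\ge x+\delta$ as $x\downarrow-\delta$ (i.e. for $x$ close to $-\delta$), for any $0\le s\le T+\delta$, $-\delta\le w\le s+\delta$. **Viscosity solutions.** $C^{1,2,2}_0(D_\delta)$ is the set of $\varphi\in C^{1,2,2}(\mathcal D_\delta)$ such that $\varphi$ and its derivatives $\varphi_t,\varphi_x,\varphi_{xx},\varphi_w,\varphi_{ww}$ extend continuously to $D_\delta$, with $\varphi=0$ off $D_\delta$. An upper semicontinuous (resp. lower semicontinuous) function $v$ on $D_\delta$ is a viscosity subsolution (resp. supersolution) on $\mathcal D_\delta$ if whenever $\theta_0\in\mathcal D_\delta$ and $\varphi\in C^{1,2,2}_0(D_\delta)$ satisfy $0=(v-\varphi)(\theta_0)=\max_{\mathcal D_\delta}(v-\varphi)$ (resp. $\min$), then $\varphi_t(\theta_0)+\mathcal L^{n,\delta}[\varphi](\theta_0)\ge0$ (resp. $\le0$). **The functions $u^*,u_*$.** Fix a continuous viscosity subsolution $\underline\psi$ and a continuous viscosity supersolution $\overline\psi$ of $(\mathrm E)$ on $\mathcal D_\delta$, both of class $(\Psi)$ and equal to $\Psi$ on $\mathcal D^{*,c}_\delta$ (such functions exist). Let $\mathcal F$ be the set of continuous viscosity subsolutions $v$ of class $(\Psi)$ with $\underline\psi\le v\le\overline\psi$,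 $u_0(\theta)=\sup_{v\in\mathcal F}v(\theta)$ on $D_\delta$, and $$u^*(\theta)=\lim_{\rho\downarrow0}\sup\{u_0(\eta):\eta\in\mathcal D_\delta,|\eta-\theta|\le \rho\},\qquad u_*(\theta)=\lim_{\rho\downarrow0}\inf\{u_0(\eta):\eta\in\mathcal D_\delta,|\eta-\theta|\le \rho\}.$$
   Formalization: Ψ=0 on the complement of D_1 is required only for s>0 (for all s it contradicts inf Ψ_x>1 in (iii)); and λ is assumed bounded and continuous up to max(T+1,T+2δ), since for δ>1/2 the equation uses λ beyond T+1, where it is not specified. *)

theory Defs
  imports "HOL-Analysis.Analysis"
begin

record model =
  horizon :: real                  (* T *)
  prem :: real                     (* p *)
  rate :: real                     (* r *)
  drift :: real                    (* mu *)
  vol :: real                      (* sigma *)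
  disc :: real                     (* c *)
  maxdiv :: real                   (* M *)
  arr_cdf :: "real \<Rightarrow> real"        (* F *)
  arr_dens :: "real \<Rightarrow> real"       (* f *)
  intensity :: "real \<Rightarrow> real"      (* lambda *)
  claim_cdf :: "real \<Rightarrow> real"      (* G *)
  claim_dens :: "real \<Rightarrow> real"     (* g *)
  visc :: "nat \<Rightarrow> real"            (* epsilon_n, used for n >= 1 only *)

text \<open>\<open>F\<close> is a distribution function on \<open>[0,\<infinity>)\<close> with density \<open>f\<close>, extended by \<open>0\<close> to the
  negative half-line.\<close>

definition cdf_with_density :: "(real \<Rightarrow> real) \<Rightarrow> (real \<Rightarrow> real) \<Rightarrow> bool" where
  "cdf_with_density F f \<longleftrightarrow>
     (\<forall>t\<ge>0. 0 \<le> f t) \<and> set_integrable lborel {0..} f \<and> (LINT t:{0..}|lborel. f t) = 1 \<and>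
     (\<forall>t. F t = (LINT u:{0..t}|lborel. f u))"

text \<open>The intensity is a total function which equals \<open>f / (1 - F)\<close> on \<open>[0,T]\<close> and is an arbitrary
  extension outside; positivity forces \<open>F t < 1\<close> there, as division by \<open>0\<close> yields \<open>0\<close>. It is
  required to be bounded and continuous on \<open>[-1,T+1]\<close>; the parameter \<open>\<delta>\<close> enters because the
  equation on \<open>D_\<delta>\<close> evaluates it up to \<open>w = T + 2 \<delta>\<close>, which exceeds \<open>T + 1\<close> if \<open>\<delta> > 1/2\<close>.\<close>

definition valid_model :: "model \<Rightarrow> real \<Rightarrow> bool" where
  "valid_model P \<delta> \<longleftrightarrow>
     0 < horizon P \<and> 0 < prem P \<and> 0 < rate P \<and> 0 < drift P \<and> 0 < vol P \<and> 0 < disc P \<and>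
     prem P \<le> maxdiv P \<and>
     cdf_with_density (arr_cdf P) (arr_dens P) \<and>
     (\<forall>t\<in>{0..horizon P}. intensity P t = arr_dens P t / (1 - arr_cdf P t) \<and> 0 < intensity P t) \<and>
     continuous_on {-1..max (horizon P + 1) (horizon P + 2 * \<delta>)} (intensity P) \<and>
     bounded (intensity P ` {-1..max (horizon P + 1) (horizon P + 2 * \<delta>)}) \<and>
     cdf_with_density (claim_cdf P) (claim_dens P) \<and>
     (\<forall>n\<ge>1. 0 < visc P n \<and> visc P (Suc n) \<le> visc P n) \<and> visc P \<longlonglongrightarrow> 0"

text \<open>Points are \<open>(s,x,w)\<close>; functions are total on \<open>\<real>\<^sup>3\<close>, with relevant values on
  \<open>(0,T+\<delta>] \<times> \<real>\<^sup>2\<close>, the union of \<open>dom_D\<close> and \<open>dom_C\<close>.\<close>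

type_synonym point = "real \<times> real \<times> real"

definition dom_D :: "model \<Rightarrow> real \<Rightarrow> point set" where
  "dom_D P \<delta> = {(s, x, w). 0 < s \<and> s \<le> horizon P + \<delta> \<and> -\<delta> \<le> x \<and> -\<delta> \<le> w \<and> w \<le> s + \<delta>}"

definition slice :: "real \<Rightarrow> real \<Rightarrow> (real \<times> real) set" where
  "slice \<delta> s = {(x, w). -\<delta> < x \<and> -\<delta> < w \<and> w < s + \<delta>}"

definition dom_C :: "model \<Rightarrow> real \<Rightarrow> point set" where
  "dom_C P \<delta> = ({horizon P + \<delta>} \<times> UNIV) \<union>
     (\<Union>s\<in>{0<..<horizon P + \<delta>}. {s} \<times> (UNIV - slice \<delta> s))"

definition pd_t :: "(point \<Rightarrow> real) \<Rightarrow> point \<Rightarrow> real" where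
  "pd_t \<phi> = (\<lambda>(s, x, w). deriv (\<lambda>t. \<phi> (t, x, w)) s)"

definition pd_x :: "(point \<Rightarrow> real) \<Rightarrow> point \<Rightarrow> real" where
  "pd_x \<phi> = (\<lambda>(s, x, w). deriv (\<lambda>y. \<phi> (s, y, w)) x)"

definition pd_w :: "(point \<Rightarrow> real) \<Rightarrow> point \<Rightarrow> real" where
  "pd_w \<phi> = (\<lambda>(s, x, w). deriv (\<lambda>v. \<phi> (s, x, v)) w)"

text \<open>\<open>C\<^sup>1\<^sup>,\<^sup>k\<^sup>,\<^sup>k\<close> on an open set: the pure partial derivatives of order at most \<open>1\<close> in \<open>s\<close> and at
  most \<open>k\<close> in \<open>x\<close> and in \<open>w\<close> exist and are jointly continuous (no mixed derivatives).\<close>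

definition C1kk_on :: "nat \<Rightarrow> point set \<Rightarrow> (point \<Rightarrow> real) \<Rightarrow> bool" where
  "C1kk_on k U \<phi> \<longleftrightarrow>
     (\<forall>(s, x, w)\<in>U. (\<lambda>t. \<phi> (t, x, w)) differentiable (at s)) \<and>
     (\<forall>j<k. \<forall>(s, x, w)\<in>U. (\<lambda>y. (pd_x ^^ j) \<phi> (s, y, w)) differentiable (at x)) \<and>
     (\<forall>j<k. \<forall>(s, x, w)\<in>U. (\<lambda>v. (pd_w ^^ j) \<phi> (s, x, v)) differentiable (at w)) \<and>
     continuous_on U (pd_t \<phi>) \<and>
     (\<forall>j\<le>k. continuous_on U ((pd_x ^^ j) \<phi>)) \<and>
     (\<forall>j\<le>k. continuous_on U ((pd_w ^^ j) \<phi>))"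

definition ham :: "model \<Rightarrow> point \<Rightarrow> real \<Rightarrow> real \<times> real \<Rightarrow> real \<Rightarrow> real \<Rightarrow> real \<Rightarrow> real \<Rightarrow> real" where
  "ham P = (\<lambda>(s, x, w) y (\<xi>1, \<xi>2) A z \<gamma> a.
     (vol P)\<^sup>2 / 2 * \<gamma>\<^sup>2 * x\<^sup>2 * A
     + (prem P + (rate P + (drift P - rate P) * \<gamma>) * x - a) * \<xi>1
     + \<xi>2 + intensity P w * z + (a - disc P * y))"

definition ham_n :: "model \<Rightarrow> nat \<Rightarrow> point \<Rightarrow> real \<Rightarrow> real \<times> real \<Rightarrow> real \<Rightarrow> real \<Rightarrow> real \<Rightarrow> real \<Rightarrow> real \<Rightarrow> real"
  where
  "ham_n P n \<theta> y \<xi> A1 A2 z \<gamma> a =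
     ham P \<theta> y \<xi> A1 z \<gamma> a + visc P n / 2 * A1 + visc P n / 2 * A2"

definition nonloc :: "model \<Rightarrow> real \<Rightarrow> (point \<Rightarrow> real) \<Rightarrow> point \<Rightarrow> real" where
  "nonloc P \<delta> \<phi> = (\<lambda>(s, x, w).
     (LINT u:{0..x + \<delta>}|interval_measure (claim_cdf P). \<phi> (s, x - u, -\<delta>)) - \<phi> (s, x, w))"

definition ham_of :: "model \<Rightarrow> nat \<Rightarrow> real \<Rightarrow> (point \<Rightarrow> real) \<Rightarrow> point \<Rightarrow> real \<Rightarrow> real \<Rightarrow> real" where
  "ham_of P n \<delta> \<phi> \<theta> \<gamma> a =
     ham_n P n \<theta> (\<phi> \<theta>) (pd_x \<phi> \<theta>, pd_w \<phi> \<theta>) (pd_x (pd_x \<phi>) \<theta>) (pd_w (pd_w \<phi>) \<theta>)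
       (nonloc P \<delta> \<phi> \<theta>) \<gamma> a"

definition hjb_op :: "model \<Rightarrow> nat \<Rightarrow> real \<Rightarrow> (point \<Rightarrow> real) \<Rightarrow> point \<Rightarrow> real" where
  "hjb_op P n \<delta> \<phi> \<theta> = (SUP (\<gamma>, a)\<in>{0..1} \<times> {0..maxdiv P}. ham_of P n \<delta> \<phi> \<theta> \<gamma> a)"

text \<open>The complement of \<open>D_1\<close> in condition (i) is taken within the time range \<open>s > 0\<close> in which the
  problem is posed. If \<open>\<Psi>\<close> vanished also for \<open>s \<le> 0\<close>, continuity of \<open>\<Psi>\<close> at \<open>s = 0\<close> would
  contradict the lower bound on \<open>\<Psi>\<^sub>x\<close> over \<open>s \<in> (0,T]\<close> in condition (iii), and no \<open>\<Psi>\<close> would exist.\<close>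

definition Psi_conditions :: "model \<Rightarrow> (point \<Rightarrow> real) \<Rightarrow> bool" where
  "Psi_conditions P \<Psi> \<longleftrightarrow>
     C1kk_on 3 UNIV \<Psi> \<and>
     (\<exists>K1>0. \<forall>\<theta>\<in>dom_D P 1. 0 \<le> \<Psi> \<theta> \<and> \<Psi> \<theta> \<le> K1) \<and>
     (\<forall>\<theta>\<in>({0<..} \<times> UNIV) - dom_D P 1. \<Psi> \<theta> = 0) \<and>
     (\<exists>K2. 0 < K2 \<and> K2 < maxdiv P \<and>
        (\<forall>\<theta>\<in>dom_D P 1. \<forall>\<delta>. 0 < \<delta> \<longrightarrow> \<delta> < 1 \<longrightarrow> (\<forall>n\<ge>1.
           maxdiv P - K2 \<le> pd_t \<Psi> \<theta> + ham_of P n \<delta> \<Psi> \<theta> 0 (maxdiv P)))) \<and>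
     (\<forall>s x x' w. (s, x, w) \<in> interior (dom_D P 1) \<longrightarrow> (s, x', w) \<in> interior (dom_D P 1) \<longrightarrow>
        x < x' \<longrightarrow> \<Psi> (s, x, w) < \<Psi> (s, x', w)) \<and>
     (\<exists>\<delta>0. 0 < \<delta>0 \<and> \<delta>0 < 1 \<and>
        1 < (INF \<theta>\<in>{(s, x, w). s \<in> {0<..horizon P} \<and> x \<in> {-\<delta>0..0} \<and> w \<in> {0..s}}. pd_x \<Psi> \<theta>))"

text \<open>In the last clause \<open>s = 0\<close> is allowed, as in the original definition, although
  \<open>v (0, \<sqdot>, \<sqdot>)\<close> lies outside \<open>(0,T+\<delta>] \<times> \<real>\<^sup>2\<close> and is not constrained by anything else.\<close>

definition class_Psi :: "model \<Rightarrow> (point \<Rightarrow> real) \<Rightarrow> real \<Rightarrow> (point \<Rightarrow> real) \<Rightarrow> bool" where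
  "class_Psi P \<Psi> \<delta> v \<longleftrightarrow>
     (\<forall>\<theta>\<in>dom_C P \<delta>. v \<theta> = \<Psi> \<theta>) \<and>
     (\<forall>s x x' w. (s, x, w) \<in> dom_D P \<delta> \<longrightarrow> (s, x', w) \<in> dom_D P \<delta> \<longrightarrow> x \<le> x' \<longrightarrow>
        v (s, x, w) \<le> v (s, x', w)) \<and>
     bounded (v ` dom_D P \<delta>) \<and>
     (\<forall>s w. 0 \<le> s \<longrightarrow> s \<le> horizon P + \<delta> \<longrightarrow> -\<delta> \<le> w \<longrightarrow> w \<le> s + \<delta> \<longrightarrow>
        (\<forall>\<^sub>F x in at_right (-\<delta>). x + \<delta> \<le> v (s, x, w) - v (s, -\<delta>, w)))"

text \<open>On \<open>dom_D\<close> the values of a test function are those of its continuous extension from the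
  interior; they matter there, since \<open>nonloc\<close> integrates over the boundary part \<open>w = -\<delta>\<close>.\<close>

definition test_functions :: "model \<Rightarrow> real \<Rightarrow> (point \<Rightarrow> real) set" where
  "test_functions P \<delta> = {\<phi>.
     C1kk_on 2 (interior (dom_D P \<delta>)) \<phi> \<and> continuous_on (dom_D P \<delta>) \<phi> \<and>
     (\<forall>d\<in>{pd_t \<phi>, pd_x \<phi>, pd_x (pd_x \<phi>), pd_w \<phi>, pd_w (pd_w \<phi>)}.
        \<exists>h. continuous_on (dom_D P \<delta>) h \<and> (\<forall>\<theta>\<in>interior (dom_D P \<delta>). h \<theta> = d \<theta>)) \<and>
     (\<forall>\<theta>. \<theta> \<notin> dom_D P \<delta> \<longrightarrow> \<phi> \<theta> = 0)}"

definition usc_on :: "'a::topological_space set \<Rightarrow> ('a \<Rightarrow> real) \<Rightarrow> bool" where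
  "usc_on S v \<longleftrightarrow> (\<forall>\<theta>\<in>S. \<forall>y>v \<theta>. \<forall>\<^sub>F \<eta> in at \<theta> within S. v \<eta> < y)"

definition lsc_on :: "'a::topological_space set \<Rightarrow> ('a \<Rightarrow> real) \<Rightarrow> bool" where
  "lsc_on S v \<longleftrightarrow> (\<forall>\<theta>\<in>S. \<forall>y<v \<theta>. \<forall>\<^sub>F \<eta> in at \<theta> within S. y < v \<eta>)"

definition visc_subsol :: "model \<Rightarrow> nat \<Rightarrow> real \<Rightarrow> (point \<Rightarrow> real) \<Rightarrow> bool" where
  "visc_subsol P n \<delta> v \<longleftrightarrow> usc_on (dom_D P \<delta>) v \<and>
     (\<forall>\<theta>0\<in>interior (dom_D P \<delta>). \<forall>\<phi>\<in>test_functions P \<delta>.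
        v \<theta>0 - \<phi> \<theta>0 = 0 \<longrightarrow> (\<forall>\<theta>\<in>interior (dom_D P \<delta>). v \<theta> - \<phi> \<theta> \<le> 0) \<longrightarrow>
        0 \<le> pd_t \<phi> \<theta>0 + hjb_op P n \<delta> \<phi> \<theta>0)"

definition visc_supersol :: "model \<Rightarrow> nat \<Rightarrow> real \<Rightarrow> (point \<Rightarrow> real) \<Rightarrow> bool" where
  "visc_supersol P n \<delta> v \<longleftrightarrow> lsc_on (dom_D P \<delta>) v \<and>
     (\<forall>\<theta>0\<in>interior (dom_D P \<delta>). \<forall>\<phi>\<in>test_functions P \<delta>.
        v \<theta>0 - \<phi> \<theta>0 = 0 \<longrightarrow> (\<forall>\<theta>\<in>interior (dom_D P \<delta>). 0 \<le> v \<theta> - \<phi> \<theta>) \<longrightarrow>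
        pd_t \<phi> \<theta>0 + hjb_op P n \<delta> \<phi> \<theta>0 \<le> 0)"

definition cont_visc_sol :: "model \<Rightarrow> nat \<Rightarrow> real \<Rightarrow> (point \<Rightarrow> real) \<Rightarrow> bool" where
  "cont_visc_sol P n \<delta> v \<longleftrightarrow>
     continuous_on (dom_D P \<delta>) v \<and> visc_subsol P n \<delta> v \<and> visc_supersol P n \<delta> v"

definition perron_family ::
  "model \<Rightarrow> (point \<Rightarrow> real) \<Rightarrow> nat \<Rightarrow> real \<Rightarrow> (point \<Rightarrow> real) \<Rightarrow> (point \<Rightarrow> real) \<Rightarrow> (point \<Rightarrow> real) set" where
  "perron_family P \<Psi> n \<delta> \<psi>l \<psi>u = {v.
     continuous_on (dom_D P \<delta>) v \<and> visc_subsol P n \<delta> v \<and> class_Psi P \<Psi> \<delta> v \<and>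
     (\<forall>\<theta>\<in>dom_D P \<delta>. \<psi>l \<theta> \<le> v \<theta> \<and> v \<theta> \<le> \<psi>u \<theta>)}"

definition perron_sup ::
  "model \<Rightarrow> (point \<Rightarrow> real) \<Rightarrow> nat \<Rightarrow> real \<Rightarrow> (point \<Rightarrow> real) \<Rightarrow> (point \<Rightarrow> real) \<Rightarrow> point \<Rightarrow> real" where
  "perron_sup P \<Psi> n \<delta> \<psi>l \<psi>u \<theta> = (SUP v\<in>perron_family P \<Psi> n \<delta> \<psi>l \<psi>u. v \<theta>)"

definition upper_env :: "point set \<Rightarrow> (point \<Rightarrow> real) \<Rightarrow> point \<Rightarrow> real" where
  "upper_env U v \<theta> = Lim (at_right 0) (\<lambda>\<rho>. SUP \<eta>\<in>{\<eta>\<in>U. dist \<eta> \<theta> \<le> \<rho>}. v \<eta>)"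

definition lower_env :: "point set \<Rightarrow> (point \<Rightarrow> real) \<Rightarrow> point \<Rightarrow> real" where
  "lower_env U v \<theta> = Lim (at_right 0) (\<lambda>\<rho>. INF \<eta>\<in>{\<eta>\<in>U. dist \<eta> \<theta> \<le> \<rho>}. v \<eta>)"

end

theory Submission
  imports Defs "HOL-Computational_Algebra.Polynomial"
begin

text \<open>A test function may be chosen freely in the interior, but the nonlocal term only sees its values on the
  line \<open>w = -\<delta>\<close>, where a solution equals \<open>\<Psi>\<close>. A test function can be made arbitrarily large there, so the
  existence of a bounded subsolution forces \<open>\<lambda> \<ge> 0\<close>; and it can be brought arbitrarily close to \<open>\<Psi>\<close> there, so
  that (E) becomes a local Hamilton--Jacobi--Bellman equation with a continuous source term. For this equation a
  comparison principle is proved by doubling variables. As only pure second derivatives occur, the theorem on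
  sums can be avoided: the supersolution is replaced by its inf-convolution, which near the maximum is a viscosity
  supersolution of an equation with constant coefficients. It hence satisfies a mean value inequality over
  ellipses, and its Steklov averages are smooth supersolutions, so that one test function for the subsolution
  suffices. Perron's method, carried out with all semicontinuous local subsolutions between the two barriers,
  then gives a continuous local solution \<open>U\<close>. Comparing it with its infimum over larger \<open>x\<close> shows that \<open>U\<close>
  increases in \<open>x\<close>; thus \<open>U\<close> is of class \<open>(\<Psi>)\<close> and, by comparison, the largest element of the Perron
  family of the theorem.\<close>

section \<open>Semicontinuity\<close>

text \<open>Two features of the setting shape the proof. The intensity is positive by assumption on
  \<open>[0,T]\<close> only, whereas the equation evaluates it for \<open>w\<close> between
  \<open>-\<delta>\<close> and \<open>T + 2 * \<delta>\<close>; without a sign there, the nonlocal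
  term would not be monotone in the test function. The sign must therefore be secured before the
  equation can be made local. Moreover, the domain is unbounded in \<open>x\<close> and carries no
  datum at \<open>s = 0\<close>, since the problem runs backwards from \<open>T + \<delta>\<close>.
  A penalty growing like \<open>ln (x + 2)\<close> and \<open>1 / s\<close> restores compactness,
  and the discount rate turns it into a strict inequality. The smoothing works because, for a fixed
  control, the supersolution inequality is linear; once its coefficients are frozen it is invariant
  under translations, so averages inherit it for all controls at once. The subsolution can then
  select its control, and the averaged supersolution is tested with the same one. The added
  viscosity in both variables keeps the ellipses nondegenerate and disposes of points where the
  second derivative in \<open>x\<close> of a test function is very negative.\<close>

lemma usc_on_iff_nhds:
  "usc_on S f \<longleftrightarrow> (\<forall>x\<in>S. \<forall>y>f x. \<forall>\<^sub>F z in nhds x. z \<in> S \<longrightarrow> f z < y)"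
proof -
  have "(\<forall>\<^sub>F z in at x within S. f z < y) \<longleftrightarrow> (\<forall>\<^sub>F z in nhds x. z \<in> S \<longrightarrow> f z < y)"
    if "f x < y" for x y
    unfolding eventually_at_filter by (intro eventually_cong eventuallyI) (use that in auto)
  then show ?thesis unfolding usc_on_def by blast
qed

lemma lsc_on_iff_usc_on: "lsc_on S f \<longleftrightarrow> usc_on S (\<lambda>x. - f x)"
proof
  assume l: "lsc_on S f"
  show "usc_on S (\<lambda>x. - f x)"
    unfolding usc_on_def
  proof (intro ballI allI impI)
    fix x y assume "x \<in> S" "- f x < y"
    then have "\<forall>\<^sub>F z in at x within S. - y < f z" using l unfolding lsc_on_def by auto
    then show "\<forall>\<^sub>F z in at x within S. - f z < y" by (rule eventually_mono) auto
  qed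
next
  assume u: "usc_on S (\<lambda>x. - f x)"
  show "lsc_on S f"
    unfolding lsc_on_def
  proof (intro ballI allI impI)
    fix x y assume "x \<in> S" "y < f x"
    then have "\<forall>\<^sub>F z in at x within S. - f z < - y" using u[unfolded usc_on_def, rule_format, of x "- y"] by auto
    then show "\<forall>\<^sub>F z in at x within S. y < f z" by (rule eventually_mono) auto
  qed
qed

lemma usc_on_subset: "usc_on S f \<Longrightarrow> T \<subseteq> S \<Longrightarrow> usc_on T f"
  unfolding usc_on_iff_nhds by (fast elim: eventually_mono)

lemma usc_on_compose:
  assumes "usc_on S f" "continuous_on T g" "g ` T \<subseteq> S"
  shows "usc_on T (\<lambda>x. f (g x))"
  unfolding usc_on_def
proof (intro ballI allI impI)
  fix x y assume x: "x \<in> T" and y: "f (g x) < y"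
  have "\<forall>\<^sub>F z in nhds (g x). z \<in> S \<longrightarrow> f z < y"
    using assms(1,3) x y unfolding usc_on_iff_nhds by blast
  moreover have "(g \<longlongrightarrow> g x) (at x within T)" using assms(2) x by (simp add: continuous_on_def)
  ultimately have "\<forall>\<^sub>F z in at x within T. g z \<in> S \<longrightarrow> f (g z) < y"
    unfolding filterlim_iff by (elim allE impE)
  moreover have "\<forall>\<^sub>F z in at x within T. z \<in> T" by (simp add: eventually_at_filter)
  ultimately show "\<forall>\<^sub>F z in at x within T. f (g z) < y"
    by eventually_elim (use assms(3) in auto)
qed

lemma usc_on_add:
  assumes "usc_on S f" "usc_on S g"
  shows "usc_on S (\<lambda>x. f x + g x)"
  unfolding usc_on_def
proof (intro ballI allI impI)
  fix x y assume x: "x \<in> S" and y: "f x + g x < y"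
  define e where "e = (y - f x - g x) / 2"
  have e: "e > 0" using y by (simp add: e_def)
  have "\<forall>\<^sub>F z in at x within S. f z < f x + e" "\<forall>\<^sub>F z in at x within S. g z < g x + e"
    using assms x e unfolding usc_on_def by auto
  then show "\<forall>\<^sub>F z in at x within S. f z + g z < y"
    by eventually_elim (use e_def in \<open>simp add: field_simps\<close>)
qed

lemma continuous_on_imp_usc_on:
  fixes f :: "'a::topological_space \<Rightarrow> real"
  assumes "continuous_on S f" shows "usc_on S f"
  using assms unfolding usc_on_def continuous_on_def by (auto dest: order_tendstoD(2))

lemma continuous_on_imp_lsc_on:
  fixes f :: "'a::topological_space \<Rightarrow> real"
  assumes "continuous_on S f" shows "lsc_on S f"
  using assms unfolding lsc_on_def continuous_on_def by (auto dest: order_tendstoD(1))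

lemma usc_lsc_imp_continuous_on:
  fixes f :: "'a::topological_space \<Rightarrow> real"
  assumes "usc_on S f" "lsc_on S f" shows "continuous_on S f"
  using assms unfolding usc_on_def lsc_on_def continuous_on_def by (auto intro!: order_tendstoI)

lemma usc_on_eventually:
  assumes "usc_on S f" "x \<in> S" "(X \<longlongrightarrow> x) F" "\<forall>\<^sub>F n in F. X n \<in> S" "f x < y"
  shows "\<forall>\<^sub>F n in F. f (X n) < y"
proof -
  have "\<forall>\<^sub>F z in nhds x. z \<in> S \<longrightarrow> f z < y"
    using assms(1,2,5) unfolding usc_on_iff_nhds by blast
  then have "\<forall>\<^sub>F n in F. X n \<in> S \<longrightarrow> f (X n) < y"
    using assms(3) unfolding filterlim_iff by blast
  with assms(4) show ?thesis by eventually_elim auto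
qed

lemma lsc_on_eventually:
  assumes "lsc_on S f" "x \<in> S" "(X \<longlongrightarrow> x) F" "\<forall>\<^sub>F n in F. X n \<in> S" "y < f x"
  shows "\<forall>\<^sub>F n in F. y < f (X n)"
  using usc_on_eventually[of S "\<lambda>x. - f x" x X F "- y"] assms by (simp add: lsc_on_iff_usc_on)

text \<open>Without a maximum every \<open>x\<close> is beaten by some \<open>Y x\<close>, and by
  semicontinuity on a whole neighbourhood of \<open>x\<close>. Among the finitely many
  \<open>Y c\<close> of a subcover the best one would be beaten by another of them.\<close>

lemma usc_attains_sup:
  assumes K: "compact K" "K \<noteq> {}" and u: "usc_on K f"
  obtains x where "x \<in> K" "\<And>y. y \<in> K \<Longrightarrow> f y \<le> f x"
proof -
  have "\<exists>x\<in>K. \<forall>y\<in>K. f y \<le> f x"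
  proof (rule ccontr)
    assume "\<not> ?thesis"
    then have "\<forall>x\<in>K. \<exists>y\<in>K. f x < f y" by force
    then obtain Y where Y: "\<And>x. x \<in> K \<Longrightarrow> Y x \<in> K \<and> f x < f (Y x)" by metis
    have "\<exists>U. open U \<and> x \<in> U \<and> (\<forall>z\<in>U. z \<in> K \<longrightarrow> f z < f (Y x))" if "x \<in> K" for x
    proof -
      have "\<forall>\<^sub>F z in nhds x. z \<in> K \<longrightarrow> f z < f (Y x)"
        using u[unfolded usc_on_iff_nhds, rule_format, OF that] Y[OF that] by auto
      then show ?thesis unfolding eventually_nhds by auto
    qed
    then obtain U where U: "\<And>x. x \<in> K \<Longrightarrow> open (U x) \<and> x \<in> U x \<and> (\<forall>z\<in>U x. z \<in> K \<longrightarrow> f z < f (Y x))"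
      by metis
    have op: "\<And>c. c \<in> K \<Longrightarrow> open (U c)" and cov: "K \<subseteq> (\<Union>c\<in>K. U c)" using U by auto
    obtain C where C: "C \<subseteq> K" "finite C" "K \<subseteq> (\<Union>c\<in>C. U c)"
      by (rule compactE_image[OF K(1) op cov])
    have Cne: "C \<noteq> {}" using C K by auto
    obtain c where c: "c \<in> C" "\<And>d. d \<in> C \<Longrightarrow> f (Y d) \<le> f (Y c)"
    proof -
      have "Max ((\<lambda>d. f (Y d)) ` C) \<in> (\<lambda>d. f (Y d)) ` C" using C(2) Cne by (intro Max_in) auto
      then obtain c where c: "c \<in> C" "f (Y c) = Max ((\<lambda>d. f (Y d)) ` C)" by auto
      have "f (Y d) \<le> f (Y c)" if "d \<in> C" for d unfolding c(2) using that C(2) by auto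
      with c(1) show ?thesis by (rule that)
    qed
    have "Y c \<in> K" using Y C c by auto
    then obtain d where "d \<in> C" "Y c \<in> U d" using C by auto
    then have "f (Y c) < f (Y d)" using U[of d] C \<open>Y c \<in> K\<close> by auto
    with c \<open>d \<in> C\<close> show False by fastforce
  qed
  then show ?thesis using that by blast
qed

text \<open>Replaces compactness of \<open>S\<close>: the superlevel set of a single reference point
  \<open>x0\<close> already lies in the compact \<open>K\<close>. The domains below are neither
  closed nor bounded, so maxima are always obtained this way.\<close>

lemma usc_coercive_attains_sup:
  fixes f :: "'a::t2_space \<Rightarrow> real"
  assumes u: "usc_on S f" and x0: "x0 \<in> S"
    and K: "compact K" "K \<subseteq> S" "\<And>x. x \<in> S \<Longrightarrow> f x0 \<le> f x \<Longrightarrow> x \<in> K"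
  obtains x where "x \<in> K" "\<And>y. y \<in> S \<Longrightarrow> f y \<le> f x"
proof -
  have "x0 \<in> K" using K x0 by auto
  obtain x where x: "x \<in> K" "\<And>y. y \<in> K \<Longrightarrow> f y \<le> f x"
    using usc_attains_sup[OF K(1) _ usc_on_subset[OF u K(2)]] \<open>x0 \<in> K\<close> by blast
  have "f y \<le> f x" if "y \<in> S" for y
  proof (cases "f x0 \<le> f y")
    case True then show ?thesis using x K(3) that by auto
  next
    case False then show ?thesis using x(2)[OF \<open>x0 \<in> K\<close>] by linarith
  qed
  with x(1) that show ?thesis by blast
qed

section \<open>Functions with continuous pure partial derivatives\<close>

text \<open>The derivatives are arguments, so that sums, products and compositions of test functions
  can be computed symbolically, without evaluating \<open>deriv\<close>. They matter on
  \<open>U\<close> only. As in \<open>C1kk_on\<close> there are no mixed derivatives, hence no chain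
  rule along skew directions; several constructions below are built around this.\<close>

definition pderivs :: "point set \<Rightarrow> (point \<Rightarrow> real) \<Rightarrow> (point \<Rightarrow> real) \<Rightarrow> (point \<Rightarrow> real) \<Rightarrow> (point \<Rightarrow> real) \<Rightarrow>
    (point \<Rightarrow> real) \<Rightarrow> (point \<Rightarrow> real) \<Rightarrow> bool" where
  "pderivs U f ft fx fxx fw fww \<longleftrightarrow>
    (\<forall>s x w. (s, x, w) \<in> U \<longrightarrow>
      ((\<lambda>t. f (t, x, w)) has_real_derivative ft (s, x, w)) (at s) \<and>
      ((\<lambda>y. f (s, y, w)) has_real_derivative fx (s, x, w)) (at x) \<and>
      ((\<lambda>y. fx (s, y, w)) has_real_derivative fxx (s, x, w)) (at x) \<and>
      ((\<lambda>v. f (s, x, v)) has_real_derivative fw (s, x, w)) (at w) \<and>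
      ((\<lambda>v. fw (s, x, v)) has_real_derivative fww (s, x, w)) (at w)) \<and>
    continuous_on U f \<and> continuous_on U ft \<and> continuous_on U fx \<and> continuous_on U fxx \<and>
    continuous_on U fw \<and> continuous_on U fww"

lemma pderivs_subset: "pderivs U f ft fx fxx fw fww \<Longrightarrow> V \<subseteq> U \<Longrightarrow> pderivs V f ft fx fxx fw fww"
  unfolding pderivs_def by (blast intro: continuous_on_subset)

text \<open>Serves to glue a product with a cutoff, smooth on \<open>U\<close>, to the zero function
  off the support of the cutoff.\<close>

lemma pderivs_Un:
  assumes "open U" "open V" "pderivs U f ft fx fxx fw fww" "pderivs V f ft fx fxx fw fww"
  shows "pderivs (U \<union> V) f ft fx fxx fw fww"
  using assms unfolding pderivs_def by (auto intro!: continuous_on_open_Un)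

lemma pderivs_add:
  assumes "pderivs U f ft fx fxx fw fww" "pderivs U g gt gx gxx gw gww"
  shows "pderivs U (\<lambda>z. f z + g z) (\<lambda>z. ft z + gt z) (\<lambda>z. fx z + gx z) (\<lambda>z. fxx z + gxx z)
    (\<lambda>z. fw z + gw z) (\<lambda>z. fww z + gww z)"
  using assms unfolding pderivs_def by (auto intro!: DERIV_add continuous_on_add)

lemma pderivs_cmult:
  assumes "pderivs U f ft fx fxx fw fww"
  shows "pderivs U (\<lambda>z. k * f z) (\<lambda>z. k * ft z) (\<lambda>z. k * fx z) (\<lambda>z. k * fxx z)
    (\<lambda>z. k * fw z) (\<lambda>z. k * fww z)"
  using assms unfolding pderivs_def by (auto intro!: DERIV_cmult continuous_on_mult_left)

lemma pderivs_diff: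
  assumes "pderivs U f ft fx fxx fw fww" "pderivs U g gt gx gxx gw gww"
  shows "pderivs U (\<lambda>z. f z - g z) (\<lambda>z. ft z - gt z) (\<lambda>z. fx z - gx z) (\<lambda>z. fxx z - gxx z)
    (\<lambda>z. fw z - gw z) (\<lambda>z. fww z - gww z)"
  using assms unfolding pderivs_def by (auto intro!: DERIV_diff continuous_on_diff)

lemma pderivsD:
  assumes "pderivs U f ft fx fxx fw fww" "(s, x, w) \<in> U"
  shows "((\<lambda>t. f (t, x, w)) has_real_derivative ft (s, x, w)) (at s)"
    "((\<lambda>y. f (s, y, w)) has_real_derivative fx (s, x, w)) (at x)"
    "((\<lambda>y. fx (s, y, w)) has_real_derivative fxx (s, x, w)) (at x)"
    "((\<lambda>v. f (s, x, v)) has_real_derivative fw (s, x, w)) (at w)"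
    "((\<lambda>v. fw (s, x, v)) has_real_derivative fww (s, x, w)) (at w)"
  using assms unfolding pderivs_def by blast+

lemma pderivs_continuous:
  assumes "pderivs U f ft fx fxx fw fww"
  shows "continuous_on U f" "continuous_on U ft" "continuous_on U fx" "continuous_on U fxx"
    "continuous_on U fw" "continuous_on U fww"
  using assms unfolding pderivs_def by blast+

lemma pderivsI:
  assumes "\<And>s x w. (s, x, w) \<in> U \<Longrightarrow> ((\<lambda>t. f (t, x, w)) has_real_derivative ft (s, x, w)) (at s)"
    "\<And>s x w. (s, x, w) \<in> U \<Longrightarrow> ((\<lambda>y. f (s, y, w)) has_real_derivative fx (s, x, w)) (at x)"
    "\<And>s x w. (s, x, w) \<in> U \<Longrightarrow> ((\<lambda>y. fx (s, y, w)) has_real_derivative fxx (s, x, w)) (at x)"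
    "\<And>s x w. (s, x, w) \<in> U \<Longrightarrow> ((\<lambda>v. f (s, x, v)) has_real_derivative fw (s, x, w)) (at w)"
    "\<And>s x w. (s, x, w) \<in> U \<Longrightarrow> ((\<lambda>v. fw (s, x, v)) has_real_derivative fww (s, x, w)) (at w)"
    "continuous_on U f" "continuous_on U ft" "continuous_on U fx" "continuous_on U fxx"
    "continuous_on U fw" "continuous_on U fww"
  shows "pderivs U f ft fx fxx fw fww"
  using assms unfolding pderivs_def by blast

lemma pderivs_mult:
  assumes f: "pderivs U f ft fx fxx fw fww" and g: "pderivs U g gt gx gxx gw gww"
  shows "pderivs U (\<lambda>z. f z * g z) (\<lambda>z. ft z * g z + f z * gt z) (\<lambda>z. fx z * g z + f z * gx z)
    (\<lambda>z. fxx z * g z + 2 * fx z * gx z + f z * gxx z)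
    (\<lambda>z. fw z * g z + f z * gw z) (\<lambda>z. fww z * g z + 2 * fw z * gw z + f z * gww z)"
proof (rule pderivsI)
  fix s x w assume u: "(s,x,w) \<in> U"
  note F = pderivsD[OF f u] and G = pderivsD[OF g u]
  show "((\<lambda>t. f (t,x,w) * g (t,x,w)) has_real_derivative ft (s,x,w) * g (s,x,w) + f (s,x,w) * gt (s,x,w)) (at s)"
    by (rule DERIV_cong[OF DERIV_mult[OF F(1) G(1)]]) simp
  show "((\<lambda>t. f (s,t,w) * g (s,t,w)) has_real_derivative fx (s,x,w) * g (s,x,w) + f (s,x,w) * gx (s,x,w)) (at x)"
    by (rule DERIV_cong[OF DERIV_mult[OF F(2) G(2)]]) simp
  show "((\<lambda>t. f (s,x,t) * g (s,x,t)) has_real_derivative fw (s,x,w) * g (s,x,w) + f (s,x,w) * gw (s,x,w)) (at w)"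
    by (rule DERIV_cong[OF DERIV_mult[OF F(4) G(4)]]) simp
  show "((\<lambda>t. fx (s,t,w) * g (s,t,w) + f (s,t,w) * gx (s,t,w)) has_real_derivative
    fxx (s,x,w) * g (s,x,w) + 2 * fx (s,x,w) * gx (s,x,w) + f (s,x,w) * gxx (s,x,w)) (at x)"
    by (rule DERIV_cong[OF DERIV_add[OF DERIV_mult[OF F(3) G(2)] DERIV_mult[OF F(2) G(3)]]]) simp
  show "((\<lambda>t. fw (s,x,t) * g (s,x,t) + f (s,x,t) * gw (s,x,t)) has_real_derivative
    fww (s,x,w) * g (s,x,w) + 2 * fw (s,x,w) * gw (s,x,w) + f (s,x,w) * gww (s,x,w)) (at w)"
    by (rule DERIV_cong[OF DERIV_add[OF DERIV_mult[OF F(5) G(4)] DERIV_mult[OF F(4) G(5)]]]) simp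
qed (use pderivs_continuous[OF f] pderivs_continuous[OF g] in \<open>auto intro!: continuous_intros\<close>)

text \<open>The explicit parts of the test functions (quadratics, penalties) separate into functions
  of one variable each.\<close>

lemma pderivs_sep:
  assumes "\<And>s. (A has_real_derivative A' s) (at s)" "continuous_on UNIV A'"
    "\<And>x. (B has_real_derivative B' x) (at x)" "\<And>x. (B' has_real_derivative B'' x) (at x)"
    "continuous_on UNIV B''"
    "\<And>w. (C has_real_derivative C' w) (at w)" "\<And>w. (C' has_real_derivative C'' w) (at w)"
    "continuous_on UNIV C''"
  shows "pderivs UNIV (\<lambda>(s,x,w). A s + B x + C w) (\<lambda>(s,x,w). A' s) (\<lambda>(s,x,w). B' x)
    (\<lambda>(s,x,w). B'' x) (\<lambda>(s,x,w). C' w) (\<lambda>(s,x,w). C'' w)"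
proof -
  have c: "continuous_on UNIV A" "continuous_on UNIV B" "continuous_on UNIV B'"
    "continuous_on UNIV C" "continuous_on UNIV C'"
    by (rule DERIV_continuous_on, rule has_field_derivative_at_within, rule assms)+
  have s: "continuous_on UNIV (\<lambda>z::point. h (fst z))" "continuous_on UNIV (\<lambda>z::point. h (fst (snd z)))"
    "continuous_on UNIV (\<lambda>z::point. h (snd (snd z)))"
    if "continuous_on UNIV h" for h :: "real \<Rightarrow> real"
    by (rule continuous_on_compose2[OF that]; auto intro!: continuous_intros)+
  show ?thesis
  proof (rule pderivsI)
    fix s x w :: real
    show "((\<lambda>t. case (t, x, w) of (s, x, w) \<Rightarrow> A s + B x + C w) has_real_derivative (case (s,x,w) of (s,x,w) \<Rightarrow> A' s)) (at s)"
      by (auto intro!: derivative_eq_intros assms)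
    show "((\<lambda>t. case (s, t, w) of (s, x, w) \<Rightarrow> A s + B x + C w) has_real_derivative (case (s,x,w) of (s,x,w) \<Rightarrow> B' x)) (at x)"
      by (auto intro!: derivative_eq_intros assms)
    show "((\<lambda>t. case (s, x, t) of (s, x, w) \<Rightarrow> A s + B x + C w) has_real_derivative (case (s,x,w) of (s,x,w) \<Rightarrow> C' w)) (at w)"
      by (auto intro!: derivative_eq_intros assms)
  qed (use assms in \<open>auto simp: case_prod_beta intro!: continuous_intros s c\<close>)
qed

lemma pderivs_const: "pderivs U (\<lambda>_. k) (\<lambda>_. 0) (\<lambda>_. 0) (\<lambda>_. 0) (\<lambda>_. 0) (\<lambda>_. 0)"
  unfolding pderivs_def by auto

lemma pderivs_cong:
  assumes "open U" "\<And>z. z \<in> U \<Longrightarrow> f z = g z" "\<And>z. z \<in> U \<Longrightarrow> ft z = gt z" "\<And>z. z \<in> U \<Longrightarrow> fx z = gx z"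
    "\<And>z. z \<in> U \<Longrightarrow> fxx z = gxx z" "\<And>z. z \<in> U \<Longrightarrow> fw z = gw z" "\<And>z. z \<in> U \<Longrightarrow> fww z = gww z"
    "pderivs U f ft fx fxx fw fww"
  shows "pderivs U g gt gx gxx gw gww"
proof -
  have ev: "\<forall>\<^sub>F t in nhds s. (t,x,w) \<in> U" "\<forall>\<^sub>F t in nhds x. (s,t,w) \<in> U" "\<forall>\<^sub>F t in nhds w. (s,x,t) \<in> U"
    if "(s,x,w) \<in> U" for s x w
  proof -
    have "((\<lambda>t. (t,x,w)) \<longlongrightarrow> (s,x,w)) (nhds s)" "((\<lambda>t. (s,t,w)) \<longlongrightarrow> (s,x,w)) (nhds x)"
      "((\<lambda>t. (s,x,t)) \<longlongrightarrow> (s,x,w)) (nhds w)"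
      by (auto intro!: tendsto_intros filterlim_ident)
    then show "\<forall>\<^sub>F t in nhds s. (t,x,w) \<in> U" "\<forall>\<^sub>F t in nhds x. (s,t,w) \<in> U" "\<forall>\<^sub>F t in nhds w. (s,x,t) \<in> U"
      using assms(1) that by (auto dest: topological_tendstoD)
  qed
  have "((\<lambda>t. g (t, x, w)) has_real_derivative gt (s, x, w)) (at s) \<and>
      ((\<lambda>y. g (s, y, w)) has_real_derivative gx (s, x, w)) (at x) \<and>
      ((\<lambda>y. gx (s, y, w)) has_real_derivative gxx (s, x, w)) (at x) \<and>
      ((\<lambda>v. g (s, x, v)) has_real_derivative gw (s, x, w)) (at w) \<and>
      ((\<lambda>v. gw (s, x, v)) has_real_derivative gww (s, x, w)) (at w)" if u: "(s,x,w) \<in> U" for s x w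
  proof (intro conjI)
    note E = ev[OF u]
    note P = assms(8)[unfolded pderivs_def, THEN conjunct1, rule_format, OF u]
    show "((\<lambda>t. g (t, x, w)) has_real_derivative gt (s, x, w)) (at s)"
      using P assms(3)[OF u] DERIV_cong_ev[OF refl eventually_mono[OF E(1) assms(2)] refl] by simp
    show "((\<lambda>t. g (s,t, w)) has_real_derivative gx (s, x, w)) (at x)"
      using P assms(4)[OF u] DERIV_cong_ev[OF refl eventually_mono[OF E(2) assms(2)] refl] by simp
    show "((\<lambda>t. gx (s,t, w)) has_real_derivative gxx (s, x, w)) (at x)"
      using P assms(5)[OF u] DERIV_cong_ev[OF refl eventually_mono[OF E(2) assms(4)] refl] by simp
    show "((\<lambda>t. g (s,x,t)) has_real_derivative gw (s, x, w)) (at w)"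
      using P assms(6)[OF u] DERIV_cong_ev[OF refl eventually_mono[OF E(3) assms(2)] refl] by simp
    show "((\<lambda>t. gw (s,x,t)) has_real_derivative gww (s, x, w)) (at w)"
      using P assms(7)[OF u] DERIV_cong_ev[OF refl eventually_mono[OF E(3) assms(6)] refl] by simp
  qed
  moreover have "continuous_on U g" "continuous_on U gt" "continuous_on U gx" "continuous_on U gxx"
    "continuous_on U gw" "continuous_on U gww"
    using assms unfolding pderivs_def by (auto cong: continuous_on_cong)
  ultimately show ?thesis unfolding pderivs_def by blast
qed

text \<open>The map acts on each coordinate separately, so pure derivatives are carried to pure
  derivatives. A shear or a rotation would bring in mixed ones.\<close>

lemma pderivs_affine:
  fixes h1 h2 h3 k :: real
  assumes "pderivs U f ft fx fxx fw fww"
  defines "T \<equiv> \<lambda>(s,x,w). (s + h1, k * x + h2, w + h3) :: point"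
  shows "pderivs (T -` U) (\<lambda>z. f (T z)) (\<lambda>z. ft (T z)) (\<lambda>z. k * fx (T z)) (\<lambda>z. k\<^sup>2 * fxx (T z))
    (\<lambda>z. fw (T z)) (\<lambda>z. fww (T z))"
proof -
  have cT: "continuous_on A T" for A
    unfolding T_def case_prod_beta by (intro continuous_intros)
  have cont: "continuous_on (T -` U) (\<lambda>z. g (T z))" if "continuous_on U g" for g :: "point \<Rightarrow> real"
    by (rule continuous_on_compose2[OF that cT]) auto
  have ch1: "((\<lambda>t. g (t + a)) has_real_derivative D) (at x)"
    if "(g has_real_derivative D) (at (x + a))" for g D x and a :: real
    using that by (simp add: DERIV_shift)
  have ch2: "((\<lambda>t. g (k * t + a)) has_real_derivative k * D) (at x)"
    if "(g has_real_derivative D) (at (k * x + a))" for g D x and a :: real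
  proof -
    have "((\<lambda>t. k * t + a) has_real_derivative k) (at x)" by (auto intro!: derivative_eq_intros)
    from DERIV_chain2[OF that this] show ?thesis by (simp add: mult.commute)
  qed
  show ?thesis
    unfolding pderivs_def
  proof (intro conjI allI impI)
    fix s x w assume "(s,x,w) \<in> T -` U"
    then have u: "(s + h1, k * x + h2, w + h3) \<in> U" by (simp add: T_def)
    note P = assms(1)[unfolded pderivs_def, THEN conjunct1, rule_format, OF u]
    show "((\<lambda>t. f (T (t, x, w))) has_real_derivative ft (T (s, x, w))) (at s)"
      using P by (auto simp: T_def intro!: ch1[of "\<lambda>t. f (t, k * x + h2, w + h3)"])
    show "((\<lambda>t. f (T (s,t, w))) has_real_derivative k * fx (T (s, x, w))) (at x)"
      using P by (auto simp: T_def intro!: ch2[of "\<lambda>t. f (s + h1, t, w + h3)"])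
    have "((\<lambda>t. fx (T (s,t, w))) has_real_derivative k * fxx (T (s, x, w))) (at x)"
      using P by (auto simp: T_def intro!: ch2[of "\<lambda>t. fx (s + h1, t, w + h3)"])
    from DERIV_cmult[OF this, of k]
    show "((\<lambda>t. k * fx (T (s,t, w))) has_real_derivative k\<^sup>2 * fxx (T (s, x, w))) (at x)"
      by (simp add: power2_eq_square mult.assoc)
    show "((\<lambda>t. f (T (s,x,t))) has_real_derivative fw (T (s, x, w))) (at w)"
      using P by (auto simp: T_def intro!: ch1[of "\<lambda>t. f (s + h1, k * x + h2, t)"])
    show "((\<lambda>t. fw (T (s,x,t))) has_real_derivative fww (T (s, x, w))) (at w)"
      using P by (auto simp: T_def intro!: ch1[of "\<lambda>t. fw (s + h1, k * x + h2, t)"])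
  qed (use assms(1) in \<open>auto simp: pderivs_def intro!: cont continuous_on_mult_left\<close>)
qed

lemma pderivs_translate:
  assumes "pderivs U f ft fx fxx fw fww"
  shows "pderivs {z. z + h \<in> U} (\<lambda>z. f (z + h)) (\<lambda>z. ft (z + h)) (\<lambda>z. fx (z + h)) (\<lambda>z. fxx (z + h))
    (\<lambda>z. fw (z + h)) (\<lambda>z. fww (z + h))"
proof -
  obtain h1 h2 h3 where h: "h = (h1, h2, h3)" by (cases h)
  have T: "(\<lambda>(s,x,w). (s + h1, 1 * x + h2, w + h3)) = (\<lambda>z. z + h)" by (auto simp: h)
  show ?thesis
    using pderivs_affine[OF assms, of h1 1 h2 h3, unfolded T] by (simp add: vimage_def)
qed

lemma C1kk_on_imp_pderivs:
  assumes "C1kk_on k U f" "k \<ge> 2"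
  shows "pderivs U f (pd_t f) (pd_x f) (pd_x (pd_x f)) (pd_w f) (pd_w (pd_w f))"
proof -
  have T: "\<forall>(s, x, w)\<in>U. (\<lambda>t. f (t, x, w)) differentiable (at s)"
    and X: "\<And>j. j < k \<Longrightarrow> \<forall>(s, x, w)\<in>U. (\<lambda>y. (pd_x ^^ j) f (s, y, w)) differentiable (at x)"
    and W: "\<And>j. j < k \<Longrightarrow> \<forall>(s, x, w)\<in>U. (\<lambda>v. (pd_w ^^ j) f (s, x, v)) differentiable (at w)"
    and c: "continuous_on U (pd_t f)" "\<And>j. j \<le> k \<Longrightarrow> continuous_on U ((pd_x ^^ j) f)"
      "\<And>j. j \<le> k \<Longrightarrow> continuous_on U ((pd_w ^^ j) f)"
    using assms(1)[unfolded C1kk_on_def] by simp_all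
  have c': "continuous_on U f" "continuous_on U (pd_x f)" "continuous_on U (pd_x (pd_x f))"
     "continuous_on U (pd_w f)" "continuous_on U (pd_w (pd_w f))"
    using c(2)[of 0] c(2)[of 1] c(2)[of 2] c(3)[of 1] c(3)[of 2] assms(2) by (simp_all add: numeral_2_eq_2)
  show ?thesis
  proof (rule pderivsI)
    fix s x w assume u: "(s,x,w) \<in> U"
    show "((\<lambda>t. f (t, x, w)) has_real_derivative pd_t f (s, x, w)) (at s)"
      using bspec[OF T u] by (simp add: pd_t_def DERIV_deriv_iff_real_differentiable)
    show "((\<lambda>y. f (s, y, w)) has_real_derivative pd_x f (s, x, w)) (at x)"
      using bspec[OF X[of 0] u] assms(2) by (simp add: pd_x_def DERIV_deriv_iff_real_differentiable)
    show "((\<lambda>y. f (s, x, y)) has_real_derivative pd_w f (s, x, w)) (at w)"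
      using bspec[OF W[of 0] u] assms(2) by (simp add: pd_w_def DERIV_deriv_iff_real_differentiable)
    have "(\<lambda>y. pd_x f (s, y, w)) differentiable (at x)" using bspec[OF X[of 1] u] assms(2) by simp
    then show "((\<lambda>y. pd_x f (s, y, w)) has_real_derivative pd_x (pd_x f) (s, x, w)) (at x)"
      unfolding pd_x_def[of "pd_x f"] by (simp add: DERIV_deriv_iff_real_differentiable)
    have "(\<lambda>y. pd_w f (s, x, y)) differentiable (at w)" using bspec[OF W[of 1] u] assms(2) by simp
    then show "((\<lambda>y. pd_w f (s, x, y)) has_real_derivative pd_w (pd_w f) (s, x, w)) (at w)"
      unfolding pd_w_def[of "pd_w f"] by (simp add: DERIV_deriv_iff_real_differentiable)
  qed (fact c(1) c')+
qed

text \<open>Openness matters for the second order: \<open>pd_x f\<close> agrees with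
  \<open>fx\<close> on \<open>U\<close> only, and differentiating it once more needs this agreement
  on a neighbourhood of the point.\<close>

lemma pderivs_pd_eq:
  assumes "pderivs U f ft fx fxx fw fww" "open U" "z \<in> U"
  shows "pd_t f z = ft z" "pd_x f z = fx z" "pd_x (pd_x f) z = fxx z" "pd_w f z = fw z"
    "pd_w (pd_w f) z = fww z"
proof -
  obtain s x w where z: "z = (s,x,w)" by (cases z)
  note P = assms(1)[unfolded pderivs_def, THEN conjunct1, rule_format]
  have e: "pd_t f y = ft y" "pd_x f y = fx y" "pd_w f y = fw y" if "y \<in> U" for y
    using that P by (auto simp: pd_t_def pd_x_def pd_w_def intro!: DERIV_imp_deriv split: prod.split)
  show "pd_t f z = ft z" "pd_x f z = fx z" "pd_w f z = fw z" using e assms by auto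
  have "pderivs U f (pd_t f) (pd_x f) fxx (pd_w f) fww"
    by (rule pderivs_cong[OF assms(2) _ _ _ _ _ _ assms(1)]) (simp_all add: e)
  then show "pd_x (pd_x f) z = fxx z" "pd_w (pd_w f) z = fww z"
    using assms(3) unfolding pderivs_def z by (auto simp: pd_x_def pd_w_def intro!: DERIV_imp_deriv)
qed

lemma pderivs_imp_C1kk_on:
  assumes "pderivs U f ft fx fxx fw fww" "open U"
  shows "C1kk_on 2 U f"
proof -
  note e = pderivs_pd_eq[OF assms]
  have P: "pderivs U f (pd_t f) (pd_x f) (pd_x (pd_x f)) (pd_w f) (pd_w (pd_w f))"
    by (rule pderivs_cong[OF assms(2) _ _ _ _ _ _ assms(1)]) (simp_all add: e)
  have j: "j = 0 \<or> j = 1" if "j < 2" for j :: nat using that by auto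
  have j': "j = 0 \<or> j = 1 \<or> j = 2" if "j \<le> 2" for j :: nat using that by auto
  have d: "g differentiable (at y)" if "(g has_real_derivative D) (at y)" for g :: "real \<Rightarrow> real" and D y
    unfolding real_differentiable_def using that by (rule exI)
  note D = pderivsD[OF P, THEN d] and c = pderivs_continuous[OF P]
  show ?thesis
    unfolding C1kk_on_def
  proof (intro conjI allI impI)
    show "\<forall>(s, x, w)\<in>U. (\<lambda>t. f (t, x, w)) differentiable at s" by (clarify, erule D(1))
    show "continuous_on U (pd_t f)" by (rule c)
  next
    fix j :: nat assume "j < 2"
    then consider "j = 0" | "j = 1" using j by blast
    then show "\<forall>(s, x, w)\<in>U. (\<lambda>y. (pd_x ^^ j) f (s, y, w)) differentiable at x"
    proof cases
      case 1 show ?thesis unfolding 1 funpow_0 by (clarify, erule D(2))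
    next
      case 2 show ?thesis unfolding 2 One_nat_def funpow.simps o_apply id_apply by (clarify, erule D(3))
    qed
    from \<open>j < 2\<close> consider "j = 0" | "j = 1" using j by blast
    then show "\<forall>(s, x, w)\<in>U. (\<lambda>v. (pd_w ^^ j) f (s, x, v)) differentiable at w"
    proof cases
      case 1 show ?thesis unfolding 1 funpow_0 by (clarify, erule D(4))
    next
      case 2 show ?thesis unfolding 2 One_nat_def funpow.simps o_apply id_apply by (clarify, erule D(5))
    qed
  next
    fix j :: nat assume "j \<le> 2"
    then consider "j = 0" | "j = 1" | "j = 2" using j' by blast
    then have "(pd_x ^^ j) f = f \<and> (pd_w ^^ j) f = f \<or> (pd_x ^^ j) f = pd_x f \<and> (pd_w ^^ j) f = pd_w f
      \<or> (pd_x ^^ j) f = pd_x (pd_x f) \<and> (pd_w ^^ j) f = pd_w (pd_w f)"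
      by cases (simp_all add: numeral_2_eq_2)
    then show "continuous_on U ((pd_x ^^ j) f)" "continuous_on U ((pd_w ^^ j) f)"
      using c by metis+
  qed
qed

section \<open>The mean value inequality for viscosity supersolutions\<close>

text \<open>Functions that agree on the circle of radius \<open>r\<close> with the real part of a polynomial. They form an
  algebra, so by Stone--Weierstrass harmonic polynomials are dense in the continuous functions there.\<close>

definition hpoly :: "real \<Rightarrow> (complex \<Rightarrow> real) set" where
  "hpoly r = {f. \<exists>p. \<forall>z. cmod z = r \<longrightarrow> f z = Re (poly p z)}"

lemma hpolyI: "(\<And>z. cmod z = r \<Longrightarrow> f z = Re (poly p z)) \<Longrightarrow> f \<in> hpoly r"
  unfolding hpoly_def by blast

lemma hpoly_const: "(\<lambda>_. c) \<in> hpoly r"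
  by (rule hpolyI[where p="[:of_real c:]"]) simp

lemma hpoly_add:
  assumes "f \<in> hpoly r" "g \<in> hpoly r" shows "(\<lambda>z. f z + g z) \<in> hpoly r"
proof -
  obtain p q where "\<And>z. cmod z = r \<Longrightarrow> f z = Re (poly p z)" "\<And>z. cmod z = r \<Longrightarrow> g z = Re (poly q z)"
    using assms unfolding hpoly_def by blast
  then show ?thesis by (intro hpolyI[where p="p + q"]) simp
qed

lemma hpoly_sum: "finite I \<Longrightarrow> (\<And>i. i \<in> I \<Longrightarrow> f i \<in> hpoly r) \<Longrightarrow> (\<lambda>z. \<Sum>i\<in>I. f i z) \<in> hpoly r"
  by (induction I rule: finite_induct) (auto intro!: hpoly_add hpoly_const)

text \<open>On the circle \<open>z * cnj z = r^2\<close>, so for \<open>j \<le> i\<close> the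
  monomial reduces to a multiple of \<open>z ^ (i - j)\<close>. For \<open>i < j\<close> pass to the
  conjugate, which has the same real part.\<close>

lemma hpoly_monom: "(\<lambda>z. Re (c * z ^ i * cnj z ^ j)) \<in> hpoly r"
proof -
  have *: "(\<lambda>z. Re (c * z ^ i * cnj z ^ j)) \<in> hpoly r" if "j \<le> i" for c :: complex and i j
  proof (rule hpolyI[where p="monom (c * of_real (r\<^sup>2) ^ j) (i - j)"])
    fix z assume z: "cmod z = r"
    have "z ^ i * cnj z ^ j = z ^ (i - j) * (z * cnj z) ^ j"
      using that by (simp add: power_mult_distrib flip: power_add mult.assoc)
    also have "z * cnj z = of_real (r\<^sup>2)" using z by (metis complex_norm_square of_real_power)
    finally have "z ^ i * cnj z ^ j = z ^ (i - j) * of_real (r\<^sup>2) ^ j" .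
    then have "c * z ^ i * cnj z ^ j = c * of_real (r\<^sup>2) ^ j * z ^ (i - j)"
      by (metis mult.assoc mult.commute)
    then show "Re (c * z ^ i * cnj z ^ j) = Re (poly (monom (c * of_real (r\<^sup>2) ^ j) (i - j)) z)"
      by (simp only: poly_monom)
  qed
  show ?thesis
  proof (cases "j \<le> i")
    case True then show ?thesis by (rule *)
  next
    case False
    have "Re (c * z ^ i * cnj z ^ j) = Re (cnj c * z ^ j * cnj z ^ i)" for z
    proof -
      have "Re (c * z ^ i * cnj z ^ j) = Re (cnj (c * z ^ i * cnj z ^ j))" by (simp only: cnj.sel)
      also have "cnj (c * z ^ i * cnj z ^ j) = cnj c * z ^ j * cnj z ^ i" by simp
      finally show ?thesis .
    qed
    then show ?thesis using *[of i j "cnj c"] False by simp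
  qed
qed

text \<open>\<open>Re A * Re B\<close> is half of \<open>Re (A * B) + Re (A * cnj B)\<close>. The
  first part is again a polynomial; the second expands into the monomials of the previous
  lemma.\<close>

lemma hpoly_mult:
  assumes "f \<in> hpoly r" "g \<in> hpoly r" shows "(\<lambda>z. f z * g z) \<in> hpoly r"
proof -
  obtain p q where f: "\<And>z. cmod z = r \<Longrightarrow> f z = Re (poly p z)"
    and g: "\<And>z. cmod z = r \<Longrightarrow> g z = Re (poly q z)"
    using assms unfolding hpoly_def by blast
  define h where "h = (\<lambda>z. \<Sum>i\<le>degree p. \<Sum>j\<le>degree q. Re (coeff p i * cnj (coeff q j) / 2 * z ^ i * cnj z ^ j))"
  have "h \<in> hpoly r" unfolding h_def by (intro hpoly_sum hpoly_monom) auto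
  moreover have "(\<lambda>z. Re (poly (smult (1/2) (p * q)) z)) \<in> hpoly r" by (rule hpolyI) (rule refl)
  ultimately have "(\<lambda>z. Re (poly (smult (1/2) (p * q)) z) + h z) \<in> hpoly r" by (intro hpoly_add)
  then obtain P where P: "\<And>z. cmod z = r \<Longrightarrow> Re (poly (smult (1/2) (p * q)) z) + h z = Re (poly P z)"
    unfolding hpoly_def by blast
  have hz: "h z = Re (poly p z * cnj (poly q z)) / 2" for z
  proof -
    have "poly p z * cnj (poly q z) = (\<Sum>i\<le>degree p. \<Sum>j\<le>degree q. coeff p i * cnj (coeff q j) * z ^ i * cnj z ^ j)"
      by (simp add: poly_altdef sum_product mult_ac)
    then show ?thesis unfolding h_def by (simp add: sum_divide_distrib Re_sum flip: Re_divide_of_real)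
  qed
  have R: "Re A * Re B = Re (A * B) / 2 + Re (A * cnj B) / 2" for A B :: complex
    by (simp add: field_simps)
  show ?thesis
  proof (rule hpolyI[where p=P])
    fix z assume z: "cmod z = r"
    have "f z * g z = Re (poly p z * poly q z) / 2 + Re (poly p z * cnj (poly q z)) / 2"
      using f[OF z] g[OF z] R by simp
    also have "\<dots> = Re (poly P z)" using P[OF z] by (simp add: hz)
    finally show "f z * g z = Re (poly P z)" .
  qed
qed

lemma hpoly_dense:
  assumes f: "continuous_on (sphere 0 r) f" and e: "e > 0"
  obtains p where "\<And>z. cmod z = r \<Longrightarrow> \<bar>f z - Re (poly p z)\<bar> < e"
proof -
  have "\<exists>g. g \<in> hpoly r \<and> (\<forall>x\<in>sphere 0 r. \<bar>f x - g x\<bar> < e)"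
  proof (rule Stone_Weierstrass_HOL[where P="\<lambda>g. g \<in> hpoly r"])
    fix g assume "g \<in> hpoly r"
    then obtain p where p: "\<And>z. cmod z = r \<Longrightarrow> g z = Re (poly p z)" unfolding hpoly_def by blast
    have "continuous_on (sphere 0 r) (\<lambda>z. Re (poly p z))" by (intro continuous_intros)
    then show "continuous_on (sphere 0 r) g" by (rule continuous_on_eq) (simp add: p)
  next
    fix x y :: complex assume xy: "x \<in> sphere 0 r \<and> y \<in> sphere 0 r \<and> x \<noteq> y"
    have 1: "Re \<in> hpoly r" by (rule hpolyI[where p="[:0,1:]"]) simp
    have 2: "Im \<in> hpoly r" by (rule hpolyI[where p="[:0,-\<i>:]"]) simp
    from xy have "Re x \<noteq> Re y \<or> Im x \<noteq> Im y" by (auto simp: complex_eq_iff)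
    with 1 2 show "\<exists>f. f \<in> hpoly r \<and> f x \<noteq> f y" by blast
  qed (use f e in \<open>auto intro: hpoly_const hpoly_add hpoly_mult\<close>)
  then obtain g where "g \<in> hpoly r" "\<forall>x\<in>sphere 0 r. \<bar>f x - g x\<bar> < e" by blast
  then show ?thesis using that unfolding hpoly_def by force
qed

section \<open>Mean values of polynomials over circles, and harmonic functions on ellipses\<close>

lemma has_integral_cis:
  fixes m :: int assumes "m \<noteq> 0"
  shows "((\<lambda>t. cis (2 * pi * of_int m * t)) has_integral 0) {0..1}"
proof -
  define c where "c = 2 * pi * of_int m"
  have c: "c \<noteq> 0" using assms by (simp add: c_def)
  have "((\<lambda>t. exp (\<i> * of_real c * of_real t)) has_integral
      (exp (\<i> * of_real c * of_real 1) / (\<i> * of_real c) - exp (\<i> * of_real c * of_real 0) / (\<i> * of_real c))) {0..1}"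
  proof (rule fundamental_theorem_of_calculus)
    fix t :: real assume "t \<in> {0..1}"
    have "((\<lambda>t. \<i> * of_real c * of_real t) has_vector_derivative \<i> * of_real c) (at t)"
      by (auto intro!: derivative_eq_intros simp: has_vector_derivative_def scaleR_conv_of_real)
    from field_vector_diff_chain_at[OF this DERIV_exp]
    have "((\<lambda>t. exp (\<i> * of_real c * of_real t)) has_vector_derivative
        \<i> * of_real c * exp (\<i> * of_real c * of_real t)) (at t)" by (simp add: o_def)
    from has_vector_derivative_divide[OF this, of "\<i> * of_real c"] c
    show "((\<lambda>t. exp (\<i> * of_real c * of_real t) / (\<i> * of_real c)) has_vector_derivative
        exp (\<i> * of_real c * of_real t)) (at t within {0..1})"
      by (auto intro: has_vector_derivative_at_within)
  qed simp
  moreover have "exp (\<i> * of_real c) = 1"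
  proof -
    have "exp (\<i> * of_real c) = cis c" by (simp add: cis_conv_exp)
    also have "\<dots> = 1" unfolding c_def by (metis cis_multiple_2pi Ints_of_int)
    finally show ?thesis .
  qed
  moreover have "cis (c * t) = exp (\<i> * of_real c * of_real t)" for t by (simp add: cis_conv_exp mult.assoc)
  ultimately show ?thesis by (simp add: c_def[symmetric])
qed

text \<open>All powers except the constant one integrate to zero. The winding number
  \<open>k\<close> and the sign of \<open>\<rho>\<close> are free so that reflected parametrisations
  of the same circle are covered too.\<close>

lemma has_integral_poly_circle:
  fixes k :: int and \<rho> :: real assumes "k \<noteq> 0"
  shows "((\<lambda>t. poly p (of_real \<rho> * cis (2 * pi * of_int k * t))) has_integral poly p 0) {0..1}"
proof -
  have n: "((\<lambda>t. coeff p i * (of_real \<rho> * cis (2 * pi * of_int k * t)) ^ i) has_integral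
      (if i = 0 then poly p 0 else 0)) {0..1}" for i
  proof (cases "i = 0")
    case True
    then show ?thesis using has_integral_const_real[of "coeff p 0" 0 1] by (simp add: poly_0_coeff_0)
  next
    case False
    have "((\<lambda>t. cis (2 * pi * of_int (int i * k) * t)) has_integral 0) {0..1}"
      by (rule has_integral_cis) (use assms False in auto)
    from has_integral_mult_right[OF this, of "coeff p i * of_real \<rho> ^ i"]
    have "((\<lambda>t. coeff p i * of_real \<rho> ^ i * cis (2 * pi * of_int (int i * k) * t)) has_integral 0) {0..1}" by simp
    moreover have "coeff p i * (of_real \<rho> * cis (2 * pi * of_int k * t)) ^ i
        = coeff p i * of_real \<rho> ^ i * cis (2 * pi * of_int (int i * k) * t)" for t
    proof -
      have "cis (2 * pi * of_int k * t) ^ i = cis (2 * pi * of_int (int i * k) * t)"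
        unfolding Complex.DeMoivre by (rule arg_cong[where f=cis]) simp
      then show ?thesis by (simp only: power_mult_distrib mult.assoc)
    qed
    ultimately show ?thesis using False by (simp only: if_False)
  qed
  have "((\<lambda>t. \<Sum>i\<le>degree p. coeff p i * (of_real \<rho> * cis (2 * pi * of_int k * t)) ^ i) has_integral
      (\<Sum>i\<le>degree p. if i = 0 then poly p 0 else 0)) {0..1}"
    by (intro has_integral_sum n) auto
  then show ?thesis by (simp add: poly_altdef[of p "_ * _"])
qed

text \<open>\<open>Z\<close> maps the ellipse with semi-axes proportional to
  \<open>\<alpha>\<close>, \<open>\<beta>\<close> to a circle. The point of the formulas is that
  \<open>\<alpha>^2\<close> times the second \<open>x\<close>-derivative plus
  \<open>\<beta>^2\<close> times the second \<open>w\<close>-derivative vanishes.\<close>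

lemma pderivs_Re_poly:
  fixes \<alpha> \<beta> x0 w0 :: real
  defines "Z \<equiv> \<lambda>(s,x,w). Complex ((x - x0) / \<alpha>) ((w - w0) / \<beta>)"
  shows "pderivs UNIV (\<lambda>z. Re (poly p (Z z))) (\<lambda>_. 0) (\<lambda>z. Re (poly (pderiv p) (Z z)) / \<alpha>)
    (\<lambda>z. Re (poly (pderiv (pderiv p)) (Z z)) / \<alpha>\<^sup>2) (\<lambda>z. Re (\<i> * poly (pderiv p) (Z z)) / \<beta>)
    (\<lambda>z. - Re (poly (pderiv (pderiv p)) (Z z)) / \<beta>\<^sup>2)"
proof -
  have Zalt: "Z = (\<lambda>z. of_real ((fst (snd z) - x0) / \<alpha>) + \<i> * of_real ((snd (snd z) - w0) / \<beta>))"
    by (auto simp: Z_def complex_eq_iff)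
  have cZ: "continuous_on UNIV Z"
    unfolding Zalt divide_inverse by (intro continuous_intros)
  have cp: "continuous_on UNIV (\<lambda>z. poly q (Z z))" for q
    by (rule continuous_on_compose2[OF _ cZ, where t=UNIV]) (auto intro: continuous_intros)
  have dx: "((\<lambda>y. Re (c * poly q (Z (s,y,w)))) has_real_derivative Re (c * poly (pderiv q) (Z (s,x,w))) / \<alpha>) (at x)"
    for c q s x w
  proof -
    have "((\<lambda>y. of_real ((y - x0) / \<alpha>) + \<i> * of_real ((w - w0) / \<beta>)) has_vector_derivative of_real (1/\<alpha>)) (at x)"
      by (auto intro!: derivative_eq_intros simp: has_vector_derivative_def scaleR_conv_of_real divide_inverse)
    then have "((\<lambda>y. Z (s,y,w)) has_vector_derivative of_real (1/\<alpha>)) (at x)" by (simp add: Zalt)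
    from field_vector_diff_chain_at[OF this poly_DERIV, of q]
    have "((\<lambda>y. poly q (Z (s,y,w))) has_vector_derivative of_real (1/\<alpha>) * poly (pderiv q) (Z (s,x,w))) (at x)"
      by (simp add: o_def)
    then have "((\<lambda>y. c * poly q (Z (s,y,w))) has_vector_derivative c * (of_real (1/\<alpha>) * poly (pderiv q) (Z (s,x,w)))) (at x)"
      by (rule has_vector_derivative_mult_right)
    then have "((\<lambda>y. Re (c * poly q (Z (s,y,w)))) has_vector_derivative Re (c * (of_real (1/\<alpha>) * poly (pderiv q) (Z (s,x,w))))) (at x)"
      by (rule bounded_linear.has_vector_derivative[OF bounded_linear_Re])
    moreover have "Re (c * (of_real (1/\<alpha>) * X)) = Re (c * X) / \<alpha>" for X
      by (simp add: field_simps)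
    ultimately show ?thesis by (simp add: has_real_derivative_iff_has_vector_derivative)
  qed
  have dw: "((\<lambda>y. Re (c * poly q (Z (s,x,y)))) has_real_derivative Re (c * \<i> * poly (pderiv q) (Z (s,x,w))) / \<beta>) (at w)"
    for c q s x w
  proof -
    have "((\<lambda>y. of_real ((x - x0) / \<alpha>) + \<i> * of_real ((y - w0) / \<beta>)) has_vector_derivative \<i> * of_real (1/\<beta>)) (at w)"
      by (auto intro!: derivative_eq_intros simp: has_vector_derivative_def scaleR_conv_of_real divide_inverse)
    then have "((\<lambda>y. Z (s,x,y)) has_vector_derivative \<i> * of_real (1/\<beta>)) (at w)" by (simp add: Zalt)
    from field_vector_diff_chain_at[OF this poly_DERIV, of q]
    have "((\<lambda>y. poly q (Z (s,x,y))) has_vector_derivative \<i> * of_real (1/\<beta>) * poly (pderiv q) (Z (s,x,w))) (at w)"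
      by (simp add: o_def)
    then have "((\<lambda>y. c * poly q (Z (s,x,y))) has_vector_derivative c * (\<i> * of_real (1/\<beta>) * poly (pderiv q) (Z (s,x,w)))) (at w)"
      by (rule has_vector_derivative_mult_right)
    then have "((\<lambda>y. Re (c * poly q (Z (s,x,y)))) has_vector_derivative Re (c * (\<i> * of_real (1/\<beta>) * poly (pderiv q) (Z (s,x,w))))) (at w)"
      by (rule bounded_linear.has_vector_derivative[OF bounded_linear_Re])
    moreover have "Re (c * (\<i> * of_real (1/\<beta>) * X)) = Re (c * \<i> * X) / \<beta>" for X
      by (simp add: field_simps)
    ultimately show ?thesis unfolding has_real_derivative_iff_has_vector_derivative by (simp only: mult.assoc)
  qed
  show ?thesis
  proof (rule pderivsI)
    fix s x w :: real
    show "((\<lambda>t. Re (poly p (Z (t,x,w)))) has_real_derivative 0) (at s)" by (simp add: Zalt)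
    show "((\<lambda>t. Re (poly p (Z (s,t,w)))) has_real_derivative Re (poly (pderiv p) (Z (s,x,w))) / \<alpha>) (at x)"
      using dx[of 1] by simp
    show "((\<lambda>t. Re (poly (pderiv p) (Z (s,t,w))) / \<alpha>) has_real_derivative
        Re (poly (pderiv (pderiv p)) (Z (s,x,w))) / \<alpha>\<^sup>2) (at x)"
      using DERIV_cdivide[OF dx[where c=1 and q="pderiv p"], where c=\<alpha>] by (simp add: power2_eq_square)
    show "((\<lambda>t. Re (poly p (Z (s,x,t)))) has_real_derivative Re (\<i> * poly (pderiv p) (Z (s,x,w))) / \<beta>) (at w)"
      using dw[of 1] by simp
    show "((\<lambda>t. Re (\<i> * poly (pderiv p) (Z (s,x,t))) / \<beta>) has_real_derivative
        - Re (poly (pderiv (pderiv p)) (Z (s,x,w))) / \<beta>\<^sup>2) (at w)"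
      using DERIV_cdivide[OF dw[where c=\<i> and q="pderiv p"], where c=\<beta>] by (simp add: power2_eq_square)
  qed (auto simp: divide_inverse intro!: continuous_intros cp)
qed

lemma compact_elliptic_cylinder:
  fixes s x w \<tau> r :: real
  assumes "a > 0" "b > 0"
  shows "compact {(s',x',w'). \<bar>s' - s\<bar> \<le> \<tau> \<and> (x' - x)\<^sup>2 / a + (w' - w)\<^sup>2 / b \<le> r\<^sup>2}" (is "compact ?C")
proof -
  have C: "?C = {z. \<bar>fst z - s\<bar> \<le> \<tau>} \<inter> {z. (fst (snd z) - x)\<^sup>2 / a + (snd (snd z) - w)\<^sup>2 / b \<le> r\<^sup>2}"
    by auto
  have "closed ?C"
    by (subst C, unfold divide_inverse) (intro closed_Int closed_Collect_le continuous_intros)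
  moreover have "bounded ?C"
  proof (rule bounded_subset[OF bounded_cbox])
    show "?C \<subseteq> cbox (s - \<tau>, x - sqrt (a * r\<^sup>2), w - sqrt (b * r\<^sup>2)) (s + \<tau>, x + sqrt (a * r\<^sup>2), w + sqrt (b * r\<^sup>2))"
    proof
      fix z assume z: "z \<in> ?C"
      obtain s' x' w' where ze: "z = (s',x',w')" by (cases z)
      have h: "\<bar>s' - s\<bar> \<le> \<tau>" "(x' - x)\<^sup>2 / a + (w' - w)\<^sup>2 / b \<le> r\<^sup>2" using z by (simp_all add: ze)
      have "0 \<le> (x' - x)\<^sup>2 / a" "0 \<le> (w' - w)\<^sup>2 / b" using assms by simp_all
      with h(2) have "(x' - x)\<^sup>2 / a \<le> r\<^sup>2" "(w' - w)\<^sup>2 / b \<le> r\<^sup>2" by simp_all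
      then have "(x' - x)\<^sup>2 \<le> a * r\<^sup>2" "(w' - w)\<^sup>2 \<le> b * r\<^sup>2" using assms by (simp_all add: field_simps)
      then have "\<bar>x' - x\<bar> \<le> sqrt (a * r\<^sup>2)" "\<bar>w' - w\<bar> \<le> sqrt (b * r\<^sup>2)"  by (auto intro!: real_le_rsqrt)
      with h(1) show "z \<in> cbox (s - \<tau>, x - sqrt (a * r\<^sup>2), w - sqrt (b * r\<^sup>2))
          (s + \<tau>, x + sqrt (a * r\<^sup>2), w + sqrt (b * r\<^sup>2))"
        unfolding cbox_Pair_eq ze by (auto simp: abs_le_iff)
    qed
  qed
  ultimately show ?thesis by (simp add: compact_eq_bounded_closed)
qed

text \<open>Compare \<open>V\<close> with harmonic polynomials that are close to it on the boundary ellipse; the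
  term \<open>- Q (s' - s)\<^sup>2\<close> localises the comparison to one time slice.\<close>

lemma mean_value_inequality:
  fixes V :: "point \<Rightarrow> real" and a b r C \<tau> s x w \<sigma>1 \<sigma>2 :: real
  assumes V: "continuous_on UNIV V" and ab: "a > 0" "b > 0" and r: "r > 0" and \<tau>: "\<tau> > 0"
    and B: "\<And>s' x' w'. \<bar>s' - s\<bar> \<le> \<tau> \<Longrightarrow> (x' - x)\<^sup>2 / a + (w' - w)\<^sup>2 / b \<le> r\<^sup>2 \<Longrightarrow> (s', x', w') \<in> B"
    and visc: "\<And>z f ft fx fxx fw fww. z \<in> B \<Longrightarrow> pderivs UNIV f ft fx fxx fw fww \<Longrightarrow> f z = V z \<Longrightarrow>
      \<forall>\<^sub>F z' in nhds z. f z' \<le> V z' \<Longrightarrow> a * fxx z + b * fww z \<le> C"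
    and \<sigma>: "\<sigma>1 \<in> {1, -1}" "\<sigma>2 \<in> {1, -1}"
  shows "integral {0..1} (\<lambda>t. V (s, x + \<sigma>1 * sqrt a * r * cos (2 * pi * t), w + \<sigma>2 * sqrt b * r * sin (2 * pi * t)))
    - C * r\<^sup>2 / 4 \<le> V (s, x, w)"
proof (rule field_le_epsilon)
  fix \<epsilon> :: real assume "\<epsilon> > 0"
  \<comment> \<open>Error budget: one \<open>\<eta>\<close> each for the touching value, for the
    shift inside \<open>\<psi>0\<close> and for the approximation of the mean, and
    \<open>\<eta> * r^2 / 4\<close> from the strictness added to \<open>C\<close>.\<close>
  define \<eta> where "\<eta> = \<epsilon> / (3 + r\<^sup>2 / 4)"
  have "3 + r\<^sup>2 / 4 > 0" by (simp add: add_pos_nonneg)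
  then have \<eta>: "\<eta> > 0" "\<eta> * (3 + r\<^sup>2 / 4) = \<epsilon>" using \<open>\<epsilon> > 0\<close> by (simp_all add: \<eta>_def)
  define Z where "Z = (\<lambda>(s::real, x', w'). Complex ((x' - x) / sqrt a) ((w' - w) / sqrt b))"
  define f where "f = (\<lambda>z. V (s, x + sqrt a * Re z, w + sqrt b * Im z))"
  have cf: "continuous_on S f" for S
    unfolding f_def by (rule continuous_on_compose2[OF V]) (auto intro!: continuous_intros)
  obtain p where p: "\<And>z. cmod z = r \<Longrightarrow> \<bar>f z - Re (poly p z)\<bar> < \<eta>"
    using hpoly_dense[OF cf \<eta>(1)] by metis
  define K where "K = {(s',x',w'). \<bar>s' - s\<bar> \<le> \<tau> \<and> (x' - x)\<^sup>2 / a + (w' - w)\<^sup>2 / b \<le> r\<^sup>2}"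
  have K: "compact K" unfolding K_def by (rule compact_elliptic_cylinder[OF ab])
  have cK: "(s,x,w) \<in> K" using \<tau> r by (simp add: K_def)
  have "uniformly_continuous_on K V"
    using K V by (meson compact_uniformly_continuous continuous_on_subset subset_UNIV)
  then obtain d where d: "d > 0" "\<And>z z'. z \<in> K \<Longrightarrow> z' \<in> K \<Longrightarrow> dist z' z < d \<Longrightarrow> dist (V z') (V z) < \<eta>"
    using \<eta>(1) unfolding uniformly_continuous_on_def by metis
  \<comment> \<open>Over times within \<open>\<tau>1\<close> the value of \<open>V\<close> changes
    by less than \<open>\<eta>\<close>, so the approximation by \<open>p\<close>, made in the slice
    \<open>s\<close>, remains usable on the lateral surface.\<close>
  define \<tau>1 where "\<tau>1 = min \<tau> (d / 2)"
  have \<tau>1: "\<tau>1 > 0" "\<tau>1 \<le> \<tau>" "\<tau>1 < d" using \<tau> d by (auto simp: \<tau>1_def)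
  \<comment> \<open>The quadratic correction vanishes on the boundary ellipse and contributes
    exactly \<open>C + \<eta>\<close> to the operator, more than a function touching
    \<open>V\<close> from below may have.\<close>
  define \<psi>0 where "\<psi>0 = (\<lambda>z. Re (poly p (Z z)) + (case z of (s',x',w') \<Rightarrow> 0 + (C + \<eta>) / 4 * ((x' - x)\<^sup>2 / a - r\<^sup>2) + (C + \<eta>) / 4 * ((w' - w)\<^sup>2 / b) - \<eta>))"
  have sq: "((\<lambda>y. (y - c)\<^sup>2) has_real_derivative 2 * (y - c)) (at y)" for y c :: real
    by (auto intro!: derivative_eq_intros)
  have P0: "pderivs UNIV \<psi>0 (\<lambda>z. 0 + (case z of (s',x',w') \<Rightarrow> 0))
     (\<lambda>z. Re (poly (pderiv p) (Z z)) / sqrt a + (case z of (s',x',w') \<Rightarrow> (C + \<eta>) / 4 * (2 * (x' - x) / a)))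
     (\<lambda>z. Re (poly (pderiv (pderiv p)) (Z z)) / (sqrt a)\<^sup>2 + (case z of (s',x',w') \<Rightarrow> (C + \<eta>) / 4 * (2 / a)))
     (\<lambda>z. Re (\<i> * poly (pderiv p) (Z z)) / sqrt b + (case z of (s',x',w') \<Rightarrow> (C + \<eta>) / 4 * (2 * (w' - w) / b)))
     (\<lambda>z. - Re (poly (pderiv (pderiv p)) (Z z)) / (sqrt b)\<^sup>2 + (case z of (s',x',w') \<Rightarrow> (C + \<eta>) / 4 * (2 / b)))"
    unfolding \<psi>0_def Z_def add_diff_eq[symmetric]
    by (rule pderivs_add[OF pderivs_Re_poly pderivs_sep])
      (use ab in \<open>auto intro!: derivative_eq_intros simp: field_simps\<close>)
  have c0: "continuous_on S \<psi>0" for S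
    using pderivs_continuous(1)[OF P0] by (rule continuous_on_subset) simp
  obtain Bd where Bd: "\<And>z. z \<in> K \<Longrightarrow> \<bar>V z - \<psi>0 z\<bar> \<le> Bd"
  proof -
    have "continuous_on K (\<lambda>z. V z - \<psi>0 z)"
      by (intro continuous_on_diff c0 continuous_on_subset[OF V]) auto
    then have "bounded ((\<lambda>z. V z - \<psi>0 z) ` K)" using K compact_continuous_image compact_imp_bounded by blast
    then show ?thesis using that unfolding bounded_real by auto
  qed
  have Bd0: "Bd \<ge> 0" using Bd[OF cK] by linarith
  \<comment> \<open>Chosen so that on the end faces, where the distance from \<open>s\<close> is
    \<open>\<tau>1\<close>, the time penalty equals \<open>Bd\<close> and pushes
    \<open>\<psi>\<close> below \<open>V\<close>.\<close>
  define Q where "Q = Bd / \<tau>1\<^sup>2"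
  have Q0: "Q \<ge> 0" using Bd0 by (simp add: Q_def)
  define \<psi> where "\<psi> = (\<lambda>z. \<psi>0 z + (case z of (s',x',w') \<Rightarrow> - Q * (s' - s)\<^sup>2 + 0 + 0))"
  have P: "pderivs UNIV \<psi> (\<lambda>z. (0 + (case z of (s',x',w') \<Rightarrow> 0)) + (case z of (s',x',w') \<Rightarrow> - Q * (2 * (s' - s))))
     (\<lambda>z. (Re (poly (pderiv p) (Z z)) / sqrt a + (case z of (s',x',w') \<Rightarrow> (C + \<eta>) / 4 * (2 * (x' - x) / a))) + (case z of (s',x',w') \<Rightarrow> 0))
     (\<lambda>z. (Re (poly (pderiv (pderiv p)) (Z z)) / (sqrt a)\<^sup>2 + (case z of (s',x',w') \<Rightarrow> (C + \<eta>) / 4 * (2 / a))) + (case z of (s',x',w') \<Rightarrow> 0))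
     (\<lambda>z. (Re (\<i> * poly (pderiv p) (Z z)) / sqrt b + (case z of (s',x',w') \<Rightarrow> (C + \<eta>) / 4 * (2 * (w' - w) / b))) + (case z of (s',x',w') \<Rightarrow> 0))
     (\<lambda>z. (- Re (poly (pderiv (pderiv p)) (Z z)) / (sqrt b)\<^sup>2 + (case z of (s',x',w') \<Rightarrow> (C + \<eta>) / 4 * (2 / b))) + (case z of (s',x',w') \<Rightarrow> 0))"
    unfolding \<psi>_def
    by (rule pderivs_add[OF P0 pderivs_sep]) (auto intro!: derivative_eq_intros continuous_intros)
  define K1 where "K1 = {(s',x',w'). \<bar>s' - s\<bar> \<le> \<tau>1 \<and> (x' - x)\<^sup>2 / a + (w' - w)\<^sup>2 / b \<le> r\<^sup>2}"
  have K1: "compact K1" unfolding K1_def by (rule compact_elliptic_cylinder[OF ab])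
  have K1K: "K1 \<subseteq> K" unfolding K1_def K_def using \<tau>1 by auto
  have cK1: "(s,x,w) \<in> K1" using \<tau>1 r by (simp add: K1_def)
  have c\<psi>: "continuous_on S \<psi>" for S
    using pderivs_continuous(1)[OF P] by (rule continuous_on_subset) simp
  have "continuous_on K1 (\<lambda>z. V z - \<psi> z)" by (intro continuous_on_diff c\<psi> continuous_on_subset[OF V]) auto
  then obtain z1 where z1: "z1 \<in> K1" "\<And>z. z \<in> K1 \<Longrightarrow> V z1 - \<psi> z1 \<le> V z - \<psi> z"
    using continuous_attains_inf[OF K1] cK1 by blast
  obtain s1 x1 w1 where z1e: "z1 = (s1,x1,w1)" by (cases z1)
  have "V z1 - \<psi> z1 \<ge> - \<eta>"
  proof -
    have b1: "\<bar>s1 - s\<bar> \<le> \<tau>1" "(x1 - x)\<^sup>2 / a + (w1 - w)\<^sup>2 / b \<le> r\<^sup>2" using z1(1) by (auto simp: z1e K1_def)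
    have z1K: "z1 \<in> K" using z1 K1K by auto
    consider "\<bar>s1 - s\<bar> = \<tau>1" | "(x1 - x)\<^sup>2 / a + (w1 - w)\<^sup>2 / b = r\<^sup>2"
      | "\<bar>s1 - s\<bar> < \<tau>1" "(x1 - x)\<^sup>2 / a + (w1 - w)\<^sup>2 / b < r\<^sup>2" using b1 by linarith
    then show ?thesis
    proof cases
      case 1
      have "(s1 - s)\<^sup>2 = \<tau>1\<^sup>2" using 1 by (metis power2_abs)
      then have "\<psi> z1 = \<psi>0 z1 - Bd" using \<tau>1(1) by (simp add: \<psi>_def z1e Q_def)
      then show ?thesis using Bd[OF z1K] \<eta>(1) by linarith
    next
      case 2
      have mod: "cmod (Z z1) = r"
      proof -
        have "(cmod (Z z1))\<^sup>2 = (x1 - x)\<^sup>2 / a + (w1 - w)\<^sup>2 / b"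
          using ab by (simp add: Z_def z1e cmod_power2 power_divide)
        then show ?thesis using 2 r by (simp add: power2_eq_iff_nonneg)
      qed
      have fZ: "f (Z z1) = V (s, x1, w1)" using ab by (simp add: f_def Z_def z1e)
      have "\<psi>0 z1 = Re (poly p (Z z1)) - \<eta>"
      proof -
        have "(C + \<eta>) / 4 * ((x1 - x)\<^sup>2 / a - r\<^sup>2) + (C + \<eta>) / 4 * ((w1 - w)\<^sup>2 / b)
          = (C + \<eta>) / 4 * ((x1 - x)\<^sup>2 / a + (w1 - w)\<^sup>2 / b - r\<^sup>2)" by (simp only: distrib_left[symmetric]) (simp add: algebra_simps)
        then show ?thesis unfolding \<psi>0_def z1e using 2 by simp
      qed
      moreover have "\<psi> z1 \<le> \<psi>0 z1" using Q0 by (simp add: \<psi>_def z1e)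
      moreover have "Re (poly p (Z z1)) < V (s,x1,w1) + \<eta>" using p[OF mod] fZ by auto
      moreover have "dist (V z1) (V (s,x1,w1)) < \<eta>"
      proof (rule d(2)[OF _ z1K])
        show "(s,x1,w1) \<in> K" using b1 \<tau> by (simp add: K_def)
        show "dist z1 (s,x1,w1) < d" using b1 \<tau>1 by (simp add: z1e dist_Pair_Pair dist_real_def)
      qed
      ultimately show ?thesis by (simp add: dist_real_def)
    next
      case 3
      have op: "open {(s',x',w'). \<bar>s' - s\<bar> < \<tau>1 \<and> (x' - x)\<^sup>2 / a + (w' - w)\<^sup>2 / b < r\<^sup>2}" (is "open ?O")
      proof -
        have "?O = {z. \<bar>fst z - s\<bar> < \<tau>1} \<inter> {z. (fst (snd z) - x)\<^sup>2 / a + (snd (snd z) - w)\<^sup>2 / b < r\<^sup>2}" by auto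
        also have "open \<dots>" unfolding divide_inverse by (intro open_Int open_Collect_less continuous_intros)
        finally show ?thesis .
      qed
      have z1B: "z1 \<in> B" using z1K B by (auto simp: z1e K_def)
      have ev: "\<forall>\<^sub>F z' in nhds z1. \<psi> z' + (V z1 - \<psi> z1) \<le> V z'"
      proof -
        have "\<forall>\<^sub>F z' in nhds z1. z' \<in> ?O" using op 3 by (intro eventually_nhds_in_open) (auto simp: z1e)
        then show ?thesis
        proof eventually_elim
          case (elim z')
          then have "z' \<in> K1" by (auto simp: K1_def)
          from z1(2)[OF this] show ?case by linarith
        qed
      qed
      have "a * (Re (poly (pderiv (pderiv p)) (Z z1)) / (sqrt a)\<^sup>2 + (C + \<eta>) / 4 * (2 / a) + 0 + 0)
          + b * (- Re (poly (pderiv (pderiv p)) (Z z1)) / (sqrt b)\<^sup>2 + (C + \<eta>) / 4 * (2 / b) + 0 + 0) \<le> C"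
        using visc[OF z1B pderivs_add[OF P pderivs_const[of UNIV "V z1 - \<psi> z1"]] _ ev] by (simp add: z1e)
      moreover have "a * (R / (sqrt a)\<^sup>2 + (C + \<eta>) / 4 * (2 / a) + 0 + 0)
          + b * (- R / (sqrt b)\<^sup>2 + (C + \<eta>) / 4 * (2 / b) + 0 + 0) = C + \<eta>" for R
        using ab by (simp add: field_simps)
      ultimately have False using \<eta>(1) by simp
      then show ?thesis ..
    qed
  qed
  then have 1: "V (s,x,w) \<ge> \<psi> (s,x,w) - \<eta>" using z1(2)[OF cK1] by linarith
  have "Z (s,x,w) = 0" by (simp add: Z_def complex_eq_iff)
  then have 2: "\<psi> (s,x,w) = Re (poly p 0) - (C + \<eta>) / 4 * r\<^sup>2 - \<eta>"
    by (simp add: \<psi>_def \<psi>0_def algebra_simps)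
  \<comment> \<open>With radius \<open>\<sigma>1 * r\<close>, equal signs give the positive and
    opposite signs the negative orientation; all four reflected ellipses become circles traversed
    once.\<close>
  define k :: int where "k = (if \<sigma>1 = \<sigma>2 then 1 else -1)"
  define \<zeta> where "\<zeta> = (\<lambda>t. of_real (\<sigma>1 * r) * cis (2 * pi * of_int k * t))"
  have \<zeta>: "\<zeta> t = Complex (\<sigma>1 * r * cos (2 * pi * t)) (\<sigma>2 * r * sin (2 * pi * t))" for t
    using \<sigma> by (auto simp: \<zeta>_def k_def complex_eq_iff)
  have cz: "cmod (\<zeta> t) = r" for t using \<sigma> r by (auto simp: \<zeta>_def norm_mult)
  have "((\<lambda>t. poly p (\<zeta> t)) has_integral poly p 0) {0..1}"
    unfolding \<zeta>_def by (rule has_integral_poly_circle) (simp add: k_def)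
  from has_integral_linear[OF this bounded_linear_Re]
  have I: "((\<lambda>t. Re (poly p (\<zeta> t))) has_integral Re (poly p 0)) {0..1}" unfolding o_def .
  have fI: "V (s, x + \<sigma>1 * sqrt a * r * cos (2 * pi * t), w + \<sigma>2 * sqrt b * r * sin (2 * pi * t)) = f (\<zeta> t)" for t
    by (simp add: f_def \<zeta> mult_ac)
  have "integral {0..1} (\<lambda>t. f (\<zeta> t)) \<le> integral {0..1} (\<lambda>t. Re (poly p (\<zeta> t)) + \<eta>)"
  proof (rule integral_le)
    have c\<zeta>: "continuous_on {0..1} \<zeta>" unfolding \<zeta>_def by (intro continuous_intros)
    have "continuous_on {0..1} (\<lambda>t. f (\<zeta> t))" by (rule continuous_on_compose2[OF cf[of UNIV] c\<zeta>]) auto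
    then show "(\<lambda>t. f (\<zeta> t)) integrable_on {0..1}" by (rule integrable_continuous_real)
    have "(\<lambda>t. Re (poly p (\<zeta> t))) integrable_on {0..1}" using I by blast
    then show "(\<lambda>t. Re (poly p (\<zeta> t)) + \<eta>) integrable_on {0..1}" by (intro integrable_add) auto
    show "f (\<zeta> t) \<le> Re (poly p (\<zeta> t)) + \<eta>" for t using p[OF cz[of t]] by linarith
  qed
  also have "integral {0..1} (\<lambda>t. Re (poly p (\<zeta> t)) + \<eta>) = Re (poly p 0) + \<eta>"
    using has_integral_add[OF I has_integral_const_real[of \<eta> 0 1]] by (simp add: integral_unique)
  finally have 3: "integral {0..1} (\<lambda>t. f (\<zeta> t)) \<le> Re (poly p 0) + \<eta>" .
  have "integral {0..1} (\<lambda>t. f (\<zeta> t)) - C * r\<^sup>2 / 4 \<le> V (s,x,w) + \<eta> * (3 + r\<^sup>2 / 4)"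
    using 1 2 3 by (simp add: field_simps)
  then show "integral {0..1} (\<lambda>t. V (s, x + \<sigma>1 * sqrt a * r * cos (2 * pi * t), w + \<sigma>2 * sqrt b * r * sin (2 * pi * t)))
    - C * r\<^sup>2 / 4 \<le> V (s, x, w) + \<epsilon>"
    unfolding fI \<eta>(2) .
qed

section \<open>Averages along curves and Steklov smoothing\<close>

definition avg :: "(real \<Rightarrow> point) \<Rightarrow> (point \<Rightarrow> real) \<Rightarrow> point \<Rightarrow> real" where
  "avg c f z = integral {0..1} (\<lambda>t. f (z + c t))"

lemma avg_integrable:
  fixes f :: "point \<Rightarrow> real" and c :: "real \<Rightarrow> point"
  assumes "continuous_on UNIV f" "continuous_on {0..1} c"
  shows "(\<lambda>t. f (z + c t)) integrable_on {0..1}"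
  by (intro integrable_continuous_real continuous_on_compose2[OF assms(1)])
    (auto intro!: continuous_intros assms)

lemma avg_continuous:
  assumes "continuous_on UNIV f" "continuous_on {0..1} c"
  shows "continuous_on UNIV (avg c f)"
proof -
  have "continuous_on (UNIV \<times> cbox 0 1) (\<lambda>z. f (fst z + c (snd z)))"
    by (intro continuous_on_compose2[OF assms(1)] continuous_intros continuous_on_compose2[OF assms(2)]) auto
  then have "continuous_on UNIV (\<lambda>z. integral (cbox 0 1) (\<lambda>t. f (z + c t)))"
    by (intro integral_continuous_on_param) (simp add: case_prod_beta)
  then show ?thesis by (simp add: avg_def[abs_def])
qed

text \<open>Fubini. Ellipses and segments are both instances of \<open>avg\<close>, so this one fact
  carries a mean value inequality through the smoothing and also reorders the smoothing
  directions.\<close>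

lemma avg_commute:
  assumes f: "continuous_on UNIV f" and c: "continuous_on {0..1} c" and d: "continuous_on {0..1} d"
  shows "avg c (avg d f) z = avg d (avg c f) z"
proof -
  have "continuous_on (cbox (0,0) (1,1)) (\<lambda>p. f (z + c (fst p) + d (snd p)))"
    by (intro continuous_on_compose2[OF f] continuous_intros continuous_on_compose2[OF c]
        continuous_on_compose2[OF d]) (auto simp: cbox_Pair_eq)
  then have "integral (cbox 0 1) (\<lambda>t. integral (cbox 0 1) (\<lambda>u. f (z + c t + d u)))
    = integral (cbox 0 1) (\<lambda>u. integral (cbox 0 1) (\<lambda>t. f (z + c t + d u)))"
    by (intro integral_swap_continuous) (simp add: case_prod_beta)
  then show ?thesis by (simp add: avg_def add_ac)
qed

lemma avg_mono:
  assumes "continuous_on UNIV f" "continuous_on UNIV g" "continuous_on {0..1} c"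
    "\<And>t. t \<in> {0..1} \<Longrightarrow> f (z + c t) \<le> g (z + c t)"
  shows "avg c f z \<le> avg c g z"
  unfolding avg_def by (intro integral_le avg_integrable assms) 

lemma avg_add_const:
  assumes "continuous_on UNIV f" "continuous_on {0..1} c"
  shows "avg c (\<lambda>z. f z + k) z = avg c f z + k"
  unfolding avg_def by (subst integral_add) (auto intro!: avg_integrable assms)

lemma avg_const: "avg c (\<lambda>_. k) z = k"
  by (simp add: avg_def)

lemma avg_near:
  assumes f: "continuous_on UNIV f" and c: "continuous_on {0..1} c"
    and n: "\<And>t. t \<in> {0..1} \<Longrightarrow> \<bar>f (z + c t) - k\<bar> \<le> e"
  shows "\<bar>avg c f z - k\<bar> \<le> e"
proof -
  have "avg c f z \<le> avg c (\<lambda>_. k + e) z" "avg c (\<lambda>_. k - e) z \<le> avg c f z"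
    by (rule avg_mono[OF _ _ c]; use f n in \<open>force simp: abs_le_iff\<close>)+
  then show ?thesis by (simp add: avg_const abs_le_iff)
qed

definition seg :: "point \<Rightarrow> real \<Rightarrow> real \<Rightarrow> point" where "seg e h t = (t * h) *\<^sub>R e"

lemma continuous_on_seg [continuous_intros]: "continuous_on S (seg e h)"
  unfolding seg_def[abs_def] by (intro continuous_intros)

lemma avg_seg_deriv:
  assumes f: "continuous_on UNIV f" and h: "h > 0"
  shows "((\<lambda>t. avg (seg e h) f (z + t *\<^sub>R e)) has_real_derivative
    (f (z + (t + h) *\<^sub>R e) - f (z + t *\<^sub>R e)) / h) (at t)"
proof -
  define g where "g = (\<lambda>u. f (z + u *\<^sub>R e))"
  have g: "continuous_on S g" for S
    unfolding g_def by (rule continuous_on_compose2[OF f]) (auto intro!: continuous_intros)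
  \<comment> \<open>Any base point to the left of \<open>t\<close> serves; the primitive
    \<open>G\<close> is only needed near \<open>t\<close> and to its right.\<close>
  define a where "a = t - 1"
  define G where "G = (\<lambda>u. integral {a..u} g)"
  have G: "(G has_real_derivative g u) (at u)" if "a < u" for u
  proof -
    have "(G has_vector_derivative g u) (at u within {a..u + 1})"
      unfolding G_def by (rule integral_has_vector_derivative[OF g]) (use that in auto)
    then have "(G has_vector_derivative g u) (at u)"
      using that by (subst (asm) at_within_interior) (auto simp: interior_atLeastAtMost_real)
    then show ?thesis by (simp add: has_real_derivative_iff_has_vector_derivative)
  qed
  have eq: "avg (seg e h) f (z + u *\<^sub>R e) = (G (u + h) - G u) / h" if "a < u" for u
  proof -
    have "((\<lambda>v. g (u + v * h)) has_integral G (u + 1 * h) / h - G (u + 0 * h) / h) {0..1}"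
    proof (rule fundamental_theorem_of_calculus)
      fix v :: real assume v: "v \<in> {0..1}"
      have au: "a < u + v * h" using that v h by (smt (verit) atLeastAtMost_iff mult_nonneg_nonneg)
      have "((\<lambda>v. u + v * h) has_real_derivative h) (at v)" by (auto intro!: derivative_eq_intros)
      from DERIV_cdivide[OF DERIV_chain2[OF G[OF au] this], of h] h
      show "((\<lambda>v. G (u + v * h) / h) has_vector_derivative g (u + v * h)) (at v within {0..1})"
        by (simp add: has_real_derivative_iff_has_vector_derivative has_vector_derivative_at_within)
    qed simp
    moreover have "g (u + v * h) = f (z + u *\<^sub>R e + seg e h v)" for v
      by (simp add: g_def seg_def scaleR_add_left add_ac)
    ultimately show ?thesis by (simp add: avg_def integral_unique diff_divide_distrib)
  qed
  have at: "a < t" by (simp add: a_def)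
  have "((\<lambda>u. G (u + h)) has_real_derivative g (t + h)) (at t)"
    using G[of "t + h"] at h by (simp add: DERIV_shift)
  from DERIV_cdivide[OF DERIV_diff[OF this G[OF at]], of h]
  have "((\<lambda>u. (G (u + h) - G u) / h) has_real_derivative (g (t + h) - g t) / h) (at t)" .
  moreover have "\<forall>\<^sub>F u in nhds t. (G (u + h) - G u) / h = avg (seg e h) f (z + u *\<^sub>R e)"
    using eventually_nhds_in_open[of "{a<..}" t] at by (auto elim!: eventually_mono simp: eq)
  ultimately show ?thesis
    unfolding g_def by (subst (asm) DERIV_cong_ev[OF refl _ refl]) auto
qed

text \<open>Each averaging in the direction \<open>e\<close> turns a derivative into a difference
  quotient, so two of them yield continuous second derivatives from mere continuity of
  \<open>f\<close>.\<close>

lemma avg_seg_seg_deriv: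
  fixes f :: "point \<Rightarrow> real" and e :: point and h :: real
  assumes f: "continuous_on UNIV f" and h: "h > 0"
  defines "F1 \<equiv> \<lambda>y. (avg (seg e h) f (y + h *\<^sub>R e) - avg (seg e h) f y) / h"
  defines "F2 \<equiv> \<lambda>y. (f (y + (2 * h) *\<^sub>R e) - 2 * f (y + h *\<^sub>R e) + f y) / h\<^sup>2"
  shows "((\<lambda>t. avg (seg e h) (avg (seg e h) f) (z + t *\<^sub>R e)) has_real_derivative F1 (z + t *\<^sub>R e)) (at t)"
    and "((\<lambda>t. F1 (z + t *\<^sub>R e)) has_real_derivative F2 (z + t *\<^sub>R e)) (at t)"
    and "continuous_on UNIV F1" "continuous_on UNIV F2"
proof -
  have c: "continuous_on UNIV (avg (seg e h) f)" by (intro avg_continuous f continuous_intros)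
  show "((\<lambda>t. avg (seg e h) (avg (seg e h) f) (z + t *\<^sub>R e)) has_real_derivative F1 (z + t *\<^sub>R e)) (at t)"
    using avg_seg_deriv[OF c h, of e z t] by (simp add: F1_def scaleR_add_left add_ac)
  have 1: "((\<lambda>t. avg (seg e h) f (z + h *\<^sub>R e + t *\<^sub>R e)) has_real_derivative
      (f (z + h *\<^sub>R e + (t + h) *\<^sub>R e) - f (z + h *\<^sub>R e + t *\<^sub>R e)) / h) (at t)"
    by (rule avg_seg_deriv[OF f h])
  have "((\<lambda>t. (avg (seg e h) f (z + h *\<^sub>R e + t *\<^sub>R e) - avg (seg e h) f (z + t *\<^sub>R e)) / h) has_real_derivative
     ((f (z + h *\<^sub>R e + (t + h) *\<^sub>R e) - f (z + h *\<^sub>R e + t *\<^sub>R e)) / h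
      - (f (z + (t + h) *\<^sub>R e) - f (z + t *\<^sub>R e)) / h) / h) (at t)"
    by (rule DERIV_cdivide[OF DERIV_diff[OF 1 avg_seg_deriv[OF f h]]])
  moreover have "z + h *\<^sub>R e + t *\<^sub>R e = z + t *\<^sub>R e + h *\<^sub>R e" for t by simp
  moreover have "((f (z + h *\<^sub>R e + (t + h) *\<^sub>R e) - f (z + h *\<^sub>R e + t *\<^sub>R e)) / h
      - (f (z + (t + h) *\<^sub>R e) - f (z + t *\<^sub>R e)) / h) / h = F2 (z + t *\<^sub>R e)"
  proof -
    have "z + h *\<^sub>R e + (t + h) *\<^sub>R e = z + t *\<^sub>R e + (2 * h) *\<^sub>R e"
      "z + h *\<^sub>R e + t *\<^sub>R e = z + t *\<^sub>R e + h *\<^sub>R e" "z + (t + h) *\<^sub>R e = z + t *\<^sub>R e + h *\<^sub>R e"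
      by (cases z, cases e, simp add: algebra_simps)+
    note e = this
    show ?thesis unfolding F2_def e using h by (simp add: divide_simps power2_eq_square)
  qed
  ultimately show "((\<lambda>t. F1 (z + t *\<^sub>R e)) has_real_derivative F2 (z + t *\<^sub>R e)) (at t)"
    unfolding F1_def by (simp only:)
  have sh: "continuous_on UNIV (\<lambda>y. g (y + v))" if "continuous_on UNIV g" for g :: "point \<Rightarrow> real" and v
    by (rule continuous_on_compose2[OF that]) (auto intro!: continuous_intros)
  show "continuous_on UNIV F1" unfolding F1_def divide_inverse by (intro continuous_intros sh c)
  show "continuous_on UNIV F2" unfolding F2_def divide_inverse by (intro continuous_intros sh f)
qed

definition es :: point where "es = (1,0,0)"
definition ex :: point where "ex = (0,1,0)"
definition ew :: point where "ew = (0,0,1)"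

text \<open>Two averagings in \<open>x\<close> and in \<open>w\<close> for two derivatives, one in
  \<open>s\<close> for one derivative. The segments are one-sided, so each averaging moves a point
  by at most \<open>h\<close>.\<close>

definition steklov :: "real \<Rightarrow> (point \<Rightarrow> real) \<Rightarrow> point \<Rightarrow> real" where
  "steklov h f = avg (seg ex h) (avg (seg ex h) (avg (seg ew h) (avg (seg ew h) (avg (seg es h) f))))"

text \<open>Since the averagings commute, those in the direction of differentiation can be moved
  outermost, where the derivative formulas apply.\<close>

lemma steklov_pderivs:
  assumes f: "continuous_on UNIV f" and h: "h > 0"
  obtains ft fx fxx fw fww where "pderivs UNIV (steklov h f) ft fx fxx fw fww"
proof -
  let ?S = "avg (seg es h)" and ?X = "avg (seg ex h)" and ?W = "avg (seg ew h)"
  have c: "continuous_on UNIV (avg (seg e h) g)" if "continuous_on UNIV g" for e g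
    by (intro avg_continuous that continuous_intros)
  have sw: "avg (seg e h) (avg (seg e' h) g) = avg (seg e' h) (avg (seg e h) g)" if "continuous_on UNIV g" for e e' g
    by (rule ext) (intro avg_commute that continuous_intros)
  define g where "g = ?S f"
  have cg: "continuous_on UNIV g" unfolding g_def by (rule c[OF f])
  have C: "continuous_on UNIV (?W (?W g))" "continuous_on UNIV (?X (?W (?W g)))" by (intro c cg)+
  have eX: "steklov h f = ?X (?X (?W (?W g)))" by (simp add: steklov_def g_def)
  have "steklov h f = ?X (?W (?X (?W g)))" unfolding eX by (subst (2) sw) (intro c cg refl)+
  also have "\<dots> = ?X (?W (?W (?X g)))" unfolding sw[OF cg, of ex ew] ..
  also have "\<dots> = ?W (?X (?W (?X g)))" by (rule sw) (intro c cg)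
  also have "?X (?W (?X g)) = ?W (?X (?X g))" by (rule sw) (intro c cg)
  finally have eW: "steklov h f = ?W (?W (?X (?X g)))" .
  have "?W g = ?S (?W f)" unfolding g_def by (rule sw[OF f])
  moreover have "?W (?S (?W f)) = ?S (?W (?W f))" by (rule sw) (intro c f)
  moreover have "?X (?S (?W (?W f))) = ?S (?X (?W (?W f)))" by (rule sw) (intro c f)
  moreover have "?X (?S (?X (?W (?W f)))) = ?S (?X (?X (?W (?W f))))" by (rule sw) (intro c f)
  ultimately have eS: "steklov h f = ?S (?X (?X (?W (?W f))))" unfolding eX by simp
  have csh: "continuous_on UNIV (\<lambda>y. g (y + v))" if "continuous_on UNIV g" for g :: "point \<Rightarrow> real" and v
    by (rule continuous_on_compose2[OF that]) (auto intro!: continuous_intros)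
  define G where "G = ?X (?X (?W (?W f)))"
  have cG: "continuous_on UNIV G" unfolding G_def by (intro c f)
  define ft where "ft = (\<lambda>y. (G (y + h *\<^sub>R es) - G y) / h)"
  have cft: "continuous_on UNIV ft" unfolding ft_def divide_inverse by (intro continuous_intros csh cG)
  have dt: "((\<lambda>t. steklov h f (t, x, w)) has_real_derivative ft (s,x,w)) (at s)" for s x w
    using avg_seg_deriv[OF cG h, where e=es and z="(0,x,w)" and t=s] unfolding eS G_def[symmetric]
    by (simp add: es_def ft_def)
  define fx where "fx = (\<lambda>y. (avg (seg ex h) (?W (?W g)) (y + h *\<^sub>R ex) - avg (seg ex h) (?W (?W g)) y) / h)"
  define fxx where "fxx = (\<lambda>y. ((?W (?W g)) (y + (2 * h) *\<^sub>R ex) - 2 * (?W (?W g)) (y + h *\<^sub>R ex) + (?W (?W g)) y) / h\<^sup>2)"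
  define fw where "fw = (\<lambda>y. (avg (seg ew h) (?X (?X g)) (y + h *\<^sub>R ew) - avg (seg ew h) (?X (?X g)) y) / h)"
  define fww where "fww = (\<lambda>y. ((?X (?X g)) (y + (2 * h) *\<^sub>R ew) - 2 * (?X (?X g)) (y + h *\<^sub>R ew) + (?X (?X g)) y) / h\<^sup>2)"
  note X = avg_seg_seg_deriv[OF C(1) h, where e=ex]
  have cX: "continuous_on UNIV (?X (?X g))" by (intro c cg)
  note W = avg_seg_seg_deriv[OF cX h, where e=ew]
  have "pderivs UNIV (steklov h f) ft fx fxx fw fww"
  proof (rule pderivsI)
    fix s x w :: real
    have ex: "(s,0,w) + t *\<^sub>R ex = (s,t,w)" "(s,x,0) + t *\<^sub>R ew = (s,x,t)" for t by (simp_all add: ex_def ew_def)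
    show "((\<lambda>y. steklov h f (s, y, w)) has_real_derivative fx (s, x, w)) (at x)"
      using X(1)[where z="(s,0,w)" and t=x] by (simp only: eX fx_def ex)
    show "((\<lambda>y. fx (s, y, w)) has_real_derivative fxx (s, x, w)) (at x)"
      using X(2)[where z="(s,0,w)" and t=x] by (simp only: fx_def fxx_def ex)
    show "((\<lambda>y. steklov h f (s, x, y)) has_real_derivative fw (s, x, w)) (at w)"
      using W(1)[where z="(s,x,0)" and t=w] by (simp only: eW fw_def ex)
    show "((\<lambda>y. fw (s, x, y)) has_real_derivative fww (s, x, w)) (at w)"
      using W(2)[where z="(s,x,0)" and t=w] by (simp only: fw_def fww_def ex)
    show "((\<lambda>t. steklov h f (t, x, w)) has_real_derivative ft (s,x,w)) (at s)" by (rule dt)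
  next
    show "continuous_on UNIV (steklov h f)" unfolding eX by (rule c[OF C(2)])
    show "continuous_on UNIV ft" by (rule cft)
    show "continuous_on UNIV fx" unfolding fx_def by (rule X(3))
    show "continuous_on UNIV fxx" unfolding fxx_def by (rule X(4))
    show "continuous_on UNIV fw" unfolding fw_def by (rule W(3))
    show "continuous_on UNIV fww" unfolding fww_def by (rule W(4))
  qed
  then show ?thesis by (rule that)
qed

lemma steklov_continuous: "continuous_on UNIV f \<Longrightarrow> continuous_on UNIV (steklov h f)"
  unfolding steklov_def by (intro avg_continuous continuous_intros)

lemma norm_basis3 [simp]: "norm es = 1" "norm ex = 1" "norm ew = 1"
  by (simp_all add: es_def ex_def ew_def norm_Pair)

lemma norm_seg: "t \<in> {0..1} \<Longrightarrow> norm e = 1 \<Longrightarrow> h \<ge> 0 \<Longrightarrow> norm (seg e h t) \<le> h"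
  by (simp add: seg_def mult_left_le_one_le)

text \<open>A property stable under a single segment average passes through the five layers; the
  radius \<open>5 * h\<close> is the sum of the five displacements.\<close>

lemma steklov_induct:
  fixes Q :: "(point \<Rightarrow> real) \<Rightarrow> point \<Rightarrow> bool"
  assumes f: "continuous_on UNIV f" and h: "h \<ge> 0"
    and base: "\<And>z. dist z z0 \<le> 5 * h \<Longrightarrow> Q f z"
    and step: "\<And>g e z. continuous_on UNIV g \<Longrightarrow> (\<And>t. t \<in> {0..1} \<Longrightarrow> Q g (z + seg e h t)) \<Longrightarrow> Q (avg (seg e h) g) z"
  shows "Q (steklov h f) z0"
proof -
  have st: "Q (avg (seg e h) g) z" if "continuous_on UNIV g" "norm e = 1"
    "\<And>z. dist z z0 \<le> \<rho> + h \<Longrightarrow> Q g z" "dist z z0 \<le> \<rho>" for g e z \<rho>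
  proof (rule step[OF that(1)])
    fix t :: real assume "t \<in> {0..1}"
    then have "norm (seg e h t) \<le> h" using norm_seg that(2) h by blast
    moreover have "dist (z + seg e h t) z = norm (seg e h t)" by (simp add: dist_norm)
    ultimately have "dist (z + seg e h t) z0 \<le> \<rho> + h"
      using dist_triangle[of "z + seg e h t" z0 z] that(4) by linarith
    then show "Q g (z + seg e h t)" by (rule that(3))
  qed
  have c: "continuous_on UNIV (avg (seg e h) g)" if "continuous_on UNIV g" for e g
    by (intro avg_continuous that continuous_intros)
  have 1: "Q (avg (seg es h) f) z" if "dist z z0 \<le> 4 * h" for z
    by (rule st[where \<rho>="4 * h"]) (use f base that in auto)
  have 2: "Q (avg (seg ew h) (avg (seg es h) f)) z" if "dist z z0 \<le> 3 * h" for z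
    by (rule st[where \<rho>="3 * h"]) (use f 1 that in \<open>auto intro!: c\<close>)
  have 3: "Q (avg (seg ew h) (avg (seg ew h) (avg (seg es h) f))) z" if "dist z z0 \<le> 2 * h" for z
    by (rule st[where \<rho>="2 * h"]) (use f 2 that in \<open>auto intro!: c\<close>)
  have 4: "Q (avg (seg ex h) (avg (seg ew h) (avg (seg ew h) (avg (seg es h) f)))) z" if "dist z z0 \<le> h" for z
    by (rule st[where \<rho>="h"]) (use f 3 that in \<open>auto intro!: c\<close>)
  show ?thesis unfolding steklov_def
    by (rule st[where \<rho>=0]) (use f 4 in \<open>auto intro!: c\<close>)
qed

lemma steklov_near:
  assumes f: "continuous_on UNIV f" and h: "h \<ge> 0"
    and n: "\<And>y. dist y z \<le> 5 * h \<Longrightarrow> \<bar>f y - k\<bar> \<le> e"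
  shows "\<bar>steklov h f z - k\<bar> \<le> e"
proof (rule steklov_induct[OF f h, where Q="\<lambda>f y. \<bar>f y - k\<bar> \<le> e"])
  fix g e' y assume "continuous_on UNIV g" "\<And>t. t \<in> {0..1} \<Longrightarrow> \<bar>g (y + seg e' h t) - k\<bar> \<le> e"
  then show "\<bar>avg (seg e' h) g y - k\<bar> \<le> e" by (intro avg_near continuous_intros)
qed (use n in auto)

lemma steklov_avg_le:
  assumes f: "continuous_on UNIV f" and h: "h \<ge> 0" and c: "continuous_on {0..1} c"
    and n: "\<And>y. dist y z \<le> 5 * h \<Longrightarrow> avg c f y \<le> f y + k"
  shows "avg c (steklov h f) z \<le> steklov h f z + k"
proof (rule steklov_induct[OF f h, where Q="\<lambda>f y. avg c f y \<le> f y + k"])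
  fix g e y assume g: "continuous_on UNIV g" and le: "\<And>t. t \<in> {0..1} \<Longrightarrow> avg c g (y + seg e h t) \<le> g (y + seg e h t) + k"
  have "avg c (avg (seg e h) g) y = avg (seg e h) (avg c g) y"
    by (intro avg_commute g c continuous_intros)
  also have "\<dots> \<le> avg (seg e h) (\<lambda>z. g z + k) y"
    by (intro avg_mono avg_continuous g c continuous_intros le)
  also have "\<dots> = avg (seg e h) g y + k" by (intro avg_add_const g continuous_intros)
  finally show "avg c (avg (seg e h) g) y \<le> avg (seg e h) g y + k" .
qed (use n in auto)

text \<open>\<open>g y - m / 2 * (y - x)^2\<close> is convex on the interval, and its midpoint
  inequality at \<open>x\<close> is the claim.\<close>

lemma second_difference_ge:
  fixes g g' g'' :: "real \<Rightarrow> real"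
  assumes "\<And>y. \<bar>y - x\<bar> \<le> \<bar>A\<bar> \<Longrightarrow> (g has_real_derivative g' y) (at y)"
    "\<And>y. \<bar>y - x\<bar> \<le> \<bar>A\<bar> \<Longrightarrow> (g' has_real_derivative g'' y) (at y)"
    "\<And>y. \<bar>y - x\<bar> \<le> \<bar>A\<bar> \<Longrightarrow> m \<le> g'' y"
  shows "m * A\<^sup>2 \<le> g (x + A) + g (x - A) - 2 * g x"
proof -
  define I where "I = {x - \<bar>A\<bar>..x + \<bar>A\<bar>}"
  have I: "y \<in> I \<longleftrightarrow> \<bar>y - x\<bar> \<le> \<bar>A\<bar>" for y by (auto simp: I_def abs_le_iff)
  have "convex_on I (\<lambda>y. g y - m / 2 * (y - x)\<^sup>2)"
  proof (rule f''_ge0_imp_convex)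
    show "convex I" by (simp add: I_def)
    fix y assume "y \<in> I"
    then have y: "\<bar>y - x\<bar> \<le> \<bar>A\<bar>" by (simp add: I)
    show "((\<lambda>y. g y - m / 2 * (y - x)\<^sup>2) has_real_derivative g' y - m * (y - x)) (at y)"
      by (rule DERIV_cong[OF DERIV_diff[OF assms(1)[OF y]]]) (auto intro!: derivative_eq_intros)
    show "((\<lambda>y. g' y - m * (y - x)) has_real_derivative g'' y - m) (at y)"
      by (rule DERIV_cong[OF DERIV_diff[OF assms(2)[OF y]]]) (auto intro!: derivative_eq_intros)
    show "g'' y - m \<ge> 0" using assms(3)[OF y] by simp
  qed
  from convex_onD[OF this, of "1/2" "x + A" "x - A"]
  have "g ((1/2) * (x + A) + (1/2) * (x - A)) - m / 2 * ((1/2) * (x + A) + (1/2) * (x - A) - x)\<^sup>2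
    \<le> (1/2) * (g (x + A) - m / 2 * A\<^sup>2) + (1/2) * (g (x - A) - m / 2 * A\<^sup>2)"
    by (simp add: I)
  moreover have "(1/2) * (x + A) + (1/2) * (x - A) = x" by (simp add: field_simps)
  ultimately show ?thesis by (simp add: field_simps)
qed

definition ellipse :: "real \<Rightarrow> real \<Rightarrow> real \<Rightarrow> point" where
  "ellipse A B t = (0, A * cos (2 * pi * t), B * sin (2 * pi * t))"

lemma continuous_on_ellipse [continuous_intros]: "continuous_on S (ellipse A B)"
  unfolding ellipse_def[abs_def] by (intro continuous_intros)

lemma has_integral_cos_sq:
  "((\<lambda>t. (cos (2 * pi * t))\<^sup>2) has_integral 1/2) {0..1}" "((\<lambda>t. (sin (2 * pi * t))\<^sup>2) has_integral 1/2) {0..1}"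
proof -
  have "((\<lambda>t. Re (cis (2 * pi * of_int 2 * t))) has_integral Re 0) {0..1}"
    using has_integral_linear[OF has_integral_cis[of 2] bounded_linear_Re] by (simp add: o_def)
  then have c: "((\<lambda>t. cos (2 * (2 * pi * t))) has_integral 0) {0..1}" by (simp add: mult_ac)
  have C: "1/2 + 1/2 * cos (2 * u) = (cos u)\<^sup>2" "1/2 - 1/2 * cos (2 * u) = (sin u)\<^sup>2" for u :: real
    unfolding cos_double_cos by (simp_all add: field_simps sin_squared_eq)
  have h: "((\<lambda>t. 1/2 :: real) has_integral 1/2) {0..1::real}" using has_integral_const_real[of "1/2::real" 0 1] by simp
  show "((\<lambda>t. (cos (2 * pi * t))\<^sup>2) has_integral 1/2) {0..1}" 
    using has_integral_add[OF h has_integral_mult_right[OF c, of "1/2"]] unfolding C by simp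
  show "((\<lambda>t. (sin (2 * pi * t))\<^sup>2) has_integral 1/2) {0..1}" 
    using has_integral_diff[OF h has_integral_mult_right[OF c, of "1/2"]] unfolding C by simp
qed

text \<open>The four reflected ellipses cancel the first
  order terms, so that no mixed derivative is needed.\<close>

lemma mean_value_imp_second_order:
  assumes P: "pderivs UNIV f ft fx fxx fw fww" and ab: "a > 0" "b > 0"
    and mv: "\<And>r \<sigma>1 \<sigma>2. 0 < r \<Longrightarrow> r < R \<Longrightarrow> \<sigma>1 \<in> {1,-1} \<Longrightarrow> \<sigma>2 \<in> {1,-1} \<Longrightarrow>
      avg (ellipse (\<sigma>1 * sqrt a * r) (\<sigma>2 * sqrt b * r)) f z \<le> f z + C * r\<^sup>2 / 4"
    and R: "R > 0"
  shows "a * fxx z + b * fww z \<le> C"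
proof (rule field_le_epsilon)
  fix \<epsilon> :: real assume \<epsilon>: "\<epsilon> > 0"
  define \<eta> where "\<eta> = \<epsilon> / (a + b)"
  have \<eta>: "\<eta> > 0" "\<eta> * (a + b) = \<epsilon>" using \<epsilon> ab by (simp_all add: \<eta>_def)
  obtain s x w where z: "z = (s,x,w)" by (cases z)
  have c: "isCont fxx z" "isCont fww z"
    using pderivs_continuous(4,6)[OF P] continuous_on_eq_continuous_at[OF open_UNIV] by blast+
  obtain d1 where d1: "d1 > 0" "\<And>y. dist y z < d1 \<Longrightarrow> dist (fxx y) (fxx z) < \<eta>"
    using c(1) \<eta>(1) unfolding continuous_at_eps_delta by blast
  obtain d2 where d2: "d2 > 0" "\<And>y. dist y z < d2 \<Longrightarrow> dist (fww y) (fww z) < \<eta>"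
    using c(2) \<eta>(1) unfolding continuous_at_eps_delta by blast
  define D where "D = sqrt a + sqrt b"
  have D: "D > 0" using ab by (simp add: D_def add_pos_pos)
  define r where "r = min (R / 2) (min (d1 / (2 * D)) (d2 / (2 * D)))"
  have r: "0 < r" "r < R" "r * D < d1" "r * D < d2"
  proof -
    show "0 < r" using R d1 d2 D by (simp add: r_def)
    show "r < R" using R by (simp add: r_def min_def)
    have "r \<le> d1 / (2 * D)" "r \<le> d2 / (2 * D)" by (simp_all add: r_def)
    then have "r * D \<le> d1 / 2" "r * D \<le> d2 / 2" using D by (simp_all add: field_simps)
    then show "r * D < d1" "r * D < d2" using d1 d2 by linarith+
  qed
  \<comment> \<open>Two second differences in \<open>x\<close>, at the heights \<open>w + B\<close>
    and \<open>w - B\<close>, plus twice the one in \<open>w\<close> at \<open>x\<close>, add up to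
    the sum over the four corners minus \<open>4 * f z\<close>.\<close>
  have pt: "2 * A\<^sup>2 * (fxx z - \<eta>) + 2 * B\<^sup>2 * (fww z - \<eta>) \<le>
      f (z + (0,A,B)) + f (z + (0,-A,B)) + f (z + (0,A,-B)) + f (z + (0,-A,-B)) - 4 * f z"
    if "\<bar>A\<bar> \<le> sqrt a * r" "\<bar>B\<bar> \<le> sqrt b * r" for A B
  proof -
    have AB: "\<bar>A\<bar> + \<bar>B\<bar> < d1" "\<bar>A\<bar> + \<bar>B\<bar> < d2"
      using that r(3,4) by (simp_all add: D_def algebra_simps)
    have ds: "dist (s,y,v) z \<le> \<bar>y - x\<bar> + \<bar>v - w\<bar>" for y v
    proof -
      have "dist (s,y,v) z = sqrt (\<bar>y - x\<bar>\<^sup>2 + \<bar>v - w\<bar>\<^sup>2)" by (simp add: z dist_Pair_Pair dist_real_def)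
      also have "\<dots> \<le> \<bar>y - x\<bar> + \<bar>v - w\<bar>" by (rule sqrt_sum_squares_le_sum) auto
      finally show ?thesis .
    qed
    have X: "(fxx z - \<eta>) * A\<^sup>2 \<le> f (s, x + A, v) + f (s, x - A, v) - 2 * f (s, x, v)" if v: "\<bar>v - w\<bar> \<le> \<bar>B\<bar>" for v
    proof (rule second_difference_ge)
      fix y assume y: "\<bar>y - x\<bar> \<le> \<bar>A\<bar>"
      show "((\<lambda>y. f (s,y,v)) has_real_derivative fx (s,y,v)) (at y)" "((\<lambda>y. fx (s,y,v)) has_real_derivative fxx (s,y,v)) (at y)"
        using pderivsD[OF P] by auto
      have "dist (s,y,v) z < d1" using ds[of y v] y v AB by linarith
      from d1(2)[OF this] show "fxx z - \<eta> \<le> fxx (s,y,v)" by (auto simp: dist_real_def)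
    qed
    have W: "(fww z - \<eta>) * B\<^sup>2 \<le> f (s, x, w + B) + f (s, x, w - B) - 2 * f (s, x, w)"
    proof (rule second_difference_ge)
      fix v assume v: "\<bar>v - w\<bar> \<le> \<bar>B\<bar>"
      show "((\<lambda>v. f (s,x,v)) has_real_derivative fw (s,x,v)) (at v)" "((\<lambda>v. fw (s,x,v)) has_real_derivative fww (s,x,v)) (at v)"
        using pderivsD[OF P] by auto
      have "dist (s,x,v) z < d2" using ds[of x v] v AB by simp
      from d2(2)[OF this] show "fww z - \<eta> \<le> fww (s,x,v)" by (auto simp: dist_real_def)
    qed
    have "(fxx z - \<eta>) * A\<^sup>2 \<le> f (s, x + A, w + B) + f (s, x - A, w + B) - 2 * f (s, x, w + B)"
      "(fxx z - \<eta>) * A\<^sup>2 \<le> f (s, x + A, w - B) + f (s, x - A, w - B) - 2 * f (s, x, w - B)"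
      by (rule X; simp)+
    with W show ?thesis by (simp add: z algebra_simps)
  qed
  define E where "E = (\<lambda>\<sigma>1 \<sigma>2. ellipse (\<sigma>1 * sqrt a * r) (\<sigma>2 * sqrt b * r))"
  have cf: "continuous_on UNIV f" using pderivs_continuous[OF P] by simp
  have i: "((\<lambda>t. f (z + E \<sigma>1 \<sigma>2 t)) has_integral avg (E \<sigma>1 \<sigma>2) f z) {0..1}" for \<sigma>1 \<sigma>2
    unfolding avg_def by (intro integrable_integral avg_integrable cf) (auto simp: E_def intro!: continuous_intros)
  define A where "A = (\<lambda>t. sqrt a * r * cos (2 * pi * t))"
  define B where "B = (\<lambda>t. sqrt b * r * sin (2 * pi * t))"
  have EA: "E \<sigma>1 \<sigma>2 t = (0, \<sigma>1 * A t, \<sigma>2 * B t)" for \<sigma>1 \<sigma>2 t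
    by (simp add: E_def ellipse_def A_def B_def mult.assoc)
  have "((\<lambda>t. 2 * (a * r\<^sup>2) * (fxx z - \<eta>) * (cos (2 * pi * t))\<^sup>2 + 2 * (b * r\<^sup>2) * (fww z - \<eta>) * (sin (2 * pi * t))\<^sup>2)
      has_integral 2 * (a * r\<^sup>2) * (fxx z - \<eta>) * (1/2) + 2 * (b * r\<^sup>2) * (fww z - \<eta>) * (1/2)) {0..1}"
    by (intro has_integral_add has_integral_mult_right has_integral_cos_sq)
  moreover have "((\<lambda>t. f (z + E 1 1 t) + f (z + E (-1) 1 t) + f (z + E 1 (-1) t) + f (z + E (-1) (-1) t) - 4 * f z)
      has_integral avg (E 1 1) f z + avg (E (-1) 1) f z + avg (E 1 (-1)) f z + avg (E (-1) (-1)) f z - 4 * f z) {0..1}"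
    using has_integral_const_real[of "4 * f z" 0 1] by (intro has_integral_add has_integral_diff i) simp
  ultimately have "2 * (a * r\<^sup>2) * (fxx z - \<eta>) * (1/2) + 2 * (b * r\<^sup>2) * (fww z - \<eta>) * (1/2)
     \<le> avg (E 1 1) f z + avg (E (-1) 1) f z + avg (E 1 (-1)) f z + avg (E (-1) (-1)) f z - 4 * f z"
  proof (rule has_integral_le)
    fix t :: real
    have "\<bar>A t\<bar> \<le> sqrt a * r" "\<bar>B t\<bar> \<le> sqrt b * r"
      using r(1) ab by (simp_all add: A_def B_def abs_mult mult_left_le)
    from pt[OF this] show "2 * (a * r\<^sup>2) * (fxx z - \<eta>) * (cos (2 * pi * t))\<^sup>2 + 2 * (b * r\<^sup>2) * (fww z - \<eta>) * (sin (2 * pi * t))\<^sup>2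
      \<le> f (z + E 1 1 t) + f (z + E (-1) 1 t) + f (z + E 1 (-1) t) + f (z + E (-1) (-1) t) - 4 * f z"
      using ab by (simp add: EA A_def B_def power_mult_distrib mult_ac)
  qed
  also have "\<dots> \<le> C * r\<^sup>2"
    using mv[of r 1 1] mv[of r "-1" 1] mv[of r 1 "-1"] mv[of r "-1" "-1"] r by (simp add: E_def)
  finally have "r\<^sup>2 * (a * (fxx z - \<eta>) + b * (fww z - \<eta>)) \<le> r\<^sup>2 * C" by (simp add: algebra_simps)
  then have "a * (fxx z - \<eta>) + b * (fww z - \<eta>) \<le> C" using r(1) by simp
  then show "a * fxx z + b * fww z \<le> C + \<epsilon>" unfolding \<eta>(2)[symmetric] by (simp add: algebra_simps)
qed

text \<open>Around every point near \<open>z\<close> the mean value inequality holds with the same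
  constant. The elliptic mean commutes with the smoothing, so \<open>steklov h V\<close> satisfies
  it as well, and being smooth it yields the differential inequality in the limit of small
  radii.\<close>

lemma steklov_supersolution:
  assumes V: "continuous_on UNIV V" and ab: "a > 0" "b > 0" and \<rho>: "\<rho> > 0" and h: "0 < h" "20 * h < \<rho>"
    and visc: "\<And>z f ft fx fxx fw fww. z \<in> ball z0 \<rho> \<Longrightarrow> pderivs UNIV f ft fx fxx fw fww \<Longrightarrow> f z = V z \<Longrightarrow>
      \<forall>\<^sub>F z' in nhds z. f z' \<le> V z' \<Longrightarrow> a * fxx z + b * fww z \<le> C"
    and z: "z \<in> ball z0 (\<rho> / 2)" and P: "pderivs UNIV (steklov h V) ft fx fxx fw fww"
  shows "a * fxx z + b * fww z \<le> C"
proof -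
  define D where "D = sqrt a + sqrt b"
  have D: "D > 0" using ab by (simp add: D_def add_pos_pos)
  \<comment> \<open>Distances add up to less than \<open>\<rho>\<close>: \<open>\<rho> / 2\<close>
    for \<open>z\<close>, \<open>5 * h < \<rho> / 4\<close> for the smoothing,
    \<open>\<rho> / 16\<close> in time and \<open>r * D < \<rho> / 8\<close> for the
    ellipse.\<close>
  show ?thesis
  proof (rule mean_value_imp_second_order[OF P ab, where R="\<rho> / (8 * D)"])
    show "0 < \<rho> / (8 * D)" using D \<rho> by simp
    fix r \<sigma>1 \<sigma>2 :: real assume r: "0 < r" "r < \<rho> / (8 * D)" and \<sigma>: "\<sigma>1 \<in> {1,-1}" "\<sigma>2 \<in> {1,-1}"
    have rD: "r * D < \<rho> / 8" using r D by (simp add: field_simps)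
    show "avg (ellipse (\<sigma>1 * sqrt a * r) (\<sigma>2 * sqrt b * r)) (steklov h V) z \<le> steklov h V z + C * r\<^sup>2 / 4"
    proof (rule steklov_avg_le[OF V less_imp_le[OF h(1)]])
      show "continuous_on {0..1} (ellipse (\<sigma>1 * sqrt a * r) (\<sigma>2 * sqrt b * r))" by (intro continuous_intros)
      fix y assume y: "dist y z \<le> 5 * h"
      obtain s x w where ye: "y = (s,x,w)" by (cases y)
      have yz: "dist y z0 < 3 / 4 * \<rho>"
        using y z h dist_triangle[of y z0 z] by (simp add: dist_commute)
      have "integral {0..1} (\<lambda>t. V (s, x + \<sigma>1 * sqrt a * r * cos (2 * pi * t), w + \<sigma>2 * sqrt b * r * sin (2 * pi * t)))
          - C * r\<^sup>2 / 4 \<le> V (s, x, w)"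
      proof (rule mean_value_inequality[OF V ab r(1) _ _ _ \<sigma>, where \<tau>="\<rho> / 16" and B="ball z0 \<rho>"])
        fix s' x' w' assume h: "\<bar>s' - s\<bar> \<le> \<rho> / 16" "(x' - x)\<^sup>2 / a + (w' - w)\<^sup>2 / b \<le> r\<^sup>2"
        have "0 \<le> (x' - x)\<^sup>2 / a" "0 \<le> (w' - w)\<^sup>2 / b" using ab by simp_all
        with h(2) have "(x' - x)\<^sup>2 / a \<le> r\<^sup>2" "(w' - w)\<^sup>2 / b \<le> r\<^sup>2" by simp_all
        then have "(x' - x)\<^sup>2 \<le> (sqrt a * r)\<^sup>2" "(w' - w)\<^sup>2 \<le> (sqrt b * r)\<^sup>2"
          using ab by (simp_all add: field_simps)
        then have *: "\<bar>x' - x\<bar> \<le> sqrt a * r" "\<bar>w' - w\<bar> \<le> sqrt b * r"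
          using ab r by (simp_all add: abs_le_square_iff[symmetric])
        have "dist (s',x',w') (s,x,w) \<le> \<bar>s' - s\<bar> + dist (x',w') (x,w)"
          unfolding dist_Pair_Pair[of s'] dist_real_def[of s'] by (rule order_trans[OF sqrt_sum_squares_le_sum]) auto
        also have "dist (x',w') (x,w) \<le> \<bar>x' - x\<bar> + \<bar>w' - w\<bar>"
          unfolding dist_Pair_Pair dist_real_def by (rule sqrt_sum_squares_le_sum) auto
        finally have "dist (s',x',w') y \<le> \<rho> / 16 + r * D" using h(1) * by (simp add: ye D_def algebra_simps)
        then show "(s',x',w') \<in> ball z0 \<rho>"
          using yz rD \<rho> dist_triangle[of "(s',x',w')" z0 y] by (simp add: dist_commute)
      next
        fix z f ft fx fxx fw fww
        assume "z \<in> ball z0 \<rho>" "pderivs UNIV f ft fx fxx fw fww" "f z = V z" "\<forall>\<^sub>F z' in nhds z. f z' \<le> V z'"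
        then show "a * fxx z + b * fww z \<le> C" by (rule visc)
      qed (use \<rho> in auto)
      then show "avg (ellipse (\<sigma>1 * sqrt a * r) (\<sigma>2 * sqrt b * r)) V y \<le> V y + C * r\<^sup>2 / 4"
        by (simp add: avg_def ellipse_def ye)
    qed
  qed
qed

section \<open>Touching functions\<close>

text \<open>If \<open>m\<close> were positive, \<open>g'\<close> would vanish at \<open>x\<close>
  and be positive just to the right of it, so \<open>g\<close> would exceed \<open>g x\<close>
  there. Continuity of the second derivative does not enter.\<close>

lemma local_max_second_derivative:
  fixes g g' :: "real \<Rightarrow> real"
  assumes d: "\<forall>\<^sub>F t in nhds x. (g has_real_derivative g' t) (at t)"
    and d2: "(g' has_real_derivative m) (at x)"
    and mx: "\<forall>\<^sub>F t in nhds x. g t \<le> g x"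
  shows "g' x = 0" "m \<le> 0"
proof -
  obtain e where e: "e > 0" "\<And>t. dist t x < e \<Longrightarrow> (g has_real_derivative g' t) (at t) \<and> g t \<le> g x"
    using eventually_conj[OF d mx] unfolding eventually_nhds_metric by blast
  show z: "g' x = 0"
  proof (rule DERIV_local_max[OF _ e(1)])
    show "(g has_real_derivative g' x) (at x)" using e by simp
    show "\<forall>y. \<bar>x - y\<bar> < e \<longrightarrow> g y \<le> g x" using e(2) by (simp add: dist_real_def abs_minus_commute)
  qed
  show "m \<le> 0"
  proof (rule ccontr)
    assume "\<not> m \<le> 0"
    then obtain d where d: "d > 0" "\<And>h. 0 < h \<Longrightarrow> h < d \<Longrightarrow> g' x < g' (x + h)"
      using DERIV_pos_inc_right[OF d2] by auto
    define k where "k = min d e / 2"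
    have k: "0 < k" "k < d" "k < e" using d e by (auto simp: k_def)
    have "\<exists>t. x < t \<and> t < x + k \<and> g (x + k) - g x = (x + k - x) * g' t"
      by (rule MVT2) (use k e in \<open>auto simp: dist_real_def\<close>)
    then obtain t where t: "x < t" "t < x + k" "g (x + k) - g x = k * g' t" by auto
    have "g' t > 0" using d(2)[of "t - x"] t k z by simp
    then have "g (x + k) > g x" using t(3) k by (metis diff_gt_0_iff_gt mult_pos_pos)
    moreover have "g (x + k) \<le> g x" using e(2)[of "x + k"] k by (simp add: dist_real_def)
    ultimately show False by simp
  qed
qed

lemma eventually_nhds_lines:
  fixes s x w :: real
  assumes "\<forall>\<^sub>F z in nhds (s,x,w). P z"
  shows "\<forall>\<^sub>F t in nhds s. P (t,x,w)" "\<forall>\<^sub>F t in nhds x. P (s,t,w)" "\<forall>\<^sub>F t in nhds w. P (s,x,t)"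
proof -
  have "((\<lambda>t. (t,x,w)) \<longlongrightarrow> (s,x,w)) (nhds s)" "((\<lambda>t. (s,t,w)) \<longlongrightarrow> (s,x,w)) (nhds x)"
    "((\<lambda>t. (s,x,t)) \<longlongrightarrow> (s,x,w)) (nhds w)"
    by (auto intro!: tendsto_intros filterlim_ident)
  then show "\<forall>\<^sub>F t in nhds s. P (t,x,w)" "\<forall>\<^sub>F t in nhds x. P (s,t,w)" "\<forall>\<^sub>F t in nhds w. P (s,x,t)"
    using assms unfolding filterlim_iff by blast+
qed

lemma pderivs_touch:
  assumes f: "pderivs U f ft fx fxx fw fww" and g: "pderivs V g gt gx gxx gw gww"
    and op: "open U" "open V" "z \<in> U" "z \<in> V"
    and eq: "f z = g z" and le: "\<forall>\<^sub>F z' in nhds z. f z' \<le> g z'"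
  shows "ft z = gt z" "fx z = gx z" "fw z = gw z" "fxx z \<le> gxx z" "fww z \<le> gww z"
proof -
  obtain s x w where z: "z = (s,x,w)" by (cases z)
  have P: "pderivs (U \<inter> V) (\<lambda>z. f z - g z) (\<lambda>z. ft z - gt z) (\<lambda>z. fx z - gx z) (\<lambda>z. fxx z - gxx z)
    (\<lambda>z. fw z - gw z) (\<lambda>z. fww z - gww z)"
    by (rule pderivs_diff[OF pderivs_subset[OF f] pderivs_subset[OF g]]) auto
  have zU: "(s,x,w) \<in> U \<inter> V" using op z by simp
  have ev: "\<forall>\<^sub>F z' in nhds (s,x,w). z' \<in> U \<inter> V"
    using op zU by (intro eventually_nhds_in_open) auto
  have le': "\<forall>\<^sub>F z' in nhds (s,x,w). f z' - g z' \<le> f (s,x,w) - g (s,x,w)"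
    using le eq unfolding z by simp
  note ev = eventually_nhds_lines[OF ev] and le' = eventually_nhds_lines[OF le']
  note D = pderivsD[OF P zU]
  obtain e where e: "e > 0" "\<And>t. dist t s < e \<Longrightarrow> f (t,x,w) - g (t,x,w) \<le> f (s,x,w) - g (s,x,w)"
    using le'(1) unfolding eventually_nhds_metric by blast
  have "ft (s,x,w) - gt (s,x,w) = 0"
    by (rule DERIV_local_max[OF D(1) e(1)]) (use e(2) in \<open>simp add: dist_real_def abs_minus_commute\<close>)
  then show "ft z = gt z" by (simp add: z)
  have "\<forall>\<^sub>F t in nhds x. ((\<lambda>y. f (s,y,w) - g (s,y,w)) has_real_derivative fx (s,t,w) - gx (s,t,w)) (at t)"
    using ev(2) by eventually_elim (rule pderivsD(2)[OF P])
  from local_max_second_derivative[OF this D(3) le'(2)]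
  show "fx z = gx z" "fxx z \<le> gxx z" by (simp_all add: z)
  have "\<forall>\<^sub>F t in nhds w. ((\<lambda>y. f (s,x,y) - g (s,x,y)) has_real_derivative fw (s,x,t) - gw (s,x,t)) (at t)"
    using ev(3) by eventually_elim (rule pderivsD(4)[OF P])
  from local_max_second_derivative[OF this D(5) le'(3)]
  show "fw z = gw z" "fww z \<le> gww z" by (simp_all add: z)
qed

lemma norm_point_sq: "(norm ((s,x,w) :: point))\<^sup>2 = s\<^sup>2 + x\<^sup>2 + w\<^sup>2"
  by (simp add: norm_Pair)

lemma pderivs_quadratic:
  fixes k s0 x0 w0 :: real
  shows "pderivs UNIV (\<lambda>z. k * (norm (z - (s0,x0,w0)))\<^sup>2) (\<lambda>z. 2 * k * (fst z - s0)) (\<lambda>z. 2 * k * (fst (snd z) - x0))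
     (\<lambda>_. 2 * k) (\<lambda>z. 2 * k * (snd (snd z) - w0)) (\<lambda>_. 2 * k)"
proof -
  have "pderivs UNIV (\<lambda>(s,x,w). k * (s - s0)\<^sup>2 + k * (x - x0)\<^sup>2 + k * (w - w0)\<^sup>2) (\<lambda>(s,x,w). 2 * k * (s - s0))
    (\<lambda>(s,x,w). 2 * k * (x - x0)) (\<lambda>(s,x,w). 2 * k) (\<lambda>(s,x,w). 2 * k * (w - w0)) (\<lambda>(s,x,w). 2 * k)"
    by (rule pderivs_sep) (auto intro!: derivative_eq_intros continuous_intros)
  moreover have "(\<lambda>(s,x,w). k * (s - s0)\<^sup>2 + k * (x - x0)\<^sup>2 + k * (w - w0)\<^sup>2) = (\<lambda>z. k * (norm (z - (s0,x0,w0)))\<^sup>2)"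
  proof
    fix z :: point
    obtain s x w where z: "z = (s,x,w)" by (cases z)
    have "z - (s0,x0,w0) = (s - s0, x - x0, w - w0)" by (simp add: z)
    then show "(case z of (s,x,w) \<Rightarrow> k * (s - s0)\<^sup>2 + k * (x - x0)\<^sup>2 + k * (w - w0)\<^sup>2) = k * (norm (z - (s0,x0,w0)))\<^sup>2"
      by (simp only: norm_point_sq) (simp add: z distrib_left)
  qed
  ultimately show ?thesis by (simp add: case_prod_beta')
qed

section \<open>The local equation\<close>

abbreviation sc :: "point \<Rightarrow> real" where "sc z \<equiv> fst z"
abbreviation xc :: "point \<Rightarrow> real" where "xc z \<equiv> fst (snd z)"
abbreviation wc :: "point \<Rightarrow> real" where "wc z \<equiv> snd (snd z)"

text \<open>The nonlocal integral only involves the values on \<open>w = -\<delta>\<close>, where the solution is prescribed. It is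
  therefore a known source, \<open>Sf\<close>, and the equation is a local one with zero order coefficient \<open>Kf\<close>.\<close>

locale hjb =
  fixes sg pr rt mu M ep c0 :: real and Sf Kf :: "point \<Rightarrow> real" and Om :: "point set"
  assumes pos: "0 < pr" "0 < rt" "0 < mu" "0 \<le> M" "0 < ep" "0 < c0"
    and Om: "open Om" and cS: "continuous_on Om Sf" and cK: "continuous_on Om Kf"
    and K: "\<theta> \<in> Om \<Longrightarrow> c0 \<le> Kf \<theta>"
begin

definition diff :: "real \<Rightarrow> real \<Rightarrow> real" where "diff \<gamma> x = sg\<^sup>2 / 2 * \<gamma>\<^sup>2 * x\<^sup>2 + ep"

definition drft :: "real \<Rightarrow> real \<Rightarrow> real \<Rightarrow> real" where "drft \<gamma> q x = pr + (rt + (mu - rt) * \<gamma>) * x - q"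

definition opr :: "real \<Rightarrow> real \<Rightarrow> point \<Rightarrow> real \<Rightarrow> real \<Rightarrow> real \<Rightarrow> real \<Rightarrow> real \<Rightarrow> real \<Rightarrow> real" where
  "opr \<gamma> q \<theta> y a b c d e =
    a + diff \<gamma> (xc \<theta>) * c + ep * e + drft \<gamma> q (xc \<theta>) * b + d + q + Sf \<theta> - Kf \<theta> * y"

text \<open>The equation being local, tests on a neighbourhood \<open>N\<close> are allowed. The
  supremum over controls is replaced by the existence of one control, which is the same because the
  control set is compact.\<close>

definition vsub :: "(point \<Rightarrow> real) \<Rightarrow> bool" where
  "vsub u \<longleftrightarrow> (\<forall>\<theta> N f ft fx fxx fw fww. \<theta> \<in> N \<longrightarrow> open N \<longrightarrow> N \<subseteq> Om \<longrightarrow> pderivs N f ft fx fxx fw fww \<longrightarrow>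
     f \<theta> = u \<theta> \<longrightarrow> (\<forall>z\<in>N. u z \<le> f z) \<longrightarrow>
     (\<exists>\<gamma>\<in>{0..1}. \<exists>q\<in>{0..M}. 0 \<le> opr \<gamma> q \<theta> (u \<theta>) (ft \<theta>) (fx \<theta>) (fxx \<theta>) (fw \<theta>) (fww \<theta>)))"

text \<open>The margin \<open>\<eta>\<close> measures strictness; doubling of variables needs it
  positive, and the penalty supplies it. A nonpositive supremum becomes a bound for every
  control.\<close>

definition vsuper :: "real \<Rightarrow> (point \<Rightarrow> real) \<Rightarrow> bool" where
  "vsuper \<eta> v \<longleftrightarrow> (\<forall>\<theta> N f ft fx fxx fw fww. \<theta> \<in> N \<longrightarrow> open N \<longrightarrow> N \<subseteq> Om \<longrightarrow> pderivs N f ft fx fxx fw fww \<longrightarrow>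
     f \<theta> = v \<theta> \<longrightarrow> (\<forall>z\<in>N. f z \<le> v z) \<longrightarrow>
     (\<forall>\<gamma>\<in>{0..1}. \<forall>q\<in>{0..M}. opr \<gamma> q \<theta> (v \<theta>) (ft \<theta>) (fx \<theta>) (fxx \<theta>) (fw \<theta>) (fww \<theta>) \<le> - \<eta>))"

lemma vsubD:
  assumes "vsub u" "\<theta> \<in> U" "open U" "\<theta> \<in> Om" "pderivs U f ft fx fxx fw fww"
    "f \<theta> = u \<theta>" "\<forall>\<^sub>F z in nhds \<theta>. u z \<le> f z"
  shows "\<exists>\<gamma>\<in>{0..1}. \<exists>q\<in>{0..M}. 0 \<le> opr \<gamma> q \<theta> (u \<theta>) (ft \<theta>) (fx \<theta>) (fxx \<theta>) (fw \<theta>) (fww \<theta>)"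
proof -
  obtain V where V: "open V" "\<theta> \<in> V" "\<forall>z\<in>V. u z \<le> f z"
    using assms(7) unfolding eventually_nhds by blast
  have "pderivs (U \<inter> V \<inter> Om) f ft fx fxx fw fww" by (rule pderivs_subset[OF assms(5)]) auto
  moreover have "open (U \<inter> V \<inter> Om)" using assms(3) V(1) Om by auto
  ultimately show ?thesis
    using assms(1)[unfolded vsub_def, rule_format, of \<theta> "U \<inter> V \<inter> Om" f ft fx fxx fw fww] assms(2,4,6) V by auto
qed

lemma vsuperD:
  assumes "vsuper \<eta> v" "\<theta> \<in> U" "open U" "\<theta> \<in> Om" "pderivs U f ft fx fxx fw fww"
    "f \<theta> = v \<theta>" "\<forall>\<^sub>F z in nhds \<theta>. f z \<le> v z" "\<gamma> \<in> {0..1}" "q \<in> {0..M}"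
  shows "opr \<gamma> q \<theta> (v \<theta>) (ft \<theta>) (fx \<theta>) (fxx \<theta>) (fw \<theta>) (fww \<theta>) \<le> - \<eta>"
proof -
  obtain V where V: "open V" "\<theta> \<in> V" "\<forall>z\<in>V. f z \<le> v z"
    using assms(7) unfolding eventually_nhds by blast
  have "pderivs (U \<inter> V \<inter> Om) f ft fx fxx fw fww" by (rule pderivs_subset[OF assms(5)]) auto
  moreover have "open (U \<inter> V \<inter> Om)" using assms(3) V(1) Om by auto
  ultimately show ?thesis
    using assms(1)[unfolded vsuper_def, rule_format, of \<theta> "U \<inter> V \<inter> Om" f ft fx fxx fw fww \<gamma> q] assms(2,4,6,8,9) V by auto
qed

lemma diff_ge: "ep \<le> diff \<gamma> x"
  by (simp add: diff_def)

lemma drft_rate: "\<gamma> \<in> {0..1} \<Longrightarrow> 0 \<le> rt + (mu - rt) * \<gamma> \<and> rt + (mu - rt) * \<gamma> \<le> rt + mu"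
proof -
  assume "\<gamma> \<in> {0..1}"
  then have g: "0 \<le> \<gamma>" "\<gamma> \<le> 1" by auto
  have "rt + (mu - rt) * \<gamma> = rt * (1 - \<gamma>) + mu * \<gamma>" by (simp add: algebra_simps)
  moreover have "0 \<le> rt * (1 - \<gamma>)" "0 \<le> mu * \<gamma>" "rt * (1 - \<gamma>) \<le> rt" "mu * \<gamma> \<le> mu"
    using g pos by (auto intro: mult_left_le)
  ultimately show ?thesis by linarith
qed

text \<open>The bound is free of the controls: \<open>q\<close> enters only through the coefficient
  \<open>pr - q\<close> of \<open>b\<close>, and \<open>\<gamma>\<close> only through the rate
  multiplying \<open>x * b\<close>.\<close>

lemma drft_diff_le:
  assumes "\<gamma> \<in> {0..1}" "q \<in> {0..M}"
  shows "\<bar>drft \<gamma> q x * b - drft \<gamma> q x' * b'\<bar> \<le> (pr + M) * \<bar>b - b'\<bar> + (rt + mu) * \<bar>x * b - x' * b'\<bar>"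
proof -
  have "drft \<gamma> q x * b - drft \<gamma> q x' * b' = (pr - q) * (b - b') + (rt + (mu - rt) * \<gamma>) * (x * b - x' * b')"
    by (simp add: drft_def algebra_simps)
  also have "\<bar>\<dots>\<bar> \<le> \<bar>pr - q\<bar> * \<bar>b - b'\<bar> + \<bar>rt + (mu - rt) * \<gamma>\<bar> * \<bar>x * b - x' * b'\<bar>"
    by (rule order_trans[OF abs_triangle_ineq]) (simp add: abs_mult)
  also have "\<dots> \<le> (pr + M) * \<bar>b - b'\<bar> + (rt + mu) * \<bar>x * b - x' * b'\<bar>"
    using drft_rate[OF assms(1)] assms(2) pos by (intro add_mono mult_right_mono) auto
  finally show ?thesis .
qed

lemma diff_diff_le:
  assumes "\<gamma> \<in> {0..1}"
  shows "\<bar>diff \<gamma> x - diff \<gamma> x'\<bar> \<le> sg\<^sup>2 / 2 * \<bar>x\<^sup>2 - x'\<^sup>2\<bar>"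
proof -
  have "\<gamma>\<^sup>2 \<le> 1" using assms by (auto intro: power_le_one)
  have "diff \<gamma> x - diff \<gamma> x' = sg\<^sup>2 / 2 * \<gamma>\<^sup>2 * (x\<^sup>2 - x'\<^sup>2)" by (simp add: diff_def algebra_simps)
  then have "\<bar>diff \<gamma> x - diff \<gamma> x'\<bar> = sg\<^sup>2 / 2 * \<gamma>\<^sup>2 * \<bar>x\<^sup>2 - x'\<^sup>2\<bar>" by (simp only: abs_mult) simp
  also have "\<dots> \<le> sg\<^sup>2 / 2 * 1 * \<bar>x\<^sup>2 - x'\<^sup>2\<bar>"
    using \<open>\<gamma>\<^sup>2 \<le> 1\<close> by (intro mult_right_mono mult_left_mono) auto
  finally show ?thesis by simp
qed

end

section \<open>Inf-convolution\<close>

lemma LIMSEQ_dist_Suc: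
  fixes Y :: "nat \<Rightarrow> 'a::metric_space"
  assumes "\<And>n. dist (Y n) y < 1 / real (Suc n)"
  shows "Y \<longlonglongrightarrow> y"
proof (rule metric_LIMSEQ_I)
  fix e :: real assume "e > 0"
  then obtain n0 where n0: "inverse (real (Suc n0)) < e" using reals_Archimedean by blast
  have "dist (Y n) y < e" if "n \<ge> n0" for n
  proof -
    have "1 / real (Suc n) \<le> inverse (real (Suc n0))" using that by (simp add: field_simps)
    then show ?thesis using assms[of n] n0 by linarith
  qed
  then show "\<exists>n0. \<forall>n\<ge>n0. dist (Y n) y < e" by blast
qed

definition infconv :: "real \<Rightarrow> point set \<Rightarrow> (point \<Rightarrow> real) \<Rightarrow> point \<Rightarrow> real" where
  "infconv \<alpha> D v y = (INF z\<in>D. v z + (norm (y - z))\<^sup>2 / (2 * \<alpha>))"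

definition infmin :: "real \<Rightarrow> point set \<Rightarrow> (point \<Rightarrow> real) \<Rightarrow> point \<Rightarrow> point \<Rightarrow> bool" where
  "infmin \<alpha> D v y z \<longleftrightarrow> z \<in> D \<and> infconv \<alpha> D v y = v z + (norm (y - z))\<^sup>2 / (2 * \<alpha>)"

text \<open>\<open>D\<close> need be neither closed nor bounded: compact sublevel bounds are
  demanded of \<open>v\<close> itself. The penalised functions have them, since they blow up at
  \<open>s = 0\<close> and for large \<open>x\<close>.\<close>

locale coercive_lsc =
  fixes D :: "point set" and v :: "point \<Rightarrow> real" and \<alpha> :: real
  assumes D: "D \<noteq> {}" and lsc: "lsc_on D v" and \<alpha>: "\<alpha> > 0"
    and coercive: "\<And>c. \<exists>K. compact K \<and> K \<subseteq> D \<and> (\<forall>z\<in>D. v z \<le> c \<longrightarrow> z \<in> K)"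
begin

lemma minimum_ex:
  assumes q: "continuous_on D q" "\<And>z. z \<in> D \<Longrightarrow> 0 \<le> q z"
  obtains z where "z \<in> D" "\<And>z'. z' \<in> D \<Longrightarrow> v z + q z \<le> v z' + q z'"
proof -
  obtain x0 where x0: "x0 \<in> D" using D by auto
  obtain K where K: "compact K" "K \<subseteq> D" "\<And>z. z \<in> D \<Longrightarrow> v z \<le> v x0 + q x0 \<Longrightarrow> z \<in> K"
    using coercive by metis
  have "usc_on D (\<lambda>z. - v z + - q z)"
  proof (rule usc_on_add)
    show "usc_on D (\<lambda>z. - v z)" using lsc by (simp add: lsc_on_iff_usc_on)
    show "usc_on D (\<lambda>z. - q z)" by (intro continuous_on_imp_usc_on continuous_intros q(1))
  qed
  then obtain z where z: "z \<in> K" "\<And>z'. z' \<in> D \<Longrightarrow> - v z' + - q z' \<le> - v z + - q z"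
    by (rule usc_coercive_attains_sup[OF _ x0 K(1,2)]) (use K(3) q(2) in force)+
  show ?thesis
  proof (rule that)
    show "z \<in> D" using z(1) K(2) by auto
    show "v z + q z \<le> v z' + q z'" if "z' \<in> D" for z' using z(2)[OF that] by linarith
  qed
qed

lemma infmin_ex: "\<exists>z. infmin \<alpha> D v y z"
proof -
  obtain z where z: "z \<in> D" "\<And>z'. z' \<in> D \<Longrightarrow> v z + (norm (y - z))\<^sup>2 / (2 * \<alpha>) \<le> v z' + (norm (y - z'))\<^sup>2 / (2 * \<alpha>)"
    by (rule minimum_ex[of "\<lambda>z. (norm (y - z))\<^sup>2 / (2 * \<alpha>)"]) (use \<alpha> in \<open>auto intro!: continuous_intros\<close>)
  have "infconv \<alpha> D v y = v z + (norm (y - z))\<^sup>2 / (2 * \<alpha>)"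
    unfolding infconv_def by (rule cInf_eq_minimum) (use z in auto)
  then show ?thesis using z(1) unfolding infmin_def by blast
qed

lemma infconv_le: assumes "z \<in> D" shows "infconv \<alpha> D v y \<le> v z + (norm (y - z))\<^sup>2 / (2 * \<alpha>)"
proof -
  obtain m where m: "m \<in> D" "\<And>z'. z' \<in> D \<Longrightarrow> v m + 0 \<le> v z' + 0"
    by (rule minimum_ex[of "\<lambda>_. 0"]) auto
  have "bdd_below ((\<lambda>z. v z + (norm (y - z))\<^sup>2 / (2 * \<alpha>)) ` D)"
    by (rule bdd_belowI2[where m="v m"]) (use m \<alpha> in \<open>simp add: add_increasing2\<close>)
  then show ?thesis unfolding infconv_def by (rule cINF_lower) (rule assms)
qed

lemma infconv_ge: assumes "\<And>z. z \<in> D \<Longrightarrow> B \<le> v z" shows "B \<le> infconv \<alpha> D v y"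
proof -
  obtain z where z: "infmin \<alpha> D v y z" using infmin_ex by blast
  have "0 \<le> (norm (y - z))\<^sup>2 / (2 * \<alpha>)" using \<alpha> by simp
  with z assms[of z] show ?thesis unfolding infmin_def by linarith
qed

text \<open>\<open>(norm y)^2 / (2 * \<alpha>)\<close> minus the inf-convolution is a supremum of
  affine functions of \<open>y\<close>, finite everywhere; thus it is convex and therefore
  continuous.\<close>

lemma infconv_continuous: "continuous_on UNIV (infconv \<alpha> D v)"
proof -
  define g where "g = (\<lambda>y. (norm y)\<^sup>2 / (2 * \<alpha>) - infconv \<alpha> D v y)"
  have ex: "(norm (y - z))\<^sup>2 / (2 * \<alpha>) = (norm y)\<^sup>2 / (2 * \<alpha>) - inner y z / \<alpha> + (norm z)\<^sup>2 / (2 * \<alpha>)" for y z :: point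
    using \<alpha> by (simp add: power2_norm_eq_inner inner_diff inner_commute field_simps)
  have up: "inner y z / \<alpha> - (norm z)\<^sup>2 / (2 * \<alpha>) - v z \<le> g y" if "z \<in> D" for y z
    using infconv_le[OF that, of y] ex[of y z] by (simp add: g_def)
  have "convex_on UNIV g"
  proof (rule convex_onI)
    fix t :: real and x y :: point assume t: "0 < t" "t < 1"
    obtain z where z: "infmin \<alpha> D v ((1 - t) *\<^sub>R x + t *\<^sub>R y) z" using infmin_ex by blast
    then have zD: "z \<in> D" by (simp add: infmin_def)
    have "g ((1 - t) *\<^sub>R x + t *\<^sub>R y) = inner ((1 - t) *\<^sub>R x + t *\<^sub>R y) z / \<alpha> - (norm z)\<^sup>2 / (2 * \<alpha>) - v z"
      using z ex[of "(1 - t) *\<^sub>R x + t *\<^sub>R y" z] by (simp add: g_def infmin_def)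
    also have "\<dots> = (1 - t) * (inner x z / \<alpha> - (norm z)\<^sup>2 / (2 * \<alpha>) - v z) + t * (inner y z / \<alpha> - (norm z)\<^sup>2 / (2 * \<alpha>) - v z)"
      unfolding inner_add_left inner_scaleR_left using \<alpha> by (simp add: field_simps)
    also have "\<dots> \<le> (1 - t) * g x + t * g y"
      using t up[OF zD] by (intro add_mono mult_left_mono) auto
    finally show "g ((1 - t) *\<^sub>R x + t *\<^sub>R y) \<le> (1 - t) * g x + t * g y" .
  qed simp
  then have "continuous_on UNIV g" by (rule convex_on_continuous[OF open_UNIV])
  then have "continuous_on UNIV (\<lambda>y. (norm y)\<^sup>2 / (2 * \<alpha>) - g y)"
    using \<alpha> by (intro continuous_intros) auto
  then show ?thesis by (simp add: g_def)
qed

text \<open>Minimisers for points tending to \<open>y0\<close> stay in a compact set by coercivity,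
  and by semicontinuity their limits are minimisers for \<open>y0\<close>. Uniqueness there leaves
  \<open>z0\<close> as the only limit.\<close>

lemma infmin_near:
  assumes un: "\<And>z. infmin \<alpha> D v y0 z \<Longrightarrow> z = z0" and d: "d > 0"
  shows "\<forall>\<^sub>F y in nhds y0. \<forall>z. infmin \<alpha> D v y z \<longrightarrow> dist z z0 < d"
proof (rule ccontr)
  assume neg: "\<not> ?thesis"
  have "\<exists>y z. dist y y0 < 1 / real (Suc n) \<and> infmin \<alpha> D v y z \<and> d \<le> dist z z0" for n
    using neg unfolding eventually_nhds_metric by (meson not_le of_nat_0_less_iff zero_less_Suc zero_less_divide_1_iff)
  then obtain Y Z where YZ: "\<And>n. dist (Y n) y0 < 1 / real (Suc n)" "\<And>n. infmin \<alpha> D v (Y n) (Z n)" "\<And>n. d \<le> dist (Z n) z0"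
    by metis
  have Y: "Y \<longlonglongrightarrow> y0" using YZ(1) by (rule LIMSEQ_dist_Suc)
  have ic: "isCont (infconv \<alpha> D v) y0" using infconv_continuous continuous_on_eq_continuous_at[OF open_UNIV] by blast
  have I: "(\<lambda>n. infconv \<alpha> D v (Y n)) \<longlonglongrightarrow> infconv \<alpha> D v y0"
    by (rule isCont_tendsto_compose[OF ic Y])
  obtain B where B: "\<And>n. infconv \<alpha> D v (Y n) \<le> B"
  proof -
    have "bounded (range (\<lambda>n. infconv \<alpha> D v (Y n)))" by (rule convergent_imp_bounded[OF I])
    then obtain B where "\<forall>y\<in>range (\<lambda>n. infconv \<alpha> D v (Y n)). \<bar>y\<bar> \<le> B" unfolding bounded_real by blast
    then show ?thesis using that[of B] by (simp add: abs_le_iff)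
  qed
  obtain K where K: "compact K" "K \<subseteq> D" "\<And>z. z \<in> D \<Longrightarrow> v z \<le> B \<Longrightarrow> z \<in> K" using coercive by metis
  have ZK: "Z n \<in> K" for n
  proof (rule K(3))
    show "Z n \<in> D" using YZ(2) by (simp add: infmin_def)
    have "0 \<le> (norm (Y n - Z n))\<^sup>2 / (2 * \<alpha>)" using \<alpha> by simp
    then show "v (Z n) \<le> B" using YZ(2)[of n] B[of n] unfolding infmin_def by linarith
  qed
  obtain l r where l: "l \<in> K" "strict_mono r" "(Z \<circ> r) \<longlonglongrightarrow> l"
    using K(1) ZK unfolding compact_eq_seq_compact_metric seq_compact_def by metis
  have lD: "l \<in> D" using l(1) K(2) by auto
  have Yr: "(\<lambda>n. Y (r n)) \<longlonglongrightarrow> y0" using LIMSEQ_subseq_LIMSEQ[OF Y l(2)] by (simp add: o_def)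
  have Ir: "(\<lambda>n. infconv \<alpha> D v (Y (r n))) \<longlonglongrightarrow> infconv \<alpha> D v y0"
    using LIMSEQ_subseq_LIMSEQ[OF I l(2)] by (simp add: o_def)
  have lZ: "(\<lambda>n. Z (r n)) \<longlonglongrightarrow> l" using l(3) by (simp add: o_def)
  have "v l + (norm (y0 - l))\<^sup>2 / (2 * \<alpha>) \<le> infconv \<alpha> D v y0"
  proof (rule field_le_epsilon)
    fix e :: real assume e: "e > 0"
    have "\<forall>\<^sub>F n in sequentially. v l - e < v (Z (r n))"
      by (rule lsc_on_eventually[OF lsc lD lZ]) (use subsetD[OF K(2) ZK] e in simp_all)
    then have "\<forall>\<^sub>F n in sequentially. v l - e + (norm (Y (r n) - Z (r n)))\<^sup>2 / (2 * \<alpha>) \<le> infconv \<alpha> D v (Y (r n))"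
    proof eventually_elim
      case (elim n)
      then show ?case using YZ(2)[of "r n"] unfolding infmin_def by linarith
    qed
    then have "v l - e + (norm (y0 - l))\<^sup>2 / (2 * \<alpha>) \<le> infconv \<alpha> D v y0"
      by (intro tendsto_le[OF _ Ir]) (use Yr lZ \<alpha> in \<open>auto intro!: tendsto_intros\<close>)
    then show "v l + (norm (y0 - l))\<^sup>2 / (2 * \<alpha>) \<le> infconv \<alpha> D v y0 + e" by linarith
  qed
  then have "infmin \<alpha> D v y0 l" using infconv_le[OF lD, of y0] lD unfolding infmin_def by linarith
  then have "l = z0" by (rule un)
  moreover have "d \<le> dist l z0"
    by (rule tendsto_lowerbound[OF tendsto_dist[OF lZ tendsto_const]]) (use YZ(3) in auto)
  ultimately show False using d by simp
qed

text \<open>The paraboloid with vertex \<open>z\<close> lies above the inf-convolution and meets it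
  at \<open>y\<close>. A function touching from below at \<open>y\<close> thus also touches this
  paraboloid, which fixes its gradient and bounds its second derivatives from above.\<close>

lemma infconv_touch:
  assumes z: "infmin \<alpha> D v y z" and f: "pderivs U f ft fx fxx fw fww" "open U" "y \<in> U"
    and eq: "f y = infconv \<alpha> D v y" and le: "\<forall>\<^sub>F y' in nhds y. f y' \<le> infconv \<alpha> D v y'"
  shows "ft y = (sc y - sc z) / \<alpha>" "fx y = (xc y - xc z) / \<alpha>" "fw y = (wc y - wc z) / \<alpha>"
    "fxx y \<le> 1 / \<alpha>" "fww y \<le> 1 / \<alpha>"
proof -
  obtain s0 x0 w0 where ze: "z = (s0,x0,w0)" by (cases z)
  have zD: "z \<in> D" using z by (simp add: infmin_def)
  define g where "g = (\<lambda>y'. 1 / (2 * \<alpha>) * (norm (y' - (s0,x0,w0)))\<^sup>2 + v z)"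
  note G = pderivs_add[OF pderivs_quadratic[of "1 / (2 * \<alpha>)" s0 x0 w0] pderivs_const[of UNIV "v z"], folded g_def]
  have e: "f y = g y" using z eq by (simp add: g_def infmin_def ze)
  have l: "\<forall>\<^sub>F y' in nhds y. f y' \<le> g y'"
    using le
  proof eventually_elim
    case (elim y')
    then show ?case using infconv_le[OF zD, of y'] by (simp add: g_def ze)
  qed
  from pderivs_touch[OF f(1) G f(2) open_UNIV f(3) UNIV_I e l]
  show "ft y = (sc y - sc z) / \<alpha>" "fx y = (xc y - xc z) / \<alpha>" "fw y = (wc y - wc z) / \<alpha>"
    "fxx y \<le> 1 / \<alpha>" "fww y \<le> 1 / \<alpha>"
    using \<alpha> by (simp_all add: ze)
qed

end

section \<open>Bounds and locally uniform convergence of the smoothing\<close>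

lemma steklov_ge:
  assumes f: "continuous_on UNIV f" and h: "h \<ge> 0" and B: "\<And>y. B \<le> f y"
  shows "B \<le> steklov h f z"
proof (rule steklov_induct[OF f h, where Q="\<lambda>f y. B \<le> f y"])
  fix g e y assume g: "continuous_on UNIV g" and le: "\<And>t. t \<in> {0..1} \<Longrightarrow> B \<le> g (y + seg e h t)"
  have "avg (seg e h) (\<lambda>_. B) y \<le> avg (seg e h) g y"
    by (intro avg_mono g continuous_intros le)
  then show "B \<le> avg (seg e h) g y" by (simp add: avg_const)
qed (use B in auto)

lemma steklov_uniform:
  assumes f: "continuous_on UNIV f" and S: "compact S" and e: "e > 0"
  shows "\<forall>\<^sub>F n in sequentially. \<forall>z\<in>S. \<bar>steklov (1 / real (Suc n)) f z - f z\<bar> \<le> e"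
proof -
  define S' where "S' = {x + y |x y. x \<in> S \<and> y \<in> cball 0 1}"
  have S': "compact S'" unfolding S'_def by (rule compact_sums[OF S compact_cball])
  have mem: "y \<in> S'" if "z \<in> S" "dist y z \<le> 1" for y z
  proof -
    have "norm (y - z) \<le> 1" using that(2) by (simp add: dist_norm)
    then have "y = z + (y - z)" "y - z \<in> cball 0 1" by simp_all
    then show ?thesis unfolding S'_def using that(1) by blast
  qed
  have "uniformly_continuous_on S' f"
    using S' f by (meson compact_uniformly_continuous continuous_on_subset subset_UNIV)
  then obtain d where d: "d > 0" "\<And>z z'. z \<in> S' \<Longrightarrow> z' \<in> S' \<Longrightarrow> dist z' z < d \<Longrightarrow> dist (f z') (f z) < e"
    using e unfolding uniformly_continuous_on_def by metis
  have "\<forall>\<^sub>F n in sequentially. 1 / real (Suc n) < min (d / 5) (1 / 5)"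
    using LIMSEQ_Suc[OF lim_1_over_n] by (rule order_tendstoD(2)) (use d in auto)
  then show ?thesis
  proof eventually_elim
    case (elim n)
    show ?case
    proof
      fix z assume z: "z \<in> S"
      show "\<bar>steklov (1 / real (Suc n)) f z - f z\<bar> \<le> e"
      proof (rule steklov_near[OF f])
        fix y assume y: "dist y z \<le> 5 * (1 / real (Suc n))"
        then have "dist y z < d" "dist y z \<le> 1" using elim by linarith+
        with d(2)[of z y] mem[OF z, of y] mem[OF z, of z] show "\<bar>f y - f z\<bar> \<le> e" by (simp add: dist_real_def)
      qed simp
    qed
  qed
qed

lemma abs_sum6_le:
  fixes a b c d e f :: real
  assumes "\<bar>a\<bar> \<le> A" "\<bar>b\<bar> \<le> B" "\<bar>c\<bar> \<le> C" "\<bar>d\<bar> \<le> D" "\<bar>e\<bar> \<le> E" "\<bar>f\<bar> \<le> G"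
  shows "\<bar>a + b + c + d + e - f\<bar> \<le> A + B + C + D + E + G"
  using assms unfolding abs_le_iff by linarith

context hjb
begin

section \<open>Freezing the coefficients\<close>

text \<open>A test function touching the inf-convolution at \<open>y\<close> is translated to one
  touching \<open>v\<close> at a minimiser \<open>z\<close>, where the equation holds with
  coefficients taken at \<open>z\<close>. As the minimiser for \<open>y0\<close> is unique,
  \<open>z\<close> is close to \<open>z0\<close> and the lower order terms can be frozen. The radius
  must not depend on the control, because the subsolution will choose it later.\<close>

lemma frozen_coefficients:
  assumes C: "coercive_lsc D v \<alpha>" and OmD: "Om \<subseteq> D" and super: "vsuper \<eta> v" and z0: "z0 \<in> Om"
    and un: "\<And>z. infmin \<alpha> D v y0 z \<Longrightarrow> z = z0" and e: "e > 0"
  defines "F \<equiv> \<lambda>\<gamma> q. (sc y0 - sc z0) / \<alpha> + drft \<gamma> q (xc z0) * ((xc y0 - xc z0) / \<alpha>) + (wc y0 - wc z0) / \<alpha>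
    + q + Sf z0 - Kf z0 * v z0"
  obtains \<rho> where "\<rho> > 0" "\<And>y f ft fx fxx fw fww \<gamma> q. y \<in> ball y0 \<rho> \<Longrightarrow> pderivs UNIV f ft fx fxx fw fww \<Longrightarrow>
     f y = infconv \<alpha> D v y \<Longrightarrow> \<forall>\<^sub>F y' in nhds y. f y' \<le> infconv \<alpha> D v y' \<Longrightarrow> \<gamma> \<in> {0..1} \<Longrightarrow> q \<in> {0..M} \<Longrightarrow>
     diff \<gamma> (xc z0) * fxx y + ep * fww y \<le> - F \<gamma> q - \<eta> + e"
proof -
  interpret C: coercive_lsc D v \<alpha> by fact
  note \<alpha> = C.\<alpha>
  let ?V = "infconv \<alpha> D v"
  have m0: "infmin \<alpha> D v y0 z0" using C.infmin_ex[of y0] un by blast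
  define px where "px = (xc y0 - xc z0) / \<alpha>"
  define vv where "vv = (\<lambda>p. ?V (fst p) - (norm (fst p - snd p))\<^sup>2 / (2 * \<alpha>))"
  \<comment> \<open>Dominates the change of all terms of order at most one, uniformly in the
    controls, and tends to zero as \<open>(y,z)\<close> tends to \<open>(y0,z0)\<close>.\<close>
  define Err where "Err = (\<lambda>p::point \<times> point. \<bar>(sc (fst p) - sc (snd p)) / \<alpha> - (sc y0 - sc z0) / \<alpha>\<bar>
    + (pr + M) * \<bar>(xc (fst p) - xc (snd p)) / \<alpha> - px\<bar>
    + (rt + mu) * \<bar>xc (snd p) * ((xc (fst p) - xc (snd p)) / \<alpha>) - xc z0 * px\<bar>
    + \<bar>(wc (fst p) - wc (snd p)) / \<alpha> - (wc y0 - wc z0) / \<alpha>\<bar> + \<bar>Sf (snd p) - Sf z0\<bar>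
    + \<bar>Kf (snd p) * vv p - Kf z0 * v z0\<bar>)"
  define Fm where "Fm = \<bar>(sc y0 - sc z0) / \<alpha>\<bar> + ((pr + M) * \<bar>px\<bar> + (rt + mu) * \<bar>xc z0 * px\<bar>) + \<bar>(wc y0 - wc z0) / \<alpha>\<bar>
    + M + \<bar>Sf z0\<bar> + \<bar>Kf z0 * v z0\<bar>"
  define L where "L = 1 / \<alpha> + (Fm + \<bar>\<eta>\<bar>) / ep"
  have Fm: "\<bar>F \<gamma> q\<bar> \<le> Fm" if "\<gamma> \<in> {0..1}" "q \<in> {0..M}" for \<gamma> q
  proof -
    have "\<bar>drft \<gamma> q (xc z0) * px\<bar> \<le> (pr + M) * \<bar>px\<bar> + (rt + mu) * \<bar>xc z0 * px\<bar>"
      using drft_diff_le[OF that, of "xc z0" px 0 0] by simp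
    moreover have "\<bar>q\<bar> \<le> M" using that by auto
    ultimately show ?thesis unfolding F_def Fm_def px_def[symmetric]
      by (intro abs_sum6_le) auto
  qed
  have Fm0: "Fm \<ge> 0" using pos unfolding Fm_def by (intro add_nonneg_nonneg mult_nonneg_nonneg) auto
  have L: "L > 0" using \<alpha> Fm0 pos by (simp add: L_def add_pos_nonneg)
  have epL: "ep * L = ep / \<alpha> + Fm + \<bar>\<eta>\<bar>" using pos by (simp add: L_def field_simps)
  have cV: "isCont ?V y0" using C.infconv_continuous continuous_on_eq_continuous_at[OF open_UNIV] by blast
  have cSK: "isCont Sf z0" "isCont Kf z0"
    using cS cK z0 continuous_on_eq_continuous_at[OF Om] by blast+
  let ?N = "nhds (y0,z0)"
  have l1: "(fst \<longlongrightarrow> y0) ?N" and l2: "(snd \<longlongrightarrow> z0) ?N"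
    using tendsto_fst[OF filterlim_ident, of "(y0,z0)"] tendsto_snd[OF filterlim_ident, of "(y0,z0)"] by simp_all
  have lV: "((\<lambda>p. ?V (fst p)) \<longlongrightarrow> ?V y0) ?N" by (rule isCont_tendsto_compose[OF cV l1])
  have lS: "((\<lambda>p. Sf (snd p)) \<longlongrightarrow> Sf z0) ?N" and lK: "((\<lambda>p. Kf (snd p)) \<longlongrightarrow> Kf z0) ?N"
    by (rule isCont_tendsto_compose[OF cSK(1) l2], rule isCont_tendsto_compose[OF cSK(2) l2])
  have lvv: "(vv \<longlongrightarrow> v z0) ?N"
  proof -
    have "(vv \<longlongrightarrow> ?V y0 - (norm (y0 - z0))\<^sup>2 / (2 * \<alpha>)) ?N"
      unfolding vv_def using \<alpha> by (intro tendsto_intros lV l1 l2) auto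
    then show ?thesis using m0 by (simp add: infmin_def)
  qed
  have "(Err \<longlongrightarrow> \<bar>(sc y0 - sc z0) / \<alpha> - (sc y0 - sc z0) / \<alpha>\<bar> + (pr + M) * \<bar>(xc y0 - xc z0) / \<alpha> - px\<bar>
    + (rt + mu) * \<bar>xc z0 * ((xc y0 - xc z0) / \<alpha>) - xc z0 * px\<bar>
    + \<bar>(wc y0 - wc z0) / \<alpha> - (wc y0 - wc z0) / \<alpha>\<bar> + \<bar>Sf z0 - Sf z0\<bar>
    + \<bar>Kf z0 * v z0 - Kf z0 * v z0\<bar>) ?N"
    unfolding Err_def using \<alpha> by (intro tendsto_intros l1 l2 lS lK lvv) auto
  then have "(Err \<longlongrightarrow> 0) ?N" by (simp add: px_def)
  then have "\<forall>\<^sub>F p in ?N. Err p < e / 2" by (rule order_tendstoD(2)) (use e in simp)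
  moreover have "\<forall>\<^sub>F p in ?N. sg\<^sup>2 / 2 * \<bar>(xc z0)\<^sup>2 - (xc (snd p))\<^sup>2\<bar> < e / (2 * L)"
  proof (rule order_tendstoD(2))
    have "((\<lambda>p. sg\<^sup>2 / 2 * \<bar>(xc z0)\<^sup>2 - (xc (snd p))\<^sup>2\<bar>) \<longlongrightarrow> sg\<^sup>2 / 2 * \<bar>(xc z0)\<^sup>2 - (xc z0)\<^sup>2\<bar>) ?N"
      by (intro tendsto_intros l2)
    then show "((\<lambda>p. sg\<^sup>2 / 2 * \<bar>(xc z0)\<^sup>2 - (xc (snd p))\<^sup>2\<bar>) \<longlongrightarrow> 0) ?N" by simp
  qed (use e L in simp)
  moreover have "\<forall>\<^sub>F p in ?N. snd p \<in> Om" using topological_tendstoD[OF l2 Om z0] .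
  ultimately have "\<forall>\<^sub>F p in nhds y0 \<times>\<^sub>F nhds z0. Err p < e / 2 \<and>
      sg\<^sup>2 / 2 * \<bar>(xc z0)\<^sup>2 - (xc (snd p))\<^sup>2\<bar> < e / (2 * L) \<and> snd p \<in> Om"
    unfolding nhds_prod[symmetric] by eventually_elim auto
  then obtain Py Pz where Py: "eventually Py (nhds y0)" and Pz: "eventually Pz (nhds z0)"
    and PP: "\<And>y z. Py y \<Longrightarrow> Pz z \<Longrightarrow> Err (y,z) < e / 2 \<and> sg\<^sup>2 / 2 * \<bar>(xc z0)\<^sup>2 - (xc z)\<^sup>2\<bar> < e / (2 * L) \<and> z \<in> Om"
    unfolding eventually_prod_filter by auto
  obtain d where d: "d > 0" "\<And>z. dist z z0 < d \<Longrightarrow> Pz z" using Pz unfolding eventually_nhds_metric by blast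
  from eventually_conj[OF Py C.infmin_near[OF un d(1)]]
  obtain \<rho> where \<rho>: "\<rho> > 0" "\<And>y. dist y y0 < \<rho> \<Longrightarrow> Py y \<and> (\<forall>z. infmin \<alpha> D v y z \<longrightarrow> dist z z0 < d)"
    unfolding eventually_nhds_metric by blast
  show ?thesis
  proof (rule that[OF \<rho>(1)])
    fix y f ft fx fxx fw fww and \<gamma> q :: real
    assume y: "y \<in> ball y0 \<rho>" and f: "pderivs UNIV f ft fx fxx fw fww" and fy: "f y = ?V y"
      and fle: "\<forall>\<^sub>F y' in nhds y. f y' \<le> ?V y'" and g: "\<gamma> \<in> {0..1}" "q \<in> {0..M}"
    obtain z where z: "infmin \<alpha> D v y z" using C.infmin_ex by blast
    have yz: "Err (y,z) < e / 2" "sg\<^sup>2 / 2 * \<bar>(xc z0)\<^sup>2 - (xc z)\<^sup>2\<bar> < e / (2 * L)" "z \<in> Om"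
    proof -
      have "dist y y0 < \<rho>" using y by (simp add: dist_commute)
      then have "Py y" "dist z z0 < d" using \<rho>(2) z by blast+
      from PP[OF this(1) d(2)[OF this(2)]]
      show "Err (y,z) < e / 2" "sg\<^sup>2 / 2 * \<bar>(xc z0)\<^sup>2 - (xc z)\<^sup>2\<bar> < e / (2 * L)" "z \<in> Om" by blast+
    qed
    note T = C.infconv_touch[OF z f open_UNIV UNIV_I fy fle]
    \<comment> \<open>Translating by \<open>h\<close> works since using \<open>z'\<close> as
      competitor for the point \<open>z' + h\<close> bounds the inf-convolution there by
      \<open>v z' + k\<close>, with the same \<open>k\<close> for all \<open>z'\<close>.\<close>
    define h where "h = y - z"
    define k where "k = (norm h)\<^sup>2 / (2 * \<alpha>)"
    have G: "pderivs UNIV (\<lambda>z'. f (z' + h) - k) (\<lambda>z'. ft (z' + h) - 0) (\<lambda>z'. fx (z' + h) - 0) (\<lambda>z'. fxx (z' + h) - 0)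
       (\<lambda>z'. fw (z' + h) - 0) (\<lambda>z'. fww (z' + h) - 0)"
      using pderivs_diff[OF pderivs_translate[OF f, of h], of "\<lambda>_. k", OF pderivs_const] by simp
    have vz: "v z = ?V y - k" using z by (simp add: infmin_def k_def h_def)
    have le: "\<forall>\<^sub>F z' in nhds z. f (z' + h) - k \<le> v z'"
    proof -
      have "((\<lambda>z'. z' + h) \<longlongrightarrow> z + h) (nhds z)" by (intro tendsto_intros filterlim_ident)
      then have "filterlim (\<lambda>z'. z' + h) (nhds y) (nhds z)" by (simp add: h_def)
      then have "\<forall>\<^sub>F z' in nhds z. f (z' + h) \<le> ?V (z' + h)" using fle unfolding filterlim_iff by blast
      moreover have "\<forall>\<^sub>F z' in nhds z. z' \<in> Om" using Om yz(3) by (rule eventually_nhds_in_open)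
      ultimately show ?thesis
      proof eventually_elim
        case (elim z')
        then show ?case using C.infconv_le[of z' "z' + h"] OmD by (auto simp: k_def)
      qed
    qed
    have eqv: "f (z + h) - k = v z" using fy vz by (simp add: h_def)
    note S = vsuperD[OF super UNIV_I open_UNIV yz(3) G]
    from S[OF eqv le g]
    have op: "opr \<gamma> q z (v z) (ft y) (fx y) (fxx y) (fw y) (fww y) \<le> - \<eta>" by (simp add: h_def)
    have vvz: "vv (y,z) = v z" using vz by (simp add: vv_def k_def h_def)
    have "\<bar>drft \<gamma> q (xc z) * fx y - drft \<gamma> q (xc z0) * px\<bar> \<le> (pr + M) * \<bar>fx y - px\<bar> + (rt + mu) * \<bar>xc z * fx y - xc z0 * px\<bar>"
      by (rule drft_diff_le[OF g])
    then have "\<bar>(ft y - (sc y0 - sc z0) / \<alpha>) + (drft \<gamma> q (xc z) * fx y - drft \<gamma> q (xc z0) * px)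
        + (fw y - (wc y0 - wc z0) / \<alpha>) + 0 + (Sf z - Sf z0) - (Kf z0 * v z0 - Kf z0 * v z0 + Kf z * v z - Kf z0 * v z0)\<bar>
      \<le> \<bar>ft y - (sc y0 - sc z0) / \<alpha>\<bar> + ((pr + M) * \<bar>fx y - px\<bar> + (rt + mu) * \<bar>xc z * fx y - xc z0 * px\<bar>)
        + \<bar>fw y - (wc y0 - wc z0) / \<alpha>\<bar> + 0 + \<bar>Sf z - Sf z0\<bar> + \<bar>Kf z * v z - Kf z0 * v z0\<bar>"
      by (intro abs_sum6_le) auto
    also have "\<dots> = Err (y,z)" unfolding Err_def fst_conv snd_conv vvz T(1-3)[symmetric] by simp
    finally have first: "F \<gamma> q - Err (y,z) \<le> ft y + drft \<gamma> q (xc z) * fx y + fw y + q + Sf z - Kf z * v z"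
      unfolding F_def px_def[symmetric] abs_le_iff by linarith
    then have main: "diff \<gamma> (xc z) * fxx y + ep * fww y \<le> - F \<gamma> q - \<eta> + e / 2"
      using op yz(1) unfolding opr_def by linarith
    show "diff \<gamma> (xc z0) * fxx y + ep * fww y \<le> - F \<gamma> q - \<eta> + e"
    proof (cases "fxx y \<ge> - L")
      case True
      have "1 / \<alpha> \<le> L" using Fm0 pos by (simp add: L_def)
      then have "\<bar>fxx y\<bar> \<le> L" using True T(4) by linarith
      have "(diff \<gamma> (xc z0) - diff \<gamma> (xc z)) * fxx y \<le> \<bar>diff \<gamma> (xc z0) - diff \<gamma> (xc z)\<bar> * \<bar>fxx y\<bar>"
        by (metis abs_ge_self abs_mult)
      also have "\<dots> \<le> (e / (2 * L)) * L"
        using diff_diff_le[OF g(1), of "xc z0" "xc z"] yz(2) \<open>\<bar>fxx y\<bar> \<le> L\<close> e L by (intro mult_mono) auto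
      also have "\<dots> = e / 2" using L by simp
      finally show ?thesis using main by (simp add: left_diff_distrib)
    next
      case False
      have "diff \<gamma> (xc z0) * fxx y \<le> ep * fxx y"
        using False L diff_ge by (intro mult_right_mono_neg) auto
      also have "\<dots> \<le> ep * (- L)" using False pos by (intro mult_left_mono) auto
      finally have "diff \<gamma> (xc z0) * fxx y \<le> - (ep / \<alpha> + Fm + \<bar>\<eta>\<bar>)" using epL by simp
      moreover have "ep * fww y \<le> ep * (1 / \<alpha>)" using T(5) pos by (intro mult_left_mono) auto
      ultimately show ?thesis using Fm[OF g] e by simp
    qed
  qed
qed

section \<open>Doubling of variables\<close>

text \<open>Let \<open>\<theta>\<close> and \<open>y\<close> maximise \<open>u \<theta> - V y - |\<theta> - y|\<^sup>2 / (2 \<alpha>)\<close> with \<open>V\<close> smooth. Moving \<open>y\<close> along with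
  \<open>\<theta>\<close> by a map that scales \<open>x\<close> by a factor \<open>t\<close> produces a test function for \<open>u\<close>. The factors \<open>t = 1\<close> and
  \<open>t = \<xi> / x\<close> handle the two diffusion coefficients, and taking the better one serves both; this
  replaces the matrix inequality in the theorem on sums.\<close>

lemma contact_inequality:
  assumes sub: "vsub u" and OmD: "Om \<subseteq> D" and \<alpha>: "\<alpha> > 0" and V: "pderivs UNIV V Vt Vx Vxx Vw Vww"
    and \<theta>: "\<theta> \<in> Om"
    and mx: "\<And>\<theta>' y'. \<theta>' \<in> D \<Longrightarrow> u \<theta>' - V y' - (norm (\<theta>' - y'))\<^sup>2 / (2 * \<alpha>) \<le> u \<theta> - V y - (norm (\<theta> - y))\<^sup>2 / (2 * \<alpha>)"
  shows "\<exists>\<gamma>\<in>{0..1}. \<exists>q\<in>{0..M}. 0 \<le> (sc \<theta> - sc y) / \<alpha> + sg\<^sup>2 / 2 * ((xc \<theta> - \<xi>)\<^sup>2 / \<alpha>) + (diff \<gamma> \<xi> * Vxx y + ep * Vww y)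
    + drft \<gamma> q (xc \<theta>) * ((xc \<theta> - xc y) / \<alpha>) + (wc \<theta> - wc y) / \<alpha> + q + Sf \<theta> - Kf \<theta> * u \<theta>"
proof -
  obtain s1 x1 w1 where te: "\<theta> = (s1,x1,w1)" by (cases \<theta>)
  obtain s2 x2 w2 where ye: "y = (s2,x2,w2)" by (cases y)
  have \<theta>D: "\<theta> \<in> D" using \<theta> OmD by auto
  \<comment> \<open>With \<open>\<theta>\<close> fixed, maximality in \<open>y\<close> says that
    this concave paraboloid touches \<open>V\<close> from below at \<open>y\<close>. It gives the
    gradient of \<open>V\<close> and the bound \<open>Vxx y \<ge> -1 / \<alpha>\<close>.\<close>
  define f where "f = (\<lambda>y'. - 1 / (2 * \<alpha>) * (norm (y' - (s1,x1,w1)))\<^sup>2 + (V y + (norm (\<theta> - y))\<^sup>2 / (2 * \<alpha>)))"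
  note F = pderivs_add[OF pderivs_quadratic[of "- 1 / (2 * \<alpha>)" s1 x1 w1] pderivs_const[of UNIV "V y + (norm (\<theta> - y))\<^sup>2 / (2 * \<alpha>)"], folded f_def]
  have fy: "f y = V y" by (simp add: f_def te norm_minus_commute)
  have fle: "f y' \<le> V y'" for y' using mx[OF \<theta>D, of y'] by (simp add: f_def te norm_minus_commute)
  have A: "Vt y = (s1 - s2) / \<alpha>" "Vx y = (x1 - x2) / \<alpha>" "Vw y = (w1 - w2) / \<alpha>" "- 1 / \<alpha> \<le> Vxx y"
    using pderivs_touch[OF F V open_UNIV open_UNIV UNIV_I UNIV_I fy always_eventually] fle \<alpha>
    by (simp_all add: ye field_simps)
  \<comment> \<open>\<open>c t\<close> will be the second \<open>x\<close>-derivative of the test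
    function with scaling factor \<open>t\<close>. The part \<open>ep\<close> of the diffusion asks
    for \<open>c t \<le> Vxx y\<close>, the part proportional to the squared capital for the bound
    on \<open>x1^2 * c t\<close>.\<close>
  define c where "c = (\<lambda>t. t\<^sup>2 * Vxx y + (1 - t)\<^sup>2 / \<alpha>)"
  obtain t where t: "c t \<le> Vxx y" "x1\<^sup>2 * c t \<le> \<xi>\<^sup>2 * Vxx y + (x1 - \<xi>)\<^sup>2 / \<alpha>"
  proof (cases "x1 = 0")
    \<comment> \<open>Here \<open>\<xi> / x1\<close> makes no sense, but \<open>t = 1\<close>
      serves: the second bound only needs \<open>Vxx y + 1 / \<alpha> \<ge> 0\<close>.\<close>
    case True
    have "0 \<le> \<xi>\<^sup>2 * (Vxx y + 1 / \<alpha>)" using A(4) by (intro mult_nonneg_nonneg) auto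
    then show ?thesis using that[of 1] True by (simp add: c_def distrib_left)
  next
    case False
    have tau: "x1\<^sup>2 * c (\<xi> / x1) = \<xi>\<^sup>2 * Vxx y + (x1 - \<xi>)\<^sup>2 / \<alpha>"
    proof -
      have "x1\<^sup>2 * (\<xi> / x1)\<^sup>2 = \<xi>\<^sup>2" "x1\<^sup>2 * (1 - \<xi> / x1)\<^sup>2 = (x1 - \<xi>)\<^sup>2"
        using False by (simp_all add: power_mult_distrib[symmetric] right_diff_distrib)
      then show ?thesis unfolding c_def distrib_left by (metis mult.assoc times_divide_eq_right)
    qed
    show ?thesis
    proof (cases "c (\<xi> / x1) \<le> Vxx y")
      case True then show ?thesis using that[of "\<xi> / x1"] tau by simp
    next
      case False
      then have "x1\<^sup>2 * Vxx y \<le> x1\<^sup>2 * c (\<xi> / x1)" by (intro mult_left_mono) auto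
      then show ?thesis using that[of 1] tau by (simp add: c_def)
    qed
  qed
  \<comment> \<open>\<open>T\<close> sends \<open>\<theta>\<close> to \<open>y\<close>, keeps the
    differences in \<open>s\<close> and \<open>w\<close> constant and makes that in \<open>x\<close>
    affine in \<open>x\<close>. Inserting \<open>T z\<close> for \<open>y'\<close> in the maximality
    condition produces \<open>\<phi>\<close>.\<close>
  define T where "T = (\<lambda>(s,x,w). (s + (s2 - s1), t * x + (x2 - t * x1), w + (w2 - w1)) :: point)"
  define k where "k = u \<theta> - V y - (x1 - x2)\<^sup>2 / (2 * \<alpha>)"
  define \<phi> where "\<phi> = (\<lambda>z. V (T z) + (case z of (s,x,w) \<Rightarrow> 0 + ((1 - t) * x - (x2 - t * x1))\<^sup>2 / (2 * \<alpha>) + k))"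
  have P: "pderivs UNIV \<phi> (\<lambda>z. Vt (T z) + (case z of (s,x,w) \<Rightarrow> 0))
     (\<lambda>z. t * Vx (T z) + (case z of (s,x,w) \<Rightarrow> (1 - t) * ((1 - t) * x - (x2 - t * x1)) / \<alpha>))
     (\<lambda>z. t\<^sup>2 * Vxx (T z) + (case z of (s,x,w) \<Rightarrow> (1 - t)\<^sup>2 / \<alpha>))
     (\<lambda>z. Vw (T z) + (case z of (s,x,w) \<Rightarrow> 0)) (\<lambda>z. Vww (T z) + (case z of (s,x,w) \<Rightarrow> 0))"
    unfolding \<phi>_def T_def
    by (rule pderivs_add[OF pderivs_affine[OF V, unfolded vimage_UNIV] pderivs_sep])
      (use \<alpha> in \<open>auto intro!: derivative_eq_intros continuous_intros simp: power2_eq_square field_simps\<close>)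
  have T\<theta>: "T \<theta> = y" by (simp add: T_def te ye algebra_simps)
  have x12: "(1 - t) * x1 - (x2 - t * x1) = x1 - x2" by (simp add: algebra_simps)
  have "\<phi> \<theta> = V y + (case \<theta> of (s,x,w) \<Rightarrow> 0 + ((1 - t) * x - (x2 - t * x1))\<^sup>2 / (2 * \<alpha>) + k)"
    by (simp only: \<phi>_def T\<theta>)
  then have eq: "\<phi> \<theta> = u \<theta>" unfolding k_def by (simp add: te x12)
  have le: "u z \<le> \<phi> z" if "z \<in> D" for z
  proof -
    obtain s x w where ze: "z = (s,x,w)" by (cases z)
    have "z - T z = (s1 - s2, (1 - t) * x - (x2 - t * x1), w1 - w2)" by (simp add: T_def ze algebra_simps)
    then have 1: "(norm (z - T z))\<^sup>2 = (s1 - s2)\<^sup>2 + ((1 - t) * x - (x2 - t * x1))\<^sup>2 + (w1 - w2)\<^sup>2" by (simp only: norm_point_sq)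
    have 2: "(norm (\<theta> - y))\<^sup>2 = (s1 - s2)\<^sup>2 + (x1 - x2)\<^sup>2 + (w1 - w2)\<^sup>2"
    proof -
      have "\<theta> - y = (s1 - s2, x1 - x2, w1 - w2)" by (simp add: te ye)
      then show ?thesis by (simp only: norm_point_sq)
    qed
    show ?thesis using mx[OF that, of "T z"] unfolding 1 2 by (simp add: \<phi>_def ze k_def add_divide_distrib)
  qed
  have ev: "\<forall>\<^sub>F z in nhds \<theta>. u z \<le> \<phi> z"
    using eventually_nhds_in_open[OF Om \<theta>] by eventually_elim (use le OmD in auto)
  obtain \<gamma> q where g: "\<gamma> \<in> {0..1}" "q \<in> {0..M}" and
    "0 \<le> opr \<gamma> q \<theta> (u \<theta>) (Vt y + 0) (t * Vx y + (1 - t) * ((1 - t) * x1 - (x2 - t * x1)) / \<alpha>) (t\<^sup>2 * Vxx y + (1 - t)\<^sup>2 / \<alpha>) (Vw y + 0) (Vww y + 0)"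
    using vsubD[OF sub UNIV_I open_UNIV \<theta> P eq ev] unfolding T\<theta> by (auto simp: te)
  moreover have "t * Vx y + (1 - t) * ((1 - t) * x1 - (x2 - t * x1)) / \<alpha> = (x1 - x2) / \<alpha>"
    unfolding x12 A(2) using \<alpha> by (simp add: field_simps)
  ultimately have op: "0 \<le> opr \<gamma> q \<theta> (u \<theta>) ((s1 - s2) / \<alpha>) ((x1 - x2) / \<alpha>) (c t) ((w1 - w2) / \<alpha>) (Vww y)"
    by (simp add: A c_def)
  have "diff \<gamma> x1 * c t \<le> diff \<gamma> \<xi> * Vxx y + sg\<^sup>2 / 2 * ((x1 - \<xi>)\<^sup>2 / \<alpha>)"
  proof -
    have "\<gamma>\<^sup>2 \<le> 1" using g by (auto intro: power_le_one)
    have "diff \<gamma> x1 * c t = sg\<^sup>2 / 2 * \<gamma>\<^sup>2 * (x1\<^sup>2 * c t) + ep * c t" by (simp add: diff_def algebra_simps)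
    also have "\<dots> \<le> sg\<^sup>2 / 2 * \<gamma>\<^sup>2 * (\<xi>\<^sup>2 * Vxx y + (x1 - \<xi>)\<^sup>2 / \<alpha>) + ep * Vxx y"
      using t pos by (intro add_mono mult_left_mono) auto
    also have "\<dots> = diff \<gamma> \<xi> * Vxx y + sg\<^sup>2 / 2 * \<gamma>\<^sup>2 * ((x1 - \<xi>)\<^sup>2 / \<alpha>)" by (simp add: diff_def algebra_simps)
    also have "\<dots> \<le> diff \<gamma> \<xi> * Vxx y + sg\<^sup>2 / 2 * 1 * ((x1 - \<xi>)\<^sup>2 / \<alpha>)"
      using \<open>\<gamma>\<^sup>2 \<le> 1\<close> \<alpha> by (intro add_left_mono mult_right_mono mult_left_mono) auto
    finally show ?thesis by simp
  qed
  with op show ?thesis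
    by (intro bexI[OF _ g(1)] bexI[OF _ g(2)]) (simp add: opr_def te ye)
qed

end

text \<open>The second point ranges over the whole space; it is controlled because \<open>u\<close>
  is bounded above on \<open>D\<close> and \<open>u\<close> minus the quadratic is at least
  \<open>m\<close>, which bounds the distance of the pair.\<close>

lemma coercive_pair:
  assumes "coercive_lsc D (\<lambda>z. - u z) \<alpha>"
  obtains K :: "(point \<times> point) set" where "compact K" "K \<subseteq> D \<times> UNIV"
    "\<And>\<theta> y. \<theta> \<in> D \<Longrightarrow> m \<le> u \<theta> - (norm (\<theta> - y))\<^sup>2 / (2 * \<alpha>) \<Longrightarrow> (\<theta>, y) \<in> K"
proof -
  interpret U: coercive_lsc D "\<lambda>z. - u z" \<alpha> by fact
  obtain z where z: "z \<in> D" "\<And>z'. z' \<in> D \<Longrightarrow> - u z + 0 \<le> - u z' + 0"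
    by (rule U.minimum_ex[of "\<lambda>_. 0"]) auto
  obtain K1 where K1: "compact K1" "K1 \<subseteq> D" "\<And>\<theta>. \<theta> \<in> D \<Longrightarrow> - u \<theta> \<le> - m \<Longrightarrow> \<theta> \<in> K1"
    using U.coercive by metis
  obtain R where R: "\<And>\<theta>. \<theta> \<in> K1 \<Longrightarrow> norm \<theta> \<le> R"
    using compact_imp_bounded[OF K1(1)] unfolding bounded_iff by blast
  define Q where "Q = 2 * \<alpha> * (u z - m)"
  show ?thesis
  proof (rule that)
    show "compact (K1 \<times> cball (0::point) (R + Q + 1))" by (intro compact_Times K1 compact_cball)
    show "K1 \<times> cball 0 (R + Q + 1) \<subseteq> D \<times> UNIV" using K1 by auto
    fix \<theta> y :: point assume \<theta>: "\<theta> \<in> D" and m: "m \<le> u \<theta> - (norm (\<theta> - y))\<^sup>2 / (2 * \<alpha>)"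
    have "0 \<le> (norm (\<theta> - y))\<^sup>2 / (2 * \<alpha>)" using U.\<alpha> by simp
    then have t: "\<theta> \<in> K1" using m K1(3)[OF \<theta>] by linarith
    have "(norm (\<theta> - y))\<^sup>2 / (2 * \<alpha>) \<le> u z - m" using m z(2)[OF \<theta>] by linarith
    then have Q: "(norm (\<theta> - y))\<^sup>2 \<le> Q" using U.\<alpha> by (simp add: Q_def field_simps)
    have "norm (\<theta> - y) \<le> Q + 1"
    proof (cases "norm (\<theta> - y) \<le> 1")
      case True then show ?thesis using Q by (smt (verit) zero_le_power2)
    next
      case False
      then have "norm (\<theta> - y) * 1 \<le> norm (\<theta> - y) * norm (\<theta> - y)" by (intro mult_left_mono) auto
      then show ?thesis using Q by (simp add: power2_eq_square)
    qed
    then have "norm y \<le> R + Q + 1" using R[OF t] norm_triangle_ineq3[of y \<theta>] by (simp add: norm_minus_commute)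
    then show "(\<theta>, y) \<in> K1 \<times> cball 0 (R + Q + 1)" using t by simp
  qed
qed

text \<open>Parallelogram law. Over \<open>y\<close>, two quadratic penalties with parameter
  \<open>2 * \<alpha>\<close> are least at the midpoint, where they combine to one with
  \<open>4 * \<alpha>\<close>; any excess is the last square.\<close>

lemma midpoint_identity:
  fixes \<theta> y z :: "'a::real_inner"
  shows "(norm (y - z))\<^sup>2 + (norm (\<theta> - y))\<^sup>2 = (norm (\<theta> - z))\<^sup>2 / 2 + (norm (\<theta> + z - 2 *\<^sub>R y))\<^sup>2 / 2"
  by (simp add: power2_norm_eq_inner inner_diff inner_add inner_commute field_simps)

context hjb
begin

text \<open>The doubled function is maximised with smoothed inf-convolutions \<open>W n\<close> in
  place of \<open>v\<close>, so that one test function for \<open>u\<close> is enough. In the limit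
  \<open>y\<close> and a minimiser \<open>z\<close> of the inf-convolution at \<open>y\<close>
  appear; maximality forces \<open>y\<close> to be the midpoint of \<open>\<theta>\<close> and
  \<open>z\<close>. Hence the minimiser is unique, as freezing requires, and both gradients
  coincide.\<close>

lemma doubling_estimate:
  assumes CV: "coercive_lsc D v \<alpha>" and CU: "coercive_lsc D (\<lambda>z. - u z) \<alpha>" and OmD: "Om \<subseteq> D"
    and sub: "vsub u" and super: "vsuper \<eta> v"
  obtains \<theta> z where "\<theta> \<in> D" "z \<in> D"
    "\<And>\<theta>' z'. \<theta>' \<in> D \<Longrightarrow> z' \<in> D \<Longrightarrow> u \<theta>' - v z' - (norm (\<theta>' - z'))\<^sup>2 / (4 * \<alpha>) \<le> u \<theta> - v z - (norm (\<theta> - z))\<^sup>2 / (4 * \<alpha>)"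
    "\<theta> \<in> Om \<Longrightarrow> z \<in> Om \<Longrightarrow> \<eta> \<le> sg\<^sup>2 / 2 * ((xc \<theta> - xc z)\<^sup>2 / \<alpha>) + (rt + mu) * ((xc \<theta> - xc z)\<^sup>2 / (2 * \<alpha>))
       + Sf \<theta> - Sf z - Kf \<theta> * u \<theta> + Kf z * v z"
proof -
  interpret V: coercive_lsc D v \<alpha> by fact
  interpret U: coercive_lsc D "\<lambda>z. - u z" \<alpha> by fact
  note \<alpha> = V.\<alpha>
  have usc: "usc_on D u" using U.lsc by (simp add: lsc_on_iff_usc_on)
  let ?V = "infconv \<alpha> D v"
  note cV = V.infconv_continuous
  obtain zm where zm: "zm \<in> D" "\<And>z'. z' \<in> D \<Longrightarrow> v zm + 0 \<le> v z' + 0"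
    by (rule V.minimum_ex[of "\<lambda>_. 0"]) auto
  define B where "B = v zm"
  have B: "B \<le> v z" if "z \<in> D" for z using zm(2)[OF that] by (simp add: B_def)
  have BV: "B \<le> ?V y" for y by (rule V.infconv_ge[OF B])
  define h where "h = (\<lambda>n. 1 / real (Suc n))"
  have h: "h n > 0" for n by (simp add: h_def)
  have h0: "h \<longlonglongrightarrow> 0" unfolding h_def by (rule LIMSEQ_Suc[OF lim_1_over_n])
  define W where "W = (\<lambda>n. steklov (h n) ?V)"
  have cW: "continuous_on UNIV (W n)" for n unfolding W_def by (rule steklov_continuous[OF cV])
  have BW: "B \<le> W n y" for n y unfolding W_def using h by (intro steklov_ge[OF cV _ BV]) (simp add: less_imp_le)
  have unif: "\<forall>\<^sub>F n in sequentially. \<forall>z\<in>S. \<bar>W n z - ?V z\<bar> \<le> e" if "compact S" "e > 0" for S e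
    unfolding W_def h_def by (rule steklov_uniform[OF cV that])
  define f where "f = (\<lambda>n (\<theta>,y). u \<theta> - W n y - (norm (\<theta> - y))\<^sup>2 / (2 * \<alpha>))"
  obtain t0 where t0: "t0 \<in> D" using V.D by auto
  have fu: "usc_on (D \<times> UNIV) (f n)" for n
  proof -
    have "usc_on (D \<times> UNIV) (\<lambda>p. u (fst p))"
      by (rule usc_on_compose[OF usc]) (auto intro!: continuous_intros)
    moreover have "usc_on (D \<times> UNIV) (\<lambda>p. - W n (snd p) - (norm (fst p - snd p))\<^sup>2 / (2 * \<alpha>))"
      using \<alpha> by (intro continuous_on_imp_usc_on continuous_intros continuous_on_compose2[OF cW]) auto
    ultimately have "usc_on (D \<times> UNIV) (\<lambda>p. u (fst p) + (- W n (snd p) - (norm (fst p - snd p))\<^sup>2 / (2 * \<alpha>)))"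
      by (rule usc_on_add)
    then show ?thesis by (simp add: f_def case_prod_beta' algebra_simps)
  qed
  have "\<exists>p. p \<in> D \<times> UNIV \<and> (\<forall>q\<in>D \<times> UNIV. f n q \<le> f n p)" for n
  proof -
    obtain K where K: "compact K" "K \<subseteq> D \<times> UNIV"
      "\<And>\<theta> y. \<theta> \<in> D \<Longrightarrow> f n (t0,t0) + B \<le> u \<theta> - (norm (\<theta> - y))\<^sup>2 / (2 * \<alpha>) \<Longrightarrow> (\<theta>, y) \<in> K"
      using coercive_pair[OF CU] by metis
    have mem: "p \<in> K" if p: "p \<in> D \<times> UNIV" "f n (t0,t0) \<le> f n p" for p
    proof -
      obtain \<theta> y where pe: "p = (\<theta>,y)" by (cases p)
      have "f n (\<theta>,y) \<le> u \<theta> - (norm (\<theta> - y))\<^sup>2 / (2 * \<alpha>) - B" using BW[of n y] by (simp add: f_def)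
      moreover have "\<theta> \<in> D" using p(1) by (simp add: pe)
      ultimately show ?thesis unfolding pe using p(2) by (intro K(3)) (simp_all add: pe)
    qed
    have t00: "(t0,t0) \<in> D \<times> UNIV" using t0 by simp
    obtain pm where pm: "pm \<in> K" "\<And>q. q \<in> D \<times> UNIV \<Longrightarrow> f n q \<le> f n pm"
    proof (rule usc_coercive_attains_sup[OF fu[of n] t00 K(1,2)])
      show "x \<in> K" if "x \<in> D \<times> UNIV" "f n (t0,t0) \<le> f n x" for x using that by (rule mem)
    qed (rule that)
    have "pm \<in> D \<times> UNIV" by (rule subsetD[OF K(2) pm(1)])
    with pm(2) show ?thesis by (intro exI[of _ pm] conjI ballI)
  qed
  then have "\<forall>n. \<exists>p. p \<in> D \<times> UNIV \<and> (\<forall>q\<in>D \<times> UNIV. f n q \<le> f n p)" ..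
  from choice[OF this] obtain p where pp: "\<forall>n. p n \<in> D \<times> UNIV \<and> (\<forall>q\<in>D \<times> UNIV. f n q \<le> f n (p n))" ..
  have p: "p n \<in> D \<times> UNIV" "q \<in> D \<times> UNIV \<Longrightarrow> f n q \<le> f n (p n)" for n q
    by (rule conjunct1[OF spec[OF pp, of n]], rule bspec[OF conjunct2[OF spec[OF pp, of n]]])
  \<comment> \<open>From \<open>J\<close> on the maximal values have a common lower bound, so all
    the later maximisers lie in one compact set and a subsequence converges.\<close>
  obtain J where J: "\<And>n. n \<ge> J \<Longrightarrow> \<bar>W n t0 - ?V t0\<bar> \<le> 1"
    using unif[of "{t0}" 1] unfolding eventually_sequentially by auto
  obtain K where K: "compact K" "K \<subseteq> D \<times> UNIV"
    "\<And>\<theta> y. \<theta> \<in> D \<Longrightarrow> u t0 - ?V t0 - 1 + B \<le> u \<theta> - (norm (\<theta> - y))\<^sup>2 / (2 * \<alpha>) \<Longrightarrow> (\<theta>, y) \<in> K"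
    using coercive_pair[OF CU] by metis
  have pK: "p n \<in> K" if "n \<ge> J" for n
  proof -
    obtain \<theta> y where pe: "p n = (\<theta>,y)" by (cases "p n")
    have "f n (t0,t0) \<le> f n (\<theta>,y)" using p(2)[of "(t0,t0)" n] t0 by (simp add: pe)
    moreover have "u t0 - ?V t0 - 1 \<le> f n (t0,t0)" using J[OF that] by (simp add: f_def abs_le_iff)
    moreover have "f n (\<theta>,y) \<le> u \<theta> - (norm (\<theta> - y))\<^sup>2 / (2 * \<alpha>) - B" using BW[of n y] by (simp add: f_def)
    moreover have "\<theta> \<in> D" using p(1)[of n] by (simp add: pe)
    ultimately show ?thesis unfolding pe by (intro K(3)) simp_all
  qed
  have "seq_compact K" "\<forall>n. p (J + n) \<in> K" using K(1) pK by (simp_all add: compact_eq_seq_compact_metric)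
  then obtain l r where l: "l \<in> K" "strict_mono r" "((\<lambda>n. p (J + n)) \<circ> r) \<longlonglongrightarrow> l"
    by (rule seq_compactE)
  define R where "R = (\<lambda>k. J + r k)"
  have RT: "filterlim R at_top sequentially"
    unfolding R_def by (intro filterlim_at_top_mono[OF filterlim_subseq[OF l(2)]]) auto
  have evR: "\<forall>\<^sub>F k in sequentially. P (R k)" if "\<forall>\<^sub>F n in sequentially. P n" for P
    using RT that unfolding filterlim_iff by blast
  obtain \<theta> y where le: "l = (\<theta>, y)" by (cases l)
  define T where "T = (\<lambda>k. fst (p (R k)))"
  define Y where "Y = (\<lambda>k. snd (p (R k)))"
  have lim: "T \<longlonglongrightarrow> \<theta>" "Y \<longlonglongrightarrow> y"
    using tendsto_fst[OF l(3)] tendsto_snd[OF l(3)] by (simp_all add: T_def Y_def R_def o_def le)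
  have \<theta>D: "\<theta> \<in> D" using l(1) K(2) le by auto
  have TD: "T k \<in> D" for k using p(1)[of "R k"] by (auto simp: T_def)
  have mxk: "u \<theta>' - W (R k) y' - (norm (\<theta>' - y'))\<^sup>2 / (2 * \<alpha>) \<le> u (T k) - W (R k) (Y k) - (norm (T k - Y k))\<^sup>2 / (2 * \<alpha>)"
    if "\<theta>' \<in> D" for \<theta>' y' k
    using p(2)[of "(\<theta>',y')" "R k"] that by (simp add: f_def case_prod_beta' T_def Y_def)
  have WV: "(\<lambda>k. W (R k) y') \<longlonglongrightarrow> ?V y'" for y'
  proof (rule tendstoI)
    fix e :: real assume e: "e > 0"
    then have "\<forall>\<^sub>F n in sequentially. \<forall>z\<in>{y'}. \<bar>W n z - ?V z\<bar> \<le> e / 2" by (intro unif) simp_all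
    from evR[OF this] show "\<forall>\<^sub>F k in sequentially. dist (W (R k) y') (?V y') < e"
      by eventually_elim (use e in \<open>simp add: dist_real_def\<close>)
  qed
  have YK: "Y k \<in> snd ` K" for k using pK[of "R k"] by (auto simp: Y_def R_def)
  have cVat: "isCont ?V z" for z using cV continuous_on_eq_continuous_at[OF open_UNIV] by blast
  have WY: "(\<lambda>k. W (R k) (Y k)) \<longlonglongrightarrow> ?V y"
  proof -
    have cK': "compact (snd ` K)" by (rule compact_continuous_image[OF continuous_on_snd[OF continuous_on_id] K(1)])
    have "(\<lambda>k. W (R k) (Y k) - ?V (Y k)) \<longlonglongrightarrow> 0"
    proof (rule tendstoI)
      fix e :: real assume e: "e > 0"
      then have "\<forall>\<^sub>F n in sequentially. \<forall>z\<in>snd ` K. \<bar>W n z - ?V z\<bar> \<le> e / 2"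
        by (intro unif[OF cK']) simp
      from evR[OF this] show "\<forall>\<^sub>F k in sequentially. dist (W (R k) (Y k) - ?V (Y k)) 0 < e"
      proof eventually_elim
        case (elim k)
        from bspec[OF elim YK[of k]] show ?case using e by (simp add: dist_real_def)
      qed
    qed
    from tendsto_add[OF this isCont_tendsto_compose[OF cVat lim(2)]] show ?thesis by simp
  qed
  have max0: "u \<theta>' - ?V y' - (norm (\<theta>' - y'))\<^sup>2 / (2 * \<alpha>) \<le> u \<theta> - ?V y - (norm (\<theta> - y))\<^sup>2 / (2 * \<alpha>)"
    if "\<theta>' \<in> D" for \<theta>' y'
  proof (rule field_le_epsilon)
    fix e :: real assume e: "e > 0"
    have "\<forall>\<^sub>F k in sequentially. u (T k) < u \<theta> + e"
      by (rule usc_on_eventually[OF usc \<theta>D lim(1)]) (use TD e in auto)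
    then have "\<forall>\<^sub>F k in sequentially. u \<theta>' - W (R k) y' - (norm (\<theta>' - y'))\<^sup>2 / (2 * \<alpha>)
        \<le> u \<theta> + e - W (R k) (Y k) - (norm (T k - Y k))\<^sup>2 / (2 * \<alpha>)"
    proof eventually_elim
      case (elim k)
      then show ?case using mxk[OF that, where k=k and y'=y'] by linarith
    qed
    moreover have "(\<lambda>k. u \<theta>' - W (R k) y' - (norm (\<theta>' - y'))\<^sup>2 / (2 * \<alpha>)) \<longlonglongrightarrow> u \<theta>' - ?V y' - (norm (\<theta>' - y'))\<^sup>2 / (2 * \<alpha>)"
      by (intro tendsto_intros WV)
    moreover have "(\<lambda>k. u \<theta> + e - W (R k) (Y k) - (norm (T k - Y k))\<^sup>2 / (2 * \<alpha>)) \<longlonglongrightarrow> u \<theta> + e - ?V y - (norm (\<theta> - y))\<^sup>2 / (2 * \<alpha>)"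
      using \<alpha> by (intro tendsto_intros WY lim) auto
    ultimately have "u \<theta>' - ?V y' - (norm (\<theta>' - y'))\<^sup>2 / (2 * \<alpha>) \<le> u \<theta> + e - ?V y - (norm (\<theta> - y))\<^sup>2 / (2 * \<alpha>)"
      by (intro tendsto_le[OF sequentially_bot])
    then show "u \<theta>' - ?V y' - (norm (\<theta>' - y'))\<^sup>2 / (2 * \<alpha>) \<le> u \<theta> - ?V y - (norm (\<theta> - y))\<^sup>2 / (2 * \<alpha>) + e" by linarith
  qed
  \<comment> \<open>Semicontinuity bounds \<open>u (T k)\<close> from above only. The lower bound
    comes from comparing the maximiser with the limit pair; full convergence is needed for the zero
    order term \<open>Kf * u\<close>.\<close>
  have uT: "(\<lambda>k. u (T k)) \<longlonglongrightarrow> u \<theta>"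
  proof (rule order_tendstoI)
    fix a assume "u \<theta> < a"
    then show "\<forall>\<^sub>F k in sequentially. u (T k) < a"
      by (intro usc_on_eventually[OF usc \<theta>D lim(1)]) (use TD in auto)
  next
    fix a assume a: "a < u \<theta>"
    have "(\<lambda>k. u \<theta> - W (R k) y - (norm (\<theta> - y))\<^sup>2 / (2 * \<alpha>) + W (R k) (Y k) + (norm (T k - Y k))\<^sup>2 / (2 * \<alpha>))
       \<longlonglongrightarrow> u \<theta> - ?V y - (norm (\<theta> - y))\<^sup>2 / (2 * \<alpha>) + ?V y + (norm (\<theta> - y))\<^sup>2 / (2 * \<alpha>)"
      using \<alpha> by (intro tendsto_intros WV WY lim) auto
    then have "\<forall>\<^sub>F k in sequentially. a < u \<theta> - W (R k) y - (norm (\<theta> - y))\<^sup>2 / (2 * \<alpha>) + W (R k) (Y k) + (norm (T k - Y k))\<^sup>2 / (2 * \<alpha>)"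
      by (rule order_tendstoD(1)) (use a in simp)
    then show "\<forall>\<^sub>F k in sequentially. a < u (T k)"
    proof eventually_elim
      case (elim k)
      then show ?case using mxk[OF \<theta>D, where k=k and y'=y] by linarith
    qed
  qed
  obtain z where z: "infmin \<alpha> D v y z" using V.infmin_ex by blast
  have zD: "z \<in> D" using z by (simp add: infmin_def)
  have chain: "u \<theta>' - v z' - (norm (\<theta>' - z'))\<^sup>2 / (4 * \<alpha>) \<le> u \<theta> - v z'' - ((norm (y - z''))\<^sup>2 + (norm (\<theta> - y))\<^sup>2) / (2 * \<alpha>)"
    if D': "\<theta>' \<in> D" "z' \<in> D" and m: "infmin \<alpha> D v y z''" for \<theta>' z' z''
  proof -
    define c where "c = (1/2) *\<^sub>R (\<theta>' + z')"
    have "((norm (c - z'))\<^sup>2 + (norm (\<theta>' - c))\<^sup>2) / (2 * \<alpha>) = (norm (\<theta>' - z'))\<^sup>2 / (4 * \<alpha>)"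
      unfolding midpoint_identity by (simp add: c_def)
    then have "u \<theta>' - v z' - (norm (\<theta>' - z'))\<^sup>2 / (4 * \<alpha>) = u \<theta>' - (v z' + (norm (c - z'))\<^sup>2 / (2 * \<alpha>)) - (norm (\<theta>' - c))\<^sup>2 / (2 * \<alpha>)"
      by (simp add: add_divide_distrib)
    also have "\<dots> \<le> u \<theta>' - ?V c - (norm (\<theta>' - c))\<^sup>2 / (2 * \<alpha>)" using V.infconv_le[OF D'(2), of c] by simp
    also have "\<dots> \<le> u \<theta> - ?V y - (norm (\<theta> - y))\<^sup>2 / (2 * \<alpha>)" by (rule max0[OF D'(1)])
    also have "\<dots> = u \<theta> - v z'' - ((norm (y - z''))\<^sup>2 + (norm (\<theta> - y))\<^sup>2) / (2 * \<alpha>)"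
      using m by (simp add: infmin_def add_divide_distrib)
    finally show ?thesis .
  qed
  \<comment> \<open>Apply \<open>chain\<close> to the pair \<open>(\<theta>, z'')\<close> itself:
    the excess in the midpoint identity must vanish. Since \<open>z''\<close> is then determined by
    \<open>\<theta>\<close> and \<open>y\<close>, minimisers are unique.\<close>
  have mid: "\<theta> + z'' - 2 *\<^sub>R y = 0" if m: "infmin \<alpha> D v y z''" for z''
  proof -
    have "z'' \<in> D" using m by (simp add: infmin_def)
    from chain[OF \<theta>D this m] have "((norm (\<theta> - z''))\<^sup>2 / 2 + (norm (\<theta> + z'' - 2 *\<^sub>R y))\<^sup>2 / 2) / (2 * \<alpha>) \<le> (norm (\<theta> - z''))\<^sup>2 / (4 * \<alpha>)"
      unfolding midpoint_identity by linarith
    moreover have "N \<le> 0" if "(n / 2 + N / 2) / (2 * \<alpha>) \<le> n / (4 * \<alpha>)" for n N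
    proof -
      have "\<alpha> * N \<le> \<alpha> * 0" using that \<alpha> by (simp add: field_simps)
      then show ?thesis using \<alpha> by (simp only: mult_le_cancel_left_pos)
    qed
    ultimately have "(norm (\<theta> + z'' - 2 *\<^sub>R y))\<^sup>2 \<le> 0" by blast
    then show ?thesis by simp
  qed
  have un: "z'' = z" if "infmin \<alpha> D v y z''" for z'' using mid[OF that] mid[OF z] by (metis add_diff_cancel_left' eq_iff_diff_eq_0)
  have y2: "y = (1/2) *\<^sub>R (\<theta> + z)"
  proof -
    have "\<theta> + z = 2 *\<^sub>R y" using mid[OF z] by simp
    then show ?thesis by simp
  qed
  show ?thesis
  proof (rule that[OF \<theta>D zD])
    fix \<theta>' z' assume "\<theta>' \<in> D" "z' \<in> D"
    from chain[OF this z] show "u \<theta>' - v z' - (norm (\<theta>' - z'))\<^sup>2 / (4 * \<alpha>) \<le> u \<theta> - v z - (norm (\<theta> - z))\<^sup>2 / (4 * \<alpha>)"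
      unfolding midpoint_identity mid[OF z] by simp
  next
    assume \<theta>Om: "\<theta> \<in> Om" and zOm: "z \<in> Om"
    define \<xi> where "\<xi> = xc z"
    define ps where "ps = (sc y - sc z) / \<alpha>"
    define px where "px = (xc y - xc z) / \<alpha>"
    define pw where "pw = (wc y - wc z) / \<alpha>"
    have pe: "(sc \<theta> - sc y) / \<alpha> = ps" "(xc \<theta> - xc y) / \<alpha> = px" "(wc \<theta> - wc y) / \<alpha> = pw"
      "px = (xc \<theta> - \<xi>) / (2 * \<alpha>)"
      unfolding ps_def px_def pw_def y2 \<xi>_def using \<alpha> by (simp_all add: field_simps)
    show "\<eta> \<le> sg\<^sup>2 / 2 * ((xc \<theta> - xc z)\<^sup>2 / \<alpha>) + (rt + mu) * ((xc \<theta> - xc z)\<^sup>2 / (2 * \<alpha>)) + Sf \<theta> - Sf z - Kf \<theta> * u \<theta> + Kf z * v z"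
    proof (rule field_le_epsilon)
      fix e :: real assume e: "e > 0"
      obtain \<rho> where \<rho>: "\<rho> > 0" "\<And>y' f ft fx fxx fw fww \<gamma> q. y' \<in> ball y \<rho> \<Longrightarrow> pderivs UNIV f ft fx fxx fw fww \<Longrightarrow>
         f y' = ?V y' \<Longrightarrow> \<forall>\<^sub>F y'' in nhds y'. f y'' \<le> ?V y'' \<Longrightarrow> \<gamma> \<in> {0..1} \<Longrightarrow> q \<in> {0..M} \<Longrightarrow>
         diff \<gamma> \<xi> * fxx y' + ep * fww y' \<le> - (ps + drft \<gamma> q \<xi> * px + pw + q + Sf z - Kf z * v z) - \<eta> + e"
        unfolding ps_def px_def pw_def \<xi>_def by (rule frozen_coefficients[OF CV OmD super zOm un e]) blast+
      \<comment> \<open>Everything left after the second order terms and the slopes cancel between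
        the two inequalities; it no longer mentions the control.\<close>
      define E where "E = (\<lambda>k. sg\<^sup>2 / 2 * ((xc (T k) - \<xi>)\<^sup>2 / \<alpha>) + \<bar>(sc (T k) - sc (Y k)) / \<alpha> - ps\<bar>
          + \<bar>(wc (T k) - wc (Y k)) / \<alpha> - pw\<bar> + ((pr + M) * \<bar>(xc (T k) - xc (Y k)) / \<alpha> - px\<bar>
          + (rt + mu) * \<bar>xc (T k) * ((xc (T k) - xc (Y k)) / \<alpha>) - xc \<theta> * px\<bar>)
          + (rt + mu) * ((xc \<theta> - \<xi>)\<^sup>2 / (2 * \<alpha>)) + (Sf (T k) - Sf z - Kf (T k) * u (T k) + Kf z * v z))"
      have key: "\<forall>\<^sub>F k in sequentially. \<eta> \<le> e + E k"
      proof -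
        have "\<forall>\<^sub>F k in sequentially. T k \<in> Om" using topological_tendstoD[OF lim(1) Om \<theta>Om] .
        moreover have "\<forall>\<^sub>F k in sequentially. Y k \<in> ball y (\<rho> / 2)"
          by (rule topological_tendstoD[OF lim(2) open_ball]) (use \<rho>(1) in simp)
        moreover have "\<forall>\<^sub>F k in sequentially. h (R k) < \<rho> / 20"
          by (rule evR, rule order_tendstoD(2)[OF h0]) (use \<rho>(1) in simp)
        ultimately show ?thesis
        proof eventually_elim
          case (elim k)
          obtain Wt Wx Wxx Ww Www where P: "pderivs UNIV (W (R k)) Wt Wx Wxx Ww Www"
            unfolding W_def using steklov_pderivs[OF cV h] by metis
          obtain \<gamma> q where g: "\<gamma> \<in> {0..1}" "q \<in> {0..M}" and
            s: "0 \<le> (sc (T k) - sc (Y k)) / \<alpha> + sg\<^sup>2 / 2 * ((xc (T k) - \<xi>)\<^sup>2 / \<alpha>) + (diff \<gamma> \<xi> * Wxx (Y k) + ep * Www (Y k))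
              + drft \<gamma> q (xc (T k)) * ((xc (T k) - xc (Y k)) / \<alpha>) + (wc (T k) - wc (Y k)) / \<alpha> + q + Sf (T k) - Kf (T k) * u (T k)"
            using contact_inequality[OF sub OmD \<alpha> P elim(1) mxk, of \<xi>] by blast
          \<comment> \<open>The control was chosen by the subsolution; the averaged frozen
            inequality is now used for exactly this control.\<close>
          have S: "diff \<gamma> \<xi> * Wxx (Y k) + ep * Www (Y k) \<le> - (ps + drft \<gamma> q \<xi> * px + pw + q + Sf z - Kf z * v z) - \<eta> + e"
          proof (rule steklov_supersolution[OF cV _ pos(5) \<rho>(1) h _ _ elim(2) P[unfolded W_def]])
            show "0 < diff \<gamma> \<xi>" using diff_ge[of \<gamma> \<xi>] pos by linarith
            show "20 * h (R k) < \<rho>" using elim(3) by simp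
          next
            fix z' f ft fx fxx fw fww
            assume a: "z' \<in> ball y \<rho>" "pderivs UNIV f ft fx fxx fw fww" "f z' = ?V z'" "\<forall>\<^sub>F z'' in nhds z'. f z'' \<le> ?V z''"
            show "diff \<gamma> \<xi> * fxx z' + ep * fww z' \<le> - (ps + drft \<gamma> q \<xi> * px + pw + q + Sf z - Kf z * v z) - \<eta> + e"
              by (rule \<rho>(2)[OF a g])
          qed
          have d1: "\<bar>drft \<gamma> q (xc (T k)) * ((xc (T k) - xc (Y k)) / \<alpha>) - drft \<gamma> q (xc \<theta>) * px\<bar> \<le>
             (pr + M) * \<bar>(xc (T k) - xc (Y k)) / \<alpha> - px\<bar> + (rt + mu) * \<bar>xc (T k) * ((xc (T k) - xc (Y k)) / \<alpha>) - xc \<theta> * px\<bar>"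
            by (rule drft_diff_le[OF g])
          have "drft \<gamma> q (xc \<theta>) * px - drft \<gamma> q \<xi> * px = (rt + (mu - rt) * \<gamma>) * ((xc \<theta> - \<xi>)\<^sup>2 / (2 * \<alpha>))"
          proof -
            have "(xc \<theta> - \<xi>) * px = (xc \<theta> - \<xi>)\<^sup>2 / (2 * \<alpha>)" unfolding pe(4) by (simp add: power2_eq_square)
            moreover have "drft \<gamma> q (xc \<theta>) * px - drft \<gamma> q \<xi> * px = (rt + (mu - rt) * \<gamma>) * ((xc \<theta> - \<xi>) * px)"
              unfolding drft_def by (simp add: algebra_simps)
            ultimately show ?thesis by simp
          qed
          also have "\<dots> \<le> (rt + mu) * ((xc \<theta> - \<xi>)\<^sup>2 / (2 * \<alpha>))"
            using drft_rate[OF g(1)] \<alpha> by (intro mult_right_mono) auto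
          finally show ?case using s S d1 unfolding E_def by (simp only: abs_le_iff) linarith
        qed
      qed
      have cSK: "isCont Sf \<theta>" "isCont Kf \<theta>"
        using cS cK \<theta>Om continuous_on_eq_continuous_at[OF Om] by blast+
      have "E \<longlonglongrightarrow> sg\<^sup>2 / 2 * ((xc \<theta> - \<xi>)\<^sup>2 / \<alpha>) + \<bar>(sc \<theta> - sc y) / \<alpha> - ps\<bar>
          + \<bar>(wc \<theta> - wc y) / \<alpha> - pw\<bar> + ((pr + M) * \<bar>(xc \<theta> - xc y) / \<alpha> - px\<bar>
          + (rt + mu) * \<bar>xc \<theta> * ((xc \<theta> - xc y) / \<alpha>) - xc \<theta> * px\<bar>)
          + (rt + mu) * ((xc \<theta> - \<xi>)\<^sup>2 / (2 * \<alpha>)) + (Sf \<theta> - Sf z - Kf \<theta> * u \<theta> + Kf z * v z)"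
        unfolding E_def using \<alpha>
        by (intro tendsto_intros lim uT isCont_tendsto_compose[OF cSK(1) lim(1)] isCont_tendsto_compose[OF cSK(2) lim(1)]) auto
      from tendsto_lowerbound[OF tendsto_add[OF tendsto_const[of e] this] key sequentially_bot]
      show "\<eta> \<le> sg\<^sup>2 / 2 * ((xc \<theta> - xc z)\<^sup>2 / \<alpha>) + (rt + mu) * ((xc \<theta> - xc z)\<^sup>2 / (2 * \<alpha>)) + Sf \<theta> - Sf z - Kf \<theta> * u \<theta> + Kf z * v z + e"
        unfolding pe(1-3) by (simp add: \<xi>_def)
    qed
  qed
qed

text \<open>At a positive maximum of \<open>u - v\<close> the two doubled points merge as
  \<open>\<alpha>\<close> tends to zero, inside \<open>Om\<close> because of the boundary
  inequality. All error terms vanish and only the margin \<open>\<eta>\<close> remains on the left,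
  against a zero order term of the wrong sign.\<close>

lemma coercive_comparison:
  assumes CV: "\<And>\<alpha>. \<alpha> > 0 \<Longrightarrow> coercive_lsc D v \<alpha>" and CU: "\<And>\<alpha>. \<alpha> > 0 \<Longrightarrow> coercive_lsc D (\<lambda>z. - u z) \<alpha>" and OmD: "Om \<subseteq> D"
    and sub: "vsub u" and super: "vsuper \<eta> v" and \<eta>: "\<eta> > 0"
    and bd: "\<And>\<theta>. \<theta> \<in> D \<Longrightarrow> \<theta> \<notin> Om \<Longrightarrow> u \<theta> \<le> v \<theta>" and \<theta>D: "\<theta>0 \<in> D"
  shows "u \<theta>0 \<le> v \<theta>0"
proof (rule ccontr)
  assume neg: "\<not> u \<theta>0 \<le> v \<theta>0"
  define m where "m = u \<theta>0 - v \<theta>0"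
  have m: "m > 0" using neg by (simp add: m_def)
  interpret V: coercive_lsc D v 1 by (rule CV) simp
  interpret U: coercive_lsc D "\<lambda>z. - u z" 1 by (rule CU) simp
  have usc: "usc_on D u" using U.lsc by (simp add: lsc_on_iff_usc_on)
  define a where "a = (\<lambda>n. 1 / real (Suc n))"
  have a: "a n > 0" for n by (simp add: a_def)
  have a0: "a \<longlonglongrightarrow> 0" unfolding a_def by (rule LIMSEQ_Suc[OF lim_1_over_n])
  have "\<exists>\<theta> z. \<theta> \<in> D \<and> z \<in> D \<and>
    (\<forall>\<theta>'\<in>D. \<forall>z'\<in>D. u \<theta>' - v z' - (norm (\<theta>' - z'))\<^sup>2 / (4 * a n) \<le> u \<theta> - v z - (norm (\<theta> - z))\<^sup>2 / (4 * a n)) \<and>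
    (\<theta> \<in> Om \<longrightarrow> z \<in> Om \<longrightarrow> \<eta> \<le> sg\<^sup>2 / 2 * ((xc \<theta> - xc z)\<^sup>2 / a n) + (rt + mu) * ((xc \<theta> - xc z)\<^sup>2 / (2 * a n))
       + Sf \<theta> - Sf z - Kf \<theta> * u \<theta> + Kf z * v z)" for n
    by (rule doubling_estimate[OF CV[OF a] CU[OF a] OmD sub super]) (intro exI conjI ballI impI; assumption)
  then have "\<forall>n. \<exists>\<theta> z. \<theta> \<in> D \<and> z \<in> D \<and>
    (\<forall>\<theta>'\<in>D. \<forall>z'\<in>D. u \<theta>' - v z' - (norm (\<theta>' - z'))\<^sup>2 / (4 * a n) \<le> u \<theta> - v z - (norm (\<theta> - z))\<^sup>2 / (4 * a n)) \<and>
    (\<theta> \<in> Om \<longrightarrow> z \<in> Om \<longrightarrow> \<eta> \<le> sg\<^sup>2 / 2 * ((xc \<theta> - xc z)\<^sup>2 / a n) + (rt + mu) * ((xc \<theta> - xc z)\<^sup>2 / (2 * a n))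
       + Sf \<theta> - Sf z - Kf \<theta> * u \<theta> + Kf z * v z)" ..
  from this[THEN choice] obtain T where "\<forall>n. \<exists>z. T n \<in> D \<and> z \<in> D \<and>
    (\<forall>\<theta>'\<in>D. \<forall>z'\<in>D. u \<theta>' - v z' - (norm (\<theta>' - z'))\<^sup>2 / (4 * a n) \<le> u (T n) - v z - (norm (T n - z))\<^sup>2 / (4 * a n)) \<and>
    (T n \<in> Om \<longrightarrow> z \<in> Om \<longrightarrow> \<eta> \<le> sg\<^sup>2 / 2 * ((xc (T n) - xc z)\<^sup>2 / a n) + (rt + mu) * ((xc (T n) - xc z)\<^sup>2 / (2 * a n))
       + Sf (T n) - Sf z - Kf (T n) * u (T n) + Kf z * v z)" ..
  from this[THEN choice] obtain Z where TZ0: "\<forall>n. T n \<in> D \<and> Z n \<in> D \<and>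
    (\<forall>\<theta>'\<in>D. \<forall>z'\<in>D. u \<theta>' - v z' - (norm (\<theta>' - z'))\<^sup>2 / (4 * a n) \<le> u (T n) - v (Z n) - (norm (T n - Z n))\<^sup>2 / (4 * a n)) \<and>
    (T n \<in> Om \<longrightarrow> Z n \<in> Om \<longrightarrow> \<eta> \<le> sg\<^sup>2 / 2 * ((xc (T n) - xc (Z n))\<^sup>2 / a n) + (rt + mu) * ((xc (T n) - xc (Z n))\<^sup>2 / (2 * a n))
       + Sf (T n) - Sf (Z n) - Kf (T n) * u (T n) + Kf (Z n) * v (Z n))" ..
  have TZ: "\<And>n. T n \<in> D" "\<And>n. Z n \<in> D"
    "\<And>n \<theta>' z'. \<theta>' \<in> D \<Longrightarrow> z' \<in> D \<Longrightarrow> u \<theta>' - v z' - (norm (\<theta>' - z'))\<^sup>2 / (4 * a n) \<le> u (T n) - v (Z n) - (norm (T n - Z n))\<^sup>2 / (4 * a n)"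
    "\<And>n. T n \<in> Om \<Longrightarrow> Z n \<in> Om \<Longrightarrow> \<eta> \<le> sg\<^sup>2 / 2 * ((xc (T n) - xc (Z n))\<^sup>2 / a n) + (rt + mu) * ((xc (T n) - xc (Z n))\<^sup>2 / (2 * a n))
       + Sf (T n) - Sf (Z n) - Kf (T n) * u (T n) + Kf (Z n) * v (Z n)"
    using TZ0 by blast+
  define d where "d = (\<lambda>n. (norm (T n - Z n))\<^sup>2 / (4 * a n))"
  have d0: "d n \<ge> 0" for n using a[of n] by (simp add: d_def)
  obtain zm where zm: "zm \<in> D" "\<And>z'. z' \<in> D \<Longrightarrow> v zm + 0 \<le> v z' + 0"
    by (rule V.minimum_ex[of "\<lambda>_. 0"]) auto
  obtain tm where tm: "tm \<in> D" "\<And>z'. z' \<in> D \<Longrightarrow> - u tm + 0 \<le> - u z' + 0"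
    by (rule U.minimum_ex[of "\<lambda>_. 0"]) auto
  have dg: "u \<theta> - v \<theta> \<le> u (T n) - v (Z n) - d n" if "\<theta> \<in> D" for n \<theta>
    using TZ(3)[OF that that, of n] by (simp add: d_def)
  have dm: "m \<le> u (T n) - v (Z n) - d n" for n using dg[OF \<theta>D] by (simp add: m_def)
  obtain K1 where K1: "compact K1" "K1 \<subseteq> D" "\<And>\<theta>. \<theta> \<in> D \<Longrightarrow> - u \<theta> \<le> - (m + v zm) \<Longrightarrow> \<theta> \<in> K1"
    using U.coercive by metis
  obtain K2 where K2: "compact K2" "K2 \<subseteq> D" "\<And>\<theta>. \<theta> \<in> D \<Longrightarrow> v \<theta> \<le> u tm - m \<Longrightarrow> \<theta> \<in> K2"
    using V.coercive by metis
  have TK: "T n \<in> K1" for n using K1(3)[OF TZ(1)] dm[of n] d0[of n] zm(2)[OF TZ(2), of n] by simp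
  have ZK: "Z n \<in> K2" for n using K2(3)[OF TZ(2)] dm[of n] d0[of n] tm(2)[OF TZ(1), of n] by simp
  have dB: "d n \<le> u tm - v zm - m" for n using dm[of n] zm(2)[OF TZ(2), of n] tm(2)[OF TZ(1), of n] by simp
  have "seq_compact (K1 \<times> K2)" using compact_Times[OF K1(1) K2(1)] compact_eq_seq_compact_metric by blast
  moreover have "\<forall>n. (T n, Z n) \<in> K1 \<times> K2" using TK ZK by simp
  ultimately obtain l r where l: "l \<in> K1 \<times> K2" "strict_mono r" "((\<lambda>n. (T n, Z n)) \<circ> r) \<longlonglongrightarrow> l"
    by (rule seq_compactE)
  obtain \<theta> z where le: "l = (\<theta>,z)" by (cases l)
  have lim: "(\<lambda>k. T (r k)) \<longlonglongrightarrow> \<theta>" "(\<lambda>k. Z (r k)) \<longlonglongrightarrow> z"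
    using tendsto_fst[OF l(3)] tendsto_snd[OF l(3)] by (simp_all add: o_def le)
  have tD: "\<theta> \<in> D" "z \<in> D" using l(1) K1 K2 le by auto
  have ar: "(\<lambda>k. a (r k)) \<longlonglongrightarrow> 0" using LIMSEQ_subseq_LIMSEQ[OF a0 l(2)] by (simp add: o_def)
  have nd: "(norm (T n - Z n))\<^sup>2 = 4 * a n * d n" for n using a[of n] by (simp add: d_def)
  have z\<theta>: "z = \<theta>"
  proof -
    have "(\<lambda>k. (norm (T (r k) - Z (r k)))\<^sup>2) \<longlonglongrightarrow> 0"
    proof (rule tendsto_sandwich[OF always_eventually always_eventually tendsto_const])
      show "\<forall>k. (norm (T (r k) - Z (r k)))\<^sup>2 \<le> 4 * a (r k) * (u tm - v zm - m)"
        unfolding nd using dB a by (intro allI mult_left_mono) (auto simp: less_imp_le)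
      have "(\<lambda>k. 4 * a (r k) * (u tm - v zm - m)) \<longlonglongrightarrow> 4 * 0 * (u tm - v zm - m)" by (intro tendsto_intros ar)
      then show "(\<lambda>k. 4 * a (r k) * (u tm - v zm - m)) \<longlonglongrightarrow> 0" by simp
    qed simp
    moreover have "(\<lambda>k. (norm (T (r k) - Z (r k)))\<^sup>2) \<longlonglongrightarrow> (norm (\<theta> - z))\<^sup>2" by (intro tendsto_intros lim)
    ultimately have "(norm (\<theta> - z))\<^sup>2 = 0" by (rule LIMSEQ_unique[symmetric])
    then show ?thesis by simp
  qed
  have ev: "\<forall>\<^sub>F k in sequentially. u (T (r k)) < u \<theta> + e \<and> v \<theta> - e < v (Z (r k))" if "e > 0" for e
  proof (intro eventually_conj)
    show "\<forall>\<^sub>F k in sequentially. u (T (r k)) < u \<theta> + e"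
      by (rule usc_on_eventually[OF usc tD(1) lim(1)]) (use TZ that in auto)
    show "\<forall>\<^sub>F k in sequentially. v \<theta> - e < v (Z (r k))"
      by (rule lsc_on_eventually[OF V.lsc tD(1) lim(2)[unfolded z\<theta>]]) (use TZ that in auto)
  qed
  have uv: "m \<le> u \<theta> - v \<theta>"
  proof (rule field_le_epsilon)
    fix e :: real assume e: "e > 0"
    obtain k where "u (T (r k)) < u \<theta> + e / 2 \<and> v \<theta> - e / 2 < v (Z (r k))"
      using eventually_happens[OF ev[of "e / 2"]] e by auto
    then show "m \<le> u \<theta> - v \<theta> + e" using dm[of "r k"] d0[of "r k"] by linarith
  qed
  then have \<theta>Om: "\<theta> \<in> Om" using bd[OF tD(1)] m by force
  \<comment> \<open>Testing maximality with the pair \<open>(\<theta>, \<theta>)\<close> bounds the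
    penalty by the semicontinuity defects of \<open>u\<close> and \<open>v\<close>, which tend to
    zero. Mere boundedness of \<open>d\<close> would leave the diffusion error.\<close>
  have dlim: "(\<lambda>k. d (r k)) \<longlonglongrightarrow> 0"
  proof (rule order_tendstoI)
    fix b :: real assume "b < 0"
    then show "\<forall>\<^sub>F k in sequentially. b < d (r k)" using d0 by (auto intro!: always_eventually intro: less_le_trans)
  next
    fix b :: real assume b: "0 < b"
    show "\<forall>\<^sub>F k in sequentially. d (r k) < b"
      using ev[of "b / 2"] b dg[OF tD(1)] by (auto elim!: eventually_mono) (smt (verit) field_sum_of_halves)
  qed
  have uT: "(\<lambda>k. u (T (r k))) \<longlonglongrightarrow> u \<theta>" and vZ: "(\<lambda>k. v (Z (r k))) \<longlonglongrightarrow> v \<theta>"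
  proof -
    have e1: "\<forall>\<^sub>F k in sequentially. \<bar>u (T (r k)) - u \<theta>\<bar> < e \<and> \<bar>v (Z (r k)) - v \<theta>\<bar> < e" if e: "e > 0" for e
      using ev[of "e / 2"] 
    proof (rule eventually_mono)
      show "0 < e / 2" using e by simp
      fix k assume "u (T (r k)) < u \<theta> + e / 2 \<and> v \<theta> - e / 2 < v (Z (r k))"
      then show "\<bar>u (T (r k)) - u \<theta>\<bar> < e \<and> \<bar>v (Z (r k)) - v \<theta>\<bar> < e"
        using dg[OF tD(1), of "r k"] d0[of "r k"] e unfolding abs_less_iff by (auto simp: field_simps)
    qed
    show "(\<lambda>k. u (T (r k))) \<longlonglongrightarrow> u \<theta>" "(\<lambda>k. v (Z (r k))) \<longlonglongrightarrow> v \<theta>"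
      unfolding tendsto_iff dist_real_def
      by (intro allI impI, erule eventually_mono[OF e1], simp)+
  qed
  have cSK: "isCont Sf \<theta>" "isCont Kf \<theta>"
    using cS cK \<theta>Om continuous_on_eq_continuous_at[OF Om] by blast+
  define E where "E = (\<lambda>k. sg\<^sup>2 / 2 * (4 * d (r k)) + (rt + mu) * (2 * d (r k))
       + Sf (T (r k)) - Sf (Z (r k)) - Kf (T (r k)) * u (T (r k)) + Kf (Z (r k)) * v (Z (r k)))"
  have "\<forall>\<^sub>F k in sequentially. \<eta> \<le> E k"
  proof -
    have "\<forall>\<^sub>F k in sequentially. T (r k) \<in> Om" "\<forall>\<^sub>F k in sequentially. Z (r k) \<in> Om"
      using topological_tendstoD[OF lim(1) Om \<theta>Om] topological_tendstoD[OF lim(2) Om] \<theta>Om z\<theta> by auto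
    then show ?thesis
    proof eventually_elim
      case (elim k)
      let ?x = "(xc (T (r k)) - xc (Z (r k)))\<^sup>2"
      have "?x \<le> (norm (T (r k) - Z (r k)))\<^sup>2"
      proof -
        obtain s x w where w: "T (r k) - Z (r k) = (s,x,w)" by (cases "T (r k) - Z (r k)")
        have "xc (T (r k)) - xc (Z (r k)) = x" by (metis w fst_conv snd_conv fst_diff snd_diff)
        then show ?thesis unfolding w norm_point_sq by simp
      qed
      then have "?x \<le> 4 * a (r k) * d (r k)" by (simp only: nd)
      then have q: "?x / a (r k) \<le> 4 * d (r k)" "?x / (2 * a (r k)) \<le> 2 * d (r k)"
        using a[of "r k"] by (simp_all add: field_simps)
      have "sg\<^sup>2 / 2 * (?x / a (r k)) \<le> sg\<^sup>2 / 2 * (4 * d (r k))" "(rt + mu) * (?x / (2 * a (r k))) \<le> (rt + mu) * (2 * d (r k))"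
        using pos by (intro mult_left_mono q; simp)+
      then show ?case using TZ(4)[OF elim] unfolding E_def by linarith
    qed
  qed
  moreover have "E \<longlonglongrightarrow> sg\<^sup>2 / 2 * (4 * 0) + (rt + mu) * (2 * 0) + Sf \<theta> - Sf \<theta> - Kf \<theta> * u \<theta> + Kf \<theta> * v \<theta>"
    unfolding E_def
    by (intro tendsto_intros dlim uT vZ isCont_tendsto_compose[OF cSK(1)] isCont_tendsto_compose[OF cSK(2)] lim(1) lim(2)[unfolded z\<theta>])
  ultimately have "\<eta> \<le> sg\<^sup>2 / 2 * (4 * 0) + (rt + mu) * (2 * 0) + Sf \<theta> - Sf \<theta> - Kf \<theta> * u \<theta> + Kf \<theta> * v \<theta>"
    by (intro tendsto_lowerbound[OF _ _ sequentially_bot])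
  \<comment> \<open>Positivity of \<open>Kf\<close> enters: where \<open>u\<close> exceeds
    \<open>v\<close> the zero order terms contribute at most zero, contradicting
    \<open>\<eta> > 0\<close>.\<close>
  moreover have "Kf \<theta> * v \<theta> \<le> Kf \<theta> * u \<theta>"
    using K[OF \<theta>Om] pos uv m by (intro mult_left_mono) auto
  ultimately show False using \<eta> by simp
qed

end

section \<open>The comparison principle\<close>

locale hjb_dom = hjb sg pr rt mu M ep c0 Sf Kf "{(s,x,w). 0 < s \<and> s < T1 \<and> - de < x \<and> - de < w \<and> w < s + de}"
  for sg pr rt mu M ep c0 and Sf Kf :: "point \<Rightarrow> real" and T1 de :: real +
  assumes de: "0 < de" "de < 1" and T1: "0 < T1"
begin

abbreviation Om :: "point set" where
  "Om \<equiv> {(s,x,w). 0 < s \<and> s < T1 \<and> - de < x \<and> - de < w \<and> w < s + de}"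

definition D :: "point set" where
  "D = {(s,x,w). 0 < s \<and> s \<le> T1 \<and> - de \<le> x \<and> - de \<le> w \<and> w \<le> s + de}"

lemma OmD: "Om \<subseteq> D" by (auto simp: D_def)

text \<open>Compact subsets of \<open>D\<close> that keep away from the missing face
  \<open>s = 0\<close> and from large capitals.\<close>

definition box :: "real \<Rightarrow> real \<Rightarrow> point set" where
  "box s0 X = {(s,x,w). s0 \<le> s \<and> s \<le> T1 \<and> - de \<le> x \<and> x \<le> X \<and> - de \<le> w \<and> w \<le> s + de}"

lemma compact_box: "compact (box s0 X)"
proof -
  have B: "box s0 X = cbox (s0, -de, -de) (T1, X, T1 + de) \<inter> {z. wc z \<le> sc z + de}"
    by (auto simp: box_def cbox_Pair_eq)
  show ?thesis unfolding B
    by (intro compact_Int_closed compact_cbox closed_Collect_le continuous_intros)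
qed

lemma box_subset: "0 < s0 \<Longrightarrow> box s0 X \<subseteq> D"
  by (auto simp: box_def D_def)

text \<open>Solves \<open>c0 * C1 = pr + rt + mu + 1\<close>: the zero order term absorbs the
  largest drift contribution and still leaves \<open>-1\<close>.\<close>

definition C1 :: real where "C1 = (pr + rt + mu + 1) / c0"

text \<open>The logarithm grows while its product of slope and linear drift stays bounded;
  \<open>x + 2 \<ge> 1\<close> on \<open>D\<close> since \<open>de < 1\<close>, so it is
  nonnegative. The term \<open>1 / s\<close> closes the face \<open>s = 0\<close>, and its time
  derivative has the favourable sign.\<close>

definition G :: "point \<Rightarrow> real" where "G z = ln (xc z + 2) + 1 / sc z + C1"

lemma C1: "C1 > 0" "c0 * C1 = pr + rt + mu + 1"
  using pos by (simp_all add: C1_def)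

lemma G_bounds:
  assumes "z \<in> D" shows "0 \<le> G z" "ln (xc z + 2) \<le> G z" "1 / sc z \<le> G z" "C1 \<le> G z"
proof -
  have "0 < sc z" "1 \<le> xc z + 2" using assms de by (auto simp: D_def)
  then have "0 \<le> ln (xc z + 2)" "0 \<le> 1 / sc z" by simp_all
  then show "0 \<le> G z" "ln (xc z + 2) \<le> G z" "1 / sc z \<le> G z" "C1 \<le> G z" using C1 by (simp_all add: G_def)
qed

abbreviation GU :: "point set" where "GU \<equiv> {z. 0 < sc z \<and> - 2 < xc z}"

lemma Om_GU: "Om \<subseteq> GU" using de by auto

lemma G_pderivs:
  "pderivs GU G (\<lambda>z. - 1 / (sc z)\<^sup>2) (\<lambda>z. 1 / (xc z + 2)) (\<lambda>z. - 1 / (xc z + 2)\<^sup>2) (\<lambda>_. 0) (\<lambda>_. 0)"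
proof (rule pderivsI)
  fix s x w :: real assume u: "(s,x,w) \<in> GU"
  then have s: "s > 0" "x + 2 > 0" by simp_all
  show "((\<lambda>t. G (t,x,w)) has_real_derivative - 1 / (sc (s,x,w))\<^sup>2) (at s)"
    unfolding G_def using s by (auto intro!: derivative_eq_intros simp: power2_eq_square)
  show "((\<lambda>t. G (s,t,w)) has_real_derivative 1 / (xc (s,x,w) + 2)) (at x)"
    unfolding G_def using s by (auto intro!: derivative_eq_intros)
  show "((\<lambda>t. 1 / (xc (s,t,w) + 2)) has_real_derivative - 1 / (xc (s,x,w) + 2)\<^sup>2) (at x)"
    using s by (auto intro!: derivative_eq_intros simp: power2_eq_square)
  show "((\<lambda>t. G (s,x,t)) has_real_derivative 0) (at w)" unfolding G_def by simp
  show "((\<lambda>t. 0) has_real_derivative 0) (at w)" by simp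
qed (auto simp: G_def intro!: continuous_intros)

lemma opr_linear:
  "opr \<gamma> q z (y + k * y') (a + k * a') (b + k * b') (c + k * c') (d + k * d') (e + k * e') =
   opr \<gamma> q z y a b c d e + k * (a' + diff \<gamma> (xc z) * c' + ep * e' + drft \<gamma> q (xc z) * b' + d' - Kf z * y')"
  by (simp add: opr_def algebra_simps)

lemma G_bound:
  assumes z: "z \<in> Om" and g: "\<gamma> \<in> {0..1}" "q \<in> {0..M}"
  shows "- 1 / (sc z)\<^sup>2 + diff \<gamma> (xc z) * (- 1 / (xc z + 2)\<^sup>2) + ep * 0 + drft \<gamma> q (xc z) * (1 / (xc z + 2)) + 0 - Kf z * G z \<le> - 1"
proof -
  have x: "xc z + 2 \<ge> 1" "xc z \<le> xc z + 2" using z de by auto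
  have "0 \<le> diff \<gamma> (xc z)" using diff_ge[of \<gamma> "xc z"] pos by linarith
  then have 1: "diff \<gamma> (xc z) * (- 1 / (xc z + 2)\<^sup>2) \<le> 0" by (simp add: mult_nonneg_nonpos)
  have 2: "drft \<gamma> q (xc z) * (1 / (xc z + 2)) \<le> pr + (rt + mu)"
  proof -
    have "(rt + (mu - rt) * \<gamma>) * xc z \<le> (rt + mu) * (xc z + 2)"
    proof -
      have "(rt + (mu - rt) * \<gamma>) * xc z \<le> (rt + (mu - rt) * \<gamma>) * (xc z + 2)"
        using drft_rate[OF g(1)] by (intro mult_left_mono) auto
      also have "\<dots> \<le> (rt + mu) * (xc z + 2)" using drft_rate[OF g(1)] x by (intro mult_right_mono) auto
      finally show ?thesis .
    qed
    moreover have "pr \<le> pr * (xc z + 2)" using pos x by simp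
    ultimately have "drft \<gamma> q (xc z) \<le> (pr + (rt + mu)) * (xc z + 2)"
      using g(2) unfolding drft_def distrib_right[of pr] by simp
    then show ?thesis using x by (simp add: field_simps)
  qed
  have 3: "pr + rt + mu + 1 \<le> Kf z * G z"
  proof -
    have "c0 * C1 \<le> Kf z * G z"
      using K[OF z] G_bounds(4)[of z] OmD z pos C1(1) by (intro mult_mono) auto
    then show ?thesis by (simp add: C1(2))
  qed
  have "- 1 / (sc z)\<^sup>2 \<le> 0" by simp
  with 1 2 3 show ?thesis by linarith
qed

text \<open>The operator is affine in the jet, and its linear part without source is at most
  \<open>-1\<close> on \<open>G\<close>; the multiple \<open>k\<close> of \<open>G\<close> therefore
  increases the margin by \<open>k\<close>.\<close>

lemma vsuper_penalised:
  assumes v: "vsuper \<eta> v" and k: "k > 0"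
  shows "vsuper (\<eta> + k) (\<lambda>z. v z + k * G z)"
  unfolding vsuper_def
proof (intro allI impI ballI)
  fix \<theta> N f ft fx fxx fw fww and \<gamma> q :: real
  assume h: "\<theta> \<in> N" "open N" "N \<subseteq> Om" "pderivs N f ft fx fxx fw fww" "f \<theta> = v \<theta> + k * G \<theta>"
    "\<forall>z\<in>N. f z \<le> v z + k * G z" and g: "\<gamma> \<in> {0..1}" "q \<in> {0..M}"
  have PG: "pderivs N G (\<lambda>z. - 1 / (sc z)\<^sup>2) (\<lambda>z. 1 / (xc z + 2)) (\<lambda>z. - 1 / (xc z + 2)\<^sup>2) (\<lambda>_. 0) (\<lambda>_. 0)"
    by (rule pderivs_subset[OF G_pderivs]) (use h(3) Om_GU in blast)
  note P = pderivs_add[OF h(4) pderivs_cmult[OF PG, of "- k"]]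
  have t: "\<theta> \<in> Om" using h by blast
  have "f \<theta> + - k * G \<theta> = v \<theta>" "\<forall>z\<in>N. f z + - k * G z \<le> v z" using h(5,6) by (auto simp: algebra_simps)
  from v[unfolded vsuper_def, rule_format, OF h(1-3) P this(1) bspec[OF this(2)] g]
  have "opr \<gamma> q \<theta> (v \<theta>) (ft \<theta> + - k * (- 1 / (sc \<theta>)\<^sup>2)) (fx \<theta> + - k * (1 / (xc \<theta> + 2)))
     (fxx \<theta> + - k * (- 1 / (xc \<theta> + 2)\<^sup>2)) (fw \<theta> + - k * 0) (fww \<theta> + - k * 0) \<le> - \<eta>" .
  moreover have "k * (- 1 / (sc \<theta>)\<^sup>2 + diff \<gamma> (xc \<theta>) * (- 1 / (xc \<theta> + 2)\<^sup>2) + ep * 0 + drft \<gamma> q (xc \<theta>) * (1 / (xc \<theta> + 2)) + 0 - Kf \<theta> * G \<theta>) \<le> k * (- 1)"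
    using k by (intro mult_left_mono G_bound[OF t g]) auto
  moreover have "v \<theta> = (v \<theta> + k * G \<theta>) + - k * G \<theta>" by simp
  ultimately show "opr \<gamma> q \<theta> (v \<theta> + k * G \<theta>) (ft \<theta>) (fx \<theta>) (fxx \<theta>) (fw \<theta>) (fww \<theta>) \<le> - (\<eta> + k)"
    using opr_linear[of \<gamma> q \<theta> "v \<theta> + k * G \<theta>" "- k" "G \<theta>" "ft \<theta>" "- 1 / (sc \<theta>)\<^sup>2" "fx \<theta>" "1 / (xc \<theta> + 2)" "fxx \<theta>" "- 1 / (xc \<theta> + 2)\<^sup>2" "fw \<theta>" 0 "fww \<theta>" 0]
    by simp
qed

lemma vsub_penalised:
  assumes u: "vsub u" and k: "k > 0"
  shows "vsub (\<lambda>z. u z - k * G z)"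
  unfolding vsub_def
proof (intro allI impI)
  fix \<theta> N f ft fx fxx fw fww
  assume h: "\<theta> \<in> N" "open N" "N \<subseteq> Om" "pderivs N f ft fx fxx fw fww" "f \<theta> = u \<theta> - k * G \<theta>"
    "\<forall>z\<in>N. u z - k * G z \<le> f z"
  have PG: "pderivs N G (\<lambda>z. - 1 / (sc z)\<^sup>2) (\<lambda>z. 1 / (xc z + 2)) (\<lambda>z. - 1 / (xc z + 2)\<^sup>2) (\<lambda>_. 0) (\<lambda>_. 0)"
    by (rule pderivs_subset[OF G_pderivs]) (use h(3) Om_GU in blast)
  note P = pderivs_add[OF h(4) pderivs_cmult[OF PG, of k]]
  have t: "\<theta> \<in> Om" using h by blast
  have "f \<theta> + k * G \<theta> = u \<theta>" "\<forall>z\<in>N. u z \<le> f z + k * G z" using h(5,6) by (auto simp: algebra_simps)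
  from u[unfolded vsub_def, rule_format, OF h(1-3) P this(1) bspec[OF this(2)]]
  obtain \<gamma> q where g: "\<gamma> \<in> {0..1}" "q \<in> {0..M}" and
    o: "0 \<le> opr \<gamma> q \<theta> (u \<theta>) (ft \<theta> + k * (- 1 / (sc \<theta>)\<^sup>2)) (fx \<theta> + k * (1 / (xc \<theta> + 2)))
     (fxx \<theta> + k * (- 1 / (xc \<theta> + 2)\<^sup>2)) (fw \<theta> + k * 0) (fww \<theta> + k * 0)" by blast
  have "k * (- 1 / (sc \<theta>)\<^sup>2 + diff \<gamma> (xc \<theta>) * (- 1 / (xc \<theta> + 2)\<^sup>2) + ep * 0 + drft \<gamma> q (xc \<theta>) * (1 / (xc \<theta> + 2)) + 0 - Kf \<theta> * G \<theta>) \<le> k * (- 1)"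
    using k by (intro mult_left_mono G_bound[OF t g]) auto
  moreover have "u \<theta> = (u \<theta> - k * G \<theta>) + k * G \<theta>" by simp
  ultimately have "0 \<le> opr \<gamma> q \<theta> (u \<theta> - k * G \<theta>) (ft \<theta>) (fx \<theta>) (fxx \<theta>) (fw \<theta>) (fww \<theta>)"
    using o k opr_linear[of \<gamma> q \<theta> "u \<theta> - k * G \<theta>" k "G \<theta>" "ft \<theta>" "- 1 / (sc \<theta>)\<^sup>2" "fx \<theta>" "1 / (xc \<theta> + 2)" "fxx \<theta>" "- 1 / (xc \<theta> + 2)\<^sup>2" "fw \<theta>" 0 "fww \<theta>" 0]
    by simp
  with g show "\<exists>\<gamma>\<in>{0..1}. \<exists>q\<in>{0..M}. 0 \<le> opr \<gamma> q \<theta> (u \<theta> - k * G \<theta>) (ft \<theta>) (fx \<theta>) (fxx \<theta>) (fw \<theta>) (fww \<theta>)" by blast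
qed

lemma D_ne: "D \<noteq> {}"
proof -
  have "(T1, 0, 0) \<in> D" using T1 de by (simp add: D_def)
  then show ?thesis by blast
qed

lemma G_continuous: "continuous_on D G"
  by (rule continuous_on_subset[OF pderivs_continuous(1)[OF G_pderivs]]) (use de in \<open>auto simp: D_def\<close>)

text \<open>A bound \<open>Q\<close> on \<open>G\<close> bounds the capital by \<open>exp Q\<close>
  and keeps \<open>s\<close> above \<open>1 / (\<bar>Q\<bar> + 1)\<close>.\<close>

lemma penalised_coercive:
  assumes l: "lsc_on D v" and B: "\<And>z. z \<in> D \<Longrightarrow> B \<le> v z" and k: "k > 0" and \<alpha>: "\<alpha> > 0"
  shows "coercive_lsc D (\<lambda>z. v z + k * G z) \<alpha>"
proof
  show "D \<noteq> {}" by (rule D_ne)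
  show "lsc_on D (\<lambda>z. v z + k * G z)"
  proof -
    have "usc_on D (\<lambda>z. - v z + - (k * G z))"
      using l by (intro usc_on_add continuous_on_imp_usc_on[of D "\<lambda>z. - (k * G z)"])
        (auto simp: lsc_on_iff_usc_on intro!: continuous_intros G_continuous)
    then show ?thesis by (simp add: lsc_on_iff_usc_on)
  qed
  show "\<alpha> > 0" by (rule \<alpha>)
  fix c :: real
  define Q where "Q = (c - B) / k"
  show "\<exists>K. compact K \<and> K \<subseteq> D \<and> (\<forall>z\<in>D. v z + k * G z \<le> c \<longrightarrow> z \<in> K)"
  proof (intro exI conjI ballI impI)
    show "compact (box (1 / (\<bar>Q\<bar> + 1)) (exp Q))" by (rule compact_box)
    show "box (1 / (\<bar>Q\<bar> + 1)) (exp Q) \<subseteq> D" by (rule box_subset) simp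
    fix z assume z: "z \<in> D" and le: "v z + k * G z \<le> c"
    have "k * G z \<le> c - B" using le B[OF z] by linarith
    then have Q: "G z \<le> Q" using k by (simp add: Q_def field_simps)
    have p: "0 < sc z" "1 \<le> xc z + 2" using z de by (auto simp: D_def)
    have "ln (xc z + 2) \<le> Q" using G_bounds(2)[OF z] Q by linarith
    then have "exp (ln (xc z + 2)) \<le> exp Q" by (simp only: exp_le_cancel_iff)
    then have e: "xc z + 2 \<le> exp Q" using p by simp
    have "1 / sc z \<le> \<bar>Q\<bar> + 1" using G_bounds(3)[OF z] Q by linarith
    then have "1 \<le> (\<bar>Q\<bar> + 1) * sc z" using p by (simp only: pos_divide_le_eq)
    then have "1 / (\<bar>Q\<bar> + 1) \<le> sc z" by (subst pos_divide_le_eq) (auto simp: mult.commute)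
    with e show "z \<in> box (1 / (\<bar>Q\<bar> + 1)) (exp Q)" using z by (auto simp: box_def D_def)
  qed
qed

theorem comparison:
  assumes u: "usc_on D u" "vsub u" "\<And>z. z \<in> D \<Longrightarrow> u z \<le> A"
    and v: "lsc_on D v" "vsuper 0 v" "\<And>z. z \<in> D \<Longrightarrow> B \<le> v z"
    and bd: "\<And>z. z \<in> D \<Longrightarrow> z \<notin> Om \<Longrightarrow> u z \<le> v z" and z: "z \<in> D"
  shows "u z \<le> v z"
proof (rule field_le_epsilon)
  fix e :: real assume e: "e > 0"
  \<comment> \<open>The penalty weight is fitted to the given point, where both penalties together
    then cost at most \<open>e\<close>.\<close>
  define k where "k = e / (2 * (G z + 1))"
  have Gz: "G z \<ge> 0" by (rule G_bounds(1)[OF z])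
  have k: "k > 0" "2 * (k * G z) \<le> e" using e Gz by (simp_all add: k_def field_simps)
  have "u z - k * G z \<le> v z + k * G z"
  proof (rule coercive_comparison[OF _ _ OmD vsub_penalised[OF u(2) k(1)] vsuper_penalised[OF v(2) k(1)]])
    show "coercive_lsc D (\<lambda>z. v z + k * G z) \<alpha>" if "\<alpha> > 0" for \<alpha>
      by (rule penalised_coercive[OF v(1,3) k(1) that])
    have "coercive_lsc D (\<lambda>z. - u z + k * G z) \<alpha>" if "\<alpha> > 0" for \<alpha>
      by (rule penalised_coercive[of _ "- A", OF _ _ k(1) that]) (use u in \<open>auto simp: lsc_on_iff_usc_on\<close>)
    then show "coercive_lsc D (\<lambda>z. - (u z - k * G z)) \<alpha>" if "\<alpha> > 0" for \<alpha> using that by simp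
    show "u z - k * G z \<le> v z + k * G z" if "z \<in> D" "z \<notin> Om" for z
    proof -
      have "0 \<le> k * G z" using k G_bounds(1)[OF that(1)] by simp
      with bd[OF that] show ?thesis by linarith
    qed
  qed (use k z in auto)
  then show "u z \<le> v z + e" using k(2) by linarith
qed

section \<open>Monotonicity in the capital variable\<close>

text \<open>The infimum of a supersolution over larger capitals is again a supersolution: where it is locally
  constant a test function has \<open>f\<^sub>x = 0\<close> and \<open>f\<^sub>x\<^sub>x \<le> 0\<close>, so \<open>\<gamma> = 0\<close> is optimal and the operator depends on \<open>x\<close>
  only through the source, which increases in \<open>x\<close>.\<close>

lemma increasing_in_x:
  assumes u: "usc_on D u" "vsub u" "\<And>z. z \<in> D \<Longrightarrow> u z \<le> A"
    and v: "lsc_on D v" "vsuper 0 v" "\<And>z. z \<in> D \<Longrightarrow> B \<le> v z"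
    and Sm: "\<And>s x x' w. (s,x,w) \<in> Om \<Longrightarrow> x \<le> x' \<Longrightarrow> Sf (s,x,w) \<le> Sf (s,x',w)"
    and Km: "\<And>s x x' w. Kf (s,x,w) = Kf (s,x',w)"
    and bd: "\<And>s x x' w. (s,x,w) \<in> D \<Longrightarrow> (s,x,w) \<notin> Om \<Longrightarrow> x \<le> x' \<Longrightarrow> u (s,x,w) \<le> v (s,x',w)"
    and D0: "(s,x,w) \<in> D" and xx: "x \<le> x'"
  shows "u (s,x,w) \<le> v (s,x',w)"
proof (rule field_le_epsilon)
  fix e :: real assume e: "e > 0"
  have D1: "(s,x',w) \<in> D" using D0 xx by (auto simp: D_def)
  define k where "k = e / (G (s,x',w) + 1)"
  have Gz: "G (s,x',w) \<ge> 0" by (rule G_bounds(1)[OF D1])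
  have k: "k > 0" "k * G (s,x',w) \<le> e" using e Gz by (simp_all add: k_def field_simps)
  \<comment> \<open>The penalty makes the infimum over the unbounded range of larger capitals
    attained, and it leaves a margin \<open>k\<close>.\<close>
  define V where "V = (\<lambda>z. v z + k * G z)"
  interpret V: coercive_lsc D V 1
    unfolding V_def by (rule penalised_coercive[OF v(1) v(3) k(1) zero_less_one])
  have superV: "vsuper k V" using vsuper_penalised[OF v(2) k(1)] by (simp add: V_def)
  have VB: "B \<le> V z" if "z \<in> D" for z
    using v(3)[OF that] G_bounds(1)[OF that] k(1) by (simp add: V_def add_increasing2)
  define up where "up = (\<lambda>z::point. {z'\<in>D. sc z' = sc z \<and> wc z' = wc z \<and> xc z \<le> xc z'})"
  define h where "h = (\<lambda>z. INF z'\<in>up z. V z')"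
  have hmin: "\<exists>z'\<in>up z. h z = V z' \<and> (\<forall>z''\<in>up z. h z \<le> V z'')" if "z \<in> D" for z
  proof -
    have zu: "z \<in> up z" using that by (simp add: up_def)
    from V.coercive[of "V z"] obtain K where "compact K \<and> K \<subseteq> D \<and> (\<forall>z'\<in>D. V z' \<le> V z \<longrightarrow> z' \<in> K)" ..
    then have K: "compact K" "K \<subseteq> D" "\<And>z'. z' \<in> D \<Longrightarrow> V z' \<le> V z \<Longrightarrow> z' \<in> K" by blast+
    have usc: "usc_on (up z) (\<lambda>z. - V z)"
      using V.lsc unfolding lsc_on_iff_usc_on by (rule usc_on_subset) (auto simp: up_def)
    have "closed {z'. sc z' = sc z \<and> wc z' = wc z \<and> xc z \<le> xc z'}"
      unfolding Collect_conj_eq by (intro closed_Int closed_Collect_eq closed_Collect_le continuous_intros)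
    then have "compact (K \<inter> {z'. sc z' = sc z \<and> wc z' = wc z \<and> xc z \<le> xc z'})"
      using K(1) by (rule compact_Int_closed[rotated])
    moreover have "K \<inter> {z'. sc z' = sc z \<and> wc z' = wc z \<and> xc z \<le> xc z'} \<subseteq> up z" using K(2) by (auto simp: up_def)
    ultimately obtain m where m: "m \<in> up z" "\<And>z'. z' \<in> up z \<Longrightarrow> - V z' \<le> - V m"
    proof (rule usc_coercive_attains_sup[OF usc zu])
      fix y assume "y \<in> up z" "- V z \<le> - V y"
      then show "y \<in> K \<inter> {z'. sc z' = sc z \<and> wc z' = wc z \<and> xc z \<le> xc z'}" using K(3) by (auto simp: up_def)
    qed (use K(2) in \<open>auto simp: up_def\<close>)
    have "h z = V m" unfolding h_def by (rule cInf_eq_minimum) (use m in auto)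
    with m show ?thesis by auto
  qed
  have hle: "h (s,x,w) \<le> V (s,x',w)" if "(s,x,w) \<in> D" "x \<le> x'" for s x x' w
  proof -
    have "(s,x',w) \<in> up (s,x,w)" using that by (auto simp: up_def D_def)
    then show ?thesis using hmin[OF that(1)] by blast
  qed
  have hmono: "h (s,x,w) \<le> h (s,x',w)" if "(s,x,w) \<in> D" "x \<le> x'" for s x x' w
  proof -
    have "(s,x',w) \<in> D" using that by (auto simp: D_def)
    from hmin[OF this] obtain z' where z': "z' \<in> up (s,x',w)" "h (s,x',w) = V z'" by blast
    obtain y where "z' = (s,y,w)" "x' \<le> y" using z'(1) by (cases z') (auto simp: up_def)
    with z' hle[OF that(1), of y] that(2) show ?thesis by simp
  qed
  have hB: "B \<le> h z" if "z \<in> D" for z using hmin[OF that] VB by (auto simp: up_def)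
  \<comment> \<open>If \<open>h\<close> stayed at or below \<open>y\<close> along points tending to
    \<open>z\<close>, their minimisers would lie in a compact set, and a limit of them would be an
    admissible competitor for \<open>z\<close> with value at most \<open>y\<close>.\<close>
  have lsc: "lsc_on D h"
    unfolding lsc_on_def eventually_at_filter
  proof (intro ballI allI impI, rule ccontr)
    fix z y assume zD: "z \<in> D" and y: "y < h z" and neg: "\<not> (\<forall>\<^sub>F \<eta> in nhds z. \<eta> \<noteq> z \<longrightarrow> \<eta> \<in> D \<longrightarrow> y < h \<eta>)"
    have "\<exists>z'. dist z' z < 1 / real (Suc n) \<and> z' \<in> D \<and> h z' \<le> y" for n
    proof (rule ccontr)
      assume "\<not> ?thesis"
      then have "\<forall>z'. dist z' z < 1 / real (Suc n) \<longrightarrow> z' \<noteq> z \<longrightarrow> z' \<in> D \<longrightarrow> y < h z'" by force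
      moreover have "0 < 1 / real (Suc n)" by simp
      ultimately show False using neg unfolding eventually_nhds_metric by blast
    qed
    then have "\<forall>n. \<exists>z'. dist z' z < 1 / real (Suc n) \<and> z' \<in> D \<and> h z' \<le> y" ..
    from choice[OF this] obtain X where X: "\<forall>n. dist (X n) z < 1 / real (Suc n) \<and> X n \<in> D \<and> h (X n) \<le> y" ..
    then have Xl: "X \<longlonglongrightarrow> z" by (intro LIMSEQ_dist_Suc) blast
    have "\<forall>n. \<exists>z'. z' \<in> up (X n) \<and> V z' \<le> y" using X hmin by metis
    from choice[OF this] obtain Y where Y: "\<forall>n. Y n \<in> up (X n) \<and> V (Y n) \<le> y" ..
    from V.coercive[of y] obtain K where "compact K \<and> K \<subseteq> D \<and> (\<forall>z'\<in>D. V z' \<le> y \<longrightarrow> z' \<in> K)" ..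
    then have K: "compact K" "K \<subseteq> D" "\<And>z'. z' \<in> D \<Longrightarrow> V z' \<le> y \<Longrightarrow> z' \<in> K" by blast+
    have YK: "Y n \<in> K" for n using Y K(3) by (simp add: up_def)
    then have "seq_compact K" "\<forall>n. Y n \<in> K" using K(1) by (simp_all add: compact_eq_seq_compact_metric)
    then obtain l r where l: "l \<in> K" "strict_mono r" "(Y \<circ> r) \<longlonglongrightarrow> l" by (rule seq_compactE)
    have Xr: "(\<lambda>n. X (r n)) \<longlonglongrightarrow> z" using LIMSEQ_subseq_LIMSEQ[OF Xl l(2)] by (simp add: o_def)
    have Yr: "(\<lambda>n. Y (r n)) \<longlonglongrightarrow> l" using l(3) by (simp add: o_def)
    have YX: "sc (Y n) = sc (X n)" "wc (Y n) = wc (X n)" "xc (X n) \<le> xc (Y n)" for n using Y by (auto simp: up_def)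
    have l1: "(\<lambda>n. sc (Y (r n))) \<longlonglongrightarrow> sc l" "(\<lambda>n. wc (Y (r n))) \<longlonglongrightarrow> wc l" "(\<lambda>n. xc (Y (r n))) \<longlonglongrightarrow> xc l"
      by (intro tendsto_intros Yr)+
    have l2: "(\<lambda>n. sc (X (r n))) \<longlonglongrightarrow> sc z" "(\<lambda>n. wc (X (r n))) \<longlonglongrightarrow> wc z" "(\<lambda>n. xc (X (r n))) \<longlonglongrightarrow> xc z"
      by (intro tendsto_intros Xr)+
    have "sc l = sc z" by (rule LIMSEQ_unique[OF l1(1)[unfolded YX(1)] l2(1)])
    moreover have "wc l = wc z" by (rule LIMSEQ_unique[OF l1(2)[unfolded YX(2)] l2(2)])
    moreover have "xc z \<le> xc l" by (rule LIMSEQ_le[OF l2(3) l1(3)]) (simp add: YX(3))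
    ultimately have "sc l = sc z" "wc l = wc z" "xc z \<le> xc l" by simp_all
    then have "l \<in> up z" using l(1) K(2) by (auto simp: up_def)
    then have hl: "h z \<le> V l" using hmin[OF zD] by blast
    have "\<forall>\<^sub>F n in sequentially. y < V (Y (r n))"
      by (rule lsc_on_eventually[OF V.lsc _ Yr]) (use l(1) K(2) subsetD[OF K(2) YK] hl y in auto)
    then show False using Y by (auto simp: eventually_sequentially) (metis order_refl not_less)
  qed
  have super: "vsuper 0 h"
    unfolding vsuper_def
  proof (intro allI impI ballI)
    fix \<theta> N f ft fx fxx fw fww and \<gamma> q :: real
    assume N: "\<theta> \<in> N" "open N" "N \<subseteq> Om" and P: "pderivs N f ft fx fxx fw fww" and eq: "f \<theta> = h \<theta>"
      and le: "\<forall>z\<in>N. f z \<le> h z" and g: "\<gamma> \<in> {0..1}" "q \<in> {0..M}"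
    obtain s0 x0 w0 where te: "\<theta> = (s0,x0,w0)" by (cases \<theta>)
    have \<theta>Om: "\<theta> \<in> Om" and \<theta>D: "\<theta> \<in> D" using N OmD by blast+
    obtain z' where z': "z' \<in> up \<theta>" "h \<theta> = V z'" using hmin[OF \<theta>D] by blast
    obtain y where ze: "z' = (s0,y,w0)" and xy: "x0 \<le> y" using z'(1) by (cases z') (auto simp: up_def te)
    have z'Om: "z' \<in> Om" using \<theta>Om xy by (auto simp: te ze)
    define H where "H = (0, x0 - y, 0 :: real)"
    have zH: "z' + (0, x0 - y, 0) = \<theta>" by (simp add: ze te)
    note P' = pderivs_translate[OF P, of "(0, x0 - y, 0)"]
    have evN: "\<forall>\<^sub>F z in nhds \<theta>. z \<in> N" using N by (intro eventually_nhds_in_open)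
    have op: "open {z. z + (0, x0 - y, 0) \<in> N}"
    proof -
      have "open ((\<lambda>z. z + (0, x0 - y, 0)) -` N)" by (intro open_vimage N continuous_intros)
      then show ?thesis by (simp add: vimage_def)
    qed
    have mem: "z' \<in> {z. z + (0, x0 - y, 0) \<in> N}" using N(1) by (simp only: mem_Collect_eq zH)
    have ev: "\<forall>\<^sub>F z in nhds z'. f (z + (0, x0 - y, 0)) \<le> V z"
      using eventually_nhds_in_open[OF op mem]
    proof eventually_elim
      case (elim z)
      obtain s1 x1 w1 where z: "z = (s1,x1,w1)" by (cases z)
      have 1: "(s1, x1 + (x0 - y), w1) \<in> N" using elim by (simp add: z)
      then have "(s1, x1 + (x0 - y), w1) \<in> D" using N(3) OmD by blast
      from hle[OF this, of x1] xy have "h (s1, x1 + (x0 - y), w1) \<le> V z" by (simp add: z)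
      with bspec[OF le 1] show ?case by (simp add: z)
    qed
    have eqV: "f (z' + (0, x0 - y, 0)) = V z'" unfolding zH using eq z'(2) by simp
    have opV: "opr \<gamma>' q z' (V z') (ft \<theta>) (fx \<theta>) (fxx \<theta>) (fw \<theta>) (fww \<theta>) \<le> 0" if "\<gamma>' \<in> {0..1}" for \<gamma>'
      using vsuperD[OF superV mem op z'Om P' eqV ev that g(2)] k(1) unfolding zH by linarith
    show "opr \<gamma> q \<theta> (h \<theta>) (ft \<theta>) (fx \<theta>) (fxx \<theta>) (fw \<theta>) (fww \<theta>) \<le> - 0"
    \<comment> \<open>If the infimum is attained at \<open>\<theta>\<close>, the inequality for
      \<open>V\<close> applies there. Otherwise all points with capital slightly different from
      \<open>x0\<close> still have \<open>z'\<close> as competitor, so \<open>f\<close> has a local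
      maximum along the \<open>x\<close>-line.\<close>
    proof (cases "y = x0")
      case True
      then have "z' = \<theta>" by (simp add: ze te)
      then show ?thesis using opV[OF g(1)] z'(2) by simp
    next
      case False
      then have xy': "x0 < y" using xy by simp
      have "\<forall>\<^sub>F t in nhds x0. (s0,t,w0) \<in> N" 
        by (rule eventually_nhds_lines(2)[OF evN[unfolded te]])
      moreover have "\<forall>\<^sub>F t in nhds x0. t < y" using xy' 
        using eventually_nhds_in_open[of "{..<y}" x0] by simp
      ultimately have loc: "\<forall>\<^sub>F t in nhds x0. f (s0,t,w0) \<le> f (s0,x0,w0)"
      proof eventually_elim
        case (elim t)
        have "(s0,t,w0) \<in> D" using elim(1) N(3) OmD by blast
        then have "h (s0,t,w0) \<le> V (s0,y,w0)" using elim(2) by (intro hle) auto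
        then show ?case using bspec[OF le elim(1)] z'(2) eq by (simp add: ze te)
      qed
      have dv: "\<forall>\<^sub>F t in nhds x0. ((\<lambda>y. f (s0,y,w0)) has_real_derivative fx (s0,t,w0)) (at t)"
        using \<open>\<forall>\<^sub>F t in nhds x0. (s0,t,w0) \<in> N\<close> by eventually_elim (rule pderivsD(2)[OF P])
      have \<theta>N: "(s0,x0,w0) \<in> N" using N(1) by (simp add: te)
      from local_max_second_derivative[OF dv pderivsD(3)[OF P \<theta>N] loc]
      have fx: "fx \<theta> = 0" and fxx: "fxx \<theta> \<le> 0" by (simp_all add: te)
      have "diff \<gamma> (xc \<theta>) * fxx \<theta> \<le> ep * fxx \<theta>" using diff_ge fxx by (rule mult_right_mono_neg)
      moreover have "diff 0 (xc z') = ep" by (simp add: diff_def)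
      moreover have "Sf \<theta> \<le> Sf z'" using Sm[of s0 x0 w0 y] \<theta>Om xy by (simp add: te ze)
      moreover have "Kf \<theta> = Kf z'" using Km by (simp add: te ze)
      moreover have "opr 0 q z' (V z') (ft \<theta>) (fx \<theta>) (fxx \<theta>) (fw \<theta>) (fww \<theta>) \<le> 0" by (rule opV) simp
      ultimately show ?thesis unfolding opr_def fx z'(2) by simp
    qed
  qed
  have "u (s,x,w) \<le> h (s,x,w)"
  proof (rule comparison[OF u lsc super hB _ D0])
    \<comment> \<open>The boundary hypothesis compares \<open>u\<close> with \<open>v\<close> at
      every larger capital because moving right from the face \<open>x = -de\<close> can lead into
      the interior.\<close>
    fix z assume z: "z \<in> D" "z \<notin> Om"
    obtain s1 x1 w1 where ze: "z = (s1,x1,w1)" by (cases z)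
    obtain z' where z': "z' \<in> up z" "h z = V z'" using hmin[OF z(1)] by blast
    obtain y where y: "z' = (s1,y,w1)" "x1 \<le> y" using z'(1) by (cases z') (auto simp: up_def ze)
    have "z' \<in> D" using z'(1) by (simp add: up_def)
    then have "v z' \<le> V z'" using G_bounds(1) k(1) by (simp add: V_def)
    then show "u z \<le> h z" using bd[of s1 x1 w1 y] z y z'(2) by (simp add: ze)
  qed
  also have "\<dots> \<le> V (s,x',w)" by (rule hle[OF D0 xx])
  also have "\<dots> \<le> v (s,x',w) + e" using k(2) by (simp add: V_def)
  finally show "u (s,x,w) \<le> v (s,x',w) + e" .
qed

end

section \<open>Perron's method\<close>

text \<open>The infimum of all local upper bounds; for functions bounded above on \<open>S\<close>
  this is the limit of the suprema over shrinking neighbourhoods.\<close>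

definition usc_env :: "point set \<Rightarrow> (point \<Rightarrow> real) \<Rightarrow> point \<Rightarrow> real" where
  "usc_env S f z = Inf {y. \<forall>\<^sub>F z' in nhds z. z' \<in> S \<longrightarrow> f z' \<le> y}"

context
  fixes S :: "point set" and f :: "point \<Rightarrow> real" and A :: real
  assumes A: "\<And>z. z \<in> S \<Longrightarrow> f z \<le> A"
begin

lemma usc_env_aux:
  assumes "z \<in> S"
  shows "{y. \<forall>\<^sub>F z' in nhds z. z' \<in> S \<longrightarrow> f z' \<le> y} \<noteq> {}" "bdd_below {y. \<forall>\<^sub>F z' in nhds z. z' \<in> S \<longrightarrow> f z' \<le> y}"
proof -
  have "\<forall>\<^sub>F z' in nhds z. z' \<in> S \<longrightarrow> f z' \<le> A" using A by simp
  then show "{y. \<forall>\<^sub>F z' in nhds z. z' \<in> S \<longrightarrow> f z' \<le> y} \<noteq> {}" by blast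
  show "bdd_below {y. \<forall>\<^sub>F z' in nhds z. z' \<in> S \<longrightarrow> f z' \<le> y}"
    by (rule bdd_belowI[of _ "f z"]) (use assms in \<open>auto dest: eventually_nhds_x_imp_x\<close>)
qed

lemma usc_env_ge: "z \<in> S \<Longrightarrow> f z \<le> usc_env S f z"
  unfolding usc_env_def by (rule cInf_greatest[OF usc_env_aux(1)]) (auto dest: eventually_nhds_x_imp_x)

lemma usc_env_usc: "usc_on S (usc_env S f)"
  unfolding usc_on_iff_nhds
proof (intro ballI allI impI)
  fix z y assume z: "z \<in> S" and y: "usc_env S f z < y"
  from cInf_lessD[OF usc_env_aux(1)[OF z] y[unfolded usc_env_def]]
  obtain y' where "y' \<in> {y. \<forall>\<^sub>F z' in nhds z. z' \<in> S \<longrightarrow> f z' \<le> y}" and y'2: "y' < y" ..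
  then have y'1: "\<forall>\<^sub>F z' in nhds z. z' \<in> S \<longrightarrow> f z' \<le> y'" by simp
  from y'1 have "\<forall>\<^sub>F z' in nhds z. \<forall>\<^sub>F z'' in nhds z'. z'' \<in> S \<longrightarrow> f z'' \<le> y'"
    by (simp only: eventually_eventually)
  then show "\<forall>\<^sub>F z' in nhds z. z' \<in> S \<longrightarrow> usc_env S f z' < y"
  proof eventually_elim
    case (elim z')
    have "usc_env S f z' \<le> y'" if "z' \<in> S"
      unfolding usc_env_def by (rule cInf_lower[OF _ usc_env_aux(2)[OF that]]) (use elim in simp)
    then show ?case using y'2 by force
  qed
qed

lemma usc_env_le:
  assumes g: "usc_on S g" "\<And>z. z \<in> S \<Longrightarrow> f z \<le> g z" and z: "z \<in> S"
  shows "usc_env S f z \<le> g z"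
proof (rule field_le_epsilon)
  fix e :: real assume "e > 0"
  then have "\<forall>\<^sub>F z' in nhds z. z' \<in> S \<longrightarrow> g z' < g z + e"
    using g(1) z unfolding usc_on_iff_nhds by simp
  then have "\<forall>\<^sub>F z' in nhds z. z' \<in> S \<longrightarrow> f z' \<le> g z + e"
    by eventually_elim (use g(2) in force)
  then show "usc_env S f z \<le> g z + e"
    unfolding usc_env_def by (intro cInf_lower[OF _ usc_env_aux(2)[OF z]]) simp
qed

text \<open>A value below the envelope is exceeded by \<open>f\<close> at points arbitrarily close
  to \<open>z\<close>, hence at one that satisfies any prescribed local condition.\<close>

lemma usc_env_frequently:
  assumes z: "z \<in> S" and y: "y < usc_env S f z" and P: "\<forall>\<^sub>F z' in nhds z. P z'"
  obtains z' where "z' \<in> S" "y < f z'" "P z'"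
proof -
  have "\<not> (\<forall>\<^sub>F z' in nhds z. z' \<in> S \<longrightarrow> f z' \<le> y)"
  proof
    assume "\<forall>\<^sub>F z' in nhds z. z' \<in> S \<longrightarrow> f z' \<le> y"
    then have "usc_env S f z \<le> y"
      unfolding usc_env_def by (intro cInf_lower[OF _ usc_env_aux(2)[OF z]]) simp
    then show False using y by simp
  qed
  then have "\<exists>z'. z' \<in> S \<and> y < f z' \<and> P z'"
    using eventually_mono[OF P, of "\<lambda>z'. z' \<in> S \<longrightarrow> f z' \<le> y"] by force
  then show ?thesis using that by blast
qed

end

section \<open>Estimates uniform in the control, suprema of subsolutions, and local lifting\<close>

context hjb
begin

lemma isCont_nhds: "isCont f z \<Longrightarrow> (f \<longlongrightarrow> f z) (nhds z)"
  by (rule isCont_tendsto_compose[OF _ filterlim_ident])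

lemma Sf_Kf_nhds:
  assumes "z \<in> Om" shows "(Sf \<longlongrightarrow> Sf z) (nhds z)" "(Kf \<longlongrightarrow> Kf z) (nhds z)"
  using cS cK assms continuous_on_eq_continuous_at[OF Om] by (blast intro: isCont_nhds)+

lemma pderivs_nhds:
  assumes "pderivs N f ft fx fxx fw fww" "open N" "z \<in> N"
  shows "(f \<longlongrightarrow> f z) (nhds z)" "(ft \<longlongrightarrow> ft z) (nhds z)" "(fx \<longlongrightarrow> fx z) (nhds z)"
    "(fxx \<longlongrightarrow> fxx z) (nhds z)" "(fw \<longlongrightarrow> fw z) (nhds z)" "(fww \<longlongrightarrow> fww z) (nhds z)"
  using pderivs_continuous[OF assms(1)] assms(3) continuous_on_eq_continuous_at[OF assms(2)]
  by (blast intro: isCont_nhds)+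

text \<open>The error function \<open>E\<close> bounds the change for all controls simultaneously,
  because they enter the coefficients only through bounded factors.\<close>

lemma opr_tendsto:
  assumes z: "z0 \<in> Om" and lim: "(y \<longlongrightarrow> y z0) (nhds z0)" "(a \<longlongrightarrow> a z0) (nhds z0)" "(b \<longlongrightarrow> b z0) (nhds z0)"
    "(c \<longlongrightarrow> c z0) (nhds z0)" "(d \<longlongrightarrow> d z0) (nhds z0)" "(e \<longlongrightarrow> e z0) (nhds z0)" and r: "r > 0"
  shows "\<forall>\<^sub>F z in nhds z0. \<forall>\<gamma>\<in>{0..1}. \<forall>q\<in>{0..M}.
    \<bar>opr \<gamma> q z (y z) (a z) (b z) (c z) (d z) (e z) - opr \<gamma> q z0 (y z0) (a z0) (b z0) (c z0) (d z0) (e z0)\<bar> < r"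
proof -
  define E where "E = (\<lambda>z. \<bar>(a z - a z0) + (d z - d z0)\<bar> + (sg\<^sup>2 / 2 * \<bar>(xc z)\<^sup>2 * c z - (xc z0)\<^sup>2 * c z0\<bar> + ep * \<bar>c z - c z0\<bar>)
    + ep * \<bar>e z - e z0\<bar> + ((pr + M) * \<bar>b z - b z0\<bar> + (rt + mu) * \<bar>xc z * b z - xc z0 * b z0\<bar>)
    + \<bar>Sf z - Sf z0\<bar> + \<bar>Kf z * y z - Kf z0 * y z0\<bar>)"
  have "(E \<longlongrightarrow> \<bar>(a z0 - a z0) + (d z0 - d z0)\<bar> + (sg\<^sup>2 / 2 * \<bar>(xc z0)\<^sup>2 * c z0 - (xc z0)\<^sup>2 * c z0\<bar> + ep * \<bar>c z0 - c z0\<bar>)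
    + ep * \<bar>e z0 - e z0\<bar> + ((pr + M) * \<bar>b z0 - b z0\<bar> + (rt + mu) * \<bar>xc z0 * b z0 - xc z0 * b z0\<bar>)
    + \<bar>Sf z0 - Sf z0\<bar> + \<bar>Kf z0 * y z0 - Kf z0 * y z0\<bar>) (nhds z0)"
    unfolding E_def by (intro tendsto_intros lim Sf_Kf_nhds[OF z] filterlim_ident)
  then have "(E \<longlongrightarrow> 0) (nhds z0)" by simp
  then have "\<forall>\<^sub>F z in nhds z0. E z < r" by (rule order_tendstoD(2)[OF _ r])
  then show ?thesis
  proof eventually_elim
    case (elim z)
    have "\<bar>opr \<gamma> q z (y z) (a z) (b z) (c z) (d z) (e z) - opr \<gamma> q z0 (y z0) (a z0) (b z0) (c z0) (d z0) (e z0)\<bar> \<le> E z"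
      if g: "\<gamma> \<in> {0..1}" "q \<in> {0..M}" for \<gamma> q
    proof -
      have g2: "\<gamma>\<^sup>2 \<le> 1" "0 \<le> \<gamma>\<^sup>2" using g(1) by (auto intro: power_le_one)
      have "diff \<gamma> (xc z) * c z - diff \<gamma> (xc z0) * c z0
        = sg\<^sup>2 / 2 * \<gamma>\<^sup>2 * ((xc z)\<^sup>2 * c z - (xc z0)\<^sup>2 * c z0) + ep * (c z - c z0)"
        by (simp add: diff_def algebra_simps)
      also have "\<bar>\<dots>\<bar> \<le> \<bar>sg\<^sup>2 / 2 * \<gamma>\<^sup>2\<bar> * \<bar>(xc z)\<^sup>2 * c z - (xc z0)\<^sup>2 * c z0\<bar> + \<bar>ep\<bar> * \<bar>c z - c z0\<bar>"
        by (rule order_trans[OF abs_triangle_ineq]) (simp only: abs_mult order_refl)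
      also have "\<dots> \<le> sg\<^sup>2 / 2 * \<bar>(xc z)\<^sup>2 * c z - (xc z0)\<^sup>2 * c z0\<bar> + ep * \<bar>c z - c z0\<bar>"
      proof (intro add_mono mult_right_mono)
        have "sg\<^sup>2 / 2 * \<gamma>\<^sup>2 \<le> sg\<^sup>2 / 2 * 1" using g2 by (intro mult_left_mono) auto
        then show "\<bar>sg\<^sup>2 / 2 * \<gamma>\<^sup>2\<bar> \<le> sg\<^sup>2 / 2" by (simp add: abs_mult)
      qed (use pos in auto)
      finally have 1: "\<bar>diff \<gamma> (xc z) * c z - diff \<gamma> (xc z0) * c z0\<bar> \<le> sg\<^sup>2 / 2 * \<bar>(xc z)\<^sup>2 * c z - (xc z0)\<^sup>2 * c z0\<bar> + ep * \<bar>c z - c z0\<bar>" .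
      have 2: "\<bar>ep * e z - ep * e z0\<bar> \<le> ep * \<bar>e z - e z0\<bar>"
        using pos by (simp add: right_diff_distrib[symmetric] abs_mult)
      have "opr \<gamma> q z (y z) (a z) (b z) (c z) (d z) (e z) - opr \<gamma> q z0 (y z0) (a z0) (b z0) (c z0) (d z0) (e z0)
        = ((a z - a z0) + (d z - d z0)) + (diff \<gamma> (xc z) * c z - diff \<gamma> (xc z0) * c z0) + (ep * e z - ep * e z0)
          + (drft \<gamma> q (xc z) * b z - drft \<gamma> q (xc z0) * b z0) + (Sf z - Sf z0) - (Kf z * y z - Kf z0 * y z0)"
        by (simp add: opr_def)
      also have "\<bar>\<dots>\<bar> \<le> E z" unfolding E_def
        by (intro abs_sum6_le 1 2 drft_diff_le g order_refl)
      finally show ?thesis .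
    qed
    then show ?case using elim by force
  qed
qed

text \<open>The operator is continuous in the control and the control set is compact, so strict
  negativity comes with a margin.\<close>

lemma opr_negative_uniform:
  assumes neg: "\<And>\<gamma> q. \<gamma> \<in> {0..1} \<Longrightarrow> q \<in> {0..M} \<Longrightarrow> opr \<gamma> q z y a b c d e < 0"
  obtains m where "m > 0" "\<And>\<gamma> q. \<gamma> \<in> {0..1} \<Longrightarrow> q \<in> {0..M} \<Longrightarrow> opr \<gamma> q z y a b c d e \<le> - m"
proof -
  have "continuous_on ({0..1} \<times> {0..M}) (\<lambda>p. opr (fst p) (snd p) z y a b c d e)"
    unfolding opr_def diff_def drft_def by (intro continuous_intros)
  moreover have "compact ({0..1::real} \<times> {0..M})" "{0..1::real} \<times> {0..M} \<noteq> {}"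
    using pos by (auto intro: compact_Times)
  ultimately obtain p where p: "p \<in> {0..1} \<times> {0..M}"
    "\<And>p'. p' \<in> {0..1} \<times> {0..M} \<Longrightarrow> opr (fst p') (snd p') z y a b c d e \<le> opr (fst p) (snd p) z y a b c d e"
    using continuous_attains_sup[of "{0..1::real} \<times> {0..M}" "\<lambda>p. opr (fst p) (snd p) z y a b c d e"] by blast
  show ?thesis
  proof (rule that)
    show "- opr (fst p) (snd p) z y a b c d e > 0" using neg[of "fst p" "snd p"] p(1) by auto
    show "opr \<gamma> q z y a b c d e \<le> - (- opr (fst p) (snd p) z y a b c d e)" if "\<gamma> \<in> {0..1}" "q \<in> {0..M}" for \<gamma> q
      using p(2)[of "(\<gamma>,q)"] that by simp
  qed
qed

lemma diff_le: "\<gamma> \<in> {0..1} \<Longrightarrow> diff \<gamma> x \<le> sg\<^sup>2 / 2 * x\<^sup>2 + ep"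
  using mult_right_mono[OF mult_left_mono[OF power_le_one[of \<gamma> 2], of "sg\<^sup>2 / 2"], of "x\<^sup>2"] by (auto simp: diff_def)

text \<open>Adding a small multiple of \<open>|z - \<theta>|\<^sup>2\<close> makes a touching strict without destroying a strict inequality.\<close>

lemma small_quadratic:
  fixes z :: point and m :: real
  assumes m: "m > 0" and \<gamma>: "\<gamma> \<in> {0..1}"
  defines "k \<equiv> m / (4 * ((sg\<^sup>2 / 2 * (xc z)\<^sup>2 + ep) + ep))"
  shows "k > 0" "opr \<gamma> q z y a b (c + 2 * k) d (e + 2 * k) \<le> opr \<gamma> q z y a b c d e + m / 2"
    "opr \<gamma> q z y a b c d e - m / 2 \<le> opr \<gamma> q z y a b (c - 2 * k) d (e - 2 * k)"
proof -
  have p: "(sg\<^sup>2 / 2 * (xc z)\<^sup>2 + ep) + ep > 0"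
  proof -
    have "0 \<le> sg\<^sup>2 / 2 * (xc z)\<^sup>2" by simp
    then show ?thesis using pos by linarith
  qed
  then show k: "k > 0" using m by (simp add: k_def)
  have "2 * k * (diff \<gamma> (xc z) + ep) \<le> 2 * k * ((sg\<^sup>2 / 2 * (xc z)\<^sup>2 + ep) + ep)"
    using k diff_le[OF \<gamma>, of "xc z"] by (intro mult_left_mono) auto
  also have "\<dots> = m / 2" using p unfolding k_def by (simp add: field_simps)
  finally show "opr \<gamma> q z y a b (c + 2 * k) d (e + 2 * k) \<le> opr \<gamma> q z y a b c d e + m / 2"
    "opr \<gamma> q z y a b c d e - m / 2 \<le> opr \<gamma> q z y a b (c - 2 * k) d (e - 2 * k)"
    by (simp_all add: opr_def algebra_simps)
qed

lemma opr_shift: "opr \<gamma> q z (y + t) a b c d e = opr \<gamma> q z y a b c d e - Kf z * t"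
  by (simp add: opr_def algebra_simps)

text \<open>If a test function \<open>f\<close> violated the inequality at \<open>\<theta>\<close>,
  then \<open>g\<close>, which is \<open>f\<close> plus a small quadratic, would violate it near
  \<open>\<theta>\<close> with a margin and touch strictly. Some member \<open>v\<close> of the
  family almost reaches the envelope near \<open>\<theta>\<close>, so \<open>v - g\<close> has an
  interior maximum with a small value; testing \<open>v\<close> there gives a contradiction.\<close>

lemma sup_env_vsub:
  assumes OmD: "Om \<subseteq> D" and ne: "F \<noteq> {}" and F: "\<And>v. v \<in> F \<Longrightarrow> usc_on D v \<and> vsub v"
    and A: "\<And>v z. v \<in> F \<Longrightarrow> z \<in> D \<Longrightarrow> v z \<le> A"
  shows "vsub (usc_env D (\<lambda>z. SUP v\<in>F. v z))"
  unfolding vsub_def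
proof (intro allI impI, rule ccontr)
  fix \<theta> N f ft fx fxx fw fww
  define U0 where "U0 = (\<lambda>z. SUP v\<in>F. v z)"
  define U where "U = usc_env D U0"
  assume N: "\<theta> \<in> N" "open N" "N \<subseteq> Om" and P: "pderivs N f ft fx fxx fw fww"
    and "f \<theta> = usc_env D (\<lambda>z. SUP v\<in>F. v z) \<theta>" "\<forall>z\<in>N. usc_env D (\<lambda>z. SUP v\<in>F. v z) z \<le> f z"
    and "\<not> (\<exists>\<gamma>\<in>{0..1}. \<exists>q\<in>{0..M}. 0 \<le> opr \<gamma> q \<theta> (usc_env D (\<lambda>z. SUP v\<in>F. v z) \<theta>) (ft \<theta>) (fx \<theta>) (fxx \<theta>) (fw \<theta>) (fww \<theta>))"
  then have fU: "f \<theta> = U \<theta>" "\<And>z. z \<in> N \<Longrightarrow> U z \<le> f z"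
    and neg: "\<And>\<gamma> q. \<gamma> \<in> {0..1} \<Longrightarrow> q \<in> {0..M} \<Longrightarrow> opr \<gamma> q \<theta> (f \<theta>) (ft \<theta>) (fx \<theta>) (fxx \<theta>) (fw \<theta>) (fww \<theta>) < 0"
    by (auto simp: U_def U0_def not_le)
  have \<theta>: "\<theta> \<in> Om" "\<theta> \<in> D" using N OmD by blast+
  have U0A: "U0 z \<le> A" if "z \<in> D" for z unfolding U0_def by (rule cSUP_least[OF ne]) (rule A[OF _ that])
  have bdd: "bdd_above ((\<lambda>v. v z) ` F)" if "z \<in> D" for z by (rule bdd_aboveI2) (rule A[OF _ that])
  have vU: "v z \<le> U z" if "v \<in> F" "z \<in> D" for v z
  proof -
    have "v z \<le> U0 z" unfolding U0_def by (rule cSUP_upper[OF that(1) bdd[OF that(2)]])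
    also have "\<dots> \<le> U z" unfolding U_def using U0A that(2) by (rule usc_env_ge)
    finally show ?thesis .
  qed
  obtain m where m: "m > 0" "\<And>\<gamma> q. \<gamma> \<in> {0..1} \<Longrightarrow> q \<in> {0..M} \<Longrightarrow> opr \<gamma> q \<theta> (f \<theta>) (ft \<theta>) (fx \<theta>) (fxx \<theta>) (fw \<theta>) (fww \<theta>) \<le> - m"
    using opr_negative_uniform[OF neg] by metis
  define k where "k = m / (4 * ((sg\<^sup>2 / 2 * (xc \<theta>)\<^sup>2 + ep) + ep))"
  have k: "k > 0" unfolding k_def by (rule small_quadratic(1)[OF m(1), of 0]) simp
  obtain s0 x0 w0 where te: "\<theta> = (s0,x0,w0)" by (cases \<theta>)
  define g where "g = (\<lambda>z. f z + k * (norm (z - \<theta>))\<^sup>2)"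
  note P' = pderivs_add[OF P pderivs_subset[OF pderivs_quadratic[of k s0 x0 w0] subset_UNIV], folded te, folded g_def]
  have g\<theta>: "g \<theta> = f \<theta>" by (simp add: g_def)
  have neg': "opr \<gamma> q \<theta> (g \<theta>) (ft \<theta> + 2 * k * (sc \<theta> - s0)) (fx \<theta> + 2 * k * (xc \<theta> - x0)) (fxx \<theta> + 2 * k) (fw \<theta> + 2 * k * (wc \<theta> - w0)) (fww \<theta> + 2 * k) \<le> - (m / 2)"
    if "\<gamma> \<in> {0..1}" "q \<in> {0..M}" for \<gamma> q
    using small_quadratic(2)[OF m(1) that(1), of q \<theta> "f \<theta>" "ft \<theta>" "fx \<theta>" "fxx \<theta>" "fw \<theta>" "fww \<theta>", folded k_def] m(2)[OF that]
    unfolding g\<theta> by (simp add: te)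
  have "\<forall>\<^sub>F z in nhds \<theta>. Kf z < Kf \<theta> + 1" by (rule order_tendstoD(2)[OF Sf_Kf_nhds(2)[OF \<theta>(1)]]) simp
  moreover have "\<forall>\<^sub>F z in nhds \<theta>. z \<in> N" using N by (intro eventually_nhds_in_open)
  moreover have "\<forall>\<^sub>F z in nhds \<theta>. \<forall>\<gamma>\<in>{0..1}. \<forall>q\<in>{0..M}. \<bar>opr \<gamma> q z (g z) (ft z + 2 * k * (sc z - s0)) (fx z + 2 * k * (xc z - x0)) (fxx z + 2 * k) (fw z + 2 * k * (wc z - w0)) (fww z + 2 * k)
      - opr \<gamma> q \<theta> (g \<theta>) (ft \<theta> + 2 * k * (sc \<theta> - s0)) (fx \<theta> + 2 * k * (xc \<theta> - x0)) (fxx \<theta> + 2 * k) (fw \<theta> + 2 * k * (wc \<theta> - w0)) (fww \<theta> + 2 * k)\<bar> < m / 4"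
    by (rule opr_tendsto[OF \<theta>(1) pderivs_nhds[OF P' N(2,1)]]) (use m in simp)
  ultimately have "\<forall>\<^sub>F z in nhds \<theta>. Kf z < Kf \<theta> + 1 \<and> z \<in> N \<and> (\<forall>\<gamma>\<in>{0..1}. \<forall>q\<in>{0..M}.
     opr \<gamma> q z (g z) (ft z + 2 * k * (sc z - s0)) (fx z + 2 * k * (xc z - x0)) (fxx z + 2 * k) (fw z + 2 * k * (wc z - w0)) (fww z + 2 * k) < - (m / 4))"
  proof eventually_elim
    case (elim z)
    have "opr \<gamma> q z (g z) (ft z + 2 * k * (sc z - s0)) (fx z + 2 * k * (xc z - x0)) (fxx z + 2 * k) (fw z + 2 * k * (wc z - w0)) (fww z + 2 * k) < - (m / 4)"
      if g: "\<gamma> \<in> {0..1}" "q \<in> {0..M}" for \<gamma> q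
    proof -
      from bspec[OF bspec[OF elim(3) g(1)] g(2)] have
        "opr \<gamma> q z (g z) (ft z + 2 * k * (sc z - s0)) (fx z + 2 * k * (xc z - x0)) (fxx z + 2 * k) (fw z + 2 * k * (wc z - w0)) (fww z + 2 * k)
        < opr \<gamma> q \<theta> (g \<theta>) (ft \<theta> + 2 * k * (sc \<theta> - s0)) (fx \<theta> + 2 * k * (xc \<theta> - x0)) (fxx \<theta> + 2 * k) (fw \<theta> + 2 * k * (wc \<theta> - w0)) (fww \<theta> + 2 * k) + m / 4"
        unfolding abs_less_iff by linarith
      with neg'[OF g] show ?thesis by linarith
    qed
    with elim show ?case by blast
  qed
  then obtain R where R: "R > 0" "\<And>z. dist z \<theta> < R \<Longrightarrow> Kf z < Kf \<theta> + 1 \<and> z \<in> N \<and> (\<forall>\<gamma>\<in>{0..1}. \<forall>q\<in>{0..M}.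
     opr \<gamma> q z (g z) (ft z + 2 * k * (sc z - s0)) (fx z + 2 * k * (xc z - x0)) (fxx z + 2 * k) (fw z + 2 * k * (wc z - w0)) (fww z + 2 * k) < - (m / 4))"
    unfolding eventually_nhds_metric by blast
  define r where "r = R / 2"
  have r: "r > 0" "r < R" using R(1) by (simp_all add: r_def)
  have K\<theta>: "Kf \<theta> > 0" using K[OF \<theta>(1)] pos by linarith
  \<comment> \<open>The first bound limits the cost of shifting \<open>g\<close> in the zero order
    term to \<open>m / 8\<close>; the second keeps the maximum off the boundary sphere, where
    \<open>v - g\<close> is at most \<open>- k * r^2\<close>.\<close>
  define \<tau> where "\<tau> = min (m / (8 * (Kf \<theta> + 1))) (k * r\<^sup>2 / 2)"
  have "0 < m / (8 * (Kf \<theta> + 1))" "0 < k * r\<^sup>2 / 2" using m(1) K\<theta> k r by simp_all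
  then have \<tau>: "\<tau> > 0" "\<tau> \<le> m / (8 * (Kf \<theta> + 1))" "\<tau> < k * r\<^sup>2" unfolding \<tau>_def by linarith+
  have K\<tau>: "(Kf \<theta> + 1) * \<tau> \<le> m / 8"
  proof -
    have "(Kf \<theta> + 1) * \<tau> \<le> (Kf \<theta> + 1) * (m / (8 * (Kf \<theta> + 1)))" using \<tau>(2) K\<theta> by (intro mult_left_mono) auto
    moreover have "a * (m / (8 * a)) = m / 8" if "a \<noteq> 0" for a :: real using that by simp
    ultimately show ?thesis using K\<theta> by (metis add_pos_pos less_numeral_extra(1) less_irrefl)
  qed
  have ev: "\<forall>\<^sub>F z in nhds \<theta>. dist z \<theta> < r \<and> g z < g \<theta> + \<tau> / 2"
  proof (rule eventually_conj)
    show "\<forall>\<^sub>F z in nhds \<theta>. dist z \<theta> < r" unfolding eventually_nhds_metric using r(1) by blast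
    show "\<forall>\<^sub>F z in nhds \<theta>. g z < g \<theta> + \<tau> / 2"
      by (rule order_tendstoD(2)[OF pderivs_nhds(1)[OF P' N(2,1)]]) (use \<tau> in simp)
  qed
  have "U \<theta> - \<tau> / 2 < usc_env D U0 \<theta>" using \<tau> by (simp add: U_def)
  from usc_env_frequently[OF U0A \<theta>(2) this ev]
  obtain \<zeta> where \<zeta>: "\<zeta> \<in> D" "U \<theta> - \<tau> / 2 < U0 \<zeta>" "dist \<zeta> \<theta> < r" "g \<zeta> < g \<theta> + \<tau> / 2" by metis
  have "\<exists>v\<in>F. U \<theta> - \<tau> / 2 < v \<zeta>"
    using \<zeta>(2) less_cSUP_iff[OF ne bdd[OF \<zeta>(1)]] unfolding U0_def by blast
  then obtain v where v: "v \<in> F" "U \<theta> - \<tau> / 2 < v \<zeta>" by blast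
  have cb: "z \<in> N" "z \<in> D" if "z \<in> cball \<theta> r" for z
  proof -
    have "dist z \<theta> < R" using that r by (simp add: dist_commute)
    then show "z \<in> N" using R(2) by blast
    then show "z \<in> D" using N(3) OmD by blast
  qed
  have "usc_on (cball \<theta> r) (\<lambda>z. v z + - g z)"
  proof (rule usc_on_add)
    show "usc_on (cball \<theta> r) v" 
      by (rule usc_on_subset[OF conjunct1[OF F[OF v(1)]]]) (use cb(2) in blast)
    have "continuous_on (cball \<theta> r) g"
      by (rule continuous_on_subset[OF pderivs_continuous(1)[OF P']]) (use cb(1) in blast)
    then show "usc_on (cball \<theta> r) (\<lambda>z. - g z)" by (rule continuous_on_imp_usc_on[OF continuous_on_minus])
  qed
  note usc = this
  have "cball \<theta> r \<noteq> {}" using r by simp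
  then obtain z where z: "z \<in> cball \<theta> r" "\<And>y. y \<in> cball \<theta> r \<Longrightarrow> v y + - g y \<le> v z + - g z"
    by (rule usc_attains_sup[OF compact_cball _ usc]) (rule that)
  have "\<zeta> \<in> cball \<theta> r" using \<zeta>(3) by (simp add: dist_commute)
  from z(2)[OF this] have gt: "v z - g z > - \<tau>" using v(2) \<zeta>(4) fU(1) g\<theta> by linarith
  have zN: "z \<in> N" "z \<in> D" using cb z(1) by blast+
  have le: "v z - g z \<le> - (k * (norm (z - \<theta>))\<^sup>2)"
    using vU[OF v(1) zN(2)] fU(2)[OF zN(1)] by (simp add: g_def)
  have zr: "dist z \<theta> < r"
  proof (rule ccontr)
    assume "\<not> dist z \<theta> < r"
    then have "norm (z - \<theta>) = r" using z(1) by (simp add: dist_norm norm_minus_commute)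
    then show False using le gt \<tau>(3) by simp
  qed
  have zOm: "z \<in> Om" using zN N by blast
  define t where "t = v z - g z"
  have Q: "pderivs N (\<lambda>z'. g z' + t) (\<lambda>z. ft z + 2 * k * (sc z - s0) + 0) (\<lambda>z. fx z + 2 * k * (xc z - x0) + 0) (\<lambda>z. fxx z + 2 * k + 0) (\<lambda>z. fw z + 2 * k * (wc z - w0) + 0) (\<lambda>z. fww z + 2 * k + 0)"
    by (rule pderivs_add[OF P' pderivs_const])
  have "\<forall>\<^sub>F z' in nhds z. z' \<in> ball \<theta> r" using zr by (intro eventually_nhds_in_open) (auto simp: dist_commute)
  then have evz: "\<forall>\<^sub>F z' in nhds z. v z' \<le> g z' + t"
  proof eventually_elim
    case (elim z')
    then show ?case using z(2)[of z'] by (simp add: t_def)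
  qed
  have eqz: "g z + t = v z" by (simp add: t_def)
  have sub: "vsub v" using F[OF v(1)] by blast
  obtain \<gamma> q where gq: "\<gamma> \<in> {0..1}" "q \<in> {0..M}" and
    o: "0 \<le> opr \<gamma> q z (v z) (ft z + 2 * k * (sc z - s0) + 0) (fx z + 2 * k * (xc z - x0) + 0) (fxx z + 2 * k + 0) (fw z + 2 * k * (wc z - w0) + 0) (fww z + 2 * k + 0)"
    using vsubD[OF sub zN(1) N(2) zOm Q eqz evz] by blast
  have Rz: "Kf z < Kf \<theta> + 1" "opr \<gamma> q z (g z) (ft z + 2 * k * (sc z - s0)) (fx z + 2 * k * (xc z - x0)) (fxx z + 2 * k) (fw z + 2 * k * (wc z - w0)) (fww z + 2 * k) < - (m / 4)"
    using R(2)[of z] zr r(2) gq by auto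
  have "- (Kf z * t) \<le> (Kf \<theta> + 1) * \<tau>"
  proof -
    have "Kf z * (- t) \<le> (Kf \<theta> + 1) * \<tau>"
    proof (rule mult_mono)
      show "- t \<le> \<tau>" using gt by (simp add: t_def)
      have "0 \<le> k * (norm (z - \<theta>))\<^sup>2" using k by simp
      then show "0 \<le> - t" using le unfolding t_def by linarith
    qed (use Rz K\<theta> in auto)
    then show ?thesis by simp
  qed
  then show False using o Rz(2) K\<tau> m(1) unfolding eqz[symmetric] opr_shift by simp
qed

text \<open>Where \<open>L\<close> fails to be a supersolution, \<open>f\<close> lowered by a
  quadratic and raised by \<open>\<tau>\<close> is a strict classical subsolution near
  \<open>\<theta>\<close>. Away from the centre it lies below \<open>L\<close>, hence below
  \<open>U\<close>, so taking the maximum with \<open>U\<close> glues; at \<open>\<theta>\<close> it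
  exceeds \<open>L\<close>, which is what Perron's argument has to exclude.\<close>

lemma bump:
  assumes OmD: "Om \<subseteq> D" and U: "usc_on D U" "vsub U" and LU: "\<And>z. z \<in> D \<Longrightarrow> L z \<le> U z"
    and \<psi>: "continuous_on D \<psi>" "\<And>z. z \<in> D \<Longrightarrow> U z \<le> \<psi> z" "L \<theta> < \<psi> \<theta>"
    and N: "\<theta> \<in> N" "open N" "N \<subseteq> Om" and P: "pderivs N f ft fx fxx fw fww" and fL: "f \<theta> = L \<theta>" "\<And>z. z \<in> N \<Longrightarrow> f z \<le> L z"
    and g: "\<gamma> \<in> {0..1}" "q \<in> {0..M}" and op: "0 < opr \<gamma> q \<theta> (L \<theta>) (ft \<theta>) (fx \<theta>) (fxx \<theta>) (fw \<theta>) (fww \<theta>)"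
  obtains W c where "usc_on D W" "vsub W" "\<And>z. z \<in> D \<Longrightarrow> U z \<le> W z" "\<And>z. z \<in> D \<Longrightarrow> W z \<le> \<psi> z"
    "L \<theta> < c" "\<forall>\<^sub>F z in nhds \<theta>. c \<le> W z"
proof -
  have \<theta>: "\<theta> \<in> Om" "\<theta> \<in> D" using N OmD by blast+
  define m where "m = opr \<gamma> q \<theta> (L \<theta>) (ft \<theta>) (fx \<theta>) (fxx \<theta>) (fw \<theta>) (fww \<theta>)"
  have m: "m > 0" using op by (simp add: m_def)
  define k where "k = m / (4 * ((sg\<^sup>2 / 2 * (xc \<theta>)\<^sup>2 + ep) + ep))"
  have k: "k > 0" unfolding k_def by (rule small_quadratic(1)[OF m g(1)])
  obtain s0 x0 w0 where te: "\<theta> = (s0,x0,w0)" by (cases \<theta>)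
  define h where "h = (\<lambda>z. f z + - k * (norm (z - \<theta>))\<^sup>2)"
  note P' = pderivs_add[OF P pderivs_subset[OF pderivs_quadratic[of "- k" s0 x0 w0] subset_UNIV], folded te, folded h_def]
  have h\<theta>: "h \<theta> = f \<theta>" by (simp add: h_def)
  let ?o = "\<lambda>z. opr \<gamma> q z (h z) (ft z + 2 * - k * (sc z - s0)) (fx z + 2 * - k * (xc z - x0)) (fxx z + 2 * - k) (fw z + 2 * - k * (wc z - w0)) (fww z + 2 * - k)"
  have o\<theta>: "m / 2 \<le> ?o \<theta>"
    using small_quadratic(3)[OF m g(1), of q \<theta> "f \<theta>" "ft \<theta>" "fx \<theta>" "fxx \<theta>" "fw \<theta>" "fww \<theta>", folded k_def]
    unfolding h\<theta> m_def by (simp add: te fL(1)[unfolded te])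
  define \<tau>0 where "\<tau>0 = (\<psi> \<theta> - L \<theta>) / 2"
  have \<tau>0: "\<tau>0 > 0" using \<psi>(3) by (simp add: \<tau>0_def)
  have c\<psi>: "(\<psi> \<longlongrightarrow> \<psi> \<theta>) (nhds \<theta>)"
    using continuous_on_subset[OF \<psi>(1) OmD] \<theta>(1) continuous_on_eq_continuous_at[OF Om] by (blast intro: isCont_nhds)
  have K\<theta>: "Kf \<theta> > 0" using K[OF \<theta>(1)] pos by linarith
  have "\<forall>\<^sub>F z in nhds \<theta>. Kf z < Kf \<theta> + 1" by (rule order_tendstoD(2)[OF Sf_Kf_nhds(2)[OF \<theta>(1)]]) simp
  moreover have "\<forall>\<^sub>F z in nhds \<theta>. z \<in> N" using N by (intro eventually_nhds_in_open)
  moreover have "\<forall>\<^sub>F z in nhds \<theta>. 0 < \<psi> z - (h z + \<tau>0)"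
  proof (rule order_tendstoD(1))
    show "((\<lambda>z. \<psi> z - (h z + \<tau>0)) \<longlongrightarrow> \<psi> \<theta> - (h \<theta> + \<tau>0)) (nhds \<theta>)"
      by (intro tendsto_intros c\<psi> pderivs_nhds(1)[OF P' N(2,1)])
    show "0 < \<psi> \<theta> - (h \<theta> + \<tau>0)" using \<tau>0 by (simp add: h\<theta> fL \<tau>0_def field_simps)
  qed
  moreover have "\<forall>\<^sub>F z in nhds \<theta>. m / 4 < ?o z"
  proof -
    have "\<forall>\<^sub>F z in nhds \<theta>. \<forall>\<gamma>\<in>{0..1}. \<forall>q\<in>{0..M}. \<bar>opr \<gamma> q z (h z) (ft z + 2 * - k * (sc z - s0)) (fx z + 2 * - k * (xc z - x0)) (fxx z + 2 * - k) (fw z + 2 * - k * (wc z - w0)) (fww z + 2 * - k)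
      - opr \<gamma> q \<theta> (h \<theta>) (ft \<theta> + 2 * - k * (sc \<theta> - s0)) (fx \<theta> + 2 * - k * (xc \<theta> - x0)) (fxx \<theta> + 2 * - k) (fw \<theta> + 2 * - k * (wc \<theta> - w0)) (fww \<theta> + 2 * - k)\<bar> < m / 4"
      by (rule opr_tendsto[OF \<theta>(1) pderivs_nhds[OF P' N(2,1)]]) (use m in simp)
    then show ?thesis
    proof eventually_elim
      case (elim z)
      from bspec[OF bspec[OF elim g(1)] g(2)] o\<theta> show ?case unfolding abs_less_iff by linarith
    qed
  qed
  ultimately have "\<forall>\<^sub>F z in nhds \<theta>. Kf z < Kf \<theta> + 1 \<and> z \<in> N \<and> h z + \<tau>0 < \<psi> z \<and> m / 4 < ?o z"
    by eventually_elim auto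
  then obtain r where r: "r > 0" "\<And>z. dist z \<theta> < r \<Longrightarrow> Kf z < Kf \<theta> + 1 \<and> z \<in> N \<and> h z + \<tau>0 < \<psi> z \<and> m / 4 < ?o z"
    unfolding eventually_nhds_metric by blast
  \<comment> \<open>The three bounds keep the lifted function below the barrier, limit the zero
    order cost to \<open>m / 8\<close>, and let the lift be swallowed by the quadratic from distance
    \<open>r / 2\<close> on.\<close>
  define \<tau> where "\<tau> = min \<tau>0 (min (m / (8 * (Kf \<theta> + 1))) (k * (r / 2)\<^sup>2))"
  have "0 < m / (8 * (Kf \<theta> + 1))" "0 < k * (r / 2)\<^sup>2" using m K\<theta> k r by simp_all
  then have \<tau>: "\<tau> > 0" "\<tau> \<le> \<tau>0" "\<tau> \<le> m / (8 * (Kf \<theta> + 1))" "\<tau> \<le> k * (r / 2)\<^sup>2"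
    using \<tau>0 unfolding \<tau>_def by linarith+
  have K\<tau>: "(Kf \<theta> + 1) * \<tau> \<le> m / 8"
  proof -
    have "(Kf \<theta> + 1) * \<tau> \<le> (Kf \<theta> + 1) * (m / (8 * (Kf \<theta> + 1)))" using \<tau>(3) K\<theta> by (intro mult_left_mono) auto
    moreover have "a * (m / (8 * a)) = m / 8" if "a \<noteq> 0" for a :: real using that by simp
    ultimately show ?thesis using K\<theta> by (metis add_pos_pos less_numeral_extra(1) less_irrefl)
  qed
  define W where "W = (\<lambda>z. if dist z \<theta> < r then max (U z) (h z + \<tau>) else U z)"
  have far: "W z = U z" if "r / 2 \<le> dist z \<theta>" for z
  proof (cases "dist z \<theta> < r")
    case True
    then have zN: "z \<in> N" "z \<in> D" using r(2) N(3) OmD by blast+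
    have "(r / 2)\<^sup>2 \<le> (norm (z - \<theta>))\<^sup>2" using that r by (intro power_mono) (auto simp: dist_norm)
    then have "k * (r / 2)\<^sup>2 \<le> k * (norm (z - \<theta>))\<^sup>2" using k by (intro mult_left_mono) auto
    then have "h z + \<tau> \<le> U z" using \<tau>(4) fL(2)[OF zN(1)] LU[OF zN(2)] by (simp add: h_def)
    then show ?thesis by (simp add: W_def)
  qed (simp add: W_def)
  have UW: "U z \<le> W z" for z by (simp add: W_def)
  show ?thesis
  proof (rule that[of W "L \<theta> + \<tau> / 2"])
    show "U z \<le> W z" for z by (rule UW)
    show "L \<theta> < L \<theta> + \<tau> / 2" using \<tau> by simp
    show "W z \<le> \<psi> z" if "z \<in> D" for z
    proof (cases "dist z \<theta> < r")
      case True
      with r(2)[OF this] \<tau>(2) \<psi>(2)[OF that] show ?thesis by (simp add: W_def)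
    qed (use \<psi>(2)[OF that] in \<open>simp add: W_def\<close>)
    show "\<forall>\<^sub>F z in nhds \<theta>. L \<theta> + \<tau> / 2 \<le> W z"
    proof -
      have "\<forall>\<^sub>F z in nhds \<theta>. h \<theta> - \<tau> / 2 < h z"
        by (rule order_tendstoD(1)[OF pderivs_nhds(1)[OF P' N(2,1)]]) (use \<tau> in simp)
      moreover have "\<forall>\<^sub>F z in nhds \<theta>. dist z \<theta> < r" unfolding eventually_nhds_metric using r(1) by blast
      ultimately show ?thesis
        by eventually_elim (use h\<theta> fL(1) in \<open>simp add: W_def max_def\<close>)
    qed
    show "usc_on D W"
      unfolding usc_on_iff_nhds
    proof (intro ballI allI impI)
      fix z y assume z: "z \<in> D" and y: "W z < y"
      have evU: "\<forall>\<^sub>F z' in nhds z. z' \<in> D \<longrightarrow> U z' < y"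
        using U(1) z UW[of z] y unfolding usc_on_iff_nhds by force
      show "\<forall>\<^sub>F z' in nhds z. z' \<in> D \<longrightarrow> W z' < y"
      proof (cases "dist z \<theta> < r")
        case True
        then have zN: "z \<in> N" using r(2) by blast
        have "\<forall>\<^sub>F z' in nhds z. h z' < y - \<tau>"
          by (rule order_tendstoD(2)[OF pderivs_nhds(1)[OF P' N(2) zN]]) (use True y in \<open>simp add: W_def\<close>)
        with evU show ?thesis by eventually_elim (auto simp: W_def)
      next
        case False
        have "open {z'. r / 2 < dist z' \<theta>}" by (intro open_Collect_less continuous_intros)
        then have "\<forall>\<^sub>F z' in nhds z. z' \<in> {z'. r / 2 < dist z' \<theta>}"
          using False r(1) by (intro eventually_nhds_in_open) auto
        with evU show ?thesis by eventually_elim (auto simp: far)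
      qed
    qed
    show "vsub W"
      unfolding vsub_def
    proof (intro allI impI)
      fix z N' F Ft Fx Fxx Fw Fww
      assume N': "z \<in> N'" "open N'" "N' \<subseteq> Om" and PF: "pderivs N' F Ft Fx Fxx Fw Fww" and eq: "F z = W z" and le: "\<forall>z'\<in>N'. W z' \<le> F z'"
      have zOm: "z \<in> Om" using N' by blast
      have evN: "\<forall>\<^sub>F z' in nhds z. z' \<in> N'" using N' by (intro eventually_nhds_in_open)
      show "\<exists>\<gamma>\<in>{0..1}. \<exists>q\<in>{0..M}. 0 \<le> opr \<gamma> q z (W z) (Ft z) (Fx z) (Fxx z) (Fw z) (Fww z)"
      proof (cases "W z = U z")
        case True
        have "\<forall>\<^sub>F z' in nhds z. U z' \<le> F z'"
          using evN by eventually_elim (use le UW in \<open>blast intro: order_trans\<close>)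
        then show ?thesis using vsubD[OF U(2) N'(1,2) zOm PF] eq True by simp
      next
        case False
        have zr: "dist z \<theta> < r" "W z = h z + \<tau>" using False by (auto simp: W_def max_def split: if_splits)
        have zN: "z \<in> N" using r(2) zr(1) by blast
        have Q: "pderivs N (\<lambda>z'. h z' + \<tau>) (\<lambda>z. ft z + 2 * - k * (sc z - s0) + 0) (\<lambda>z. fx z + 2 * - k * (xc z - x0) + 0) (\<lambda>z. fxx z + 2 * - k + 0) (\<lambda>z. fw z + 2 * - k * (wc z - w0) + 0) (\<lambda>z. fww z + 2 * - k + 0)"
          by (rule pderivs_add[OF P' pderivs_const])
        have "\<forall>\<^sub>F z' in nhds z. z' \<in> ball \<theta> r" using zr by (intro eventually_nhds_in_open) (auto simp: dist_commute)
        with evN have ev: "\<forall>\<^sub>F z' in nhds z. h z' + \<tau> \<le> F z'"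
        proof eventually_elim
          case (elim z')
          then have "h z' + \<tau> \<le> W z'" by (simp add: W_def dist_commute)
          then show ?case using bspec[OF le elim(1)] by linarith
        qed
        have eqh: "h z + \<tau> = F z" using eq zr by simp
        note T = pderivs_touch[OF Q PF N(2) N'(2) zN N'(1) eqh ev]
        have "Kf z * \<tau> \<le> (Kf \<theta> + 1) * \<tau>" using r(2)[OF zr(1)] \<tau> by (intro mult_right_mono) auto
        then have "0 \<le> opr \<gamma> q z (h z + \<tau>) (ft z + 2 * - k * (sc z - s0)) (fx z + 2 * - k * (xc z - x0)) (fxx z + 2 * - k) (fw z + 2 * - k * (wc z - w0)) (fww z + 2 * - k)"
          unfolding opr_shift using r(2)[OF zr(1)] K\<tau> m by linarith
        \<comment> \<open>Degenerate ellipticity: \<open>F\<close> touches the lifted function from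
          above, so the first derivatives agree and the second derivatives of \<open>F\<close> are
          not smaller.\<close>
        also have "\<dots> \<le> opr \<gamma> q z (W z) (Ft z) (Fx z) (Fxx z) (Fw z) (Fww z)"
        proof -
          have "diff \<gamma> (xc z) * (fxx z + 2 * - k) \<le> diff \<gamma> (xc z) * Fxx z"
            using T(4) diff_ge[of \<gamma> "xc z"] pos by (intro mult_left_mono) auto
          moreover have "ep * (fww z + 2 * - k) \<le> ep * Fww z" using T(5) pos by (intro mult_left_mono) auto
          ultimately show ?thesis unfolding opr_def zr(2) T(1-3)[symmetric] by simp
        qed
        finally show ?thesis using g by blast
      qed
    qed
  qed
qed

end

context hjb_dom
begin

text \<open>The envelope \<open>U\<close> of the supremum is a subsolution and, being squeezed by
  the barriers, belongs to the family. Its lower envelope \<open>L\<close> is a supersolution, as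
  otherwise \<open>U\<close> could be lifted. Comparison yields \<open>U \<le> L\<close>, so the
  envelopes agree, and continuity follows.\<close>

theorem perron:
  assumes l: "continuous_on D \<psi>l" "vsub \<psi>l" "\<And>z. z \<in> D \<Longrightarrow> B \<le> \<psi>l z"
    and u: "continuous_on D \<psi>u" "vsuper 0 \<psi>u" "\<And>z. z \<in> D \<Longrightarrow> \<psi>u z \<le> A"
    and lu: "\<And>z. z \<in> D \<Longrightarrow> \<psi>l z \<le> \<psi>u z" and bd: "\<And>z. z \<in> D \<Longrightarrow> z \<notin> Om \<Longrightarrow> \<psi>u z \<le> \<psi>l z"
  obtains U where "continuous_on D U" "vsub U" "vsuper 0 U" "\<And>z. z \<in> D \<Longrightarrow> \<psi>l z \<le> U z" "\<And>z. z \<in> D \<Longrightarrow> U z \<le> \<psi>u z"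
proof -
  define F where "F = {v. usc_on D v \<and> vsub v \<and> (\<forall>z\<in>D. \<psi>l z \<le> v z \<and> v z \<le> \<psi>u z)}"
  have lF: "\<psi>l \<in> F" using l lu by (auto simp: F_def intro: continuous_on_imp_usc_on)
  define U0 where "U0 = (\<lambda>z. SUP v\<in>F. v z)"
  define U where "U = usc_env D U0"
  have ne: "F \<noteq> {}" using lF by blast
  have FA: "v z \<le> A" if "v \<in> F" "z \<in> D" for v z using that u(3)[OF that(2)] by (force simp: F_def)
  have bdd: "bdd_above ((\<lambda>v. v z) ` F)" if "z \<in> D" for z by (rule bdd_aboveI2) (rule FA[OF _ that])
  have U0u: "U0 z \<le> \<psi>u z" if "z \<in> D" for z unfolding U0_def by (rule cSUP_least[OF ne]) (use that in \<open>auto simp: F_def\<close>)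
  have U0A: "U0 z \<le> A" if "z \<in> D" for z using U0u[OF that] u(3)[OF that] by linarith
  have vU: "v z \<le> U z" if "v \<in> F" "z \<in> D" for v z
  proof -
    have "v z \<le> U0 z" unfolding U0_def by (rule cSUP_upper[OF that(1) bdd[OF that(2)]])
    also have "\<dots> \<le> U z" unfolding U_def using U0A that(2) by (rule usc_env_ge)
    finally show ?thesis .
  qed
  have Uu: "U z \<le> \<psi>u z" if "z \<in> D" for z
    unfolding U_def by (rule usc_env_le[OF U0A continuous_on_imp_usc_on[OF u(1)] U0u that])
  have lU: "\<psi>l z \<le> U z" if "z \<in> D" for z by (rule vU[OF lF that])
  have Uusc: "usc_on D U" unfolding U_def using U0A by (rule usc_env_usc)
  have Usub: "vsub U" unfolding U_def U0_def
  proof (rule sup_env_vsub[OF OmD ne])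
    show "usc_on D v \<and> vsub v" if "v \<in> F" for v using that by (simp add: F_def)
    show "v z \<le> A" if "v \<in> F" "z \<in> D" for v z using that by (rule FA)
  qed
  have BmU: "- U z \<le> - B" if "z \<in> D" for z using lU[OF that] l(3)[OF that] by linarith
  define L where "L = (\<lambda>z. - usc_env D (\<lambda>z. - U z) z)"
  have Llsc: "lsc_on D L" unfolding lsc_on_iff_usc_on L_def using usc_env_usc[where f="\<lambda>z. - U z", OF BmU] by simp
  have LU: "L z \<le> U z" if "z \<in> D" for z using usc_env_ge[where f="\<lambda>z. - U z", OF BmU that] by (simp add: L_def)
  have lL: "\<psi>l z \<le> L z" if "z \<in> D" for z
  proof -
    have "usc_env D (\<lambda>z. - U z) z \<le> - \<psi>l z"
      by (rule usc_env_le[where f="\<lambda>z. - U z", OF BmU _ _ that]) (use l(1) lU in \<open>auto intro!: continuous_on_imp_usc_on continuous_intros\<close>)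
    then show ?thesis by (simp add: L_def)
  qed
  have Lsuper: "vsuper 0 L"
    unfolding vsuper_def
  proof (intro allI impI ballI, rule ccontr)
    fix \<theta> N f ft fx fxx fw fww and \<gamma> q :: real
    assume N: "\<theta> \<in> N" "open N" "N \<subseteq> Om" and P: "pderivs N f ft fx fxx fw fww" and fL: "f \<theta> = L \<theta>" "\<forall>z\<in>N. f z \<le> L z"
      and g: "\<gamma> \<in> {0..1}" "q \<in> {0..M}" and "\<not> opr \<gamma> q \<theta> (L \<theta>) (ft \<theta>) (fx \<theta>) (fxx \<theta>) (fw \<theta>) (fww \<theta>) \<le> - 0"
    then have op: "0 < opr \<gamma> q \<theta> (L \<theta>) (ft \<theta>) (fx \<theta>) (fxx \<theta>) (fw \<theta>) (fww \<theta>)" by simp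
    have \<theta>: "\<theta> \<in> Om" "\<theta> \<in> D" using N OmD by blast+
    \<comment> \<open>If \<open>L\<close> met the upper barrier at \<open>\<theta>\<close>, then
      \<open>f\<close> would touch this barrier from below as well, and the barrier is a
      supersolution.\<close>
    have L\<psi>: "L \<theta> < \<psi>u \<theta>"
    proof (rule ccontr)
      assume "\<not> L \<theta> < \<psi>u \<theta>"
      then have eq: "L \<theta> = \<psi>u \<theta>" using LU[OF \<theta>(2)] Uu[OF \<theta>(2)] by linarith
      have "\<forall>\<^sub>F z in nhds \<theta>. z \<in> N" using N by (intro eventually_nhds_in_open)
      then have "\<forall>\<^sub>F z in nhds \<theta>. f z \<le> \<psi>u z"
      proof eventually_elim
        case (elim z)
          then have zD: "z \<in> D" using N(3) OmD by blast
          show ?case using bspec[OF fL(2) elim] LU[OF zD] Uu[OF zD] by linarith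
      qed
      from vsuperD[OF u(2) N(1,2) \<theta>(1) P _ this g] fL(1) eq op show False by simp
    qed
    obtain W c where W: "usc_on D W" "vsub W" "\<And>z. z \<in> D \<Longrightarrow> U z \<le> W z" "\<And>z. z \<in> D \<Longrightarrow> W z \<le> \<psi>u z"
      "L \<theta> < c" "\<forall>\<^sub>F z in nhds \<theta>. c \<le> W z"
    proof (rule bump[where L=L and \<theta>=\<theta> and \<psi>=\<psi>u and N=N and U=U and D=D and f=f, OF OmD Uusc Usub _ u(1) _ L\<psi> N P fL(1) _ g op])
      show "L z \<le> U z" if "z \<in> D" for z by (rule LU[OF that])
      show "U z \<le> \<psi>u z" if "z \<in> D" for z by (rule Uu[OF that])
      show "f z \<le> L z" if "z \<in> N" for z by (rule bspec[OF fL(2) that])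
    qed (rule that)
    have WF: "W \<in> F" unfolding F_def
    proof (intro CollectI conjI ballI W(1,2))
      fix z assume z: "z \<in> D"
      show "\<psi>l z \<le> W z" using lU[OF z] W(3)[OF z] by linarith
      show "W z \<le> \<psi>u z" by (rule W(4)[OF z])
    qed
    \<comment> \<open>The lifted \<open>W\<close> is in the family, hence below \<open>U\<close>. So
      \<open>U\<close> is at least \<open>c\<close> near \<open>\<theta>\<close>, while the lower
      envelope there is smaller than \<open>c\<close>.\<close>
    have ev: "\<forall>\<^sub>F z in nhds \<theta>. z \<in> D \<longrightarrow> - U z \<le> - c"
      using W(6)
    proof eventually_elim
      case (elim z)
      then show ?case using vU[OF WF, of z] by fastforce
    qed
    have "- c < usc_env D (\<lambda>z. - U z) \<theta>" using W(5) by (simp add: L_def)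
    from usc_env_frequently[where f="\<lambda>z. - U z", OF BmU \<theta>(2) this ev] show False by force
  qed
  \<comment> \<open>Off \<open>Om\<close> the barriers coincide and pinch \<open>U\<close> and
    \<open>L\<close>; this supplies the boundary inequality for comparison.\<close>
  have UL: "U z \<le> L z" if "z \<in> D" for z
  proof (rule comparison[OF Uusc Usub _ Llsc Lsuper _ _ that])
    show "U z \<le> A" if "z \<in> D" for z using Uu[OF that] u(3)[OF that] by linarith
    show "B \<le> L z" if "z \<in> D" for z using lL[OF that] l(3)[OF that] by linarith
    show "U z \<le> L z" if "z \<in> D" "z \<notin> Om" for z using Uu[OF that(1)] bd[OF that] lL[OF that(1)] by linarith
  qed
  have eq: "L z = U z" if "z \<in> D" for z using UL[OF that] LU[OF that] by linarith
  have lscU: "lsc_on D U"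
  proof -
    have "usc_on D (\<lambda>z. - L z)" using Llsc by (simp add: lsc_on_iff_usc_on)
    then have "usc_on D (\<lambda>z. - U z)" unfolding usc_on_iff_nhds
    proof (intro ballI allI impI)
      fix z y assume L: "\<forall>x\<in>D. \<forall>y>- L x. \<forall>\<^sub>F z in nhds x. z \<in> D \<longrightarrow> - L z < y" and z: "z \<in> D" "- U z < y"
      from L[rule_format, of z y] z have "\<forall>\<^sub>F z in nhds z. z \<in> D \<longrightarrow> - L z < y" by (simp add: eq)
      then show "\<forall>\<^sub>F z in nhds z. z \<in> D \<longrightarrow> - U z < y" by eventually_elim (simp add: eq)
    qed
    then show ?thesis by (simp add: lsc_on_iff_usc_on)
  qed
  have superU: "vsuper 0 U"
    unfolding vsuper_def
  proof (intro allI impI)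
    fix \<theta> N f ft fx fxx fw fww
    assume N: "\<theta> \<in> N" "open N" "N \<subseteq> Om" "pderivs N f ft fx fxx fw fww" "f \<theta> = U \<theta>" "\<forall>z\<in>N. f z \<le> U z"
    have ND: "z \<in> D" if "z \<in> N" for z using that N(3) OmD by blast
    show "\<forall>\<gamma>\<in>{0..1}. \<forall>q\<in>{0..M}. opr \<gamma> q \<theta> (U \<theta>) (ft \<theta>) (fx \<theta>) (fxx \<theta>) (fw \<theta>) (fww \<theta>) \<le> - 0"
      using Lsuper[unfolded vsuper_def, rule_format, OF N(1-4)] N(5,6) ND[OF N(1)] by (simp add: eq ND)
  qed
  show ?thesis
    by (rule that[OF usc_lsc_imp_continuous_on[OF Uusc lscU] Usub superU lU Uu])
qed

end

section \<open>Extending local test functions\<close>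

text \<open>Square and cube of the positive part: of class \<open>C^1\<close> and
  \<open>C^2\<close>. Two derivatives are all that test functions need, so the cube can replace the
  usual exponential cutoffs.\<close>

definition pos2 :: "real \<Rightarrow> real" where "pos2 y = (max 0 y)\<^sup>2"
definition pos3 :: "real \<Rightarrow> real" where "pos3 y = y * pos2 y"

lemma pos2_deriv: "(pos2 has_real_derivative 2 * max 0 y) (at y)"
proof -
  consider "y > 0" | "y < 0" | "y = 0" by linarith
  then show ?thesis
  proof cases
    case 1
    have ev: "\<forall>\<^sub>F t in nhds y. t\<^sup>2 = pos2 t"
      using eventually_nhds_in_open[of "{0<..}" y] 1 by (auto elim!: eventually_mono simp: pos2_def)
    have dv: "((\<lambda>t. t\<^sup>2) has_real_derivative 2 * max 0 y) (at y)"
      using 1 by (auto intro!: derivative_eq_intros)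
    show ?thesis by (rule iffD1[OF DERIV_cong_ev[OF refl ev refl] dv])
  next
    case 2
    have ev: "\<forall>\<^sub>F t in nhds y. 0 = pos2 t"
      using eventually_nhds_in_open[of "{..<0}" y] 2 by (auto elim!: eventually_mono simp: pos2_def max_def)
    have dv: "((\<lambda>t. 0) has_real_derivative 2 * max 0 y) (at y)" using 2 by simp
    show ?thesis by (rule iffD1[OF DERIV_cong_ev[OF refl ev refl] dv])
  next
    case 3
    have "((\<lambda>h. (pos2 (0 + h) - pos2 0) / h) \<longlongrightarrow> 0) (at 0)"
    proof (rule Lim_null_comparison)
      show "\<forall>\<^sub>F h in at 0. norm ((pos2 (0 + h) - pos2 0) / h) \<le> \<bar>h\<bar>"
        by (rule always_eventually) (auto simp: pos2_def max_def power2_eq_square)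
      show "((\<lambda>h::real. \<bar>h\<bar>) \<longlongrightarrow> 0) (at 0)" using tendsto_rabs[OF tendsto_ident_at[of 0 UNIV]] by simp
    qed
    then show ?thesis unfolding 3 DERIV_def by simp
  qed
qed

lemma pos2_alt: "y * max 0 y = pos2 y" for y :: real
  by (auto simp: pos2_def max_def power2_eq_square)

lemma pos3_deriv: "(pos3 has_real_derivative 3 * pos2 y) (at y)"
proof -
  have "((\<lambda>y. y * pos2 y) has_real_derivative 1 * pos2 y + 2 * max 0 y * y) (at y)"
    by (rule DERIV_mult[OF DERIV_ident pos2_deriv])
  moreover have "1 * pos2 y + 2 * max 0 y * y = 3 * pos2 y" using pos2_alt[of y] by (simp add: mult.assoc mult.commute[of "max 0 y"])
  ultimately show ?thesis by (simp only: pos3_def[abs_def])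
qed

lemma pos_continuous: "continuous_on S pos2" "continuous_on S pos3"
  unfolding pos2_def[abs_def] pos3_def[abs_def] by (intro continuous_intros)+

lemma pos3_cases: "y \<le> 0 \<Longrightarrow> pos3 y = 0" "0 \<le> pos3 y" "0 \<le> y \<Longrightarrow> pos3 y = y ^ 3"
  by (auto simp: pos3_def pos2_def max_def power3_eq_cube power2_eq_square)

text \<open>A bump whose first two derivatives vanish at its centre.\<close>

definition bq :: "real \<Rightarrow> real \<Rightarrow> real" where "bq r t = 1 - (t / r) ^ 4"
definition b0 :: "real \<Rightarrow> real \<Rightarrow> real" where "b0 r t = pos3 (bq r t)"
definition b1 :: "real \<Rightarrow> real \<Rightarrow> real" where "b1 r t = 3 * pos2 (bq r t) * (- 4 * t ^ 3 / r ^ 4)"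
definition b2 :: "real \<Rightarrow> real \<Rightarrow> real" where
  "b2 r t = 6 * max 0 (bq r t) * (- 4 * t ^ 3 / r ^ 4)\<^sup>2 + 3 * pos2 (bq r t) * (- 12 * t\<^sup>2 / r ^ 4)"

lemma bq_deriv: "(bq r has_real_derivative - 4 * t ^ 3 / r ^ 4) (at t)"
  unfolding bq_def[abs_def] power_divide
  by (rule DERIV_cong[OF DERIV_diff[OF DERIV_const DERIV_cdivide[OF DERIV_pow]]]) simp

lemma b0_deriv: "(b0 r has_real_derivative b1 r t) (at t)"
  using DERIV_chain2[OF pos3_deriv bq_deriv, of r t] by (simp add: b0_def[abs_def] b1_def)

lemma b1_deriv: "(b1 r has_real_derivative b2 r t) (at t)"
proof -
  have "((\<lambda>t. - 4 * t ^ 3 / r ^ 4) has_real_derivative - 12 * t\<^sup>2 / r ^ 4) (at t)"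
    by (rule DERIV_cong[OF DERIV_cdivide[OF DERIV_cmult[OF DERIV_pow]]]) simp
  from DERIV_mult[OF DERIV_cmult[OF DERIV_chain2[OF pos2_deriv bq_deriv, of r t], of 3] this]
  show ?thesis by (simp add: b1_def[abs_def] b2_def power2_eq_square mult_ac)
qed

lemma b_continuous: "continuous_on S (b0 r)" "continuous_on S (b1 r)" "continuous_on S (b2 r)"
proof -
  have q: "continuous_on UNIV (bq r)" unfolding bq_def[abs_def] divide_inverse by (intro continuous_intros)
  have q2: "continuous_on UNIV (\<lambda>t. pos2 (bq r t))" by (rule continuous_on_compose2[OF pos_continuous(1) q subset_UNIV])
  have q3: "continuous_on UNIV (\<lambda>t. pos3 (bq r t))" by (rule continuous_on_compose2[OF pos_continuous(2) q subset_UNIV])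
  have "continuous_on UNIV (b0 r)" unfolding b0_def[abs_def] by (rule q3)
  moreover have "continuous_on UNIV (b1 r)"
    unfolding b1_def[abs_def] divide_inverse by (intro continuous_intros q2)
  moreover have "continuous_on UNIV (b2 r)"
    unfolding b2_def[abs_def] divide_inverse by (intro continuous_intros q2 q)
  ultimately have "continuous_on UNIV (b0 r)" "continuous_on UNIV (b1 r)" "continuous_on UNIV (b2 r)" by simp_all
  then show "continuous_on S (b0 r)" "continuous_on S (b1 r)" "continuous_on S (b2 r)"
    using continuous_on_subset[OF _ subset_UNIV] by simp_all
qed

lemma b_centre: "b0 r 0 = 1" "b1 r 0 = 0" "b2 r 0 = 0"
  by (simp_all add: b0_def b1_def b2_def bq_def pos3_def pos2_def)

lemma b_outside:
  assumes "r > 0" "r \<le> \<bar>t\<bar>" shows "b0 r t = 0" "b1 r t = 0" "b2 r t = 0"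
proof -
  have "1 \<le> \<bar>t / r\<bar>" using assms by (simp add: abs_divide)
  then have "1 \<le> \<bar>t / r\<bar> ^ 4" by (rule one_le_power)
  moreover have "\<bar>t / r\<bar> ^ 4 = (t / r) ^ 4" by (simp only: power_even_abs even_numeral)
  ultimately have q: "bq r t \<le> 0" by (simp add: bq_def)
  then show "b0 r t = 0" "b1 r t = 0" "b2 r t = 0"
    by (simp_all add: b0_def b1_def b2_def pos3_cases pos2_def max_def)
qed

lemma b_range: "0 \<le> b0 r t" "b0 r t \<le> 1"
proof -
  show "0 \<le> b0 r t" unfolding b0_def by (rule pos3_cases(2))
  have "bq r t \<le> 1" by (simp add: bq_def)
  then show "b0 r t \<le> 1"
    by (cases "bq r t \<le> 0") (simp_all add: b0_def pos3_cases power_le_one)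
qed

lemma bump_pderivs:
  fixes r s0 x0 w0 :: real
  shows "pderivs UNIV (\<lambda>z. b0 r (sc z - s0) * b0 r (xc z - x0) * b0 r (wc z - w0))
    (\<lambda>z. b1 r (sc z - s0) * b0 r (xc z - x0) * b0 r (wc z - w0))
    (\<lambda>z. b0 r (sc z - s0) * b1 r (xc z - x0) * b0 r (wc z - w0))
    (\<lambda>z. b0 r (sc z - s0) * b2 r (xc z - x0) * b0 r (wc z - w0))
    (\<lambda>z. b0 r (sc z - s0) * b0 r (xc z - x0) * b1 r (wc z - w0))
    (\<lambda>z. b0 r (sc z - s0) * b0 r (xc z - x0) * b2 r (wc z - w0))"
proof -
  have d: "((\<lambda>t. b0 r (t - a)) has_real_derivative b1 r (t - a)) (at t)"
    "((\<lambda>t. b1 r (t - a)) has_real_derivative b2 r (t - a)) (at t)" for t a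
    using b0_deriv[of r "t - a"] b1_deriv[of r "t - a"] DERIV_shift[of _ _ t "- a"] by simp_all
  have c: "continuous_on UNIV (\<lambda>z::point. h (sc z - a))" "continuous_on UNIV (\<lambda>z::point. h (xc z - a))"
    "continuous_on UNIV (\<lambda>z::point. h (wc z - a))" if "continuous_on UNIV h" for h :: "real \<Rightarrow> real" and a
    by (rule continuous_on_compose2[OF that]; intro continuous_intros subset_UNIV)+
  show ?thesis
  proof (rule pderivsI)
    fix s x w :: real
    show "((\<lambda>t. b0 r (sc (t,x,w) - s0) * b0 r (xc (t,x,w) - x0) * b0 r (wc (t,x,w) - w0)) has_real_derivative
       b1 r (sc (s,x,w) - s0) * b0 r (xc (s,x,w) - x0) * b0 r (wc (s,x,w) - w0)) (at s)"
      using DERIV_cmult_right[OF DERIV_cmult_right[OF d(1)]] by simp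
    show "((\<lambda>t. b0 r (sc (s,t,w) - s0) * b0 r (xc (s,t,w) - x0) * b0 r (wc (s,t,w) - w0)) has_real_derivative
       b0 r (sc (s,x,w) - s0) * b1 r (xc (s,x,w) - x0) * b0 r (wc (s,x,w) - w0)) (at x)"
      using DERIV_cmult_right[OF DERIV_cmult[OF d(1)]] by simp
    show "((\<lambda>t. b0 r (sc (s,t,w) - s0) * b1 r (xc (s,t,w) - x0) * b0 r (wc (s,t,w) - w0)) has_real_derivative
       b0 r (sc (s,x,w) - s0) * b2 r (xc (s,x,w) - x0) * b0 r (wc (s,x,w) - w0)) (at x)"
      using DERIV_cmult_right[OF DERIV_cmult[OF d(2)]] by simp
    show "((\<lambda>t. b0 r (sc (s,x,t) - s0) * b0 r (xc (s,x,t) - x0) * b0 r (wc (s,x,t) - w0)) has_real_derivative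
       b0 r (sc (s,x,w) - s0) * b0 r (xc (s,x,w) - x0) * b1 r (wc (s,x,w) - w0)) (at w)"
      using DERIV_cmult[OF d(1)] by simp
    show "((\<lambda>t. b0 r (sc (s,x,t) - s0) * b0 r (xc (s,x,t) - x0) * b1 r (wc (s,x,t) - w0)) has_real_derivative
       b0 r (sc (s,x,w) - s0) * b0 r (xc (s,x,w) - x0) * b2 r (wc (s,x,w) - w0)) (at w)"
      using DERIV_cmult[OF d(2)] by simp
  qed (intro continuous_intros c b_continuous)+
qed

text \<open>\<open>h = g + \<zeta> * (f - g)\<close> with a cutoff whose value at
  \<open>\<theta>\<close> is one and whose first and second pure derivatives vanish there, so
  \<open>h\<close> inherits the jet of \<open>f\<close>. On \<open>N\<close> it is a convex
  combination, hence preserves a one-sided bound shared by \<open>f\<close> and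
  \<open>g\<close>.\<close>

lemma pderivs_extend:
  assumes N: "open N" "\<theta> \<in> N" and f: "pderivs N f ft fx fxx fw fww" and g: "pderivs UNIV g gt gx gxx gw gww"
  obtains h ht hx hxx hw hww \<zeta> where "pderivs UNIV h ht hx hxx hw hww"
    "h \<theta> = f \<theta>" "ht \<theta> = ft \<theta>" "hx \<theta> = fx \<theta>" "hxx \<theta> = fxx \<theta>" "hw \<theta> = fw \<theta>" "hww \<theta> = fww \<theta>"
    "\<And>z. z \<notin> N \<Longrightarrow> h z = g z" "\<And>z. z \<in> N \<Longrightarrow> h z = \<zeta> z * f z + (1 - \<zeta> z) * g z" "\<And>z. 0 \<le> \<zeta> z" "\<And>z. \<zeta> z \<le> (1::real)"
proof -
  obtain s0 x0 w0 where te: "\<theta> = (s0,x0,w0)" by (cases \<theta>)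
  obtain R where R: "R > 0" "ball \<theta> R \<subseteq> N" using N open_contains_ball by blast
  \<comment> \<open>The support of the cutoff is contained in a cube of half-width \<open>r\<close>,
    whose corners are at distance at most \<open>2 * r < R\<close>.\<close>
  define r where "r = R / 4"
  have r: "r > 0" using R by (simp add: r_def)
  define C where "C = {z::point. \<bar>sc z - s0\<bar> \<le> r \<and> \<bar>xc z - x0\<bar> \<le> r \<and> \<bar>wc z - w0\<bar> \<le> r}"
  have CN: "C \<subseteq> N"
  proof
    fix z assume z: "z \<in> C"
    obtain s x w where ze: "z = (s,x,w)" by (cases z)
    have "dist \<theta> z = sqrt ((s - s0)\<^sup>2 + (x - x0)\<^sup>2 + (w - w0)\<^sup>2)"
      unfolding dist_norm te ze norm_minus_commute[of "(s0,x0,w0)"] using norm_point_sq[of "s - s0" "x - x0" "w - w0"]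
      by (metis diff_Pair norm_ge_zero real_sqrt_unique)
    also have "\<dots> \<le> sqrt (r\<^sup>2 + r\<^sup>2 + r\<^sup>2)"
      using z r by (intro real_sqrt_le_mono add_mono) (auto simp: C_def ze abs_le_square_iff[symmetric])
    also have "\<dots> \<le> 2 * r"
      using r by (intro real_le_lsqrt) (auto simp: power2_eq_square)
    also have "\<dots> < R" using R by (simp add: r_def)
    finally have "z \<in> ball \<theta> R" by simp
    then show "z \<in> N" using R(2) by blast
  qed
  have "closed C" unfolding C_def Collect_conj_eq by (intro closed_Int closed_Collect_le continuous_intros)
  then have V: "open (- C)" by (simp add: open_Compl)
  define \<zeta> where "\<zeta> = (\<lambda>z. b0 r (sc z - s0) * b0 r (xc z - x0) * b0 r (wc z - w0))"
  define \<zeta>t where "\<zeta>t = (\<lambda>z. b1 r (sc z - s0) * b0 r (xc z - x0) * b0 r (wc z - w0))"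
  define \<zeta>x where "\<zeta>x = (\<lambda>z. b0 r (sc z - s0) * b1 r (xc z - x0) * b0 r (wc z - w0))"
  define \<zeta>xx where "\<zeta>xx = (\<lambda>z. b0 r (sc z - s0) * b2 r (xc z - x0) * b0 r (wc z - w0))"
  define \<zeta>w where "\<zeta>w = (\<lambda>z. b0 r (sc z - s0) * b0 r (xc z - x0) * b1 r (wc z - w0))"
  define \<zeta>ww where "\<zeta>ww = (\<lambda>z. b0 r (sc z - s0) * b0 r (xc z - x0) * b2 r (wc z - w0))"
  have PZ: "pderivs UNIV \<zeta> \<zeta>t \<zeta>x \<zeta>xx \<zeta>w \<zeta>ww"
    unfolding \<zeta>_def \<zeta>t_def \<zeta>x_def \<zeta>xx_def \<zeta>w_def \<zeta>ww_def by (rule bump_pderivs)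
  have z0: "\<zeta> z = 0" "\<zeta>t z = 0" "\<zeta>x z = 0" "\<zeta>xx z = 0" "\<zeta>w z = 0" "\<zeta>ww z = 0" if "z \<notin> C" for z
  proof -
    have "\<not> (\<bar>sc z - s0\<bar> \<le> r \<and> \<bar>xc z - x0\<bar> \<le> r \<and> \<bar>wc z - w0\<bar> \<le> r)"
      using that by (simp add: C_def)
    then consider "r \<le> \<bar>sc z - s0\<bar>" | "r \<le> \<bar>xc z - x0\<bar>" | "r \<le> \<bar>wc z - w0\<bar>" by (meson linear)
    then show "\<zeta> z = 0" "\<zeta>t z = 0" "\<zeta>x z = 0" "\<zeta>xx z = 0" "\<zeta>w z = 0" "\<zeta>ww z = 0"
      by (cases; simp add: \<zeta>_def \<zeta>t_def \<zeta>x_def \<zeta>xx_def \<zeta>w_def \<zeta>ww_def b_outside[OF r])+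
  qed
  have zc: "\<zeta> \<theta> = 1" "\<zeta>t \<theta> = 0" "\<zeta>x \<theta> = 0" "\<zeta>xx \<theta> = 0" "\<zeta>w \<theta> = 0" "\<zeta>ww \<theta> = 0"
    by (simp_all add: \<zeta>_def \<zeta>t_def \<zeta>x_def \<zeta>xx_def \<zeta>w_def \<zeta>ww_def te b_centre)
  define d where "d = (\<lambda>f g :: point \<Rightarrow> real. \<lambda>z. if z \<in> N then f z - g z else 0)"
  note Pfg = pderivs_mult[OF pderivs_subset[OF PZ subset_UNIV] pderivs_diff[OF f pderivs_subset[OF g subset_UNIV]]]
  define ht where "ht = (\<lambda>z. \<zeta>t z * d f g z + \<zeta> z * d ft gt z)"
  define hx where "hx = (\<lambda>z. \<zeta>x z * d f g z + \<zeta> z * d fx gx z)"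
  define hxx where "hxx = (\<lambda>z. \<zeta>xx z * d f g z + 2 * \<zeta>x z * d fx gx z + \<zeta> z * d fxx gxx z)"
  define hw where "hw = (\<lambda>z. \<zeta>w z * d f g z + \<zeta> z * d fw gw z)"
  define hww where "hww = (\<lambda>z. \<zeta>ww z * d f g z + 2 * \<zeta>w z * d fw gw z + \<zeta> z * d fww gww z)"
  note hd = ht_def hx_def hxx_def hw_def hww_def d_def
  have 1: "pderivs N (\<lambda>z. \<zeta> z * d f g z) ht hx hxx hw hww"
    by (rule pderivs_cong[OF N(1) _ _ _ _ _ _ Pfg]) (simp_all add: hd)
  have 2: "pderivs (- C) (\<lambda>z. \<zeta> z * d f g z) ht hx hxx hw hww"
    by (rule pderivs_cong[OF V _ _ _ _ _ _ pderivs_const[of _ 0]]) (simp_all add: hd z0)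
  have "N \<union> - C = UNIV" using CN by blast
  with pderivs_Un[OF N(1) V 1 2] have 3: "pderivs UNIV (\<lambda>z. \<zeta> z * d f g z) ht hx hxx hw hww" by simp
  have r01: "0 \<le> \<zeta> z \<and> \<zeta> z \<le> 1" for z unfolding \<zeta>_def using b_range by (auto intro!: mult_le_one)
  show ?thesis
    by (rule that[OF pderivs_add[OF g 3], where \<zeta>=\<zeta>]) (use N(2) r01 in \<open>auto simp: hd zc algebra_simps\<close>)
qed

section \<open>Integration against the claim distribution\<close>

text \<open>Dominated convergence with a moving upper limit. At \<open>u = x\<close> the indicators
  may oscillate, hence the requirement that this point is null.\<close>

lemma interval_integral_tendsto:
  fixes h :: "real \<Rightarrow> real" and N :: "real measure"
  assumes N: "sets N = sets borel" and null: "AE u in N. u \<noteq> x" and X: "X \<longlonglongrightarrow> x"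
    and hn: "\<And>n. (\<lambda>u. indicator {0..X n} u * hn n u) \<in> borel_measurable N" and h: "(\<lambda>u. indicator {0..x} u * h u) \<in> borel_measurable N"
    and lim: "\<And>u. 0 \<le> u \<Longrightarrow> u < x \<Longrightarrow> (\<lambda>n. hn n u) \<longlonglongrightarrow> h u"
    and W: "integrable N W" "\<And>n u. 0 \<le> u \<Longrightarrow> u \<le> X n \<Longrightarrow> \<bar>hn n u\<bar> \<le> W u" "\<And>u. 0 \<le> W u"
  shows "(\<lambda>n. LINT u:{0..X n}|N. hn n u) \<longlonglongrightarrow> (LINT u:{0..x}|N. h u)"
  unfolding set_lebesgue_integral_def real_scaleR_def
proof (rule integral_dominated_convergence[OF h hn W(1)])
  show "AE u in N. (\<lambda>n. indicator {0..X n} u * hn n u) \<longlonglongrightarrow> indicator {0..x} u * h u"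
    using null
  proof eventually_elim
    case (elim u)
    consider "u < 0" | "0 \<le> u" "u < x" | "x < u" using elim by linarith
    then show ?case
    proof cases
      case 1 then show ?thesis by simp
    next
      case 2
      have "\<forall>\<^sub>F n in sequentially. u < X n" by (rule order_tendstoD(1)[OF X 2(2)])
      then have "\<forall>\<^sub>F n in sequentially. hn n u = indicator {0..X n} u * hn n u"
        by eventually_elim (use 2 in simp)
      from Lim_transform_eventually[OF lim[OF 2] this] show ?thesis using 2 by simp
    next
      case 3
      have "\<forall>\<^sub>F n in sequentially. X n < u" by (rule order_tendstoD(2)[OF X 3])
      then have "\<forall>\<^sub>F n in sequentially. 0 = indicator {0..X n} u * hn n u"
        by eventually_elim simp
      from Lim_transform_eventually[OF tendsto_const this] show ?thesis using 3 by simp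
    qed
  qed
  show "AE u in N. norm (indicator {0..X n} u * hn n u) \<le> W u" for n
    by (rule AE_I2) (use W in \<open>auto simp: indicator_def abs_mult\<close>)
qed

lemma cdf_with_densityD:
  assumes "cdf_with_density F f"
  shows "\<And>x y. x \<le> y \<Longrightarrow> F x \<le> F y" "continuous_on UNIV F" "(F \<longlongrightarrow> 1) at_top" "\<And>t. t < 0 \<Longrightarrow> F t = 0"
proof -
  have f0: "\<And>t. t \<ge> 0 \<Longrightarrow> 0 \<le> f t" and int: "set_integrable lborel {0..} f" and one: "(LINT t:{0..}|lborel. f t) = 1"
    and F: "\<And>t. F t = (LINT u:{0..t}|lborel. f u)"
    using assms unfolding cdf_with_density_def by blast+
  have sub: "set_integrable lborel {0..t} f" for t by (rule set_integrable_subset[OF int]) auto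
  show "F x \<le> F y" if "x \<le> y" for x y
    unfolding F set_lebesgue_integral_def
    by (rule integral_mono) (use sub[unfolded set_integrable_def] f0 that in \<open>auto split: split_indicator\<close>)
  show "F t = 0" if "t < 0" for t unfolding F using that by (simp add: set_lebesgue_integral_def)
  have m: "(\<lambda>u. indicator {0..t} u * f u) \<in> borel_measurable lborel" for t
    using borel_measurable_integrable[OF sub[unfolded set_integrable_def]] by simp
  show "continuous_on UNIV F"
    unfolding continuous_on_sequentially
  proof (intro allI ballI impI)
    fix X :: "nat \<Rightarrow> real" and x assume X: "(\<forall>n. X n \<in> UNIV) \<and> X \<longlonglongrightarrow> x"
    have "(\<lambda>n. LINT u:{0..X n}|lborel. f u) \<longlonglongrightarrow> (LINT u:{0..x}|lborel. f u)"
    proof (rule interval_integral_tendsto[where W="\<lambda>u. indicator {0..} u * f u"])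
      show "AE u in lborel. u \<noteq> x" by (rule AE_lborel_singleton)
      show "integrable lborel (\<lambda>u. indicator {0..} u * f u)" using int by (simp add: set_integrable_def)
    qed (use X f0 m in \<open>auto simp: indicator_def\<close>)
    then show "(F \<circ> X) \<longlonglongrightarrow> F x" by (simp add: F o_def)
  qed
  show "(F \<longlongrightarrow> 1) at_top"
    using tendsto_set_lebesgue_integral_at_top[OF _ int] one by (simp add: F[abs_def])
qed

locale claims =
  fixes F f :: "real \<Rightarrow> real"
  assumes cdf: "cdf_with_density F f"
begin

abbreviation \<mu> :: "real measure" where "\<mu> \<equiv> interval_measure F"

lemma mu_Icc: "a \<le> b \<Longrightarrow> emeasure \<mu> {a..b} = F b - F a"
  by (rule emeasure_interval_measure_Icc) (use cdf_with_densityD[OF cdf] in auto)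

lemma mu_finite: "emeasure \<mu> {a..b} < \<infinity>"
  by (cases "a \<le> b") (simp_all add: mu_Icc)

lemma AE_neq: "AE u in \<mu>. u \<noteq> x"
proof (rule AE_I[where N="{x}"])
  show "emeasure \<mu> {x} = 0" using mu_Icc[of x x] by simp
qed auto

lemma line_integrable:
  fixes h :: "real \<Rightarrow> real"
  assumes "continuous_on {a..b} h" shows "set_integrable \<mu> {a..b} h"
proof -
  have "bounded (h ` {a..b})" by (rule compact_imp_bounded[OF compact_continuous_image[OF assms compact_Icc]])
  then obtain B where "\<forall>y\<in>h ` {a..b}. \<bar>y\<bar> \<le> B" unfolding bounded_real ..
  then have B: "\<And>u. u \<in> {a..b} \<Longrightarrow> \<bar>h u\<bar> \<le> B" by simp
  show ?thesis unfolding set_integrable_def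
  proof (rule integrableI_bounded_set[where A="{a..b}" and B=B])
    show "(\<lambda>u. indicator {a..b} u *\<^sub>R h u) \<in> borel_measurable \<mu>"
      unfolding measurable_cong_sets[OF sets_interval_measure refl]
      by (rule borel_measurable_continuous_on_indicator[OF _ assms]) simp
    show "AE u in \<mu>. u \<in> {a..b} \<longrightarrow> norm (indicator {a..b} u *\<^sub>R h u) \<le> B"
      by (rule AE_I2) (use B in auto)
  qed (use mu_finite in auto)
qed

lemma line_const: "(LINT u:{a..b}|\<mu>. k) = k * measure \<mu> {a..b}"
proof -
  have "integrable \<mu> (indicator {a..b} :: real \<Rightarrow> real)"
    using line_integrable[OF continuous_on_const[of "{a..b}" 1]] by (simp add: set_integrable_def)
  then show ?thesis unfolding set_lebesgue_integral_def by (simp add: mult.commute)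
qed

text \<open>The claim distribution has total mass one and no atom at \<open>0\<close>, so long
  intervals carry at least half of it.\<close>

lemma line_mass_pos: obtains b0 where "\<And>b. b \<ge> b0 \<Longrightarrow> measure \<mu> {0..b} \<ge> 1 / 2"
proof -
  have "F 0 = 0"
  proof -
    have "isCont F 0" using cdf_with_densityD(2)[OF cdf] continuous_on_eq_continuous_at[OF open_UNIV] by blast
    then have "(F \<longlongrightarrow> F 0) (at_left 0)" by (simp add: isCont_def filterlim_at_split)
    moreover have "(F \<longlongrightarrow> 0) (at_left 0)"
      by (rule Lim_transform_eventually[OF tendsto_const])
        (use cdf_with_densityD(4)[OF cdf] in \<open>auto simp: eventually_at_filter\<close>)
    ultimately show ?thesis by (rule tendsto_unique[rotated]) simp
  qed
  have "\<forall>\<^sub>F b in at_top. 1 / 2 < F b" by (rule order_tendstoD(1)[OF cdf_with_densityD(3)[OF cdf]]) simp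
  then obtain b0 where b0: "\<And>b. b \<ge> b0 \<Longrightarrow> 1 / 2 < F b" unfolding eventually_at_top_linorder by blast
  show ?thesis
  proof (rule that[of "max b0 0"])
    fix b assume "b \<ge> max b0 0"
    then have b: "b0 \<le> b" "0 \<le> b" by auto
    have "measure \<mu> {0..b} = F b"
      unfolding measure_def mu_Icc[OF b(2)] \<open>F 0 = 0\<close> using b0[OF b(1)] by simp
    then show "measure \<mu> {0..b} \<ge> 1 / 2" using b0[OF b(1)] by simp
  qed
qed

end

section \<open>The control problem\<close>

locale control =
  fixes P :: model and \<Psi> :: "point \<Rightarrow> real" and n :: nat and \<delta> :: real
  assumes n: "1 \<le> n" and \<delta>: "0 < \<delta>" "\<delta> < 1" and VM: "valid_model P \<delta>" and PC: "Psi_conditions P \<Psi>"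
begin

definition T1 :: real where "T1 = horizon P + \<delta>"

abbreviation D :: "point set" where "D \<equiv> dom_D P \<delta>"

abbreviation Om :: "point set" where
  "Om \<equiv> {(s,x,w). 0 < s \<and> s < T1 \<and> - \<delta> < x \<and> - \<delta> < w \<and> w < s + \<delta>}"

sublocale claims "claim_cdf P" "claim_dens P"
  using VM by unfold_locales (simp add: valid_model_def)

lemma model_pos:
  "0 < horizon P" "0 < prem P" "0 < rate P" "0 < drift P" "0 < vol P" "0 < disc P" "0 < visc P n" "0 \<le> maxdiv P"
  using VM n unfolding valid_model_def by auto

lemma T1: "0 < T1" using model_pos \<delta> by (simp add: T1_def)

lemma D_iff: "(s,x,w) \<in> D \<longleftrightarrow> 0 < s \<and> s \<le> T1 \<and> - \<delta> \<le> x \<and> - \<delta> \<le> w \<and> w \<le> s + \<delta>"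
  by (simp add: dom_D_def T1_def)

lemma interior_D: "interior (dom_D P d) = {(s,x,w). 0 < s \<and> s < horizon P + d \<and> - d < x \<and> - d < w \<and> w < s + d}" (is "_ = ?O")
proof
  have "?O = {z. 0 < sc z} \<inter> {z. sc z < horizon P + d} \<inter> {z. - d < xc z} \<inter> {z. - d < wc z} \<inter> {z. wc z < sc z + d}" by auto
  also have "open \<dots>" by (intro open_Int open_Collect_less continuous_intros)
  finally have "open ?O" .
  then show "?O \<subseteq> interior (dom_D P d)" by (rule interior_maximal[rotated]) (auto simp: dom_D_def)
  show "interior (dom_D P d) \<subseteq> ?O"
  proof
    fix z assume z: "z \<in> interior (dom_D P d)"
    obtain s x w where ze: "z = (s,x,w)" by (cases z)
    obtain e where e: "e > 0" "cball z e \<subseteq> dom_D P d" using z mem_interior_cball by blast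
    have "(s + e,x,w) \<in> cball z e" "(s,x - e,w) \<in> cball z e" "(s,x,w - e) \<in> cball z e" "(s,x,w + e) \<in> cball z e"
      using e(1) by (simp_all add: ze dist_Pair_Pair dist_real_def)
    moreover have "z \<in> dom_D P d" using z interior_subset by blast
    ultimately have "(s + e,x,w) \<in> dom_D P d" "(s,x - e,w) \<in> dom_D P d" "(s,x,w - e) \<in> dom_D P d" "(s,x,w + e) \<in> dom_D P d" "(s,x,w) \<in> dom_D P d"
      using e(2) ze by blast+
    then show "z \<in> ?O" using e(1) by (simp add: ze dom_D_def)
  qed
qed

lemma intD: "interior D = Om" unfolding interior_D T1_def ..

lemma open_Om: "open Om" using open_interior[of D] unfolding intD .

lemma Om_D: "Om \<subseteq> D" using interior_subset[of D] unfolding intD .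

lemma Psi_pderivs: "pderivs UNIV \<Psi> (pd_t \<Psi>) (pd_x \<Psi>) (pd_x (pd_x \<Psi>)) (pd_w \<Psi>) (pd_w (pd_w \<Psi>))"
proof -
  have "C1kk_on 3 UNIV \<Psi>" using PC unfolding Psi_conditions_def by (elim conjE)
  then show ?thesis by (rule C1kk_on_imp_pderivs) simp
qed

lemma Psi_continuous: "continuous_on S \<Psi>"
  by (rule continuous_on_subset[OF pderivs_continuous(1)[OF Psi_pderivs] subset_UNIV])

lemma Psi_bound: obtains K1 where "K1 > 0" "\<And>z. z \<in> dom_D P 1 \<Longrightarrow> 0 \<le> \<Psi> z \<and> \<Psi> z \<le> K1"
proof -
  have "\<exists>K1>0. \<forall>\<theta>\<in>dom_D P 1. 0 \<le> \<Psi> \<theta> \<and> \<Psi> \<theta> \<le> K1" using PC unfolding Psi_conditions_def by (elim conjE)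
  then show ?thesis using that by auto
qed

lemma Psi_mono: "(s,x,w) \<in> interior (dom_D P 1) \<Longrightarrow> x \<le> x' \<Longrightarrow> \<Psi> (s,x,w) \<le> \<Psi> (s,x',w)"
proof -
  assume i: "(s,x,w) \<in> interior (dom_D P 1)" and x: "x \<le> x'"
  have m: "\<forall>s x x' w. (s, x, w) \<in> interior (dom_D P 1) \<longrightarrow> (s, x', w) \<in> interior (dom_D P 1) \<longrightarrow>
        x < x' \<longrightarrow> \<Psi> (s, x, w) < \<Psi> (s, x', w)" using PC unfolding Psi_conditions_def by (elim conjE)
  have "(s,x',w) \<in> interior (dom_D P 1)" using i x unfolding interior_D by simp
  then show ?thesis using m[rule_format, OF i, of x'] x by (cases "x = x'") auto
qed

lemma D_D1: "D \<subseteq> dom_D P 1" using \<delta> by (auto simp: dom_D_def)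

abbreviation lam :: "real \<Rightarrow> real" where "lam \<equiv> intensity P"

lemma lam_continuous: "continuous_on {- \<delta><..<T1 + \<delta>} lam"
proof -
  have "continuous_on {-1..max (horizon P + 1) (horizon P + 2 * \<delta>)} lam" using VM unfolding valid_model_def by (elim conjE)
  then show ?thesis by (rule continuous_on_subset) (use \<delta> in \<open>auto simp: T1_def\<close>)
qed

definition J :: "point \<Rightarrow> real" where "J z = (LINT u:{0..xc z + \<delta>}|\<mu>. \<Psi> (sc z, xc z - u, - \<delta>))"

lemma line_in_D: "0 < s \<Longrightarrow> s \<le> T1 \<Longrightarrow> u \<in> {0..x + \<delta>} \<Longrightarrow> (s, x - u, - \<delta>) \<in> D"
  using \<delta> by (simp add: D_iff)

lemma Psi_line: "continuous_on S (\<lambda>u. \<Psi> (s, x - u, - \<delta>))"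
  by (rule continuous_on_compose2[OF Psi_continuous[of UNIV]]) (auto intro!: continuous_intros)

lemma J_continuous: "continuous_on Om J"
  unfolding continuous_on_sequentially
proof (intro allI ballI impI)
  fix X and z assume z: "z \<in> Om" and X: "(\<forall>n. X n \<in> Om) \<and> X \<longlonglongrightarrow> z"
  have Xl: "X \<longlonglongrightarrow> z" by (rule conjunct2[OF X])
  have XO: "X n \<in> Om" for n by (rule spec[OF conjunct1[OF X]])
  obtain K1 where K1: "K1 > 0" "\<And>z. z \<in> dom_D P 1 \<Longrightarrow> 0 \<le> \<Psi> z \<and> \<Psi> z \<le> K1" by (rule Psi_bound) (rule that)
  have xl: "(\<lambda>n. xc (X n)) \<longlonglongrightarrow> xc z" "(\<lambda>n. sc (X n)) \<longlonglongrightarrow> sc z" by (intro tendsto_intros Xl)+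
  have "bounded (range (\<lambda>n. xc (X n)))" by (rule convergent_imp_bounded[OF xl(1)])
  then obtain R where "\<forall>y\<in>range (\<lambda>n. xc (X n)). \<bar>y\<bar> \<le> R" unfolding bounded_real ..
  then have R: "xc (X n) \<le> R" for n by (simp add: abs_le_iff)
  have meas: "(\<lambda>u. indicator {0..b} u * \<Psi> (s, x - u, - \<delta>)) \<in> borel_measurable \<mu>" for s x b
    using borel_measurable_integrable[OF line_integrable[OF Psi_line, unfolded set_integrable_def]] by simp
  have "(\<lambda>n. LINT u:{0..xc (X n) + \<delta>}|\<mu>. \<Psi> (sc (X n), xc (X n) - u, - \<delta>)) \<longlonglongrightarrow> (LINT u:{0..xc z + \<delta>}|\<mu>. \<Psi> (sc z, xc z - u, - \<delta>))"
  proof (rule interval_integral_tendsto[where W="\<lambda>u. indicator {0..R + \<delta>} u * K1"])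
    show "AE u in \<mu>. u \<noteq> xc z + \<delta>" by (rule AE_neq)
    show "(\<lambda>n. xc (X n) + \<delta>) \<longlonglongrightarrow> xc z + \<delta>" by (intro tendsto_intros xl)
    show "integrable \<mu> (\<lambda>u. indicator {0..R + \<delta>} u * K1)"
      using line_integrable[OF continuous_on_const[of "{0..R + \<delta>}" K1]] by (simp add: set_integrable_def)
    show "\<bar>\<Psi> (sc (X n), xc (X n) - u, - \<delta>)\<bar> \<le> indicator {0..R + \<delta>} u * K1" if "0 \<le> u" "u \<le> xc (X n) + \<delta>" for n u
    proof -
      have "0 < sc (X n)" "sc (X n) \<le> T1" using XO[of n] by auto
      then have "(sc (X n), xc (X n) - u, - \<delta>) \<in> D" using that by (intro line_in_D) auto
      then have "\<bar>\<Psi> (sc (X n), xc (X n) - u, - \<delta>)\<bar> \<le> K1" using K1(2) D_D1 by fastforce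
      moreover have "u \<in> {0..R + \<delta>}" using that R[of n] by simp
      ultimately show ?thesis by simp
    qed
    show "(\<lambda>n. \<Psi> (sc (X n), xc (X n) - u, - \<delta>)) \<longlonglongrightarrow> \<Psi> (sc z, xc z - u, - \<delta>)" for u
    proof -
      have "isCont \<Psi> (sc z, xc z - u, - \<delta>)" using Psi_continuous[of UNIV] continuous_on_eq_continuous_at[OF open_UNIV] by blast
      then show ?thesis by (rule isCont_tendsto_compose) (intro tendsto_intros xl)
    qed
  qed (use K1 in \<open>auto simp: meas\<close>)
  then show "(J \<circ> X) \<longlonglongrightarrow> J z" by (simp add: J_def o_def)
qed

text \<open>A larger capital lengthens the interval, where \<open>\<Psi>\<close> is nonnegative, and
  raises the integrand. For the latter, \<open>\<delta> < 1\<close> puts the line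
  \<open>w = -\<delta>\<close> into the interior of \<open>D_1\<close>, where \<open>\<Psi>\<close>
  increases in \<open>x\<close>.\<close>

lemma J_mono:
  assumes z: "(s,x,w) \<in> Om" and x: "x \<le> x'"
  shows "J (s,x,w) \<le> J (s,x',w)"
proof -
  have s: "0 < s" "s \<le> T1" "s < horizon P + 1" using z \<delta> by (auto simp: T1_def)
  obtain K1 where K1: "K1 > 0" "\<And>z. z \<in> dom_D P 1 \<Longrightarrow> 0 \<le> \<Psi> z \<and> \<Psi> z \<le> K1" by (rule Psi_bound) (rule that)
  have sub: "{0..x + \<delta>} \<subseteq> {0..x' + \<delta>}" using x by auto
  have "(LINT u:{0..x + \<delta>}|\<mu>. \<Psi> (s, x - u, - \<delta>)) \<le> (LINT u:{0..x' + \<delta>}|\<mu>. \<Psi> (s, x' - u, - \<delta>))"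
    unfolding set_lebesgue_integral_def
  proof (rule integral_mono)
    fix u
    show "indicator {0..x + \<delta>} u *\<^sub>R \<Psi> (s, x - u, - \<delta>) \<le> indicator {0..x' + \<delta>} u *\<^sub>R \<Psi> (s, x' - u, - \<delta>)"
    proof (cases "u \<in> {0..x + \<delta>}")
      case True
      have "(s, x - u, - \<delta>) \<in> interior (dom_D P 1)" unfolding interior_D using True s \<delta> by auto
      then have "\<Psi> (s, x - u, - \<delta>) \<le> \<Psi> (s, x' - u, - \<delta>)" using x by (intro Psi_mono) auto
      then show ?thesis using True sub by (auto simp: indicator_def)
    next
      case False
      have "0 \<le> \<Psi> (s, x' - u, - \<delta>)" if "u \<in> {0..x' + \<delta>}"
        using K1(2)[of "(s, x' - u, - \<delta>)"] line_in_D[OF s(1,2) that] D_D1 by blast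
      then show ?thesis using False by (auto simp: indicator_def)
    qed
  qed (use line_integrable[OF Psi_line] in \<open>simp_all add: set_integrable_def\<close>)
  then show ?thesis by (simp add: J_def)
qed

text \<open>The operator with the nonlocal integral as a separate argument \<open>I\<close>. The
  subtracted value in the nonlocal term is merged with the discounting into the coefficient
  \<open>disc P + lam (wc z)\<close>.\<close>

definition Hm :: "real \<Rightarrow> real \<Rightarrow> point \<Rightarrow> real \<Rightarrow> real \<Rightarrow> real \<Rightarrow> real \<Rightarrow> real \<Rightarrow> real \<Rightarrow> real \<Rightarrow> real" where
  "Hm \<gamma> q z I y a b c d e = a + ((vol P)\<^sup>2 / 2 * \<gamma>\<^sup>2 * (xc z)\<^sup>2 + visc P n / 2) * c + visc P n / 2 * e
    + (prem P + (rate P + (drift P - rate P) * \<gamma>) * xc z - q) * b + d + q + lam (wc z) * I - (disc P + lam (wc z)) * y"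

abbreviation Il :: "(point \<Rightarrow> real) \<Rightarrow> point \<Rightarrow> real" where
  "Il \<phi> z \<equiv> (LINT u:{0..xc z + \<delta>}|\<mu>. \<phi> (sc z, xc z - u, - \<delta>))"

lemma ham_expand:
  "pd_t \<phi> z + ham_of P n \<delta> \<phi> z \<gamma> q =
    Hm \<gamma> q z (Il \<phi> z) (\<phi> z) (pd_t \<phi> z) (pd_x \<phi> z) (pd_x (pd_x \<phi>) z) (pd_w \<phi> z) (pd_w (pd_w \<phi>) z)"
  by (cases z) (simp add: ham_of_def ham_n_def ham_def nonloc_def Hm_def algebra_simps)

lemma Hm_attains:
  obtains \<gamma>0 q0 where "\<gamma>0 \<in> {0..1}" "q0 \<in> {0..maxdiv P}"
    "\<And>\<gamma> q. \<gamma> \<in> {0..1} \<Longrightarrow> q \<in> {0..maxdiv P} \<Longrightarrow> Hm \<gamma> q z I y a b c d e \<le> Hm \<gamma>0 q0 z I y a b c d e"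
proof -
  have c: "continuous_on ({0..1} \<times> {0..maxdiv P}) (\<lambda>p. Hm (fst p) (snd p) z I y a b c d e)"
    unfolding Hm_def by (intro continuous_intros)
  have k: "compact ({0..1::real} \<times> {0..maxdiv P})" "{0..1::real} \<times> {0..maxdiv P} \<noteq> {}"
    using model_pos by (auto intro: compact_Times)
  obtain p where p: "p \<in> {0..1} \<times> {0..maxdiv P}"
    "\<And>p'. p' \<in> {0..1} \<times> {0..maxdiv P} \<Longrightarrow> Hm (fst p') (snd p') z I y a b c d e \<le> Hm (fst p) (snd p) z I y a b c d e"
    using continuous_attains_sup[OF k c] by blast
  show ?thesis
  proof (rule that)
    show "fst p \<in> {0..1}" "snd p \<in> {0..maxdiv P}" using p(1) by auto
    show "Hm \<gamma> q z I y a b c d e \<le> Hm (fst p) (snd p) z I y a b c d e" if "\<gamma> \<in> {0..1}" "q \<in> {0..maxdiv P}" for \<gamma> q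
      using p(2)[of "(\<gamma>,q)"] that by simp
  qed
qed

lemma hjb_op_max:
  obtains \<gamma>0 q0 where "\<gamma>0 \<in> {0..1}" "q0 \<in> {0..maxdiv P}"
    "\<And>\<gamma> q. \<gamma> \<in> {0..1} \<Longrightarrow> q \<in> {0..maxdiv P} \<Longrightarrow> ham_of P n \<delta> \<phi> z \<gamma> q \<le> hjb_op P n \<delta> \<phi> z"
    "hjb_op P n \<delta> \<phi> z = ham_of P n \<delta> \<phi> z \<gamma>0 q0"
proof -
  obtain \<gamma>0 q0 where m: "\<gamma>0 \<in> {0..1}" "q0 \<in> {0..maxdiv P}"
    "\<And>\<gamma> q. \<gamma> \<in> {0..1} \<Longrightarrow> q \<in> {0..maxdiv P} \<Longrightarrow> Hm \<gamma> q z (Il \<phi> z) (\<phi> z) (pd_t \<phi> z) (pd_x \<phi> z) (pd_x (pd_x \<phi>) z) (pd_w \<phi> z) (pd_w (pd_w \<phi>) z)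
      \<le> Hm \<gamma>0 q0 z (Il \<phi> z) (\<phi> z) (pd_t \<phi> z) (pd_x \<phi> z) (pd_x (pd_x \<phi>) z) (pd_w \<phi> z) (pd_w (pd_w \<phi>) z)"
    by (rule Hm_attains[of z "Il \<phi> z" "\<phi> z" "pd_t \<phi> z" "pd_x \<phi> z" "pd_x (pd_x \<phi>) z" "pd_w \<phi> z" "pd_w (pd_w \<phi>) z"]) (rule that)
  have le: "ham_of P n \<delta> \<phi> z \<gamma> q \<le> ham_of P n \<delta> \<phi> z \<gamma>0 q0" if "\<gamma> \<in> {0..1}" "q \<in> {0..maxdiv P}" for \<gamma> q
    using m(3)[OF that] unfolding ham_expand[symmetric] by simp
  have e: "hjb_op P n \<delta> \<phi> z = ham_of P n \<delta> \<phi> z \<gamma>0 q0"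
    unfolding hjb_op_def
  proof (rule cSup_eq_maximum)
    show "ham_of P n \<delta> \<phi> z \<gamma>0 q0 \<in> (\<lambda>(\<gamma>, a). ham_of P n \<delta> \<phi> z \<gamma> a) ` ({0..1} \<times> {0..maxdiv P})"
      by (rule image_eqI[of _ _ "(\<gamma>0, q0)"]) (use m(1,2) in auto)
  qed (use le in \<open>auto simp del: atLeastAtMost_iff\<close>)
  show ?thesis by (rule that[OF m(1,2) _ e]) (unfold e, rule le)
qed

lemma hjb_op_ge_iff: "0 \<le> pd_t \<phi> z + hjb_op P n \<delta> \<phi> z \<longleftrightarrow>
  (\<exists>\<gamma>\<in>{0..1}. \<exists>q\<in>{0..maxdiv P}. 0 \<le> pd_t \<phi> z + ham_of P n \<delta> \<phi> z \<gamma> q)"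
proof -
  obtain \<gamma>0 q0 where m: "\<gamma>0 \<in> {0..1}" "q0 \<in> {0..maxdiv P}"
    "\<And>\<gamma> q. \<gamma> \<in> {0..1} \<Longrightarrow> q \<in> {0..maxdiv P} \<Longrightarrow> ham_of P n \<delta> \<phi> z \<gamma> q \<le> hjb_op P n \<delta> \<phi> z"
    "hjb_op P n \<delta> \<phi> z = ham_of P n \<delta> \<phi> z \<gamma>0 q0" by (rule hjb_op_max) (rule that)
  show ?thesis
  proof
    assume "0 \<le> pd_t \<phi> z + hjb_op P n \<delta> \<phi> z"
    then show "\<exists>\<gamma>\<in>{0..1}. \<exists>q\<in>{0..maxdiv P}. 0 \<le> pd_t \<phi> z + ham_of P n \<delta> \<phi> z \<gamma> q"
      unfolding m(4) using m(1,2) by blast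
  next
    assume "\<exists>\<gamma>\<in>{0..1}. \<exists>q\<in>{0..maxdiv P}. 0 \<le> pd_t \<phi> z + ham_of P n \<delta> \<phi> z \<gamma> q"
    then obtain \<gamma> q where "\<gamma> \<in> {0..1}" "q \<in> {0..maxdiv P}" "0 \<le> pd_t \<phi> z + ham_of P n \<delta> \<phi> z \<gamma> q" by blast
    with m(3)[of \<gamma> q] show "0 \<le> pd_t \<phi> z + hjb_op P n \<delta> \<phi> z" by linarith
  qed
qed

lemma hjb_op_le_iff: "pd_t \<phi> z + hjb_op P n \<delta> \<phi> z \<le> 0 \<longleftrightarrow>
  (\<forall>\<gamma>\<in>{0..1}. \<forall>q\<in>{0..maxdiv P}. pd_t \<phi> z + ham_of P n \<delta> \<phi> z \<gamma> q \<le> 0)"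
proof -
  obtain \<gamma>0 q0 where m: "\<gamma>0 \<in> {0..1}" "q0 \<in> {0..maxdiv P}"
    "\<And>\<gamma> q. \<gamma> \<in> {0..1} \<Longrightarrow> q \<in> {0..maxdiv P} \<Longrightarrow> ham_of P n \<delta> \<phi> z \<gamma> q \<le> hjb_op P n \<delta> \<phi> z"
    "hjb_op P n \<delta> \<phi> z = ham_of P n \<delta> \<phi> z \<gamma>0 q0" by (rule hjb_op_max) (rule that)
  show ?thesis
  proof
    assume "pd_t \<phi> z + hjb_op P n \<delta> \<phi> z \<le> 0"
    then show "\<forall>\<gamma>\<in>{0..1}. \<forall>q\<in>{0..maxdiv P}. pd_t \<phi> z + ham_of P n \<delta> \<phi> z \<gamma> q \<le> 0"
      using m(3) by fastforce
  next
    assume "\<forall>\<gamma>\<in>{0..1}. \<forall>q\<in>{0..maxdiv P}. pd_t \<phi> z + ham_of P n \<delta> \<phi> z \<gamma> q \<le> 0"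
    then show "pd_t \<phi> z + hjb_op P n \<delta> \<phi> z \<le> 0" unfolding m(4) using m(1,2) by blast
  qed
qed

text \<open>Setting a smooth \<open>h\<close> to zero off \<open>D\<close> makes it admissible:
  continuity is only required relative to \<open>D\<close>, and the line of integration lies in
  \<open>D\<close>.\<close>

lemma test_function:
  assumes h: "pderivs UNIV h ht hx hxx hw hww"
  defines "\<Phi> \<equiv> \<lambda>z. if z \<in> D then h z else 0"
  shows "\<Phi> \<in> test_functions P \<delta>"
    and "z \<in> Om \<Longrightarrow> pd_t \<Phi> z + ham_of P n \<delta> \<Phi> z \<gamma> q = Hm \<gamma> q z (Il h z) (h z) (ht z) (hx z) (hxx z) (hw z) (hww z)"
proof -
  have Q: "pderivs Om \<Phi> ht hx hxx hw hww"
    by (rule pderivs_cong[OF open_Om _ _ _ _ _ _ pderivs_subset[OF h subset_UNIV]])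
      (use Om_D in \<open>auto simp: \<Phi>_def\<close>)
  note e = pderivs_pd_eq[OF Q open_Om]
  note c = pderivs_continuous[OF h, THEN continuous_on_subset[OF _ subset_UNIV[of D]]]
  show "\<Phi> \<in> test_functions P \<delta>"
    unfolding test_functions_def intD
  proof (intro CollectI conjI)
    show "C1kk_on 2 Om \<Phi>" by (rule pderivs_imp_C1kk_on[OF Q open_Om])
    show "continuous_on D \<Phi>" by (rule continuous_on_eq[OF c(1)]) (simp add: \<Phi>_def)
    have "\<exists>h. continuous_on D h \<and> (\<forall>\<theta>\<in>Om. h \<theta> = pd_t \<Phi> \<theta>)" "\<exists>h. continuous_on D h \<and> (\<forall>\<theta>\<in>Om. h \<theta> = pd_x \<Phi> \<theta>)"
      "\<exists>h. continuous_on D h \<and> (\<forall>\<theta>\<in>Om. h \<theta> = pd_x (pd_x \<Phi>) \<theta>)" "\<exists>h. continuous_on D h \<and> (\<forall>\<theta>\<in>Om. h \<theta> = pd_w \<Phi> \<theta>)"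
      "\<exists>h. continuous_on D h \<and> (\<forall>\<theta>\<in>Om. h \<theta> = pd_w (pd_w \<Phi>) \<theta>)"
      by (rule exI[of _ ht], intro conjI c ballI e(1)[symmetric], assumption,
        rule exI[of _ hx], intro conjI c ballI e(2)[symmetric], assumption,
        rule exI[of _ hxx], intro conjI c ballI e(3)[symmetric], assumption,
        rule exI[of _ hw], intro conjI c ballI e(4)[symmetric], assumption,
        rule exI[of _ hww], intro conjI c ballI e(5)[symmetric], assumption)
    then show "\<forall>d\<in>{pd_t \<Phi>, pd_x \<Phi>, pd_x (pd_x \<Phi>), pd_w \<Phi>, pd_w (pd_w \<Phi>)}. \<exists>h. continuous_on D h \<and> (\<forall>\<theta>\<in>Om. h \<theta> = d \<theta>)"
      by (simp only: ball_simps simp_thms)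
    show "\<forall>\<theta>. \<theta> \<notin> D \<longrightarrow> \<Phi> \<theta> = 0" by (simp add: \<Phi>_def)
  qed
  assume z: "z \<in> Om"
  have zz: "0 < sc z" "sc z \<le> T1" using z by auto
  have "Il \<Phi> z = Il h z"
    by (rule set_lebesgue_integral_cong) (use line_in_D[OF zz] in \<open>simp_all add: \<Phi>_def\<close>)
  moreover have "\<Phi> z = h z" using z Om_D by (auto simp: \<Phi>_def)
  ultimately show "pd_t \<Phi> z + ham_of P n \<delta> \<Phi> z \<gamma> q = Hm \<gamma> q z (Il h z) (h z) (ht z) (hx z) (hxx z) (hw z) (hww z)"
    unfolding ham_expand using e[OF z] by simp
qed

text \<open>The prescribed test function \<open>g\<close> enters the nonlocal term, the local one \<open>f\<close> everything else.\<close>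

lemma subsol_test:
  assumes v: "visc_subsol P n \<delta> v" and N: "open N" "\<theta> \<in> N" "N \<subseteq> Om" and f: "pderivs N f ft fx fxx fw fww"
    and g: "pderivs UNIV g gt gx gxx gw gww" and eq: "f \<theta> = v \<theta>" and le: "\<And>z. z \<in> N \<Longrightarrow> v z \<le> f z" "\<And>z. z \<in> D \<Longrightarrow> v z \<le> g z"
  shows "\<exists>\<gamma>\<in>{0..1}. \<exists>q\<in>{0..maxdiv P}. 0 \<le> Hm \<gamma> q \<theta> (Il g \<theta>) (v \<theta>) (ft \<theta>) (fx \<theta>) (fxx \<theta>) (fw \<theta>) (fww \<theta>)"
proof -
  obtain h ht hx hxx hw hww \<zeta> where h: "pderivs UNIV h ht hx hxx hw hww"
    "h \<theta> = f \<theta>" "ht \<theta> = ft \<theta>" "hx \<theta> = fx \<theta>" "hxx \<theta> = fxx \<theta>" "hw \<theta> = fw \<theta>" "hww \<theta> = fww \<theta>"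
    "\<And>z. z \<notin> N \<Longrightarrow> h z = g z" "\<And>z. z \<in> N \<Longrightarrow> h z = \<zeta> z * f z + (1 - \<zeta> z) * g z" "\<And>z. 0 \<le> \<zeta> z" "\<And>z. \<zeta> z \<le> (1::real)"
    by (rule pderivs_extend[OF N(1,2) f g]) (rule that)
  define \<Phi> where "\<Phi> = (\<lambda>z. if z \<in> D then h z else 0)"
  note T = test_function[OF h(1), folded \<Phi>_def]
  have \<theta>: "\<theta> \<in> Om" using N by blast
  have vh: "v z \<le> h z" if z: "z \<in> D" for z
  proof (cases "z \<in> N")
    case True
    have "\<zeta> z * v z \<le> \<zeta> z * f z" "(1 - \<zeta> z) * v z \<le> (1 - \<zeta> z) * g z"
      using le(1)[OF True] le(2)[OF z] h(10)[of z] h(11)[of z] by (auto intro: mult_left_mono)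
    then show ?thesis unfolding h(9)[OF True] by (simp add: algebra_simps)
  next
    case False
    show ?thesis unfolding h(8)[OF False] by (rule le(2)[OF z])
  qed
  have "\<Phi> z = h z" if "z \<in> Om" for z using that Om_D by (auto simp: \<Phi>_def)
  then have a: "v \<theta> - \<Phi> \<theta> = 0" "\<forall>z\<in>Om. v z - \<Phi> z \<le> 0" using \<theta> h(2) eq vh Om_D by (auto simp: subset_iff)
  have "0 \<le> pd_t \<Phi> \<theta> + hjb_op P n \<delta> \<Phi> \<theta>"
    using v \<theta> T(1) a unfolding visc_subsol_def intD by blast
  then obtain \<gamma> q where gq: "\<gamma> \<in> {0..1}" "q \<in> {0..maxdiv P}" "0 \<le> pd_t \<Phi> \<theta> + ham_of P n \<delta> \<Phi> \<theta> \<gamma> q"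
    unfolding hjb_op_ge_iff by blast
  \<comment> \<open>Since \<open>N\<close> is contained in the open set \<open>Om\<close>, it misses
    the line \<open>w = -\<delta>\<close>, where \<open>h\<close> is therefore just
    \<open>g\<close>.\<close>
  have "Il h \<theta> = Il g \<theta>"
  proof (rule set_lebesgue_integral_cong)
    show "\<forall>u. u \<in> {0..xc \<theta> + \<delta>} \<longrightarrow> h (sc \<theta>, xc \<theta> - u, - \<delta>) = g (sc \<theta>, xc \<theta> - u, - \<delta>)"
    proof (intro allI impI h(8))
      fix u show "(sc \<theta>, xc \<theta> - u, - \<delta>) \<notin> N" using N(3) by auto
    qed
  qed simp
  then have "0 \<le> Hm \<gamma> q \<theta> (Il g \<theta>) (v \<theta>) (ft \<theta>) (fx \<theta>) (fxx \<theta>) (fw \<theta>) (fww \<theta>)"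
    using gq(3) unfolding T(2)[OF \<theta>] h(2-7) eq by simp
  then show ?thesis by (rule bexI[OF bexI[OF _ gq(2)] gq(1)])
qed

text \<open>The same splicing from below: \<open>h\<close> is a convex combination of two functions
  that lie below \<open>v\<close>. A nonpositive supremum bounds every control.\<close>

lemma supersol_test:
  assumes v: "visc_supersol P n \<delta> v" and N: "open N" "\<theta> \<in> N" "N \<subseteq> Om" and f: "pderivs N f ft fx fxx fw fww"
    and g: "pderivs UNIV g gt gx gxx gw gww" and eq: "f \<theta> = v \<theta>" and le: "\<And>z. z \<in> N \<Longrightarrow> f z \<le> v z" "\<And>z. z \<in> D \<Longrightarrow> g z \<le> v z"
    and gq: "\<gamma> \<in> {0..1}" "q \<in> {0..maxdiv P}"
  shows "Hm \<gamma> q \<theta> (Il g \<theta>) (v \<theta>) (ft \<theta>) (fx \<theta>) (fxx \<theta>) (fw \<theta>) (fww \<theta>) \<le> 0"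
proof -
  obtain h ht hx hxx hw hww \<zeta> where h: "pderivs UNIV h ht hx hxx hw hww"
    "h \<theta> = f \<theta>" "ht \<theta> = ft \<theta>" "hx \<theta> = fx \<theta>" "hxx \<theta> = fxx \<theta>" "hw \<theta> = fw \<theta>" "hww \<theta> = fww \<theta>"
    "\<And>z. z \<notin> N \<Longrightarrow> h z = g z" "\<And>z. z \<in> N \<Longrightarrow> h z = \<zeta> z * f z + (1 - \<zeta> z) * g z" "\<And>z. 0 \<le> \<zeta> z" "\<And>z. \<zeta> z \<le> (1::real)"
    by (rule pderivs_extend[OF N(1,2) f g]) (rule that)
  define \<Phi> where "\<Phi> = (\<lambda>z. if z \<in> D then h z else 0)"
  note T = test_function[OF h(1), folded \<Phi>_def]
  have \<theta>: "\<theta> \<in> Om" using N by blast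
  have vh: "h z \<le> v z" if z: "z \<in> D" for z
  proof (cases "z \<in> N")
    case True
    have "\<zeta> z * f z \<le> \<zeta> z * v z" "(1 - \<zeta> z) * g z \<le> (1 - \<zeta> z) * v z"
      using le(1)[OF True] le(2)[OF z] h(10)[of z] h(11)[of z] by (auto intro: mult_left_mono)
    then show ?thesis unfolding h(9)[OF True] by (simp add: algebra_simps)
  next
    case False
    show ?thesis unfolding h(8)[OF False] by (rule le(2)[OF z])
  qed
  have "\<Phi> z = h z" if "z \<in> Om" for z using that Om_D by (auto simp: \<Phi>_def)
  then have a: "v \<theta> - \<Phi> \<theta> = 0" "\<forall>z\<in>Om. 0 \<le> v z - \<Phi> z" using \<theta> h(2) eq vh Om_D by (auto simp: subset_iff)
  have "pd_t \<Phi> \<theta> + hjb_op P n \<delta> \<Phi> \<theta> \<le> 0"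
    using v \<theta> T(1) a unfolding visc_supersol_def intD by blast
  then have H: "pd_t \<Phi> \<theta> + ham_of P n \<delta> \<Phi> \<theta> \<gamma> q \<le> 0"
    unfolding hjb_op_le_iff using gq by blast
  have "Il h \<theta> = Il g \<theta>"
  proof (rule set_lebesgue_integral_cong)
    show "\<forall>u. u \<in> {0..xc \<theta> + \<delta>} \<longrightarrow> h (sc \<theta>, xc \<theta> - u, - \<delta>) = g (sc \<theta>, xc \<theta> - u, - \<delta>)"
    proof (intro allI impI h(8))
      fix u show "(sc \<theta>, xc \<theta> - u, - \<delta>) \<notin> N" using N(3) by auto
    qed
  qed simp
  then show ?thesis using H unfolding T(2)[OF \<theta>] h(2-7) eq by simp
qed

text \<open>A test function may be arbitrarily large on \<open>w = -\<delta>\<close>; if the intensity were negative somewhere this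
  would violate the subsolution inequality there.\<close>

lemma intensity_nonneg:
  assumes v: "visc_subsol P n \<delta> v" and bd: "bounded (v ` D)" and w1: "- \<delta> < w1" "w1 < T1 + \<delta>"
  shows "0 \<le> lam w1"
proof (rule ccontr)
  assume "\<not> 0 \<le> lam w1"
  then have neg: "lam w1 < 0" by simp
  obtain b1 where b1: "\<And>b. b \<ge> b1 \<Longrightarrow> measure \<mu> {0..b} \<ge> 1 / 2" by (rule line_mass_pos) (rule that)
  \<comment> \<open>A time with \<open>w1 < s1 + \<delta>\<close>, so that \<open>w1\<close> occurs
    in the interior slice; the capital \<open>x1\<close> is then taken large enough for the claim
    integral to have mass at least \<open>1 / 2\<close>.\<close>
  obtain s1 where s1: "max 0 (w1 - \<delta>) < s1" "s1 < T1" using dense[of "max 0 (w1 - \<delta>)" T1] T1 w1 by auto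
  define x1 where "x1 = \<bar>b1\<bar> + 1"
  define \<theta>1 where "\<theta>1 = (s1,x1,w1)"
  have \<theta>1: "\<theta>1 \<in> Om" using s1 w1 \<delta> by (auto simp: \<theta>1_def x1_def)
  have "\<forall>w\<in>{- \<delta><..<T1 + \<delta>}. isCont lam w"
    using lam_continuous unfolding continuous_on_eq_continuous_at[OF open_greaterThanLessThan] .
  then have "isCont lam w1" by (rule bspec) (use w1 in simp)
  then have "((\<lambda>z. lam (wc z)) \<longlongrightarrow> lam (wc \<theta>1)) (nhds \<theta>1)"
  proof (intro isCont_tendsto_compose[of "wc \<theta>1" lam])
    show "((\<lambda>z. wc z) \<longlongrightarrow> wc \<theta>1) (nhds \<theta>1)" by (intro tendsto_intros filterlim_ident)
  qed (simp add: \<theta>1_def)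
  then have "\<forall>\<^sub>F z in nhds \<theta>1. lam (wc z) < lam w1 / 2" by (rule order_tendstoD(2)) (use neg in \<open>simp add: \<theta>1_def\<close>)
  moreover have "\<forall>\<^sub>F z in nhds \<theta>1. z \<in> Om" using open_Om \<theta>1 by (rule eventually_nhds_in_open)
  moreover have "\<forall>\<^sub>F z in nhds \<theta>1. b1 < xc z"
  proof (rule order_tendstoD(1))
    show "((\<lambda>z. xc z) \<longlongrightarrow> xc \<theta>1) (nhds \<theta>1)" by (intro tendsto_intros filterlim_ident)
  qed (simp add: \<theta>1_def x1_def)
  ultimately have "\<forall>\<^sub>F z in nhds \<theta>1. lam (wc z) < lam w1 / 2 \<and> z \<in> Om \<and> b1 < xc z" by eventually_elim simp
  then obtain R where R: "R > 0" "\<And>z. dist z \<theta>1 < R \<Longrightarrow> lam (wc z) < lam w1 / 2 \<and> z \<in> Om \<and> b1 < xc z"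
    unfolding eventually_nhds_metric by blast
  define r where "r = R / 2"
  have r: "r > 0" "r < R" using R by (simp_all add: r_def)
  obtain B where "\<forall>y\<in>v ` D. \<bar>y\<bar> \<le> B" using bd unfolding bounded_real ..
  then have B: "\<bar>v z\<bar> \<le> B" if "z \<in> D" for z using that by simp
  have B0: "B \<ge> 0" using B[of \<theta>1] \<theta>1 Om_D by fastforce
  \<comment> \<open>\<open>v\<close> is only semicontinuous and need not be touchable at
    \<open>\<theta>1\<close>. With \<open>k * r^2\<close> above the oscillation of \<open>v\<close>,
    a paraboloid touches it inside the ball.\<close>
  define k where "k = (2 * B + 1) / r\<^sup>2"
  have k: "k > 0" "k * r\<^sup>2 = 2 * B + 1" using r B0 by (simp_all add: k_def)
  have cb: "z \<in> Om" "z \<in> D" if "z \<in> cball \<theta>1 r" for z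
  proof -
    show "z \<in> Om" using R(2)[of z] that r by (simp add: dist_commute)
    then show "z \<in> D" using Om_D by blast
  qed
  have "usc_on D v" using v by (simp add: visc_subsol_def)
  then have "usc_on (cball \<theta>1 r) v" by (rule usc_on_subset) (use cb(2) in blast)
  moreover have "usc_on (cball \<theta>1 r) (\<lambda>z. - (k * (norm (z - \<theta>1))\<^sup>2))"
    by (intro continuous_on_imp_usc_on continuous_intros)
  ultimately have u: "usc_on (cball \<theta>1 r) (\<lambda>z. v z + - (k * (norm (z - \<theta>1))\<^sup>2))" by (rule usc_on_add)
  have "cball \<theta>1 r \<noteq> {}" using r by simp
  then obtain \<theta> where \<theta>: "\<theta> \<in> cball \<theta>1 r" "\<And>y. y \<in> cball \<theta>1 r \<Longrightarrow> v y + - (k * (norm (y - \<theta>1))\<^sup>2) \<le> v \<theta> + - (k * (norm (\<theta> - \<theta>1))\<^sup>2)"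
    by (rule usc_attains_sup[OF compact_cball _ u]) (rule that)
  have "\<theta>1 \<in> cball \<theta>1 r" using r by simp
  from \<theta>(2)[OF this] have "k * (norm (\<theta> - \<theta>1))\<^sup>2 < k * r\<^sup>2"
    unfolding k(2) using B[OF cb(2)[OF \<theta>(1)]] B[OF cb(2)[OF \<open>\<theta>1 \<in> cball \<theta>1 r\<close>]] by (simp add: abs_le_iff)
  then have "(norm (\<theta> - \<theta>1))\<^sup>2 < r\<^sup>2" using k(1) by simp
  then have \<theta>b: "\<theta> \<in> ball \<theta>1 r" using r power_less_imp_less_base[of "norm (\<theta> - \<theta>1)" 2 r] by (simp add: dist_norm norm_minus_commute)
  define f where "f = (\<lambda>z. k * (norm (z - (s1,x1,w1)))\<^sup>2 + (v \<theta> - k * (norm (\<theta> - \<theta>1))\<^sup>2))"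
  note Pf = pderivs_add[OF pderivs_quadratic[of k s1 x1 w1] pderivs_const[of UNIV "v \<theta> - k * (norm (\<theta> - \<theta>1))\<^sup>2"], folded f_def, THEN pderivs_subset[OF _ subset_UNIV[of "ball \<theta>1 r"]]]
  have feq: "f \<theta> = v \<theta>" by (simp add: f_def \<theta>1_def)
  have fle: "v z \<le> f z" if "z \<in> ball \<theta>1 r" for z
  proof -
    have "z \<in> cball \<theta>1 r" using that by simp
    from \<theta>(2)[OF this] show ?thesis by (simp add: f_def \<theta>1_def)
  qed
  have bO: "ball \<theta>1 r \<subseteq> Om" using cb(1) by (meson ball_subset_cball subsetD subsetI)
  let ?H = "\<lambda>\<gamma> q I. Hm \<gamma> q \<theta> I (v \<theta>) (2 * k * (sc \<theta> - s1) + 0) (2 * k * (xc \<theta> - x1) + 0) (2 * k + 0) (2 * k * (wc \<theta> - w1) + 0) (2 * k + 0)"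
  obtain \<gamma>0 q0 where m: "\<gamma>0 \<in> {0..1}" "q0 \<in> {0..maxdiv P}"
    "\<And>\<gamma> q. \<gamma> \<in> {0..1} \<Longrightarrow> q \<in> {0..maxdiv P} \<Longrightarrow> ?H \<gamma> q 0 \<le> ?H \<gamma>0 q0 0"
    by (rule Hm_attains) (rule that)
  have HI: "?H \<gamma> q I = ?H \<gamma> q 0 + lam (wc \<theta>) * I" for \<gamma> q I by (simp add: Hm_def)
  \<comment> \<open>A constant above \<open>v\<close>, so large that its claim integral, weighted by
    an intensity below \<open>lam w1 / 2\<close>, outweighs the largest possible remainder of the
    operator.\<close>
  define Rb where "Rb = B + 4 * \<bar>?H \<gamma>0 q0 0\<bar> / (- lam w1) + 4 / (- lam w1)"
  have "0 \<le> 4 * \<bar>?H \<gamma>0 q0 0\<bar> / (- lam w1)" "0 \<le> 4 / (- lam w1)" using neg by (intro divide_nonneg_pos; simp)+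
  then have Rb: "B \<le> Rb" "0 \<le> Rb" using B0 unfolding Rb_def by linarith+
  obtain \<gamma> q where gq: "\<gamma> \<in> {0..1}" "q \<in> {0..maxdiv P}" "0 \<le> ?H \<gamma> q (Il (\<lambda>_. Rb) \<theta>)"
    using subsol_test[OF v open_ball \<theta>b bO Pf pderivs_const feq fle, of Rb] B Rb(1) by (force simp: abs_le_iff)
  have l: "lam (wc \<theta>) < lam w1 / 2" "b1 < xc \<theta>" using R(2)[of \<theta>] \<theta>b r by (auto simp: dist_commute)
  have mm: "Rb * (1 / 2) \<le> Rb * measure \<mu> {0..xc \<theta> + \<delta>}"
    using b1[of "xc \<theta> + \<delta>"] l(2) \<delta> Rb by (intro mult_left_mono) auto
  have "lam (wc \<theta>) * Il (\<lambda>_. Rb) \<theta> \<le> lam (wc \<theta>) * (Rb * (1 / 2))"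
    unfolding line_const by (rule mult_left_mono_neg[OF mm]) (use l(1) neg in linarith)
  also have "\<dots> \<le> lam w1 / 2 * (Rb * (1 / 2))" using l(1) Rb(2) by (intro mult_right_mono) linarith+
  also have "\<dots> < - \<bar>?H \<gamma>0 q0 0\<bar>"
  proof -
    have "lam w1 / 4 * Rb = lam w1 / 4 * B - \<bar>?H \<gamma>0 q0 0\<bar> - 1" using neg by (simp add: Rb_def field_simps)
    moreover have "lam w1 / 4 * B \<le> 0" using neg B0 by (simp add: mult_nonpos_nonneg)
    ultimately show ?thesis by simp
  qed
  finally show False using gq(3) m(3)[OF gq(1,2)] unfolding HI[of \<gamma> q "Il (\<lambda>_. Rb) \<theta>"] by linarith
qed

text \<open>The penalty vanishes exactly on the part of the line \<open>s = s0\<close>,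
  \<open>w = -\<delta>\<close> with \<open>x \<le> x0\<close>. If no \<open>C\<close> sufficed,
  points violating the bound with ever larger constants would accumulate on this line, where
  \<open>V\<close> equals \<open>\<psi>\<close>; semicontinuity excludes that.\<close>

lemma line_majorant:
  assumes V: "usc_on D V" "\<And>z. z \<in> D \<Longrightarrow> V z \<le> A" and \<psi>: "continuous_on UNIV \<psi>" "\<And>z. z \<in> D \<Longrightarrow> B \<le> \<psi> z"
    and s0: "0 < s0" "s0 < T1" and eq: "\<And>x. - \<delta> \<le> x \<Longrightarrow> V (s0,x,- \<delta>) = \<psi> (s0,x,- \<delta>)" and \<eta>: "\<eta> > 0"
  obtains C where "\<And>z. z \<in> D \<Longrightarrow> V z \<le> \<psi> z + \<eta> + C * ((sc z - s0)\<^sup>2 + pos3 (xc z - x0) + (wc z + \<delta>)\<^sup>2)"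
proof (rule ccontr)
  assume neg: "\<not> thesis"
  define pen where "pen = (\<lambda>z. (sc z - s0)\<^sup>2 + pos3 (xc z - x0) + (wc z + \<delta>)\<^sup>2)"
  have "\<exists>z. z \<in> D \<and> \<psi> z + \<eta> + real (Suc n) * pen z < V z" for n
  proof (rule ccontr)
    assume no: "\<not> ?thesis"
    have "V z \<le> \<psi> z + \<eta> + real (Suc n) * pen z" if "z \<in> D" for z
    proof (rule ccontr)
      assume "\<not> ?thesis"
      then have "z \<in> D \<and> \<psi> z + \<eta> + real (Suc n) * pen z < V z" using that by linarith
      then show False using no by (rule notE[rotated, OF exI])
    qed
    then show False using neg that[of "real (Suc n)"] unfolding pen_def by blast
  qed
  then have "\<forall>n. \<exists>z. z \<in> D \<and> \<psi> z + \<eta> + real (Suc n) * pen z < V z" ..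
  from choice[OF this] obtain Z where Z0: "\<forall>n. Z n \<in> D \<and> \<psi> (Z n) + \<eta> + real (Suc n) * pen (Z n) < V (Z n)" ..
  then have Z: "Z n \<in> D" "\<psi> (Z n) + \<eta> + real (Suc n) * pen (Z n) < V (Z n)" for n by simp_all
  have p0: "0 \<le> pen z" for z unfolding pen_def using pos3_cases(2) by simp
  have pn: "pen (Z n) \<le> \<bar>A - B\<bar> * (1 / real (Suc n))" for n
  proof -
    have "real (Suc n) * pen (Z n) \<le> \<bar>A - B\<bar>" using Z(2)[of n] V(2)[OF Z(1), of n] \<psi>(2)[OF Z(1), of n] \<eta> by linarith
    then show ?thesis by (simp add: field_simps)
  qed
  have pl: "(\<lambda>n. pen (Z n)) \<longlonglongrightarrow> 0"
  proof (rule tendsto_sandwich[OF always_eventually always_eventually tendsto_const])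
    show "\<forall>n. pen (Z n) \<le> \<bar>A - B\<bar> * (1 / real (Suc n))" using pn by blast
    show "(\<lambda>n. \<bar>A - B\<bar> * (1 / real (Suc n))) \<longlonglongrightarrow> 0"
      using tendsto_mult_left[OF LIMSEQ_Suc[OF lim_1_over_n], of "\<bar>A - B\<bar>"] by simp
  qed (use p0 in simp)
  \<comment> \<open>Beyond distance one from \<open>x0\<close> the cube dominates its base, so
    bounded penalties bound the capitals and a convergent subsequence exists.\<close>
  define X where "X = \<bar>x0\<bar> + \<bar>A - B\<bar> + 1"
  have pb: "pen (Z n) \<le> \<bar>A - B\<bar>" for n
  proof -
    have "\<bar>A - B\<bar> * (1 / real (Suc n)) \<le> \<bar>A - B\<bar> * 1" by (intro mult_left_mono) auto
    with pn[of n] show ?thesis by simp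
  qed
  have xb: "xc (Z n) \<le> X" for n
  proof (rule ccontr)
    assume "\<not> xc (Z n) \<le> X"
    then have t: "1 \<le> xc (Z n) - x0" "\<bar>A - B\<bar> < xc (Z n) - x0" by (simp_all add: X_def)
    have "(xc (Z n) - x0) ^ 1 \<le> (xc (Z n) - x0) ^ 3" by (rule power_increasing) (use t in auto)
    then have "xc (Z n) - x0 \<le> pos3 (xc (Z n) - x0)" using pos3_cases(3)[of "xc (Z n) - x0"] t by simp
    also have "\<dots> \<le> pen (Z n)" by (simp add: pen_def)
    finally show False using pb[of n] t by linarith
  qed
  have "Z n \<in> cbox (0, - \<delta>, - \<delta>) (T1, X, T1 + \<delta>)" for n
  proof -
    obtain s x w where z: "Z n = (s,x,w)" by (cases "Z n")
    show ?thesis using Z(1)[of n] xb[of n] unfolding z cbox_Pair_eq by (auto simp: D_iff)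
  qed
  then have "seq_compact (cbox (0, - \<delta>, - \<delta>) (T1, X, T1 + \<delta>))" "\<forall>n. Z n \<in> cbox (0, - \<delta>, - \<delta>) (T1, X, T1 + \<delta>)"
    using compact_cbox by (simp_all add: compact_eq_seq_compact_metric[symmetric])
  then obtain l r where l: "l \<in> cbox (0, - \<delta>, - \<delta>) (T1, X, T1 + \<delta>)" "strict_mono r" "(Z \<circ> r) \<longlonglongrightarrow> l" by (rule seq_compactE)
  have Zr: "(\<lambda>n. Z (r n)) \<longlonglongrightarrow> l" using l(3) by (simp add: o_def)
  have pr: "(\<lambda>n. pen (Z (r n))) \<longlonglongrightarrow> 0" using LIMSEQ_subseq_LIMSEQ[OF pl l(2)] by (simp add: o_def)
  have pc: "continuous_on UNIV pen" unfolding pen_def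
    by (intro continuous_intros continuous_on_compose2[OF pos_continuous(2)[of UNIV]]) auto
  have "isCont pen l" using pc continuous_on_eq_continuous_at[OF open_UNIV] by blast
  from isCont_tendsto_compose[OF this Zr] pr have "pen l = 0" by (rule LIMSEQ_unique)
  moreover have "0 \<le> (sc l - s0)\<^sup>2" "0 \<le> (wc l + \<delta>)\<^sup>2" "0 \<le> pos3 (xc l - x0)" by (simp_all add: pos3_cases)
  ultimately have "(sc l - s0)\<^sup>2 = 0" "(wc l + \<delta>)\<^sup>2 = 0" unfolding pen_def by linarith+
  then have sw: "sc l = s0" "wc l = - \<delta>" by simp_all
  obtain x where le: "l = (s0,x,- \<delta>)" using sw by (cases l) auto
  have x: "- \<delta> \<le> x" using l(1) unfolding le cbox_Pair_eq by auto
  have lD: "l \<in> D" using x s0 \<delta> by (simp add: le D_iff)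
  have "\<forall>\<^sub>F n in sequentially. V (Z (r n)) < V l + \<eta> / 2"
    by (rule usc_on_eventually[OF V(1) lD Zr]) (use Z(1) \<eta> in simp_all)
  moreover have "\<forall>\<^sub>F n in sequentially. \<psi> l - \<eta> / 2 < \<psi> (Z (r n))"
  proof (rule order_tendstoD(1))
    have "isCont \<psi> l" using \<psi>(1) continuous_on_eq_continuous_at[OF open_UNIV] by blast
    then show "(\<lambda>n. \<psi> (Z (r n))) \<longlonglongrightarrow> \<psi> l" by (rule isCont_tendsto_compose[OF _ Zr])
  qed (use \<eta> in simp)
  ultimately have "\<forall>\<^sub>F n in sequentially. False"
  proof eventually_elim
    case (elim n)
    have "0 \<le> real (Suc (r n)) * pen (Z (r n))" using p0 by simp
    then show False using elim Z(2)[of "r n"] eq[OF x] unfolding le by linarith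
  qed
  then show False by simp
qed

lemma majorant_pderivs:
  obtains gt gx gxx gw gww where "pderivs UNIV (\<lambda>z. \<Psi> z + (case z of (s,x,w) \<Rightarrow> C * (s - s0)\<^sup>2 + C * pos3 (x - x0) + (C * (w + \<delta>)\<^sup>2 + k))) gt gx gxx gw gww"
proof -
  have p3: "((\<lambda>x. C * pos3 (x - x0)) has_real_derivative C * (3 * pos2 (x - x0))) (at x)" for x
    using DERIV_cmult[OF pos3_deriv[of "x - x0"], of C] DERIV_shift[of "\<lambda>t. C * pos3 t" _ x "- x0"] by simp
  have p2: "((\<lambda>x. C * (3 * pos2 (x - x0))) has_real_derivative C * (3 * (2 * max 0 (x - x0)))) (at x)" for x
    using DERIV_cmult[OF DERIV_cmult[OF pos2_deriv[of "x - x0"], of 3], of C] DERIV_shift[of "\<lambda>t. C * (3 * pos2 t)" _ x "- x0"] by simp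
  have "pderivs UNIV (\<lambda>(s,x,w). C * (s - s0)\<^sup>2 + C * pos3 (x - x0) + (C * (w + \<delta>)\<^sup>2 + k)) (\<lambda>(s,x,w). C * (2 * (s - s0)))
    (\<lambda>(s,x,w). C * (3 * pos2 (x - x0))) (\<lambda>(s,x,w). C * (3 * (2 * max 0 (x - x0)))) (\<lambda>(s,x,w). C * (2 * (w + \<delta>))) (\<lambda>(s,x,w). C * 2)"
    by (rule pderivs_sep[OF _ _ p3 p2]) (auto intro!: derivative_eq_intros continuous_intros)
  from that[OF pderivs_add[OF Psi_pderivs this]] show ?thesis .
qed

end

text \<open>That \<open>\<theta>\<close> is in the closure of \<open>S\<close> keeps the sets under
  \<open>SUP\<close> and \<open>INF\<close> nonempty; continuity of \<open>h\<close> then squeezes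
  both.\<close>

lemma envelopes_of_continuous:
  assumes h: "continuous_on T h" and S: "S \<subseteq> T" "\<And>z. z \<in> S \<Longrightarrow> g z = h z" and \<theta>: "\<theta> \<in> T" "\<theta> \<in> closure S"
  shows "upper_env S g \<theta> = h \<theta>" and "lower_env S g \<theta> = h \<theta>"
proof -
  have *: "\<forall>\<^sub>F \<rho> in at_right 0. dist (SUP \<eta>\<in>{\<eta>\<in>S. dist \<eta> \<theta> \<le> \<rho>}. g \<eta>) (h \<theta>) < e \<and>
      dist (INF \<eta>\<in>{\<eta>\<in>S. dist \<eta> \<theta> \<le> \<rho>}. g \<eta>) (h \<theta>) < e" if e: "e > 0" for e
  proof -
    have "e / 2 > 0" using e by simp
    then obtain d where d: "d > 0" "\<And>\<eta>. \<eta> \<in> T \<Longrightarrow> dist \<eta> \<theta> < d \<Longrightarrow> dist (h \<eta>) (h \<theta>) < e / 2"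
      using h \<theta>(1) unfolding continuous_on_iff by meson
    have "\<forall>\<^sub>F \<rho> in at_right 0. \<rho> \<in> {0<..<d}" by (rule eventually_at_right_real[OF d(1)])
    then show ?thesis
    proof eventually_elim
      case (elim \<rho>)
      define R where "R = {\<eta>\<in>S. dist \<eta> \<theta> \<le> \<rho>}"
      obtain y where "y \<in> S" "dist y \<theta> < \<rho>" using \<theta>(2) elim unfolding closure_approachable by auto
      then have y: "y \<in> R" by (simp add: R_def)
      have b: "h \<theta> - e / 2 \<le> g \<eta>" "g \<eta> \<le> h \<theta> + e / 2" if "\<eta> \<in> R" for \<eta>
      proof -
        have "\<eta> \<in> S" "dist \<eta> \<theta> < d" using that elim by (auto simp: R_def)
        then have "dist (g \<eta>) (h \<theta>) < e / 2" using d(2)[of \<eta>] S by auto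
        then show "h \<theta> - e / 2 \<le> g \<eta>" "g \<eta> \<le> h \<theta> + e / 2" unfolding dist_real_def by linarith+
      qed
      have bd: "bdd_above (g ` R)" "bdd_below (g ` R)"
        by (rule bdd_aboveI2[of _ _ "h \<theta> + e / 2"], rule b(2), assumption, rule bdd_belowI2[of _ "h \<theta> - e / 2"], rule b(1), assumption)
      have ne: "R \<noteq> {}" using y by blast
      have "(SUP \<eta>\<in>R. g \<eta>) \<le> h \<theta> + e / 2" by (rule cSUP_least[OF ne b(2)])
      moreover have "h \<theta> - e / 2 \<le> (SUP \<eta>\<in>R. g \<eta>)" by (rule cSUP_upper2[OF bd(1) y b(1)[OF y]])
      moreover have "h \<theta> - e / 2 \<le> (INF \<eta>\<in>R. g \<eta>)" by (rule cINF_greatest[OF ne b(1)])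
      moreover have "(INF \<eta>\<in>R. g \<eta>) \<le> h \<theta> + e / 2" by (rule cINF_lower2[OF bd(2) y b(2)[OF y]])
      ultimately show ?case unfolding R_def[symmetric] dist_real_def using e by linarith
    qed
  qed
  show "upper_env S g \<theta> = h \<theta>" unfolding upper_env_def
    by (rule tendsto_Lim[OF trivial_limit_at_right_real tendstoI]) (rule eventually_mono[OF *], assumption, erule conjunct1)
  show "lower_env S g \<theta> = h \<theta>" unfolding lower_env_def
    by (rule tendsto_Lim[OF trivial_limit_at_right_real tendstoI]) (rule eventually_mono[OF *], assumption, erule conjunct2)
qed

context control
begin

lemma D_approx:
  assumes z: "z \<in> D"
  obtains X where "\<And>n. X n \<in> Om" "X \<longlonglongrightarrow> z"
proof -
  obtain s x w where ze: "z = (s,x,w)" by (cases z)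
  have d: "0 < s" "s \<le> T1" "- \<delta> \<le> x" "- \<delta> \<le> w" "w \<le> s + \<delta>" using z by (simp_all add: ze D_iff)
  \<comment> \<open>In time and \<open>w\<close> the point moves towards \<open>(T1 / 2, 0)\<close>,
    and the capital is increased; every inequality defining \<open>Om\<close> thereby becomes
    strict.\<close>
  define X where "X n = (let t = 1 / real (Suc n) in (s + t * (T1 / 2 - s), x + t, w + t * (0 - w)))" for n
  show ?thesis
  proof (rule that)
    fix n
    define t where "t = 1 / real (Suc n)"
    have t: "0 < t" "t \<le> 1" by (simp_all add: t_def)
    have "0 \<le> (1 - t) * s" "0 \<le> (1 - t) * (w + \<delta>)" "0 \<le> (1 - t) * (s + \<delta> - w)" "0 \<le> (1 - t) * (T1 - s)"
      using t d by simp_all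
    then have c: "0 \<le> s - t * s" "0 \<le> w + \<delta> - t * w - t * \<delta>" "0 \<le> s + \<delta> - w - t * s - t * \<delta> + t * w" "0 \<le> T1 - s - t * T1 + t * s"
      unfolding left_diff_distrib distrib_left right_diff_distrib by linarith+
    have p: "0 < t * T1" "0 < t * \<delta>" using t T1 \<delta> by simp_all
    have e: "t * (T1 / 2 - s) = t * T1 / 2 - t * s" "t * (0 - w) = - (t * w)" by (simp_all add: right_diff_distrib)
    show "X n \<in> Om" unfolding X_def Let_def t_def[symmetric] e mem_Collect_eq split_conv
      using c p t d by (intro conjI; linarith)
  next
    have "(\<lambda>n. 1 / real (Suc n)) \<longlonglongrightarrow> 0" using LIMSEQ_Suc[OF lim_1_over_n] by simp
    then have "(\<lambda>n. (s + 1 / real (Suc n) * (T1 / 2 - s), x + 1 / real (Suc n), w + 1 / real (Suc n) * (0 - w)))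
        \<longlonglongrightarrow> (s + 0 * (T1 / 2 - s), x + 0, w + 0 * (0 - w))"
      by (intro tendsto_Pair tendsto_add tendsto_mult tendsto_const)
    then show "X \<longlonglongrightarrow> z" unfolding X_def Let_def ze by simp
  qed
qed

text \<open>Test functions are ordered against solutions in the interior only, but the claim
  integral runs along the boundary line \<open>w = -\<delta>\<close>.\<close>

lemma nonneg_on_D:
  assumes h: "continuous_on D h" "\<And>z. z \<in> Om \<Longrightarrow> (0::real) \<le> h z" and z: "z \<in> D"
  shows "0 \<le> h z"
proof -
  obtain X where X: "\<And>n. X n \<in> Om" "X \<longlonglongrightarrow> z" by (rule D_approx[OF z]) (rule that)
  have XD: "X n \<in> D" for n by (rule subsetD[OF Om_D X(1)])
  have "(\<lambda>n. h (X n)) \<longlonglongrightarrow> h z" by (rule continuous_on_tendsto_compose[OF h(1) X(2) z always_eventually]) (use XD in blast)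
  then show ?thesis by (rule LIMSEQ_le_const) (use h(2)[OF X(1)] in blast)
qed

lemma D_closure: "z \<in> D \<Longrightarrow> z \<in> closure Om"
  by (rule D_approx) (auto simp: closure_sequential)

lemma line_C: "0 < s \<Longrightarrow> s < T1 \<Longrightarrow> (s,x,- \<delta>) \<in> dom_C P \<delta>"
  by (auto simp: dom_C_def slice_def T1_def)

lemma D_C: "z \<in> D \<Longrightarrow> z \<notin> Om \<Longrightarrow> z \<in> dom_C P \<delta>"
  by (cases z) (auto simp: dom_C_def slice_def T1_def dom_D_def)

lemma Il_shift:
  assumes "\<And>u. 0 \<le> u \<Longrightarrow> g (sc z, xc z - u, - \<delta>) = \<Psi> (sc z, xc z - u, - \<delta>) + k"
  shows "Il g z = J z + k * measure \<mu> {0..xc z + \<delta>}"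
proof -
  have "Il g z = (LINT u:{0..xc z + \<delta>}|\<mu>. \<Psi> (sc z, xc z - u, - \<delta>) + k)"
    by (rule set_lebesgue_integral_cong) (use assms in simp_all)
  also have "\<dots> = J z + (LINT u:{0..xc z + \<delta>}|\<mu>. k)"
    unfolding J_def by (rule set_integral_add(2)[OF line_integrable[OF Psi_line] line_integrable[OF continuous_on_const]])
  finally show ?thesis unfolding line_const .
qed

end

section \<open>Reduction to the local equation\<close>

text \<open>The range is that of \<open>w\<close> in the interior domain. The assumption is
  discharged by any bounded viscosity subsolution.\<close>

locale control_pos = control +
  assumes lam: "\<And>w. - \<delta> < w \<Longrightarrow> w < T1 + \<delta> \<Longrightarrow> 0 \<le> lam w"
begin

text \<open>The viscosity appears halved, and the nonnegative intensity makes the discount rate a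
  lower bound for the zero order coefficient.\<close>

sublocale H: hjb_dom "vol P" "prem P" "rate P" "drift P" "maxdiv P" "visc P n / 2" "disc P"
  "\<lambda>z. lam (wc z) * J z" "\<lambda>z. disc P + lam (wc z)" T1 \<delta>
proof -
  have l: "continuous_on Om (\<lambda>z. lam (wc z))"
    by (rule continuous_on_compose2[OF lam_continuous]) (auto intro!: continuous_intros)
  have "0 \<le> lam (wc z)" if "z \<in> Om" for z using that by (intro lam) auto
  then show "hjb_dom (prem P) (rate P) (drift P) (maxdiv P) (visc P n / 2) (disc P)
      (\<lambda>z. lam (wc z) * J z) (\<lambda>z. disc P + lam (wc z)) T1 \<delta>"
    by unfold_locales (use model_pos \<delta> T1 open_Om l J_continuous in \<open>auto intro!: continuous_intros\<close>)
qed

lemma HD: "H.D = D" unfolding H.D_def by (simp add: dom_D_def T1_def)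

lemma Hm_opr: "Hm \<gamma> q z I y a b c d e = H.opr \<gamma> q z y a b c d e + lam (wc z) * (I - J z)"
  by (simp add: Hm_def H.opr_def H.diff_def H.drft_def algebra_simps)

lemma lam_Om: "z \<in> Om \<Longrightarrow> 0 \<le> lam (wc z)"
  by (intro lam) auto

text \<open>The global part of the test function is a majorant of \<open>v\<close> within
  \<open>\<eta>\<close> of \<open>\<Psi>\<close> on the piece of the line that the integral sees.
  The nonlocal term thus differs from its prescribed value by an amount too small to repair a strict
  violation.\<close>

lemma vsub_of_visc_subsol:
  assumes v: "visc_subsol P n \<delta> v" and bd: "bounded (v ` D)" and eq: "\<And>z. z \<in> dom_C P \<delta> \<Longrightarrow> v z = \<Psi> z"
  shows "H.vsub v"
  unfolding H.vsub_def
proof (intro allI impI)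
  fix \<theta> N f ft fx fxx fw fww
  assume a: "\<theta> \<in> N" "open N" "N \<subseteq> Om" "pderivs N f ft fx fxx fw fww" "f \<theta> = v \<theta>" "\<forall>z\<in>N. v z \<le> f z"
  let ?O = "\<lambda>\<gamma> q. H.opr \<gamma> q \<theta> (v \<theta>) (ft \<theta>) (fx \<theta>) (fxx \<theta>) (fw \<theta>) (fww \<theta>)"
  show "\<exists>\<gamma>\<in>{0..1}. \<exists>q\<in>{0..maxdiv P}. 0 \<le> ?O \<gamma> q"
  proof (rule ccontr)
    assume neg: "\<not> ?thesis"
    have neg': "?O \<gamma> q < 0" if g: "\<gamma> \<in> {0..1}" "q \<in> {0..maxdiv P}" for \<gamma> q
    proof (rule ccontr)
      assume "\<not> ?thesis"
      then have "0 \<le> ?O \<gamma> q" by simp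
      then show False using neg by (rule notE[rotated, OF bexI[OF bexI[OF _ g(2)] g(1)]])
    qed
    obtain m where m: "m > 0" "\<And>\<gamma> q. \<gamma> \<in> {0..1} \<Longrightarrow> q \<in> {0..maxdiv P} \<Longrightarrow> ?O \<gamma> q \<le> - m"
      by (rule H.opr_negative_uniform[OF neg']) (assumption, assumption, rule that)
    have \<theta>: "\<theta> \<in> Om" by (rule subsetD[OF a(3,1)])
    then have th: "0 < sc \<theta>" "sc \<theta> < T1" by auto
    define L where "L = lam (wc \<theta>) * measure \<mu> {0..xc \<theta> + \<delta>}"
    have L: "0 \<le> L" unfolding L_def using lam_Om[OF \<theta>] by simp
    \<comment> \<open>\<open>L * \<eta>\<close> is the surplus in the nonlocal term; it is kept
      below the violation margin \<open>m\<close>.\<close>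
    define \<eta> where "\<eta> = m / (L + 1)"
    have \<eta>: "\<eta> > 0" "L * \<eta> < m" using L m(1) by (simp_all add: \<eta>_def field_simps)
    obtain A where "\<forall>y\<in>v ` D. \<bar>y\<bar> \<le> A" using bd unfolding bounded_real ..
    then have A: "v z \<le> A" if "z \<in> D" for z using that by (simp add: abs_le_iff)
    obtain K1 where K1: "K1 > 0" "\<And>z. z \<in> dom_D P 1 \<Longrightarrow> 0 \<le> \<Psi> z \<and> \<Psi> z \<le> K1" by (rule Psi_bound) (rule that)
    have P0: "0 \<le> \<Psi> z" if "z \<in> D" for z using K1(2)[OF subsetD[OF D_D1 that]] ..
    have us: "usc_on D v" using v unfolding visc_subsol_def by (elim conjE)
    have vl: "v (sc \<theta>, x, - \<delta>) = \<Psi> (sc \<theta>, x, - \<delta>)" for x by (rule eq[OF line_C[OF th]])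
    obtain C where C: "\<And>z. z \<in> D \<Longrightarrow> v z \<le> \<Psi> z + \<eta> + C * ((sc z - sc \<theta>)\<^sup>2 + pos3 (xc z - xc \<theta>) + (wc z + \<delta>)\<^sup>2)"
      by (rule line_majorant[OF us A Psi_continuous P0 th vl \<eta>(1)]) (assumption, assumption, rule that)
    define g where "g = (\<lambda>z. \<Psi> z + (case z of (s,x,w) \<Rightarrow> C * (s - sc \<theta>)\<^sup>2 + C * pos3 (x - xc \<theta>) + (C * (w + \<delta>)\<^sup>2 + \<eta>)))"
    obtain gt gx gxx gw gww where Pg: "pderivs UNIV g gt gx gxx gw gww"
      by (rule majorant_pderivs[of C "sc \<theta>" "xc \<theta>" \<eta>, folded g_def]) (rule that)
    have g: "v z \<le> g z" if "z \<in> D" for z using C[OF that] by (cases z) (simp add: g_def distrib_left)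
    have "Il g \<theta> = J \<theta> + \<eta> * measure \<mu> {0..xc \<theta> + \<delta>}"
      by (rule Il_shift) (simp add: g_def pos3_cases(1))
    then have Hg: "lam (wc \<theta>) * (Il g \<theta> - J \<theta>) = L * \<eta>" by (simp add: L_def)
    have "\<exists>\<gamma>\<in>{0..1}. \<exists>q\<in>{0..maxdiv P}. 0 \<le> Hm \<gamma> q \<theta> (Il g \<theta>) (v \<theta>) (ft \<theta>) (fx \<theta>) (fxx \<theta>) (fw \<theta>) (fww \<theta>)"
      by (rule subsol_test[OF v a(2,1,3,4) Pg a(5) bspec[OF a(6)] g])
    then obtain \<gamma> q where gq: "\<gamma> \<in> {0..1}" "q \<in> {0..maxdiv P}" "0 \<le> Hm \<gamma> q \<theta> (Il g \<theta>) (v \<theta>) (ft \<theta>) (fx \<theta>) (fxx \<theta>) (fw \<theta>) (fww \<theta>)" by (elim bexE)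
    show False using gq(3) m(2)[OF gq(1,2)] \<eta>(2) unfolding Hm_opr Hg by linarith
  qed
qed

text \<open>As for subsolutions, with a minorant obtained from \<open>line_majorant\<close> for
  \<open>- v\<close> and \<open>- \<Psi>\<close>. The control is fixed beforehand, so an arbitrary
  error \<open>m\<close> replaces the uniform margin.\<close>

lemma vsuper_of_visc_supersol:
  assumes v: "visc_supersol P n \<delta> v" and bd: "bounded (v ` D)" and eq: "\<And>z. z \<in> dom_C P \<delta> \<Longrightarrow> v z = \<Psi> z"
  shows "H.vsuper 0 v"
  unfolding H.vsuper_def
proof (intro allI impI ballI)
  fix \<theta> N f ft fx fxx fw fww and \<gamma> q :: real
  assume a: "\<theta> \<in> N" "open N" "N \<subseteq> Om" "pderivs N f ft fx fxx fw fww" "f \<theta> = v \<theta>" "\<forall>z\<in>N. f z \<le> v z"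
    and gq: "\<gamma> \<in> {0..1}" "q \<in> {0..maxdiv P}"
  show "H.opr \<gamma> q \<theta> (v \<theta>) (ft \<theta>) (fx \<theta>) (fxx \<theta>) (fw \<theta>) (fww \<theta>) \<le> - 0"
  proof (rule field_le_epsilon)
    fix m :: real assume m: "m > 0"
    have \<theta>: "\<theta> \<in> Om" by (rule subsetD[OF a(3,1)])
    then have th: "0 < sc \<theta>" "sc \<theta> < T1" by auto
    define L where "L = lam (wc \<theta>) * measure \<mu> {0..xc \<theta> + \<delta>}"
    have L: "0 \<le> L" unfolding L_def using lam_Om[OF \<theta>] by simp
    define \<eta> where "\<eta> = m / (L + 1)"
    have \<eta>: "\<eta> > 0" "L * \<eta> < m" using L m by (simp_all add: \<eta>_def field_simps)
    obtain A where "\<forall>y\<in>v ` D. \<bar>y\<bar> \<le> A" using bd unfolding bounded_real ..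
    then have A: "- v z \<le> A" if "z \<in> D" for z using that by (simp add: abs_le_iff)
    obtain K1 where K1: "K1 > 0" "\<And>z. z \<in> dom_D P 1 \<Longrightarrow> 0 \<le> \<Psi> z \<and> \<Psi> z \<le> K1" by (rule Psi_bound) (rule that)
    have P0: "- K1 \<le> - \<Psi> z" if "z \<in> D" for z using K1(2)[OF subsetD[OF D_D1 that]] by simp
    have "lsc_on D v" using v unfolding visc_supersol_def by (elim conjE)
    then have us: "usc_on D (\<lambda>z. - v z)" unfolding lsc_on_iff_usc_on .
    have vl: "- v (sc \<theta>, x, - \<delta>) = - \<Psi> (sc \<theta>, x, - \<delta>)" for x using eq[OF line_C[OF th]] by simp
    obtain C where C: "\<And>z. z \<in> D \<Longrightarrow> - v z \<le> - \<Psi> z + \<eta> + C * ((sc z - sc \<theta>)\<^sup>2 + pos3 (xc z - xc \<theta>) + (wc z + \<delta>)\<^sup>2)"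
      by (rule line_majorant[OF us A continuous_on_minus[OF Psi_continuous] P0 th vl \<eta>(1)]) (assumption, assumption, rule that)
    define g where "g = (\<lambda>z. \<Psi> z + (case z of (s,x,w) \<Rightarrow> - C * (s - sc \<theta>)\<^sup>2 + - C * pos3 (x - xc \<theta>) + (- C * (w + \<delta>)\<^sup>2 + - \<eta>)))"
    obtain gt gx gxx gw gww where Pg: "pderivs UNIV g gt gx gxx gw gww"
      by (rule majorant_pderivs[of "- C" "sc \<theta>" "xc \<theta>" "- \<eta>", folded g_def]) (rule that)
    have g: "g z \<le> v z" if "z \<in> D" for z using C[OF that] by (cases z) (simp add: g_def distrib_left)
    have "Il g \<theta> = J \<theta> + - \<eta> * measure \<mu> {0..xc \<theta> + \<delta>}"
      by (rule Il_shift) (simp add: g_def pos3_cases(1))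
    then have Hg: "lam (wc \<theta>) * (Il g \<theta> - J \<theta>) = - (L * \<eta>)" by (simp add: L_def)
    have "Hm \<gamma> q \<theta> (Il g \<theta>) (v \<theta>) (ft \<theta>) (fx \<theta>) (fxx \<theta>) (fw \<theta>) (fww \<theta>) \<le> 0"
      by (rule supersol_test[OF v a(2,1,3,4) Pg a(5) bspec[OF a(6)] g gq])
    then show "H.opr \<gamma> q \<theta> (v \<theta>) (ft \<theta>) (fx \<theta>) (fxx \<theta>) (fw \<theta>) (fww \<theta>) \<le> - 0 + m"
      using \<eta>(2) unfolding Hm_opr Hg by linarith
  qed
qed

lemma line_compare:
  assumes \<theta>: "\<theta> \<in> Om" and f: "continuous_on D f" and g: "continuous_on D g" and le: "\<And>z. z \<in> Om \<Longrightarrow> f z \<le> g z"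
  shows "Il f \<theta> \<le> Il g \<theta>"
proof -
  have t: "0 < sc \<theta>" "sc \<theta> \<le> T1" using \<theta> by auto
  have le': "f z \<le> g z" if "z \<in> D" for z
    using nonneg_on_D[of "\<lambda>z. g z - f z", OF continuous_on_diff[OF g f] _ that] le by simp
  have c: "continuous_on {0..xc \<theta> + \<delta>} (\<lambda>u. h (sc \<theta>, xc \<theta> - u, - \<delta>))" if "continuous_on D h" for h :: "point \<Rightarrow> real"
    by (rule continuous_on_compose2[OF that]) (use line_in_D[OF t] in \<open>auto intro!: continuous_intros\<close>)
  show ?thesis by (rule set_integral_mono[OF line_integrable[OF c[OF f]] line_integrable[OF c[OF g]] le'[OF line_in_D[OF t]]])
qed

lemma line_Psi:
  assumes \<theta>: "\<theta> \<in> Om" and eq: "\<And>z. z \<in> dom_C P \<delta> \<Longrightarrow> U z = \<Psi> z"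
  shows "Il U \<theta> = J \<theta>"
proof -
  have th: "0 < sc \<theta>" "sc \<theta> < T1" using \<theta> by auto
  show ?thesis unfolding J_def eq[OF line_C[OF th]] ..
qed

text \<open>A test function above \<open>U\<close> has a claim integral at least that of
  \<open>U\<close>, namely the source \<open>J\<close>. As the intensity is nonnegative, the
  nonlocal inequality follows from the local one.\<close>

lemma visc_subsol_of_vsub:
  assumes V: "H.vsub V" and U: "continuous_on D U" "\<And>z. z \<in> D \<Longrightarrow> U z = V z" and eq: "\<And>z. z \<in> dom_C P \<delta> \<Longrightarrow> U z = \<Psi> z"
  shows "visc_subsol P n \<delta> U"
  unfolding visc_subsol_def intD
proof (intro conjI ballI impI)
  show "usc_on D U" by (rule continuous_on_imp_usc_on[OF U(1)])
  fix \<theta> \<phi> assume \<theta>: "\<theta> \<in> Om" and \<phi>: "\<phi> \<in> test_functions P \<delta>" and e: "U \<theta> - \<phi> \<theta> = 0" and le: "\<forall>z\<in>Om. U z - \<phi> z \<le> 0"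
  have c: "C1kk_on 2 Om \<phi>" "continuous_on D \<phi>"
    using \<phi> unfolding test_functions_def intD mem_Collect_eq by - (elim conjE, assumption)+
  have le': "U z \<le> \<phi> z" if "z \<in> Om" for z using bspec[OF le that] by simp
  have UV: "U z = V z" if "z \<in> Om" for z by (rule U(2)[OF subsetD[OF Om_D that]])
  have leV: "V z \<le> \<phi> z" if "z \<in> Om" for z using le'[OF that] unfolding UV[OF that] .
  have ev: "\<forall>\<^sub>F z in nhds \<theta>. V z \<le> \<phi> z"
    by (rule eventually_mono[OF eventually_nhds_in_open[OF open_Om \<theta>]]) (rule leV)
  have et: "\<phi> \<theta> = V \<theta>" using e UV[OF \<theta>] by simp
  obtain \<gamma> q where gq: "\<gamma> \<in> {0..1}" "q \<in> {0..maxdiv P}" "0 \<le> H.opr \<gamma> q \<theta> (V \<theta>) (pd_t \<phi> \<theta>) (pd_x \<phi> \<theta>) (pd_x (pd_x \<phi>) \<theta>) (pd_w \<phi> \<theta>) (pd_w (pd_w \<phi>) \<theta>)"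
    using H.vsubD[OF V \<theta> open_Om \<theta> C1kk_on_imp_pderivs[OF c(1) order_refl] et ev] by (elim bexE)
  have "0 \<le> lam (wc \<theta>) * (Il \<phi> \<theta> - J \<theta>)"
    using lam_Om[OF \<theta>] line_compare[OF \<theta> U(1) c(2) le'] line_Psi[OF \<theta> eq] by simp
  then have "0 \<le> pd_t \<phi> \<theta> + ham_of P n \<delta> \<phi> \<theta> \<gamma> q"
    using gq(3) unfolding ham_expand Hm_opr et by linarith
  then show "0 \<le> pd_t \<phi> \<theta> + hjb_op P n \<delta> \<phi> \<theta>"
    unfolding hjb_op_ge_iff by (rule bexI[OF bexI[OF _ gq(2)] gq(1)])
qed

lemma visc_supersol_of_vsuper:
  assumes V: "H.vsuper 0 V" and U: "continuous_on D U" "\<And>z. z \<in> D \<Longrightarrow> U z = V z" and eq: "\<And>z. z \<in> dom_C P \<delta> \<Longrightarrow> U z = \<Psi> z"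
  shows "visc_supersol P n \<delta> U"
  unfolding visc_supersol_def intD
proof (intro conjI ballI impI)
  show "lsc_on D U" by (rule continuous_on_imp_lsc_on[OF U(1)])
  fix \<theta> \<phi> assume \<theta>: "\<theta> \<in> Om" and \<phi>: "\<phi> \<in> test_functions P \<delta>" and e: "U \<theta> - \<phi> \<theta> = 0" and le: "\<forall>z\<in>Om. 0 \<le> U z - \<phi> z"
  have c: "C1kk_on 2 Om \<phi>" "continuous_on D \<phi>"
    using \<phi> unfolding test_functions_def intD mem_Collect_eq by - (elim conjE, assumption)+
  have le': "\<phi> z \<le> U z" if "z \<in> Om" for z using bspec[OF le that] by simp
  have UV: "U z = V z" if "z \<in> Om" for z by (rule U(2)[OF subsetD[OF Om_D that]])
  have leV: "\<phi> z \<le> V z" if "z \<in> Om" for z using le'[OF that] unfolding UV[OF that] .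
  have ev: "\<forall>\<^sub>F z in nhds \<theta>. \<phi> z \<le> V z"
    by (rule eventually_mono[OF eventually_nhds_in_open[OF open_Om \<theta>]]) (rule leV)
  have et: "\<phi> \<theta> = V \<theta>" using e UV[OF \<theta>] by simp
  have l: "lam (wc \<theta>) * (Il \<phi> \<theta> - J \<theta>) \<le> 0"
    using lam_Om[OF \<theta>] line_compare[OF \<theta> c(2) U(1) le'] line_Psi[OF \<theta> eq] by (simp add: mult_nonneg_nonpos)
  show "pd_t \<phi> \<theta> + hjb_op P n \<delta> \<phi> \<theta> \<le> 0"
    unfolding hjb_op_le_iff
  proof (intro ballI)
    fix \<gamma> q :: real assume gq: "\<gamma> \<in> {0..1}" "q \<in> {0..maxdiv P}"
    have "H.opr \<gamma> q \<theta> (V \<theta>) (pd_t \<phi> \<theta>) (pd_x \<phi> \<theta>) (pd_x (pd_x \<phi>) \<theta>) (pd_w \<phi> \<theta>) (pd_w (pd_w \<phi>) \<theta>) \<le> - 0"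
      by (rule H.vsuperD[OF V \<theta> open_Om \<theta> C1kk_on_imp_pderivs[OF c(1) order_refl] et ev gq])
    then show "pd_t \<phi> \<theta> + ham_of P n \<delta> \<phi> \<theta> \<gamma> q \<le> 0" using l unfolding ham_expand Hm_opr et by linarith
  qed
qed

end

lemma class_PsiD:
  assumes "class_Psi P \<Psi> \<delta> v"
  shows "z \<in> dom_C P \<delta> \<Longrightarrow> v z = \<Psi> z"
    and "(s,x,w) \<in> dom_D P \<delta> \<Longrightarrow> (s,x',w) \<in> dom_D P \<delta> \<Longrightarrow> x \<le> x' \<Longrightarrow> v (s,x,w) \<le> v (s,x',w)"
    and "bounded (v ` dom_D P \<delta>)"
    and "0 \<le> s \<Longrightarrow> s \<le> horizon P + \<delta> \<Longrightarrow> - \<delta> \<le> w \<Longrightarrow> w \<le> s + \<delta> \<Longrightarrow>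
      \<forall>\<^sub>F x in at_right (- \<delta>). x + \<delta> \<le> v (s,x,w) - v (s,- \<delta>,w)"
  using assms unfolding class_Psi_def by simp_all

lemma bounded_image_real:
  assumes "bounded (v ` S)"
  obtains A where "\<And>z. z \<in> S \<Longrightarrow> v z \<le> (A::real)" "\<And>z. z \<in> S \<Longrightarrow> - A \<le> v z"
proof -
  obtain A where "\<forall>y\<in>v ` S. \<bar>y\<bar> \<le> A" using assms unfolding bounded_real ..
  then have "\<bar>v z\<bar> \<le> A" if "z \<in> S" for z using that by simp
  then show ?thesis by (intro that[of A]) (simp_all add: abs_le_iff minus_le_iff)
qed

context control_pos
begin

lemma viscosity_comparison:
  assumes u: "visc_subsol P n \<delta> u" "class_Psi P \<Psi> \<delta> u" and v: "visc_supersol P n \<delta> v" "class_Psi P \<Psi> \<delta> v" and z: "z \<in> D"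
  shows "u z \<le> v z"
proof -
  note cu = class_PsiD[OF u(2)] and cv = class_PsiD[OF v(2)]
  obtain A where A: "\<And>z. z \<in> D \<Longrightarrow> u z \<le> A" "\<And>z. z \<in> D \<Longrightarrow> - A \<le> u z" by (rule bounded_image_real[OF cu(3)]) (rule that)
  obtain B where B: "\<And>z. z \<in> D \<Longrightarrow> v z \<le> B" "\<And>z. z \<in> D \<Longrightarrow> - B \<le> v z" by (rule bounded_image_real[OF cv(3)]) (rule that)
  have su: "usc_on D u" using u(1) unfolding visc_subsol_def by (elim conjE)
  have sv: "lsc_on D v" using v(1) unfolding visc_supersol_def by (elim conjE)
  show ?thesis
  proof (rule H.comparison[unfolded HD, OF su _ A(1) sv _ B(2) _ z])
    show "H.vsub u" by (rule vsub_of_visc_subsol[OF u(1) cu(3,1)])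
    show "H.vsuper 0 v" by (rule vsuper_of_visc_supersol[OF v(1) cv(3,1)])
    show "u z \<le> v z" if "z \<in> D" "z \<notin> Om" for z
      using cu(1)[OF D_C[OF that]] cv(1)[OF D_C[OF that]] by simp
  qed
qed

text \<open>Perron's method knows nothing of the class conditions; they are verified for its result:
  boundary values by pinching, monotonicity by the infimum over larger capitals, the slope at
  \<open>x = -\<delta>\<close> by the lower barrier.\<close>

lemma perron_solution:
  assumes l: "continuous_on D \<psi>l" "visc_subsol P n \<delta> \<psi>l" "class_Psi P \<Psi> \<delta> \<psi>l"
    and u: "continuous_on D \<psi>u" "visc_supersol P n \<delta> \<psi>u" "class_Psi P \<Psi> \<delta> \<psi>u"
  obtains U where "cont_visc_sol P n \<delta> U" "class_Psi P \<Psi> \<delta> U" "\<And>z. z \<in> D \<Longrightarrow> \<psi>l z \<le> U z \<and> U z \<le> \<psi>u z"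
proof -
  note cl = class_PsiD[OF l(3)] and cu = class_PsiD[OF u(3)]
  obtain A where A: "\<And>z. z \<in> D \<Longrightarrow> \<psi>l z \<le> A" "\<And>z. z \<in> D \<Longrightarrow> - A \<le> \<psi>l z" by (rule bounded_image_real[OF cl(3)]) (rule that)
  obtain B where B: "\<And>z. z \<in> D \<Longrightarrow> \<psi>u z \<le> B" "\<And>z. z \<in> D \<Longrightarrow> - B \<le> \<psi>u z" by (rule bounded_image_real[OF cu(3)]) (rule that)
  have lu: "\<psi>l z \<le> \<psi>u z" if "z \<in> D" for z by (rule viscosity_comparison[OF l(2,3) u(2,3) that])
  have bd: "\<psi>u z \<le> \<psi>l z" if "z \<in> D" "z \<notin> Om" for z using cl(1)[OF D_C[OF that]] cu(1)[OF D_C[OF that]] by simp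
  have sl: "H.vsub \<psi>l" by (rule vsub_of_visc_subsol[OF l(2) cl(3,1)])
  have su: "H.vsuper 0 \<psi>u" by (rule vsuper_of_visc_supersol[OF u(2) cu(3,1)])
  obtain V where V: "continuous_on D V" "H.vsub V" "H.vsuper 0 V" "\<And>z. z \<in> D \<Longrightarrow> \<psi>l z \<le> V z" "\<And>z. z \<in> D \<Longrightarrow> V z \<le> \<psi>u z"
    by (rule H.perron[unfolded HD, OF l(1) sl A(2) u(1) su B(1) lu bd]) (assumption+, rule that)
  \<comment> \<open>Off \<open>D\<close> the values of the lower barrier are taken over; they
    provide the boundary data outside \<open>D\<close> and the slope condition at
    \<open>s = 0\<close>, a time not in \<open>D\<close>.\<close>
  define U where "U z = (if z \<in> D then V z else \<psi>l z)" for z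
  have UV: "U z = V z" if "z \<in> D" for z using that by (simp add: U_def)
  have UC: "U z = \<Psi> z" if "z \<in> dom_C P \<delta>" for z
  proof (cases "z \<in> D")
    case True
    show ?thesis using UV[OF True] V(4,5)[OF True] cl(1)[OF that] cu(1)[OF that] by simp
  qed (simp add: U_def cl(1)[OF that])
  have Uc: "continuous_on D U" by (rule continuous_on_eq[OF V(1)]) (simp add: UV)
  have VA: "- A \<le> V z" "V z \<le> B" if "z \<in> D" for z using A(2)[OF that] B(1)[OF that] V(4,5)[OF that] by linarith+
  have mono: "V (s,x,w) \<le> V (s,x',w)" if xD: "(s,x,w) \<in> D" and xx: "x \<le> x'" for s x x' w
  proof (rule H.increasing_in_x[unfolded HD, OF continuous_on_imp_usc_on[OF V(1)] V(2) VA(2) continuous_on_imp_lsc_on[OF V(1)] V(3) VA(1) _ _ _ xD xx])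
    show "lam (wc (s,x,w)) * J (s,x,w) \<le> lam (wc (s,x',w)) * J (s,x',w)" if "(s,x,w) \<in> Om" "x \<le> x'" for s x x' w
      using J_mono[OF that] lam_Om[OF that(1)] by (simp add: mult_left_mono)
    show "V (s,x,w) \<le> V (s,x',w)" if d: "(s,x,w) \<in> D" "(s,x,w) \<notin> Om" "x \<le> x'" for s x x' w
    proof -
      have d': "(s,x',w) \<in> D" using d(1,3) by (simp add: D_iff)
      have "V (s,x,w) \<le> \<psi>l (s,x,w)" using V(5)[OF d(1)] bd[OF d(1,2)] by linarith
      also have "\<dots> \<le> \<psi>l (s,x',w)" by (rule cl(2)[OF d(1) d' d(3)])
      also have "\<dots> \<le> V (s,x',w)" by (rule V(4)[OF d'])
      finally show ?thesis .
    qed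
  qed simp_all
  \<comment> \<open>\<open>U\<close> dominates the lower barrier and equals it at
    \<open>x = -\<delta>\<close>, so the increments of the barrier are a lower bound for those of
    \<open>U\<close>.\<close>
  have slope: "\<forall>\<^sub>F x in at_right (- \<delta>). x + \<delta> \<le> U (s,x,w) - U (s,- \<delta>,w)"
    if sw: "0 \<le> s" "s \<le> horizon P + \<delta>" "- \<delta> \<le> w" "w \<le> s + \<delta>" for s w
  proof (cases "s = 0")
    case True
    then have "U (s,x,w) = \<psi>l (s,x,w)" for x by (simp add: U_def D_iff)
    then show ?thesis using cl(4)[OF sw] by simp
  next
    case False
    then have d: "(s,x,w) \<in> D" if "- \<delta> \<le> x" for x using sw that by (simp add: D_iff T1_def)
    have "(s,- \<delta>,w) \<in> dom_C P \<delta>" by (rule D_C[OF d[OF order_refl]]) simp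
    then have e: "U (s,- \<delta>,w) = \<psi>l (s,- \<delta>,w)" using UC cl(1) by simp
    have "\<forall>\<^sub>F x in at_right (- \<delta>). - \<delta> < x" by (rule eventually_at_right_less)
    with cl(4)[OF sw] show ?thesis
    proof eventually_elim
      case (elim x)
      have "(s,x,w) \<in> D" using elim by (intro d) simp
      then have "\<psi>l (s,x,w) \<le> U (s,x,w)" using V(4) UV by simp
      then show ?case using elim e by simp
    qed
  qed
  show ?thesis
  proof (rule that)
    show "cont_visc_sol P n \<delta> U" unfolding cont_visc_sol_def
      by (intro conjI Uc visc_subsol_of_vsub[OF V(2) Uc UV UC] visc_supersol_of_vsuper[OF V(3) Uc UV UC])
    have "bounded (U ` D)" unfolding bounded_real
    proof (intro exI ballI)
      fix y assume "y \<in> U ` D"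
      then obtain z where z: "z \<in> D" "y = U z" by blast
      show "\<bar>y\<bar> \<le> \<bar>A\<bar> + \<bar>B\<bar>" using VA[OF z(1)] unfolding z(2) UV[OF z(1)] by linarith
    qed
    then show "class_Psi P \<Psi> \<delta> U" unfolding class_Psi_def
      using UC mono slope UV by (intro conjI ballI allI impI) simp_all
    show "\<psi>l z \<le> U z \<and> U z \<le> \<psi>u z" if "z \<in> D" for z using V(4,5)[OF that] UV[OF that] by simp
  qed
qed

text \<open>\<open>U\<close> belongs to the family, and comparison with \<open>U\<close> as a
  supersolution bounds every member; the supremum is \<open>U\<close> itself and both envelopes
  return the continuous function.\<close>

lemma perron_envelopes:
  assumes l: "continuous_on D \<psi>l" "visc_subsol P n \<delta> \<psi>l" "class_Psi P \<Psi> \<delta> \<psi>l"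
    and u: "continuous_on D \<psi>u" "visc_supersol P n \<delta> \<psi>u" "class_Psi P \<Psi> \<delta> \<psi>u"
  obtains U where "cont_visc_sol P n \<delta> U" "class_Psi P \<Psi> \<delta> U"
    "\<And>z. z \<in> D \<Longrightarrow> upper_env (interior D) (perron_sup P \<Psi> n \<delta> \<psi>l \<psi>u) z = U z"
    "\<And>z. z \<in> D \<Longrightarrow> lower_env (interior D) (perron_sup P \<Psi> n \<delta> \<psi>l \<psi>u) z = U z"
proof -
  obtain U where U: "cont_visc_sol P n \<delta> U" "class_Psi P \<Psi> \<delta> U" "\<And>z. z \<in> D \<Longrightarrow> \<psi>l z \<le> U z \<and> U z \<le> \<psi>u z"
    by (rule perron_solution[OF l u]) (rule that)
  have U': "continuous_on D U" "visc_subsol P n \<delta> U" "visc_supersol P n \<delta> U" using U(1) by (simp_all add: cont_visc_sol_def)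
  have UF: "U \<in> perron_family P \<Psi> n \<delta> \<psi>l \<psi>u" unfolding perron_family_def using U' U by simp
  have p: "perron_sup P \<Psi> n \<delta> \<psi>l \<psi>u z = U z" if "z \<in> D" for z
    unfolding perron_sup_def
  proof (rule cSup_eq_maximum)
    show "U z \<in> (\<lambda>v. v z) ` perron_family P \<Psi> n \<delta> \<psi>l \<psi>u" by (rule imageI[OF UF])
    show "y \<le> U z" if "y \<in> (\<lambda>v. v z) ` perron_family P \<Psi> n \<delta> \<psi>l \<psi>u" for y
    proof -
      obtain v where v: "v \<in> perron_family P \<Psi> n \<delta> \<psi>l \<psi>u" "y = v z" using \<open>y \<in> _\<close> by blast
      have "visc_subsol P n \<delta> v" "class_Psi P \<Psi> \<delta> v" using v(1) by (simp_all add: perron_family_def)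
      from viscosity_comparison[OF this U'(3) U(2) \<open>z \<in> D\<close>] show ?thesis unfolding v(2) .
    qed
  qed
  have pO: "perron_sup P \<Psi> n \<delta> \<psi>l \<psi>u z = U z" if "z \<in> Om" for z by (rule p[OF subsetD[OF Om_D that]])
  show ?thesis
    by (rule that[OF U(1,2)]) (unfold intD, (rule envelopes_of_continuous[OF U'(1) Om_D pO _ D_closure], assumption+)+)
qed

end

theorem theorem3p5:
  fixes P :: model and \<Psi> :: "point \<Rightarrow> real" and n :: nat and \<delta> :: real
  assumes "1 \<le> n" and "0 < \<delta>" and "\<delta> < 1"
    and "valid_model P \<delta>" and "Psi_conditions P \<Psi>"
  shows
    "(\<forall>ul uu. visc_subsol P n \<delta> ul \<and> class_Psi P \<Psi> \<delta> ul \<and>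
              visc_supersol P n \<delta> uu \<and> class_Psi P \<Psi> \<delta> uu \<longrightarrow>
        (\<forall>\<theta>\<in>dom_D P \<delta>. ul \<theta> \<le> uu \<theta>))
     \<and>
     (\<forall>\<psi>l \<psi>u.
        continuous_on (dom_D P \<delta>) \<psi>l \<and> visc_subsol P n \<delta> \<psi>l \<and> class_Psi P \<Psi> \<delta> \<psi>l \<and>
        continuous_on (dom_D P \<delta>) \<psi>u \<and> visc_supersol P n \<delta> \<psi>u \<and> class_Psi P \<Psi> \<delta> \<psi>u \<longrightarrow>
        (let u0 = perron_sup P \<Psi> n \<delta> \<psi>l \<psi>u;
             u_up = upper_env (interior (dom_D P \<delta>)) u0;
             u_lo = lower_env (interior (dom_D P \<delta>)) u0
         in (\<forall>\<theta>\<in>dom_D P \<delta>. u_up \<theta> = u_lo \<theta>) \<and>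
            (\<exists>u. (\<forall>\<theta>\<in>dom_D P \<delta>. u \<theta> = u_up \<theta>) \<and>
                 cont_visc_sol P n \<delta> u \<and> class_Psi P \<Psi> \<delta> u) \<and>
            (\<forall>v. cont_visc_sol P n \<delta> v \<and> class_Psi P \<Psi> \<delta> v \<longrightarrow>
                 (\<forall>\<theta>\<in>dom_D P \<delta>. v \<theta> = u_up \<theta>))))"
proof -
  interpret control P \<Psi> n \<delta> by unfold_locales (rule assms)+
  \<comment> \<open>Each half of the theorem provides a subsolution of the class, \<open>ul\<close>
    or \<open>\<psi>l\<close>, from which the sign of the intensity is obtained.\<close>
  have pos: "control_pos P \<Psi> n \<delta>" if "visc_subsol P n \<delta> v" "class_Psi P \<Psi> \<delta> v" for v
    by unfold_locales (rule intensity_nonneg[OF that(1) class_PsiD(3)[OF that(2)]])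
  show ?thesis
  proof (intro conjI allI impI, goal_cases)
    case (1 ul uu)
    then have u: "visc_subsol P n \<delta> ul" "class_Psi P \<Psi> \<delta> ul" "visc_supersol P n \<delta> uu" "class_Psi P \<Psi> \<delta> uu" by simp_all
    show ?case by (intro ballI control_pos.viscosity_comparison[OF pos[OF u(1,2)] u])
  next
    case (2 \<psi>l \<psi>u)
    then have l: "continuous_on D \<psi>l" "visc_subsol P n \<delta> \<psi>l" "class_Psi P \<Psi> \<delta> \<psi>l"
      and u: "continuous_on D \<psi>u" "visc_supersol P n \<delta> \<psi>u" "class_Psi P \<Psi> \<delta> \<psi>u" by simp_all
    interpret control_pos P \<Psi> n \<delta> by (rule pos[OF l(2,3)])
    let ?u = "upper_env (interior D) (perron_sup P \<Psi> n \<delta> \<psi>l \<psi>u)"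
    let ?l = "lower_env (interior D) (perron_sup P \<Psi> n \<delta> \<psi>l \<psi>u)"
    obtain U where U: "cont_visc_sol P n \<delta> U" "class_Psi P \<Psi> \<delta> U" "\<And>z. z \<in> D \<Longrightarrow> ?u z = U z" "\<And>z. z \<in> D \<Longrightarrow> ?l z = U z"
      by (rule perron_envelopes[OF l u]) (rule that)
    have "\<forall>z\<in>D. ?u z = ?l z" using U(3,4) by simp
    moreover have "\<exists>u. (\<forall>z\<in>D. u z = ?u z) \<and> cont_visc_sol P n \<delta> u \<and> class_Psi P \<Psi> \<delta> u"
      by (rule exI[of _ U]) (use U in simp)
    moreover have "v z = ?u z" if v: "cont_visc_sol P n \<delta> v" "class_Psi P \<Psi> \<delta> v" and z: "z \<in> D" for v z
    proof -
      have s: "visc_subsol P n \<delta> v" "visc_supersol P n \<delta> v" "visc_subsol P n \<delta> U" "visc_supersol P n \<delta> U"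
        using v(1) U(1) by (simp_all add: cont_visc_sol_def)
      show ?thesis unfolding U(3)[OF z]
        by (rule antisym[OF viscosity_comparison[OF s(1) v(2) s(4) U(2) z] viscosity_comparison[OF s(3) U(2) s(2) v(2) z]])
    qed
    ultimately show ?case unfolding Let_def by blast
  qed
qed

end
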